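(* Let $\mathfrak g$ be a twisted affine Lie algebra of type $X_N^{(r)}$, not of type $A_{2\ell}^{(2)}$, let $k$ be a positive integer, $\lambda\in P^k$, and $X\in\Gamma_1(r)$. Then $$\tau\left(A_{\lambda+\rho}|_X\right)=A^t_{\tau(\lambda+\rho)}|_X .$$ Furthermore, there is a nonzero scalar $v(k,X)$ such that $$\overset{\bullet}{\tau}\left(\chi_\lambda|_X\right)=v(k,X)\,\overset{\bullet}{\tau}(\chi_\lambda)|_X .$$
   Context: $\mathfrak g=\mathfrak g(A)$ is the affine Kac–Moody algebra with affine Cartan matrix $A=(a_{ij})_{0\le i,j\le\ell}$, nodes labelled as in Kac's tables, $r\in\{2,3\}$. $a_i$, $a_i^\vee$ are the labels and dual labels, $h=\sum a_i$, $h^\vee=\sum a_i^\vee$; $\alpha_i,\alpha_i^\vee$ simple roots and coroots, $\Lambda_i$ fundamental weights, $\rho=\sum_{i=0}^\ell\Lambda_i$, $\delta=\sum a_i\alpha_i$, $K=\sum a_i^\vee\alpha_i^\vee$, $\theta=\delta-a_0\alpha_0$. The form on $\mathfrak h^*$ is $(\alpha_i,\alpha_j)=a_i^\vee a_i^{-1}a_{ij}$, $(\alpha_j,\Lambda_0)=a_0^{-1}\delta_{0j}$, $(\Lambda_0,\Lambda_0)=0$, identifying $\mathfrak h$ with $\mathfrak h^*$. $\mathring{\mathfrak h}^*=\mathrm{span}(\alpha_1,\dots,\alpha_\ell)$; $\mathring W=\langle s_1,\dots,s_\ell\rangle$ with sign $\epsilon$; $M$ is the lattice spanned by $\mathring W(a_0^{-1}\theta)$;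 $t_\alpha$ ($\alpha\in M$) are the translations in the Weyl group $W=\mathring W\ltimes M$. $P^k$ is the set of integral weights of level $k$. For $\mu\in\mathfrak h^*$ of level $m>0$ with $(\mu,M)\subseteq\mathbb Z$, $\Theta_\mu=e^{-\frac{(\mu,\mu)}{2m}\delta}\sum_{\alpha\in M}e^{t_\alpha(\mu)}$, a function on $Y=\{v\in\mathfrak h:\mathrm{Re}(v,\delta)>0\}$, $e^\mu(v)=e^{(\mu,v)}$; $Th_m$ is the span of these, and $A_\mu=\sum_{w\in\mathring W}\epsilon(w)\Theta_{w(\mu)}$. For $\lambda\in P^k$, $\chi_\lambda=A_{\lambda+\rho}/A_\rho$ (for $\lambda$ dominant this is the normalized character of the irreducible integrable module $L_\lambda$); $Ch_k$ is the span of the $\chi_\lambda$ with $\lambda$ dominant integral of level $k$, and is invariant under $\Gamma_1(r)$. Modular action. Write $v=2\pi i(z-\sigma\Lambda_0+u\delta)\in Y$ with $z\in\mathring{\mathfrak h}^*$, $u\in\mathbb C$, $\mathrm{Im}\,\sigma>0$. For $X=\begin{pmatrix}a&b\\c&d\end{pmatrix}\in SL(2,\mathbb Z)$, $X\cdot(\sigma,z,u)=\left(\frac{a\sigma+b}{c\sigma+d},\frac{z}{c\sigma+d},u-\frac{c(z,z)}{2(c\sigma+d)}\right)$. On theta functions $f|_X(\sigma,z,u)=j(\sigma)^{-\ell}f(X\cdot(\sigma,z,u))$ with $j(\sigma)^2=c\sigma+d$ (the same choice of $j$, i.e. of a lift of $X$ to the metaplectic group, for $\mathfrak g$ and $\mathfrak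 g^t$); on characters $f|_X(\sigma,z,u)=f(X\cdot(\sigma,z,u))$. $\Gamma_1(r)$ is the group of matrices in $SL(2,\mathbb Z)$ congruent to $\begin{pmatrix}1&*\\0&1\end{pmatrix}$ mod $r$. $\mathfrak g^t=\mathfrak g(A^t)$ is the (untwisted) transpose algebra, with data carrying a superscript $t$. $\tau:\mathfrak h^*\to(\mathfrak h^t)^*$ is the isometry with $\tau(\alpha_i)=\frac{a_i^\vee}{a_i}\alpha_i^t$, $\tau(\Lambda_i)=\frac{a_i^\vee}{a_i}\Lambda_i^t$, $\tau(\delta)=\delta^t$; also $\tau$ denotes the induced isomorphism $Th_m\to Th_m^t$, $\Theta_\mu\mapsto\Theta^t_{\tau(\mu)}$. $\overset{\bullet}{\tau}(\lambda)=\tau(\lambda+\rho)-\rho^t$, and also $\overset{\bullet}{\tau}:Ch_k\to Ch_{k+h^\vee-h}^t$ is the injective linear map $\chi_\lambda\mapsto\chi^t_{\overset{\bullet}{\tau}(\lambda)}=A^t_{\tau(\lambda+\rho)}/A^t_{\rho^t}$. *)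

theory Defs
  imports
    "HOL-Analysis.Analysis"
    "HOL-Library.Function_Algebras"
    "HOL-Number_Theory.Cong"
    "HOL-Computational_Algebra.Group_Closure"
begin

text \<open>
  A Cartan matrix \<open>(a\<^sub>i\<^sub>j)\<close> with rows and columns indexed by \<open>0..l\<close>;
  entries outside this range are never used.
\<close>

datatype gcm = GCM (rk: nat) (ent: "nat \<Rightarrow> nat \<Rightarrow> int")

definition transposed :: "gcm \<Rightarrow> gcm" where
  "transposed C = GCM (rk C) (\<lambda>i j. ent C j i)"

text \<open>
  The twisted affine types other than \<open>A\<^sub>2\<^sub>l\<^sup>(\<^sup>2\<^sup>)\<close>, numbered as in Kac's tables Aff 2 and Aff 3:
  \<open>A2odd l\<close> is \<open>A\<^sub>2\<^sub>l\<^sub>-\<^sub>1\<^sup>(\<^sup>2\<^sup>)\<close> (\<open>l \<ge> 3\<close>), \<open>D2 l\<close> is \<open>D\<^sub>l\<^sub>+\<^sub>1\<^sup>(\<^sup>2\<^sup>)\<close> (\<open>l \<ge> 2\<close>).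
  In Kac's convention a multiple bond has \<open>\<bar>a\<^sub>i\<^sub>j\<bar> > 1\<close> when its arrow points towards \<open>i\<close>.
\<close>

datatype twisted_type = A2odd nat | D2 nat | E6_2 | D4_3

fun is_twisted_type :: "twisted_type \<Rightarrow> bool" where
  "is_twisted_type (A2odd l) \<longleftrightarrow> l \<ge> 3"
| "is_twisted_type (D2 l) \<longleftrightarrow> l \<ge> 2"
| "is_twisted_type E6_2 \<longleftrightarrow> True"
| "is_twisted_type D4_3 \<longleftrightarrow> True"

fun twist_order :: "twisted_type \<Rightarrow> nat" where
  "twist_order (A2odd l) = 2"
| "twist_order (D2 l) = 2"
| "twist_order E6_2 = 2"
| "twist_order D4_3 = 3"

fun cartan :: "twisted_type \<Rightarrow> gcm" where
  \<comment> \<open>nodes 0 and 1 are both joined to 2; then the chain 2 - 3 - ... - (l-1), with (l-1) <= l\<close>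
  "cartan (A2odd l) = GCM l (\<lambda>i j.
     if i = j then 2
     else if (i, j) = (l - 1, l) then - 2
     else if {i, j} = {0, 2} then - 1
     else if {i, j} = {0, 1} then 0
     else if i = Suc j \<or> j = Suc i then - 1
     else 0)"
  \<comment> \<open>0 <= 1 - 2 - ... - (l-1) => l\<close>
| "cartan (D2 l) = GCM l (\<lambda>i j.
     if i = j then 2
     else if (i, j) = (0, 1) \<or> (i, j) = (l, l - 1) then - 2
     else if i = Suc j \<or> j = Suc i then - 1
     else 0)"
  \<comment> \<open>0 - 1 - 2 <= 3 - 4\<close>
| "cartan E6_2 = GCM 4 (\<lambda>i j.
     if i = j then 2
     else if (i, j) = (2, 3) then - 2
     else if i = Suc j \<or> j = Suc i then - 1
     else 0)"
  \<comment> \<open>0 - 1 <= 2 (triple bond)\<close>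
| "cartan D4_3 = GCM 2 (\<lambda>i j.
     if i = j then 2
     else if (i, j) = (1, 2) then - 3
     else if i = Suc j \<or> j = Suc i then - 1
     else 0)"

definition label :: "gcm \<Rightarrow> nat \<Rightarrow> nat" where
  "label C = (THE a. (\<forall>i\<le>rk C. a i > 0) \<and> (\<forall>i>rk C. a i = 0) \<and> Gcd (a ` {..rk C}) = 1
     \<and> (\<forall>i\<le>rk C. (\<Sum>j\<le>rk C. ent C i j * int (a j)) = 0))"

definition colabel :: "gcm \<Rightarrow> nat \<Rightarrow> nat" where
  "colabel C = label (transposed C)"

definition dual_coxeter :: "gcm \<Rightarrow> nat" where
  "dual_coxeter C = (\<Sum>i\<le>rk C. colabel C i)"


text \<open>Pointwise scaling, used both for vectors in coordinates and for functions on the domain \<open>Y\<close>.\<close>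

definition smul :: "complex \<Rightarrow> ('a \<Rightarrow> complex) \<Rightarrow> 'a \<Rightarrow> complex" (infixr "\<cdot>" 75) where
  "c \<cdot> f = (\<lambda>x. c * f x)"

interpretation cfun: vector_space "smul :: complex \<Rightarrow> ('a \<Rightarrow> complex) \<Rightarrow> 'a \<Rightarrow> complex"
  by standard (auto simp: smul_def fun_eq_iff algebra_simps)


subsection \<open>The Cartan subalgebra and the Weyl group\<close>

text \<open>
  An element of \<open>\<hh>\<^sup>*\<close> is given by its coordinates in the basis
  \<open>\<alpha>\<^sub>0, \<dots>, \<alpha>\<^sub>l, \<Lambda>\<^sub>0\<close>; the coordinate of \<open>\<Lambda>\<^sub>0\<close> has index \<open>l + 1\<close>.
  The form identifies \<open>\<hh>\<close> with \<open>\<hh>\<^sup>*\<close>, so that coroots and points of \<open>Y\<close> are also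
  elements of \<open>\<hh>\<^sup>*\<close>.
\<close>

type_synonym hvec = "nat \<Rightarrow> complex"

definition hstar :: "gcm \<Rightarrow> hvec set" where
  "hstar C = {x. \<forall>i > rk C + 1. x i = 0}"

definition hring :: "gcm \<Rightarrow> hvec set" where
  "hring C = {x. \<forall>i. i \<notin> {1..rk C} \<longrightarrow> x i = 0}"

definition alpha :: "nat \<Rightarrow> hvec" where
  "alpha i = (\<lambda>j. if j = i then 1 else 0)"

definition Lambda0 :: "gcm \<Rightarrow> hvec" where
  "Lambda0 C = (\<lambda>j. if j = rk C + 1 then 1 else 0)"

definition form :: "gcm \<Rightarrow> hvec \<Rightarrow> hvec \<Rightarrow> complex" where
  "form C x y =
     (\<Sum>i\<le>rk C. \<Sum>j\<le>rk C. of_nat (colabel C i) / of_nat (label C i) * of_int (ent C i j) * x i * y j)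
     + (x 0 * y (rk C + 1) + x (rk C + 1) * y 0) / of_nat (label C 0)"

text \<open>\<open>\<alpha>\<^sub>i\<^sup>\<or>\<close> as an element of \<open>\<hh>\<^sup>*\<close>: one has \<open>(\<alpha>\<^sub>i\<^sup>\<or>, \<alpha>\<^sub>j) = a\<^sub>i\<^sub>j\<close>.\<close>

definition coroot :: "gcm \<Rightarrow> nat \<Rightarrow> hvec" where
  "coroot C i = (of_nat (label C i) / of_nat (colabel C i)) \<cdot> alpha i"

definition delta :: "gcm \<Rightarrow> hvec" where
  "delta C = (\<Sum>i\<le>rk C. of_nat (label C i) \<cdot> alpha i)"

definition canonical_K :: "gcm \<Rightarrow> hvec" where
  "canonical_K C = (\<Sum>i\<le>rk C. of_nat (colabel C i) \<cdot> coroot C i)"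

definition level :: "gcm \<Rightarrow> hvec \<Rightarrow> complex" where
  "level C x = form C x (canonical_K C)"

definition theta_root :: "gcm \<Rightarrow> hvec" where
  "theta_root C = delta C - of_nat (label C 0) \<cdot> alpha 0"

text \<open>
  The coroots determine \<open>\<Lambda>\<^sub>i\<close> only up to multiples of \<open>\<delta>\<close>; as usual the
  normalization is that \<open>\<Lambda>\<^sub>i\<close> vanishes on the scaling element, i.e. \<open>(\<Lambda>\<^sub>i, \<Lambda>\<^sub>0) = 0\<close>.
\<close>

definition fund_weight :: "gcm \<Rightarrow> nat \<Rightarrow> hvec" where
  "fund_weight C i = (THE x. x \<in> hstar C
     \<and> (\<forall>j\<le>rk C. form C x (coroot C j) = (if j = i then 1 else 0))
     \<and> form C x (Lambda0 C) = 0)"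

definition rho :: "gcm \<Rightarrow> hvec" where
  "rho C = (\<Sum>i\<le>rk C. fund_weight C i)"

definition weights :: "gcm \<Rightarrow> nat \<Rightarrow> hvec set" where
  "weights C k = {x \<in> hstar C. (\<forall>i\<le>rk C. form C x (coroot C i) \<in> \<int>) \<and> level C x = of_nat k}"

definition dominant_weights :: "gcm \<Rightarrow> nat \<Rightarrow> hvec set" where
  "dominant_weights C k = {x \<in> weights C k. \<forall>i\<le>rk C. Re (form C x (coroot C i)) \<ge> 0}"

definition reflection :: "gcm \<Rightarrow> nat \<Rightarrow> hvec \<Rightarrow> hvec" where
  "reflection C i x = x - form C x (coroot C i) \<cdot> alpha i"

definition word_map :: "gcm \<Rightarrow> nat list \<Rightarrow> hvec \<Rightarrow> hvec" where
  "word_map C is = foldr (\<lambda>i w. reflection C i \<circ> w) is id"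

definition fin_weyl :: "gcm \<Rightarrow> (hvec \<Rightarrow> hvec) set" where
  "fin_weyl C = {word_map C is | is. set is \<subseteq> {1..rk C}}"

definition weyl_length :: "gcm \<Rightarrow> (hvec \<Rightarrow> hvec) \<Rightarrow> nat" where
  "weyl_length C w = (LEAST n. \<exists>is. set is \<subseteq> {1..rk C} \<and> length is = n \<and> word_map C is = w)"

definition weyl_sign :: "gcm \<Rightarrow> (hvec \<Rightarrow> hvec) \<Rightarrow> complex" where
  "weyl_sign C w = (- 1) ^ weyl_length C w"

definition latticeM :: "gcm \<Rightarrow> hvec set" where
  "latticeM C = group_closure {w ((1 / of_nat (label C 0)) \<cdot> theta_root C) | w. w \<in> fin_weyl C}"

text \<open>The usual formula for the action on \<open>\<hh>\<^sup>*\<close> of the translation \<open>t\<^sub>\<beta> \<in> W\<close>.\<close>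

definition translation :: "gcm \<Rightarrow> hvec \<Rightarrow> hvec \<Rightarrow> hvec" where
  "translation C \<beta> x = x + level C x \<cdot> \<beta>
     - (form C x \<beta> + form C \<beta> \<beta> / 2 * level C x) \<cdot> delta C"


subsection \<open>Theta functions and characters\<close>

definition Y :: "gcm \<Rightarrow> hvec set" where
  "Y C = {v \<in> hstar C. Re (form C v (delta C)) > 0}"

text \<open>Functions on \<open>Y\<close> are represented by functions that are zero outside \<open>Y\<close>.\<close>

definition Theta :: "gcm \<Rightarrow> hvec \<Rightarrow> hvec \<Rightarrow> complex" where
  "Theta C \<mu> v = (if v \<in> Y C
     then exp (- (form C \<mu> \<mu> / (2 * level C \<mu>)) * form C (delta C) v)
            * (\<Sum>\<^sub>\<infinity>\<beta>\<in>latticeM C. exp (form C (translation C \<beta> \<mu>) v))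
     else 0)"

definition theta_weights :: "gcm \<Rightarrow> real \<Rightarrow> hvec set" where
  "theta_weights C m = {\<mu> \<in> hstar C. level C \<mu> = of_real m \<and> (\<forall>\<beta>\<in>latticeM C. form C \<mu> \<beta> \<in> \<int>)}"

definition Th :: "gcm \<Rightarrow> real \<Rightarrow> (hvec \<Rightarrow> complex) set" where
  "Th C m = cfun.span (Theta C ` theta_weights C m)"

definition alt_theta :: "gcm \<Rightarrow> hvec \<Rightarrow> hvec \<Rightarrow> complex" where
  "alt_theta C \<mu> = (\<Sum>w\<in>fin_weyl C. weyl_sign C w \<cdot> Theta C (w \<mu>))"

text \<open>
  The quotient is a function on the dense open subset of \<open>Y\<close> where the denominator does not
  vanish (and by convention has the value zero elsewhere). By continuity, linear relations between
  characters on that subset are the same as those between their holomorphic extensions to \<open>Y\<close>.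
\<close>

definition chi :: "gcm \<Rightarrow> hvec \<Rightarrow> hvec \<Rightarrow> complex" where
  "chi C lam = (\<lambda>v. alt_theta C (lam + rho C) v / alt_theta C (rho C) v)"

definition Ch :: "gcm \<Rightarrow> nat \<Rightarrow> (hvec \<Rightarrow> complex) set" where
  "Ch C k = cfun.span (chi C ` dominant_weights C k)"


subsection \<open>The modular action\<close>

definition Gamma1 :: "nat \<Rightarrow> (int^2^2) set" where
  "Gamma1 r = {X. det X = 1 \<and> [X $ 1 $ 1 = 1] (mod int r) \<and> [X $ 2 $ 1 = 0] (mod int r)
     \<and> [X $ 2 $ 2 = 1] (mod int r)}"

type_synonym coords = "complex \<times> hvec \<times> complex"

definition point :: "gcm \<Rightarrow> coords \<Rightarrow> hvec" where
  "point C = (\<lambda>(\<sigma>, z, u). (2 * of_real pi * \<i>) \<cdot> (z - \<sigma> \<cdot> Lambda0 C + u \<cdot> delta C))"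

definition coord_domain :: "gcm \<Rightarrow> coords set" where
  "coord_domain C = {(\<sigma>, z, u). Im \<sigma> > 0 \<and> z \<in> hring C}"

definition coords_of :: "gcm \<Rightarrow> hvec \<Rightarrow> coords" where
  "coords_of C = inv_into (coord_domain C) (point C)"

definition autom :: "int^2^2 \<Rightarrow> complex \<Rightarrow> complex" where
  "autom X \<sigma> = of_int (X $ 2 $ 1) * \<sigma> + of_int (X $ 2 $ 2)"

definition act :: "gcm \<Rightarrow> int^2^2 \<Rightarrow> coords \<Rightarrow> coords" where
  "act C X = (\<lambda>(\<sigma>, z, u).
     ((of_int (X $ 1 $ 1) * \<sigma> + of_int (X $ 1 $ 2)) / autom X \<sigma>,
      (1 / autom X \<sigma>) \<cdot> z,
      u - of_int (X $ 2 $ 1) * form C z z / (2 * autom X \<sigma>)))"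

text \<open>\<open>(X, j)\<close> is an element of the metaplectic group above \<open>X\<close>.\<close>

definition metaplectic_lift :: "int^2^2 \<Rightarrow> (complex \<Rightarrow> complex) \<Rightarrow> bool" where
  "metaplectic_lift X j \<longleftrightarrow> j holomorphic_on {\<sigma>. Im \<sigma> > 0}
     \<and> (\<forall>\<sigma>. Im \<sigma> > 0 \<longrightarrow> (j \<sigma>)\<^sup>2 = autom X \<sigma>)"

definition slash_theta ::
  "gcm \<Rightarrow> int^2^2 \<Rightarrow> (complex \<Rightarrow> complex) \<Rightarrow> (hvec \<Rightarrow> complex) \<Rightarrow> hvec \<Rightarrow> complex" where
  "slash_theta C X j f v = (if v \<in> Y C
     then j (fst (coords_of C v)) powi (- int (rk C)) * f (point C (act C X (coords_of C v)))
     else 0)"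

definition slash_char :: "gcm \<Rightarrow> int^2^2 \<Rightarrow> (hvec \<Rightarrow> complex) \<Rightarrow> hvec \<Rightarrow> complex" where
  "slash_char C X f v = (if v \<in> Y C then f (point C (act C X (coords_of C v))) else 0)"


subsection \<open>Passing to the transpose\<close>

text \<open>
  \<open>\<tau>\<close> is determined by its values on the basis \<open>\<alpha>\<^sub>0, \<dots>, \<alpha>\<^sub>l, \<Lambda>\<^sub>0\<close>;
  its further properties (isometry, values on \<open>\<Lambda>\<^sub>i\<close> and \<open>\<delta>\<close>) are consequences.
\<close>

definition tau :: "gcm \<Rightarrow> hvec \<Rightarrow> hvec" where
  "tau C x = (\<Sum>i\<le>rk C. (of_nat (colabel C i) / of_nat (label C i) * x i) \<cdot> alpha i)
     + (of_nat (colabel C 0) / of_nat (label C 0) * x (rk C + 1)) \<cdot> Lambda0 (transposed C)"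

text \<open>
  The linear map on the span of the \<open>b i\<close> with \<open>b i \<mapsto> c i\<close> for \<open>i \<in> I\<close>,
  set to zero off that span; it exists and is unique when every linear relation among the \<open>b i\<close>
  also holds among the \<open>c i\<close>.
\<close>

definition linear_extension ::
  "'i set \<Rightarrow> ('i \<Rightarrow> hvec \<Rightarrow> complex) \<Rightarrow> ('i \<Rightarrow> hvec \<Rightarrow> complex)
     \<Rightarrow> (hvec \<Rightarrow> complex) \<Rightarrow> (hvec \<Rightarrow> complex)" where
  "linear_extension I b c = (THE T.
     (\<forall>f\<in>cfun.span (b ` I). \<forall>g\<in>cfun.span (b ` I). T (f + g) = T f + T g)
     \<and> (\<forall>a. \<forall>f\<in>cfun.span (b ` I). T (a \<cdot> f) = a \<cdot> T f)
     \<and> (\<forall>i\<in>I. T (b i) = c i)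
     \<and> (\<forall>f. f \<notin> cfun.span (b ` I) \<longrightarrow> T f = 0))"

definition tau_Th :: "gcm \<Rightarrow> real \<Rightarrow> (hvec \<Rightarrow> complex) \<Rightarrow> (hvec \<Rightarrow> complex)" where
  "tau_Th C m = linear_extension (theta_weights C m) (Theta C) (\<lambda>\<mu>. Theta (transposed C) (tau C \<mu>))"

definition tau_dot :: "gcm \<Rightarrow> hvec \<Rightarrow> hvec" where
  "tau_dot C lam = tau C (lam + rho C) - rho (transposed C)"

definition tau_dot_Ch :: "gcm \<Rightarrow> nat \<Rightarrow> (hvec \<Rightarrow> complex) \<Rightarrow> (hvec \<Rightarrow> complex)" where
  "tau_dot_Ch C k = linear_extension (dominant_weights C k) (chi C)
     (\<lambda>lam. chi (transposed C) (tau_dot C lam))"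

end

theory Submission
  imports Defs "HOL-Complex_Analysis.Complex_Analysis" "HOL-Probability.Characteristic_Functions" "HOL-Real_Asymp.Real_Asymp"
begin

text \<open>
  The isometry \<open>\<tau>\<close> intertwines the finite Weyl groups, the lattices \<open>M\<close> and the modular actions, so that \<open>f \<mapsto> f \<circ> \<tau>\<^sup>-\<^sup>1\<close>
  sends \<open>\<Theta>\<^sub>\<mu>\<close> to \<open>\<Theta>\<^sup>t\<^sub>\<tau>\<^sub>\<mu>\<close> and commutes with \<open>X\<close>. The first identity then only needs that \<open>A\<^sub>\<lambda>\<^sub>+\<^sub>\<rho>|\<^sub>X\<close> is a combination of theta
  functions, and the second follows with \<open>v = c'/c\<close> from \<open>A\<^sub>\<rho>|\<^sub>X = c A\<^sub>\<rho>\<close> and \<open>A\<^sub>\<rho>\<^sub>'|\<^sub>X = c' A\<^sub>\<rho>\<^sub>'\<close>, where \<open>\<rho>' = \<tau>\<^sup>-\<^sup>1(\<rho>\<^sup>t)\<close>.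

  Along an orthogonal sublattice of \<open>M\<close> theta functions are sums of products of one-dimensional ones, for which Poisson
  summation and Euclid's algorithm give the action of \<open>SL(2,\<int>)\<close>. Put \<open>h\<^sub>i = 1\<close>, or \<open>h\<^sub>i = a\<^sub>i\<^sup>\<or>/a\<^sub>i\<close> if \<open>X \<in> \<Gamma>\<^sub>1(r)\<close>. If all
  \<open>(\<mu>, \<alpha>\<^sub>i)/h\<^sub>i\<close> are integers, then \<open>A\<^sub>\<mu>|\<^sub>X\<close> is alternating and invariant under translations by \<open>M\<close> and by the \<open>\<alpha>\<^sub>i/h\<^sub>i\<close>, hence
  a combination of \<open>A\<^sub>\<nu>\<close> with \<open>\<nu>\<close> of the same kind. By affine reflections one may take \<open>(\<nu>, \<alpha>\<^sub>i)/h\<^sub>i \<ge> 1\<close> for \<open>0 \<le> i \<le> l\<close>; at level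
  \<open>\<Sum>a\<^sub>i h\<^sub>i\<close> this leaves a single \<open>\<nu>\<close>, which is \<open>\<rho>'\<close> respectively \<open>\<rho>\<close>. Finally \<open>A\<^sub>\<rho> \<noteq> 0\<close>, and theta functions form an
  integral domain, so that linear relations between characters lift to their numerators.
\<close>

section \<open>One-dimensional theta functions\<close>

text \<open>The orthogonal sublattice reduces Poisson summation on M to one dimension, but the
  transform then appears as a combination of theta functions of a smaller lattice, with too many
  characteristics. Its coefficients are never computed: the transform is known to be invariant under
  certain translations, and averaging over them discards every term that is not. This is the only
  place where the congruence on X matters. The transform by X carries the translation by
  \<alpha>_i/h_i to one that involves c \<alpha>_i/h_i, and the latter has to lie in M. For h = 1
  this is automatic, so that \<rho>' is served by all of SL(2,Z); for h_i = r it asks that r divide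
  c. The maps between function spaces are given by descriptions, so existence and uniqueness have to
  be shown. For theta functions the map is a change of variables and there is nothing to check. For
  characters the denominator changes from A_\<rho> to A_\<rho>', and only after relations are lifted
  to numerators is the map well defined. These two denominators are also the only source of v, which
  therefore depends neither on \<lambda> nor on k.\<close>

lemma summable_on_finite_sum:
  fixes f :: "'v \<Rightarrow> 'i \<Rightarrow> 'b :: {topological_comm_monoid_add, comm_monoid_add}"
  assumes "finite V" and "\<And>v. v \<in> V \<Longrightarrow> f v summable_on A"
  shows "(\<lambda>k. \<Sum>v\<in>V. f v k) summable_on A"
  using assms by (induction V) (auto intro!: summable_on_add)

text \<open>On a disc about z the modulus of exp (a + b s) is at most its value at one corner of the
  circumscribed square, the signs of Re b and Im b deciding which one. Absolute convergence at the
  four corners therefore already yields a Weierstrass majorant.\<close>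

lemma holomorphic_infsum_exp:
  fixes a b :: "'i \<Rightarrow> complex"
  assumes U: "open U"
    and sum: "\<And>s. s \<in> U \<Longrightarrow> (\<lambda>k. norm (exp (a k + b k * s))) summable_on A"
  shows "(\<lambda>s. \<Sum>\<^sub>\<infinity>k\<in>A. exp (a k + b k * s)) holomorphic_on U"
proof -
  have "\<exists>r>0. (\<lambda>s. \<Sum>\<^sub>\<infinity>k\<in>A. exp (a k + b k * s)) holomorphic_on ball z r" if z: "z \<in> U" for z
  proof -
    obtain R where R: "R > 0" "cball z R \<subseteq> U"
      using U z by (meson open_contains_cball)
    \<comment> \<open>The corners are at distance at most |Re| + |Im| = 2 r, so they stay inside
      U.\<close>
    define r where "r = R / 2"
    have r: "r > 0" using R by (simp add: r_def)
    define V where "V = {Complex r r, Complex r (-r), Complex (-r) r, Complex (-r) (-r)}"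
    have V: "z + v \<in> U" if "v \<in> V" for v
    proof -
      have "cmod v \<le> \<bar>Re v\<bar> + \<bar>Im v\<bar>" by (rule cmod_le)
      also have "\<dots> = R" using that r by (auto simp: V_def r_def)
      finally have "z + v \<in> cball z R" by (simp add: dist_norm)
      then show ?thesis using R by blast
    qed
    define M where "M k = (\<Sum>v\<in>V. norm (exp (a k + b k * (z + v))))" for k
    have M: "M summable_on A"
      unfolding M_def by (intro summable_on_finite_sum sum V) (auto simp: V_def)
    have le: "norm (exp (a k + b k * s)) \<le> M k" if s: "s \<in> cball z r" for k s
    proof -
      define v where "v = Complex (if Re (b k) \<ge> 0 then r else - r) (if Im (b k) \<ge> 0 then - r else r)"
      have vV: "v \<in> V" by (auto simp: v_def V_def)
      define w where "w = s - z"
      have w: "cmod w \<le> r" using s by (simp add: w_def dist_norm norm_minus_commute)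
      have "\<bar>Re w\<bar> \<le> r" "\<bar>Im w\<bar> \<le> r"
        using w abs_Re_le_cmod[of w] abs_Im_le_cmod[of w] by linarith+
      have 1: "Re (b k) * Re w \<le> Re (b k) * Re v"
        using \<open>\<bar>Re w\<bar> \<le> r\<close> mult_left_mono[of "Re w" r "Re (b k)"] mult_left_mono_neg[of "- r" "Re w" "Re (b k)"]
        by (cases "Re (b k) \<ge> 0") (auto simp: v_def)
      have 2: "Im (b k) * Im w \<ge> Im (b k) * Im v"
        using \<open>\<bar>Im w\<bar> \<le> r\<close> mult_left_mono[of "- r" "Im w" "Im (b k)"] mult_left_mono_neg[of "Im w" r "Im (b k)"]
        by (cases "Im (b k) \<ge> 0") (auto simp: v_def)
      have "Re (b k * w) \<le> Re (b k * v)" using 1 2 by simp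
      moreover have "s = z + w" by (simp add: w_def)
      ultimately have "norm (exp (a k + b k * s)) \<le> norm (exp (a k + b k * (z + v)))"
        by (simp add: distrib_left)
      also have "\<dots> \<le> M k"
        unfolding M_def using vV by (intro member_le_sum) (auto simp: V_def)
      finally show ?thesis .
    qed
    have ul: "uniform_limit (cball z r) (\<lambda>X s. \<Sum>k\<in>X. exp (a k + b k * s))
            (\<lambda>s. \<Sum>\<^sub>\<infinity>k\<in>A. exp (a k + b k * s)) (finite_subsets_at_top A)"
      by (rule Weierstrass_m_test_general[OF le M]) auto
    have "(\<lambda>s. \<Sum>\<^sub>\<infinity>k\<in>A. exp (a k + b k * s)) holomorphic_on ball z r"
      by (rule holomorphic_uniform_limit[OF _ ul])
        (auto intro!: always_eventually continuous_intros holomorphic_intros)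
    then show ?thesis using r by blast
  qed
  then obtain r where r: "\<And>z. z \<in> U \<Longrightarrow> r z > 0"
    "\<And>z. z \<in> U \<Longrightarrow> (\<lambda>s. \<Sum>\<^sub>\<infinity>k\<in>A. exp (a k + b k * s)) holomorphic_on ball z (r z)"
    by metis
  have "(\<lambda>s. \<Sum>\<^sub>\<infinity>k\<in>A. exp (a k + b k * s)) holomorphic_on (\<Union>z\<in>U. ball z (r z))"
    using r by (intro holomorphic_on_UN_open) auto
  then show ?thesis
    by (rule holomorphic_on_subset) (use r in auto)
qed

text \<open>Stone-Weierstrass supplies polynomials in the plane; restricted to the circle they are
  trigonometric polynomials, against which vanishing Fourier coefficients can be used.\<close>

lemma real_polynomial_function_cis:
  fixes p :: "complex \<Rightarrow> real"
  assumes "real_polynomial_function p"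
  shows "\<exists>A c. finite A \<and> (\<forall>x. complex_of_real (p (cis (2 * pi * x))) = (\<Sum>n\<in>A. c n * cis (2 * pi * of_int n * x)))"
  using assms
proof induction
    case (linear f)
    have *: "f (cis y) = f 1 * cos y + f \<i> * sin y" for y
    proof -
      interpret bounded_linear f by (rule linear)
      have "cis y = cos y *\<^sub>R 1 + sin y *\<^sub>R \<i>" by (simp add: complex_eq_iff)
      then show ?thesis by (simp only: add scaleR) simp
    qed
    have cosc: "complex_of_real (cos y) = (cis y + cis (- y)) / 2" for y
      by (simp add: complex_eq_iff)
    have sinc: "complex_of_real (sin y) = (cis y - cis (- y)) / (2 * \<i>)" for y
      by (auto simp: complex_eq_iff Re_divide Im_divide)
    show ?case
      by (rule exI[of _ "{1, -1}"],
          rule exI[of _ "\<lambda>n. if n = 1 then f 1 / 2 + f \<i> / (2 * \<i>) else f 1 / 2 - f \<i> / (2 * \<i>)"])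
        (simp add: * cosc sinc field_simps)
  next
    case (const c)
    show ?case by (rule exI[of _ "{0}"], rule exI[of _ "\<lambda>_. complex_of_real c"]) simp
  next
    case (add f g)
    from add.IH(1) obtain A c where A: "finite A" "\<And>x. complex_of_real (f (cis (2 * pi * x))) = (\<Sum>n\<in>A. c n * cis (2 * pi * of_int n * x))"
      by blast
    from add.IH(2) obtain B d where B: "finite B" "\<And>x. complex_of_real (g (cis (2 * pi * x))) = (\<Sum>n\<in>B. d n * cis (2 * pi * of_int n * x))"
      by blast
    show ?case
    proof (rule exI[of _ "A \<union> B"],
        rule exI[of _ "\<lambda>n. (if n \<in> A then c n else 0) + (if n \<in> B then d n else 0)"], intro conjI allI)
      fix x
      have 1: "(\<Sum>n\<in>A. c n * cis (2 * pi * of_int n * x)) = (\<Sum>n\<in>A \<union> B. (if n \<in> A then c n else 0) * cis (2 * pi * of_int n * x))"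
        using A B by (intro sum.mono_neutral_cong_left) auto
      have 2: "(\<Sum>n\<in>B. d n * cis (2 * pi * of_int n * x)) = (\<Sum>n\<in>A \<union> B. (if n \<in> B then d n else 0) * cis (2 * pi * of_int n * x))"
        using A B by (intro sum.mono_neutral_cong_left) auto
      show "complex_of_real (f (cis (2 * pi * x)) + g (cis (2 * pi * x))) = (\<Sum>n\<in>A \<union> B. ((if n \<in> A then c n else 0) + (if n \<in> B then d n else 0)) * cis (2 * pi * of_int n * x))"
        unfolding of_real_add A B 1 2 by (simp add: sum.distrib distrib_right)
    qed (use A B in auto)
  next
    case (mult f g)
    from mult.IH(1) obtain A c where A: "finite A" "\<And>x. complex_of_real (f (cis (2 * pi * x))) = (\<Sum>n\<in>A. c n * cis (2 * pi * of_int n * x))"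
      by blast
    from mult.IH(2) obtain B d where B: "finite B" "\<And>x. complex_of_real (g (cis (2 * pi * x))) = (\<Sum>n\<in>B. d n * cis (2 * pi * of_int n * x))"
      by blast
    show ?case
    proof (rule exI[of _ "(\<lambda>(m, n). m + n) ` (A \<times> B)"],
        rule exI[of _ "\<lambda>k. \<Sum>p\<in>{p\<in>A \<times> B. fst p + snd p = k}. c (fst p) * d (snd p)"], intro conjI allI)
      fix x
      have "complex_of_real (f (cis (2 * pi * x)) * g (cis (2 * pi * x)))
        = (\<Sum>p\<in>A \<times> B. c (fst p) * d (snd p) * cis (2 * pi * of_int (fst p + snd p) * x))"
        unfolding of_real_mult A B sum_product sum.cartesian_product
        by (intro sum.cong) (auto simp: cis_mult[symmetric] algebra_simps)
      also have "\<dots> = (\<Sum>k\<in>(\<lambda>(m, n). m + n) ` (A \<times> B). \<Sum>p\<in>{p\<in>A \<times> B. fst p + snd p = k}.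
          c (fst p) * d (snd p) * cis (2 * pi * of_int (fst p + snd p) * x))"
        using A B by (intro sum.group[symmetric]) auto
      also have "\<dots> = (\<Sum>k\<in>(\<lambda>(m, n). m + n) ` (A \<times> B). (\<Sum>p\<in>{p\<in>A \<times> B. fst p + snd p = k}. c (fst p) * d (snd p))
           * cis (2 * pi * of_int k * x))"
        by (intro sum.cong refl) (auto simp: sum_distrib_right)
      finally show "complex_of_real (f (cis (2 * pi * x)) * g (cis (2 * pi * x))) = \<dots>" .
    qed (use A B in auto)
  qed

text \<open>If p approximates H uniformly on the circle, the integral of H^2 equals that of H (H -
  p) and is thus arbitrarily small.\<close>

lemma fourier_unique_real:
  fixes H :: "real \<Rightarrow> real"
  assumes cont: "continuous_on UNIV H" and per: "\<And>x. H (x + 1) = H x"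
    and zero: "\<And>p. real_polynomial_function p \<Longrightarrow> integral {0..1} (\<lambda>x. H x * p (cis (2 * pi * x))) = 0"
  shows "H x = 0"
proof -
  have per_int: "H (x + of_int n) = H x" for x n
  proof -
    have nat: "H (x + of_nat n) = H x" for x n
      by (induction n) (auto simp: per add.assoc[symmetric] add.commute[of 1])
    show ?thesis
      using nat[of x "nat n"] nat[of "x + of_int n" "nat (- n)"]
      by (cases "n \<ge> 0") auto
  qed
  define h where "h z = H (Arg z / (2 * pi))" for z
  have h: "h (cis (2 * pi * x)) = H x" for x
  proof -
    obtain n :: int where n: "Arg (cis (2 * pi * x)) = 2 * pi * x + 2 * pi * of_int n"
    proof -
      have "cis (Arg (cis (2 * pi * x))) = cis (2 * pi * x)"
        using cis_Arg[of "cis (2 * pi * x)"] by (simp add: sgn_eq)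
      then obtain n :: int where "Arg (cis (2 * pi * x)) = 2 * pi * x + 2 * pi * of_int n"
        using sin_cos_eq_iff by (metis cis.sel)
      then show ?thesis by (rule that)
    qed
    show ?thesis using per_int[of x n] by (simp add: h_def n add_divide_distrib)
  qed
  have hcont: "continuous_on (sphere 0 1) h"
  proof (intro continuous_at_imp_continuous_on ballI)
    fix z :: complex assume z: "z \<in> sphere 0 1"
    then have z0: "z \<noteq> 0" by auto
    have Hc: "isCont H y" for y
      using cont by (simp add: continuous_on_eq_continuous_at)
    show "isCont h z"
    \<comment> \<open>\<open>Arg\<close> jumps on the negative axis and \<open>Arg2pi\<close> on the
      positive one. By periodicity of H both represent h, so the branch that is continuous at z can
      be taken.\<close>
    proof (cases "z \<in> \<real>\<^sub>\<le>\<^sub>0")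
      case False
      have "isCont (\<lambda>z. Arg z / (2 * pi)) z"
        by (intro continuous_intros continuous_at_Arg False) auto
      then show ?thesis
        unfolding h_def by (rule isCont_o2) (rule Hc)
    next
      case True
      then have "z \<notin> \<real>\<^sub>\<ge>\<^sub>0" using z0
        by (auto simp: complex_nonpos_Reals_iff complex_nonneg_Reals_iff complex_eq_iff)
      then have 1: "isCont (\<lambda>z. Arg2pi z / (2 * pi)) z"
        by (intro continuous_intros continuous_at_Arg2pi) auto
      have "h = (\<lambda>z. H (Arg2pi z / (2 * pi)))"
      proof
        fix w
        have "h (cis (2 * pi * (Arg2pi w / (2 * pi)))) = H (Arg2pi w / (2 * pi))" by (rule h)
        moreover have "h (cis (Arg2pi w)) = h w"
        proof (cases "w = 0")
          case True then show ?thesis by (simp add: Arg2pi_def h_def Arg_zero)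
        next
          case False
          have "cis (Arg2pi w) = sgn w"
            using Arg2pi_eq[of w] False by (simp add: sgn_eq cis_conv_exp field_simps)
          moreover have "Arg (sgn w) = Arg w"
            using False Arg_times_of_real[of "inverse (cmod w)" w] by (simp add: sgn_div_norm scaleR_conv_of_real)
          ultimately show ?thesis by (simp add: h_def)
        qed
        ultimately show "h w = H (Arg2pi w / (2 * pi))" by simp
      qed
      then show ?thesis using isCont_o2[OF 1 Hc] by simp
    qed
  qed
  have Hc: "continuous_on {0..1} H" using cont continuous_on_subset by blast
  obtain B where B: "\<And>x. x \<in> {0..1} \<Longrightarrow> \<bar>H x\<bar> \<le> B" "B > 0"
  proof -
    have "compact (H ` {0..1})" by (intro compact_continuous_image Hc) auto
    then have "bounded (H ` {0..1})" by (rule compact_imp_bounded)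
    then obtain B where "B > 0" "\<forall>x\<in>H ` {0..1}. norm x \<le> B" unfolding bounded_pos by blast
    then show ?thesis by (intro that[of B]) auto
  qed
  have sq: "integral {0..1} (\<lambda>x. (H x)\<^sup>2) = 0"
  proof (rule ccontr)
    assume ne: "integral {0..1} (\<lambda>x. (H x)\<^sup>2) \<noteq> 0"
    \<comment> \<open>With this accuracy \<open>B * e\<close> is half the integral of H^2, which
      contradicts the estimate below.\<close>
    define e where "e = \<bar>integral {0..1} (\<lambda>x. (H x)\<^sup>2)\<bar> / (2 * B)"
    have e: "e > 0" using ne B by (simp add: e_def)
    obtain p where p: "real_polynomial_function p" "\<And>z. z \<in> sphere 0 1 \<Longrightarrow> \<bar>h z - p z\<bar> < e"
      using Stone_Weierstrass_real_polynomial_function[OF _ hcont e] by auto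
    have p': "\<bar>H x - p (cis (2 * pi * x))\<bar> < e" for x
      using p(2)[of "cis (2 * pi * x)"] h by simp
    have pc: "continuous_on UNIV p"
      using p(1) continuous_on_polymonial_function real_polynomial_function_eq by blast
    have pi: "(\<lambda>x. H x * p (cis (2 * pi * x))) integrable_on {0..1}"
      by (intro integrable_continuous_real continuous_intros Hc continuous_on_compose2[OF pc]) auto
    have hi: "(\<lambda>x. (H x)\<^sup>2) integrable_on {0..1}"
      by (intro integrable_continuous_real continuous_intros Hc)
    have "integral {0..1} (\<lambda>x. (H x)\<^sup>2) = integral {0..1} (\<lambda>x. (H x)\<^sup>2) - integral {0..1} (\<lambda>x. H x * p (cis (2 * pi * x)))"
      using zero[OF p(1)] by simp
    also have "\<dots> = integral {0..1} (\<lambda>x. (H x)\<^sup>2 - H x * p (cis (2 * pi * x)))"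
      using hi pi by (rule integral_diff[symmetric])
    also have "norm \<dots> \<le> integral {0..1} (\<lambda>x::real. B * e)"
    proof (rule integral_norm_bound_integral)
      show "(\<lambda>x. (H x)\<^sup>2 - H x * p (cis (2 * pi * x))) integrable_on {0..1}"
        using hi pi by (rule integrable_diff)
      fix x :: real assume x: "x \<in> {0..1}"
      have "norm ((H x)\<^sup>2 - H x * p (cis (2 * pi * x))) = \<bar>H x\<bar> * \<bar>H x - p (cis (2 * pi * x))\<bar>"
        by (simp add: power2_eq_square abs_mult[symmetric] right_diff_distrib)
      also have "\<dots> \<le> B * e"
        using B x p'[of x] by (intro mult_mono) auto
      finally show "norm ((H x)\<^sup>2 - H x * p (cis (2 * pi * x))) \<le> B * e" .
    qed auto
    finally have "\<bar>integral {0..1} (\<lambda>x. (H x)\<^sup>2)\<bar> \<le> B * e" by simp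
    then show False using B ne by (simp add: e_def)
  qed
  have "H y = 0" if "y \<in> {0..1}" for y
  proof -
    have "((\<lambda>x. (H x)\<^sup>2) has_integral 0) (cbox 0 1)"
      using sq by (metis Hc box_real(2) continuous_on_power has_integral_integral integrable_continuous_real)
    then have "(H y)\<^sup>2 = 0"
      using that by (intro has_integral_0_cbox_imp_0[of 0 1 "\<lambda>x. (H x)\<^sup>2"]) (auto intro!: continuous_intros Hc)
    then show ?thesis by simp
  qed
  then have "H (frac x) = 0" using frac_lt_1[of x] by (intro \<open>\<And>y. y \<in> {0..1} \<Longrightarrow> H y = 0\<close>) (auto intro: less_imp_le)
  moreover have "H (frac x) = H x"
    using per_int[of "frac x" "\<lfloor>x\<rfloor>"] by (simp add: frac_def)
  ultimately show ?thesis by simp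
qed


lemma fourier_unique:
  fixes H :: "real \<Rightarrow> complex"
  assumes cont: "continuous_on UNIV H" and per: "\<And>x. H (x + 1) = H x"
    and coeff: "\<And>n::int. integral {0..1} (\<lambda>x. H x * cis (2 * pi * of_int n * x)) = 0"
  shows "H x = 0"
proof -
  have Hc: "continuous_on {0..1} H" using cont continuous_on_subset by blast
  have zero: "integral {0..1} (\<lambda>x. H x * p (cis (2 * pi * x))) = 0"
    and int: "(\<lambda>x. H x * p (cis (2 * pi * x))) integrable_on {0..1}"
    if poly: "real_polynomial_function p" for p
  proof -
    obtain A c where A: "finite A" "\<And>x. complex_of_real (p (cis (2 * pi * x))) = (\<Sum>n\<in>A. c n * cis (2 * pi * of_int n * x))"
      using real_polynomial_function_cis[OF poly] by blast
    have int: "(\<lambda>x. H x * cis (2 * pi * of_int n * x)) integrable_on {0..1}" for n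
      by (intro integrable_continuous_real continuous_intros Hc)
    have "integral {0..1} (\<lambda>x. H x * p (cis (2 * pi * x)))
        = integral {0..1} (\<lambda>x. \<Sum>n\<in>A. c n * (H x * cis (2 * pi * of_int n * x)))"
      unfolding A by (simp add: sum_distrib_left algebra_simps)
    also have "\<dots> = (\<Sum>n\<in>A. integral {0..1} (\<lambda>x. c n * (H x * cis (2 * pi * of_int n * x))))"
      by (rule integral_sum) (intro A integrable_on_mult_right int)+
    also have "\<dots> = 0" by (simp add: coeff)
    finally show "integral {0..1} (\<lambda>x. H x * p (cis (2 * pi * x))) = 0" .
    have pc: "continuous_on UNIV p"
      using poly continuous_on_polymonial_function real_polynomial_function_eq by blast
    show "(\<lambda>x. H x * p (cis (2 * pi * x))) integrable_on {0..1}"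
      by (intro integrable_continuous_real continuous_intros Hc continuous_on_compose2[OF pc]) auto
  qed
  have "Re (H x) = 0"
  proof (rule fourier_unique_real[of "\<lambda>x. Re (H x)"])
    show "continuous_on UNIV (\<lambda>x. Re (H x))" by (intro continuous_intros cont)
    fix p :: "complex \<Rightarrow> real" assume p: "real_polynomial_function p"
    show "integral {0..1} (\<lambda>x. Re (H x) * p (cis (2 * pi * x))) = 0"
      using integral_linear[OF int[OF p] bounded_linear_Re] zero[OF p] by (simp add: o_def)
  qed (simp add: per)
  moreover have "Im (H x) = 0"
  proof (rule fourier_unique_real[of "\<lambda>x. Im (H x)"])
    show "continuous_on UNIV (\<lambda>x. Im (H x))" by (intro continuous_intros cont)
    fix p :: "complex \<Rightarrow> real" assume p: "real_polynomial_function p"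
    show "integral {0..1} (\<lambda>x. Im (H x) * p (cis (2 * pi * x))) = 0"
      using integral_linear[OF int[OF p] bounded_linear_Im] zero[OF p] by (simp add: o_def)
  qed (simp add: per)
  ultimately show ?thesis by (simp add: complex_eq_iff)
qed

lemma summable_on_exp_abs_int: "(\<lambda>k::int. exp (- \<bar>real_of_int k\<bar>)) summable_on UNIV"
proof -
  have geo: "(\<lambda>n::nat. exp (- real n)) summable_on UNIV"
  proof (rule norm_summable_imp_summable_on)
    have "summable (\<lambda>n. exp (-1 :: real) ^ n)" by (rule summable_geometric) simp
    then show "summable (\<lambda>n. norm (exp (- real n)))" by (simp add: exp_of_nat_mult[symmetric])
  qed
  have 1: "(\<lambda>k::int. exp (- \<bar>real_of_int k\<bar>)) summable_on (range int)"
    using geo by (subst summable_on_reindex) (auto simp: o_def)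
  have 2: "(\<lambda>k::int. exp (- \<bar>real_of_int k\<bar>)) summable_on (range (\<lambda>n. - int n))"
    using geo by (subst summable_on_reindex) (auto simp: o_def inj_on_def)
  have "(UNIV::int set) = range int \<union> range (\<lambda>n. - int n)"
  proof -
    have "k \<in> range int \<union> range (\<lambda>n. - int n)" for k
      by (cases k rule: int_cases2) auto
    then show ?thesis by blast
  qed
  then show ?thesis using summable_on_union[OF 1 2] by simp
qed

lemma summable_on_gauss_int:
  fixes a b c :: real
  assumes "a > 0"
  shows "(\<lambda>k::int. exp (- a * (real_of_int k)\<^sup>2 + b * real_of_int k + c)) summable_on UNIV"
proof (rule summable_on_comparison_test)
  \<comment> \<open>Completing the square gives (|b| + 1) x \<le> a x^2 + (|b| + 1)^2/(4 a); the
    additional 1 is what leaves the decay exp (- |k|).\<close>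
  define D where "D = (\<bar>b\<bar> + 1)\<^sup>2 / (4 * a) + c"
  show "(\<lambda>k::int. exp D * exp (- \<bar>real_of_int k\<bar>)) summable_on UNIV"
    by (intro summable_on_cmult_right summable_on_exp_abs_int)
  fix k :: int
  define x where "x = \<bar>real_of_int k\<bar>"
  have "b * real_of_int k \<le> \<bar>b\<bar> * x"
    unfolding x_def by (metis abs_le_D1 abs_mult order_refl)
  moreover have "(\<bar>b\<bar> + 1) * x \<le> a * x\<^sup>2 + (\<bar>b\<bar> + 1)\<^sup>2 / (4 * a)"
  proof -
    have "0 \<le> (2 * a * x - (\<bar>b\<bar> + 1))\<^sup>2 / (4 * a)" using assms by simp
    also have "\<dots> = a * x\<^sup>2 + (\<bar>b\<bar> + 1)\<^sup>2 / (4 * a) - (\<bar>b\<bar> + 1) * x"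
      using assms by (simp add: field_simps power2_eq_square)
    finally show ?thesis by simp
  qed
  moreover have "(real_of_int k)\<^sup>2 = x\<^sup>2" by (simp add: x_def)
  ultimately have "- a * (real_of_int k)\<^sup>2 + b * real_of_int k + c \<le> D + - x"
    by (simp add: D_def algebra_simps)
  then show "exp (- a * (real_of_int k)\<^sup>2 + b * real_of_int k + c) \<le> exp D * exp (- \<bar>real_of_int k\<bar>)"
    unfolding exp_add[symmetric] x_def by simp
qed auto

lemma summable_on_gauss_int_complex:
  fixes a b c :: complex
  assumes "Re a > 0"
  shows "(\<lambda>k::int. norm (exp (- a * (of_int k)\<^sup>2 + b * of_int k + c))) summable_on UNIV"
  using summable_on_gauss_int[OF assms, of "Re b" "Re c"]
  by (simp add: power2_eq_square)

text \<open>This is the characteristic function of the standard normal distribution, rescaled by c =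
  sqrt (2 pi t), which turns x^2/2 into pi t x^2.\<close>

lemma gaussian_fourier_transform:
  fixes t :: real
  assumes t: "t > 0"
  shows "((\<lambda>x. complex_of_real (exp (- pi * t * x\<^sup>2)) * cis (2 * pi * s * x)) has_integral
      exp (- pi * s\<^sup>2 / t) / sqrt t) UNIV"
proof -
  define c where "c = sqrt (2 * pi * t)"
  have c: "c > 0" "c\<^sup>2 = 2 * pi * t" using t by (auto simp: c_def)
  define S where "S = 2 * pi * s / c"
  define f where "f x = std_normal_density x *\<^sub>R iexp (S * x)" for x
  have intf: "integrable lborel f"
  proof -
    have "integrable lborel (\<lambda>x. norm (f x))"
      unfolding f_def by (simp add: integrable_normal_density[of 1 0, simplified])
    moreover have "f \<in> borel_measurable lborel" unfolding f_def by measurable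
    ultimately show ?thesis by (simp add: integrable_norm_iff)
  qed
  have "exp (- S\<^sup>2 / 2) = char std_normal_distribution S"
    by (simp add: char_std_normal_distribution)
  also have "\<dots> = (LINT x|lborel. f x)"
    unfolding char_def f_def by (subst integral_density) (auto simp: normal_density_nonneg)
  also have "\<dots> = c *\<^sub>R (LINT x|lborel. f (c * x))"
    using lborel_integral_real_affine[of c f 0] c by simp
  finally have val: "(LINT x|lborel. f (c * x)) = exp (- S\<^sup>2 / 2) / c"
    using c by (simp add: scaleR_conv_of_real field_simps)
  have intfc: "integrable lborel (\<lambda>x. f (c * x))"
    using lborel_integrable_real_affine[OF intf, of c 0] c by simp
  have hi: "((\<lambda>x. f (c * x)) has_integral complex_of_real (exp (- S\<^sup>2 / 2)) / c) UNIV"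
    using has_integral_integral_lborel[OF intfc] val by simp
  have S2: "S\<^sup>2 / 2 = pi * s\<^sup>2 / t"
    unfolding S_def power_divide c using t by (simp add: field_simps power2_eq_square)
  have fc: "sqrt (2 * pi) * f (c * x) = complex_of_real (exp (- pi * t * x\<^sup>2)) * cis (2 * pi * s * x)" for x
  proof -
    have "std_normal_density (c * x) * sqrt (2 * pi) = exp (- pi * t * x\<^sup>2)"
      using c by (simp add: normal_density_def power_mult_distrib)
    moreover have "iexp (S * (c * x)) = cis (2 * pi * s * x)"
      using c by (simp add: S_def cis_conv_exp mult.assoc)
    ultimately show ?thesis
      unfolding f_def scaleR_conv_of_real by (metis mult.assoc mult.commute of_real_mult)
  qed
  have "((\<lambda>x. sqrt (2 * pi) * f (c * x)) has_integral sqrt (2 * pi) * (complex_of_real (exp (- S\<^sup>2 / 2)) / c)) UNIV"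
    by (rule has_integral_mult_right[OF hi])
  moreover have "sqrt (2 * pi) * (complex_of_real (exp (- S\<^sup>2 / 2)) / c) = exp (- pi * s\<^sup>2 / t) / sqrt t"
  proof -
    have "c = sqrt (2 * pi) * sqrt t" by (simp add: c_def real_sqrt_mult)
    then have "sqrt (2 * pi) * (exp (- S\<^sup>2 / 2) / c) = exp (- pi * s\<^sup>2 / t) / sqrt t"
      using S2 by simp
    then show ?thesis by (metis of_real_divide of_real_mult)
  qed
  ultimately show ?thesis unfolding fc by simp
qed

lemma integral_infsum:
  fixes f :: "'i \<Rightarrow> real \<Rightarrow> complex"
  assumes cont: "\<And>k. k \<in> A \<Longrightarrow> continuous_on {a..b} (f k)"
    and le: "\<And>k x. k \<in> A \<Longrightarrow> x \<in> {a..b} \<Longrightarrow> norm (f k x) \<le> M k" and M: "M summable_on A"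
  shows "((\<lambda>k. integral {a..b} (f k)) has_sum integral {a..b} (\<lambda>x. \<Sum>\<^sub>\<infinity>k\<in>A. f k x)) A"
proof -
  \<comment> \<open>Extended by zero off A, so that continuity is available for every index rather
    than only for those in A.\<close>
  define g where "g k = (if k \<in> A then f k else (\<lambda>_. 0))" for k
  have cg: "continuous_on {a..b} (g k)" for k using cont by (simp add: g_def)
  have ul: "uniform_limit {a..b} (\<lambda>X x. \<Sum>k\<in>X. g k x) (\<lambda>x. \<Sum>\<^sub>\<infinity>k\<in>A. g k x) (finite_subsets_at_top A)"
    by (rule Weierstrass_m_test_general[OF _ M]) (auto simp: g_def le)
  obtain I J where IJ: "\<And>X. ((\<lambda>x. \<Sum>k\<in>X. g k x) has_integral I X) {a..b}"
    "((\<lambda>x. \<Sum>\<^sub>\<infinity>k\<in>A. g k x) has_integral J) {a..b}" "(I \<longlongrightarrow> J) (finite_subsets_at_top A)"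
    by (rule uniform_limit_integral[OF ul]) (auto intro!: continuous_intros cg)
  have "I X = (\<Sum>k\<in>X. integral {a..b} (g k))" if "finite X" for X
    using integral_unique[OF IJ(1)[of X]] that
    by (subst (asm) integral_sum) (auto intro!: integrable_continuous_real cg)
  then have "\<forall>\<^sub>F X in finite_subsets_at_top A. I X = (\<Sum>k\<in>X. integral {a..b} (g k))"
    by (intro eventually_finite_subsets_at_top_weakI) auto
  with IJ(3) have "((\<lambda>X. \<Sum>k\<in>X. integral {a..b} (g k)) \<longlongrightarrow> J) (finite_subsets_at_top A)"
    by (rule Lim_transform_eventually)
  then have "((\<lambda>k. integral {a..b} (g k)) has_sum J) A" by (simp add: has_sum_def)
  moreover have "J = integral {a..b} (\<lambda>x. \<Sum>\<^sub>\<infinity>k\<in>A. f k x)"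
  proof -
    have "(\<lambda>x. \<Sum>\<^sub>\<infinity>k\<in>A. g k x) = (\<lambda>x. \<Sum>\<^sub>\<infinity>k\<in>A. f k x)"
      by (auto intro!: infsum_cong simp: g_def)
    then show ?thesis using integral_unique[OF IJ(2)] by simp
  qed
  ultimately show ?thesis
    by (subst (asm) has_sum_cong[of _ _ "\<lambda>k. integral {a..b} (f k)"]) (auto simp: g_def)
qed

text \<open>A periodised Gaussian; \<open>jacobi_sum\<close> is, up to a factor, its Fourier series
  when t = 1/s. The two are the sides of Poisson summation.\<close>

definition gauss_sum :: "complex \<Rightarrow> complex \<Rightarrow> complex" where
  "gauss_sum t y = (\<Sum>\<^sub>\<infinity>k::int. exp (- (of_real pi * t * (of_int k + y)\<^sup>2)))"

definition jacobi_sum :: "complex \<Rightarrow> complex \<Rightarrow> complex" where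
  "jacobi_sum s y = (\<Sum>\<^sub>\<infinity>n::int. exp (- (of_real pi * s * (of_int n)\<^sup>2) + 2 * of_real pi * \<i> * of_int n * y))"

lemma gauss_sum_summable:
  assumes "Re t > 0"
  shows "(\<lambda>k::int. norm (exp (- (of_real pi * t * (of_int k + y)\<^sup>2)))) summable_on UNIV"
  using summable_on_gauss_int_complex[of "of_real pi * t" "- (2 * of_real pi * t * y)" "- (of_real pi * t * y\<^sup>2)"] assms
  by (simp add: power2_eq_square algebra_simps)

lemma jacobi_sum_summable:
  assumes "Re s > 0"
  shows "(\<lambda>n::int. norm (exp (- (of_real pi * s * (of_int n)\<^sup>2) + 2 * of_real pi * \<i> * of_int n * y))) summable_on UNIV"
  using summable_on_gauss_int_complex[of "of_real pi * s" "2 * of_real pi * \<i> * y" 0] assms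
  by (simp add: mult_ac)

lemma holomorphic_gauss_sum_left: "(\<lambda>t. gauss_sum t y) holomorphic_on {t. Re t > 0}"
proof -
  have "(\<lambda>t. \<Sum>\<^sub>\<infinity>k::int. exp (0 + (- (of_real pi * (of_int k + y)\<^sup>2)) * t)) holomorphic_on {t. Re t > 0}"
  proof (rule holomorphic_infsum_exp)
    show "open {t. Re t > 0}" by (rule open_halfspace_Re_gt)
    show "(\<lambda>k::int. norm (exp (0 + (- (of_real pi * (of_int k + y)\<^sup>2)) * t))) summable_on UNIV" if "t \<in> {t. Re t > 0}" for t
      using gauss_sum_summable[of t y] that by (simp add: mult_ac)
  qed
  then show ?thesis by (simp add: gauss_sum_def[abs_def] mult_ac)
qed

text \<open>The exponent is quadratic in y. Once exp (- pi t y^2) is taken out of the sum it becomes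
  affine and \<open>holomorphic_infsum_exp\<close> applies.\<close>

lemma holomorphic_gauss_sum_right:
  assumes "Re t > 0"
  shows "gauss_sum t holomorphic_on UNIV"
proof -
  have eq: "exp (- (of_real pi * t * (of_int k + y)\<^sup>2)) = exp (- (of_real pi * t * y\<^sup>2)) * exp (- (of_real pi * t * (of_int k)\<^sup>2) + (- (2 * of_real pi * t * of_int k)) * y)" for y k
    unfolding exp_add[symmetric] by (simp add: power2_eq_square algebra_simps)
  have "(\<lambda>y. \<Sum>\<^sub>\<infinity>k::int. exp (- (of_real pi * t * (of_int k)\<^sup>2) + (- (2 * of_real pi * t * of_int k)) * y)) holomorphic_on UNIV"
  proof (rule holomorphic_infsum_exp)
    show "(\<lambda>k::int. norm (exp (- (of_real pi * t * (of_int k)\<^sup>2) + (- (2 * of_real pi * t * of_int k)) * y))) summable_on UNIV" for y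
      using summable_on_gauss_int_complex[of "of_real pi * t" "- (2 * of_real pi * t * y)" 0] assms by (simp add: mult_ac)
  qed auto
  then have "(\<lambda>y. exp (- (of_real pi * t * y\<^sup>2)) * (\<Sum>\<^sub>\<infinity>k::int. exp (- (of_real pi * t * (of_int k)\<^sup>2) + (- (2 * of_real pi * t * of_int k)) * y))) holomorphic_on UNIV"
    by (intro holomorphic_intros)
  then show ?thesis by (simp add: gauss_sum_def[abs_def] eq infsum_cmult_right')
qed

lemma holomorphic_jacobi_sum_left: "(\<lambda>s. jacobi_sum s y) holomorphic_on {t. Re t > 0}"
proof -
  have "(\<lambda>s. \<Sum>\<^sub>\<infinity>n::int. exp (2 * of_real pi * \<i> * of_int n * y + (- (of_real pi * (of_int n)\<^sup>2)) * s)) holomorphic_on {t. Re t > 0}"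
  proof (rule holomorphic_infsum_exp)
    show "open {t. Re t > 0}" by (rule open_halfspace_Re_gt)
    show "(\<lambda>n::int. norm (exp (2 * of_real pi * \<i> * of_int n * y + (- (of_real pi * (of_int n)\<^sup>2)) * t))) summable_on UNIV" if "t \<in> {t. Re t > 0}" for t
      using jacobi_sum_summable[of t y] that by (simp add: mult_ac add.commute)
  qed
  then show ?thesis by (simp add: jacobi_sum_def[abs_def] mult_ac add.commute)
qed

lemma holomorphic_jacobi_sum_right:
  assumes "Re s > 0"
  shows "jacobi_sum s holomorphic_on UNIV"
proof -
  have "(\<lambda>y. \<Sum>\<^sub>\<infinity>n::int. exp (- (of_real pi * s * (of_int n)\<^sup>2) + (2 * of_real pi * \<i> * of_int n) * y)) holomorphic_on UNIV"
    by (rule holomorphic_infsum_exp) (use jacobi_sum_summable[OF assms] in auto)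
  then show ?thesis by (simp add: jacobi_sum_def[abs_def])
qed

lemma filterlim_int_intervals:
  "filterlim (\<lambda>N. {- int N..<int N}) (finite_subsets_at_top UNIV) sequentially"
  unfolding filterlim_finite_subsets_at_top
proof safe
  fix X :: "int set" assume "finite X"
  then have "\<bar>x\<bar> < Max (insert 0 (abs ` X)) + 1" if "x \<in> X" for x
    using that Max_ge[of "insert 0 (abs ` X)" "\<bar>x\<bar>"] by auto
  then obtain B where B: "\<And>x. x \<in> X \<Longrightarrow> \<bar>x\<bar> < B" by blast
  show "\<forall>\<^sub>F N in sequentially. finite {- int N..<int N} \<and> X \<subseteq> {- int N..<int N} \<and> {- int N..<int N} \<subseteq> UNIV"
    using eventually_ge_at_top[of "nat B"]
  proof eventually_elim
    case (elim N)
    have "x \<in> {- int N..<int N}" if "x \<in> X" for x using B[OF that] elim by auto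
    then show ?case by auto
  qed
qed

text \<open>Termwise integration leaves only n = - m; the minus sign is there because the test
  function is exp (2 pi i m x) and not its conjugate.\<close>

lemma jacobi_sum_coeff:
  assumes s: "Re s > 0"
  shows "integral {0..1} (\<lambda>x. jacobi_sum s (complex_of_real x) * cis (2 * pi * of_int m * x)) = exp (- (of_real pi * s * (of_int m)\<^sup>2))"
proof -
  define f where "f n x = exp (- (of_real pi * s * (of_int n)\<^sup>2)) * cis (2 * pi * (of_int n + of_int m) * x)" for n :: int and x :: real
  have "((\<lambda>n. integral {0..1} (f n)) has_sum integral {0..1} (\<lambda>x. \<Sum>\<^sub>\<infinity>n\<in>UNIV. f n x)) UNIV"
  proof (rule integral_infsum)
    show "(\<lambda>n::int. norm (exp (- (of_real pi * s * (of_int n)\<^sup>2)))) summable_on UNIV"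
      using jacobi_sum_summable[OF s, of 0] by simp
  qed (auto simp: f_def norm_mult intro!: continuous_intros)
  moreover have "integral {0..1} (f n) = (if n = - m then exp (- (of_real pi * s * (of_int m)\<^sup>2)) else 0)" for n
  proof (cases "n = - m")
    case True
    then have "f n = (\<lambda>_. exp (- (of_real pi * s * (of_int m)\<^sup>2)))" by (simp add: f_def fun_eq_iff)
    then show ?thesis using True by simp
  next
    case False
    define c where "c = 2 * pi * (of_int n + of_int m :: real)"
    have c: "c \<noteq> 0" using False by (auto simp: c_def simp flip: of_int_add)
    have "((\<lambda>x. cis (c * x)) has_integral (cis (c * 1) / (\<i> * c) - cis (c * 0) / (\<i> * c))) {0..1}"
    proof (rule fundamental_theorem_of_calculus)
      fix x :: real
      have "((\<lambda>z. exp (\<i> * c * z) / (\<i> * c)) has_field_derivative exp (\<i> * c * of_real x)) (at (of_real x))"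
        using c by (auto intro!: derivative_eq_intros)
      then have "((\<lambda>x. exp (\<i> * c * of_real x) / (\<i> * c)) has_vector_derivative exp (\<i> * c * of_real x)) (at x within {0..1})"
        by (rule has_vector_derivative_real_field)
      then show "((\<lambda>x. cis (c * x) / (\<i> * c)) has_vector_derivative cis (c * x)) (at x within {0..1})"
        by (simp add: cis_conv_exp mult.assoc)
    qed simp
    moreover have "cis c = 1"
    proof -
      have "c = 2 * pi * real_of_int (n + m)" by (simp add: c_def)
      then show ?thesis using cis_multiple_2pi[of "real_of_int (n + m)"] by simp
    qed
    ultimately have "((\<lambda>x. cis (c * x)) has_integral 0) {0..1}" by simp
    then have "integral {0..1} (\<lambda>x. exp (- (of_real pi * s * (of_int n)\<^sup>2)) * cis (c * x)) = 0"
      by (simp add: integral_unique)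
    moreover have "f n = (\<lambda>x. exp (- (of_real pi * s * (of_int n)\<^sup>2)) * cis (c * x))"
      by (simp add: f_def c_def fun_eq_iff)
    ultimately show ?thesis using False by simp
  qed
  ultimately have "((\<lambda>n. if n = - m then exp (- (of_real pi * s * (of_int m)\<^sup>2)) else 0) has_sum
      integral {0..1} (\<lambda>x. \<Sum>\<^sub>\<infinity>n\<in>UNIV. f n x)) UNIV" by simp
  moreover have "((\<lambda>n. if n = - m then exp (- (of_real pi * s * (of_int m)\<^sup>2)) else 0) has_sum exp (- (of_real pi * s * (of_int m)\<^sup>2))) UNIV"
    by (rule has_sum_finite_neutralI[of "{- m}"]) auto
  ultimately have "integral {0..1} (\<lambda>x. \<Sum>\<^sub>\<infinity>n\<in>UNIV. f n x) = exp (- (of_real pi * s * (of_int m)\<^sup>2))"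
    using has_sum_unique by blast
  moreover have "(\<Sum>\<^sub>\<infinity>n\<in>UNIV. f n x) = jacobi_sum s (complex_of_real x) * cis (2 * pi * of_int m * x)" for x
    unfolding jacobi_sum_def f_def infsum_cmult_left'[symmetric]
    by (intro infsum_cong) (simp add: cis_conv_exp exp_add[symmetric] algebra_simps)
  ultimately show ?thesis by simp
qed

text \<open>Unfolding: the integer translates of [0, 1] tile the line, so this coefficient is a
  Fourier integral over the whole line. The sum over k and the improper integral are compared along
  the intervals from -N to N.\<close>

lemma gauss_sum_coeff:
  fixes t :: real
  assumes t: "t > 0"
  shows "integral {0..1} (\<lambda>x. gauss_sum t (complex_of_real x) * cis (2 * pi * of_int m * x)) = exp (- pi * (of_int m)\<^sup>2 / t) / sqrt t"
proof -
  define g where "g x = complex_of_real (exp (- pi * t * x\<^sup>2)) * cis (2 * pi * of_int m * x)" for x :: real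
  define f where "f k x = exp (- (of_real pi * of_real t * (of_int k + complex_of_real x)\<^sup>2)) * cis (2 * pi * of_int m * x)" for k :: int and x :: real
  have fg: "f k x = g (real_of_int k + x)" for k x
  proof -
    have "cis (2 * pi * of_int m * (real_of_int k + x)) = cis (2 * pi * of_int m * x)"
      using cis_multiple_2pi[of "real_of_int (m * k)"]
      by (simp add: distrib_left cis_mult[symmetric] mult.assoc)
    moreover have "exp (- (of_real pi * of_real t * (of_int k + complex_of_real x)\<^sup>2)) = complex_of_real (exp (- pi * t * (real_of_int k + x)\<^sup>2))"
      by (simp add: exp_of_real[symmetric])
    ultimately show ?thesis by (simp add: f_def g_def)
  qed
  have gc: "continuous_on S g" for S unfolding g_def by (intro continuous_intros)
  have gi: "(g has_integral (exp (- pi * (of_int m)\<^sup>2 / t) / sqrt t)) UNIV"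
    unfolding g_def using gaussian_fourier_transform[OF t, of "of_int m"] by simp
  have "((\<lambda>k. integral {0..1} (f k)) has_sum integral {0..1} (\<lambda>x. \<Sum>\<^sub>\<infinity>k\<in>UNIV. f k x)) UNIV"
  proof (rule integral_infsum)
    show "continuous_on {0..1} (f k)" for k unfolding f_def by (intro continuous_intros)
    \<comment> \<open>A majorant independent of x, from (k + x)^2 \<ge> k^2/2 - 1 for x in
      [0, 1].\<close>
    show "(\<lambda>k::int. exp (- (pi * t / 2) * (real_of_int k)\<^sup>2 + 0 * real_of_int k + pi * t)) summable_on UNIV"
      using t by (intro summable_on_gauss_int) auto
    fix k :: int and x :: real assume x: "x \<in> {0..1}"
    have "(real_of_int k)\<^sup>2 / 2 - 1 \<le> (real_of_int k + x)\<^sup>2"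
    proof -
      have "(real_of_int k + x)\<^sup>2 - (real_of_int k)\<^sup>2 / 2 + x\<^sup>2 = (real_of_int k + 2 * x)\<^sup>2 / 2"
        by (simp add: power2_eq_square field_simps)
      moreover have "x\<^sup>2 \<le> 1" using x by (simp add: power_le_one)
      ultimately show ?thesis by (smt (verit) zero_le_power2 divide_nonneg_nonneg)
    qed
    then have "pi * t * ((real_of_int k)\<^sup>2 / 2 - 1) \<le> pi * t * (real_of_int k + x)\<^sup>2"
      using t by (intro mult_left_mono) auto
    then show "norm (f k x) \<le> exp (- (pi * t / 2) * (real_of_int k)\<^sup>2 + 0 * real_of_int k + pi * t)"
      unfolding fg g_def by (simp add: norm_mult algebra_simps)
  qed
  then have hs: "((\<lambda>k. integral {0..1} (f k)) has_sum integral {0..1} (\<lambda>x. gauss_sum t (complex_of_real x) * cis (2 * pi * of_int m * x))) UNIV"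
    by (simp add: f_def gauss_sum_def infsum_cmult_left')
  have shift: "integral {0..1} (f k) = integral {real_of_int k..real_of_int k + 1} g" for k
    using integral_shift_Icc_real[of 0 1 g "real_of_int k"] by (simp add: fg[abs_def] o_def add.commute)
  have part: "(\<Sum>k\<in>{- int N..<int N}. integral {0..1} (f k)) = integral {- real N..real N} g" for N
  proof (induction N)
    case (Suc N)
    have gint: "g integrable_on S" if "S = {a..b}" for a b S
      using that by (auto intro: integrable_continuous_real gc)
    have "{- int (Suc N)..<int (Suc N)} = insert (- int (Suc N)) (insert (int N) {- int N..<int N})" by auto
    then have "(\<Sum>k\<in>{- int (Suc N)..<int (Suc N)}. integral {0..1} (f k))
      = integral {- real (Suc N)..- real N} g + (integral {real N..real (Suc N)} g + integral {- real N..real N} g)"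
      using Suc.IH by (simp add: shift algebra_simps)
    also have "integral {real N..real (Suc N)} g + integral {- real N..real N} g = integral {- real N..real (Suc N)} g"
      using Henstock_Kurzweil_Integration.integral_combine[of "- real N" "real N" "real (Suc N)" g] gint by (simp add: add.commute)
    also have "integral {- real (Suc N)..- real N} g + \<dots> = integral {- real (Suc N)..real (Suc N)} g"
      using Henstock_Kurzweil_Integration.integral_combine[of "- real (Suc N)" "- real N" "real (Suc N)" g] gint by simp
    finally show ?case .
  qed simp
  have lim1: "(\<lambda>N. integral {- real N..real N} g) \<longlonglongrightarrow> integral {0..1} (\<lambda>x. gauss_sum t (complex_of_real x) * cis (2 * pi * of_int m * x))"
    using filterlim_compose[OF hs[unfolded has_sum_def] filterlim_int_intervals] by (simp add: part)
  have lim2: "(\<lambda>N. integral {- real N..real N} g) \<longlonglongrightarrow> exp (- pi * (of_int m)\<^sup>2 / t) / sqrt t"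
  proof (rule LIMSEQ_I)
    fix e :: real assume "e > 0"
    then obtain B where B: "B > 0" "\<And>a b. ball 0 B \<subseteq> cbox a b \<Longrightarrow> norm (integral (cbox a b) g - (exp (- pi * (of_int m)\<^sup>2 / t) / sqrt t)) < e"
      using gi[unfolded has_integral_alt'[of g]] by auto
    show "\<exists>no. \<forall>n\<ge>no. norm (integral {- real n..real n} g - (exp (- pi * (of_int m)\<^sup>2 / t) / sqrt t)) < e"
    proof (intro exI[of _ "nat \<lceil>B\<rceil>"] allI impI)
      fix n assume "nat \<lceil>B\<rceil> \<le> n"
      then have "B \<le> real n" by linarith
      then have "ball 0 B \<subseteq> cbox (- real n) (real n)" by (auto simp: dist_real_def)
      from B(2)[OF this] show "norm (integral {- real n..real n} g - (exp (- pi * (of_int m)\<^sup>2 / t) / sqrt t)) < e" by simp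
    qed
  qed
  show ?thesis using LIMSEQ_unique[OF lim1 lim2] by simp
qed

lemma gauss_sum_periodic: "gauss_sum t (y + 1) = gauss_sum t y"
  unfolding gauss_sum_def
  by (rule infsum_reindex_bij_witness[of _ "\<lambda>k. k - 1" "\<lambda>k. k + 1"]) (auto simp: algebra_simps)

lemma jacobi_sum_periodic: "jacobi_sum s (y + 1) = jacobi_sum s y"
proof -
  have "exp (- (of_real pi * s * (of_int n)\<^sup>2) + 2 * of_real pi * \<i> * of_int n * (y + 1)) = exp (- (of_real pi * s * (of_int n)\<^sup>2) + 2 * of_real pi * \<i> * of_int n * y)" for n :: int
  proof -
    have "exp (2 * of_real pi * \<i> * of_int n) = 1" using exp_integer_2pi[of "of_int n"] by (simp add: mult_ac)
    moreover have "- (of_real pi * s * (of_int n)\<^sup>2) + 2 * of_real pi * \<i> * of_int n * (y + 1)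
        = (- (of_real pi * s * (of_int n)\<^sup>2) + 2 * of_real pi * \<i> * of_int n * y) + 2 * of_real pi * \<i> * of_int n"
      by (simp add: algebra_simps)
    ultimately show ?thesis by (metis exp_add mult_1_right)
  qed
  then show ?thesis by (simp add: jacobi_sum_def)
qed

text \<open>Both sides are continuous, have period 1 in y and have equal Fourier
  coefficients.\<close>

lemma poisson_gauss_real:
  fixes s y :: real
  assumes s: "s > 0"
  shows "gauss_sum (1 / s) y = csqrt s * jacobi_sum s y"
proof -
  define H where "H x = gauss_sum (1 / s) (complex_of_real x) - csqrt s * jacobi_sum s (complex_of_real x)" for x
  have cg: "continuous_on UNIV (\<lambda>x. gauss_sum (1 / s) (complex_of_real x))"
    by (rule continuous_on_compose2[OF holomorphic_on_imp_continuous_on[OF holomorphic_gauss_sum_right]])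
      (use s in \<open>auto intro!: continuous_intros simp flip: of_real_divide\<close>)
  have cj: "continuous_on UNIV (\<lambda>x. jacobi_sum s (complex_of_real x))"
    by (rule continuous_on_compose2[OF holomorphic_on_imp_continuous_on[OF holomorphic_jacobi_sum_right]])
      (use s in \<open>auto intro!: continuous_intros\<close>)
  have "H y = 0"
  proof (rule fourier_unique)
    show "continuous_on UNIV H" unfolding H_def by (intro continuous_intros cg cj)
    show "H (x + 1) = H x" for x by (simp add: H_def gauss_sum_periodic jacobi_sum_periodic)
    fix n :: int
    have "integral {0..1} (\<lambda>x. H x * cis (2 * pi * of_int n * x)) =
        integral {0..1} (\<lambda>x. gauss_sum (1 / s) (complex_of_real x) * cis (2 * pi * of_int n * x)
            - csqrt s * (jacobi_sum s (complex_of_real x) * cis (2 * pi * of_int n * x)))"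
      by (simp add: H_def algebra_simps)
    also have "\<dots> = integral {0..1} (\<lambda>x. gauss_sum (1 / s) (complex_of_real x) * cis (2 * pi * of_int n * x))
          - csqrt s * integral {0..1} (\<lambda>x. jacobi_sum s (complex_of_real x) * cis (2 * pi * of_int n * x))"
      by (subst integral_diff)
        (auto intro!: integrable_continuous_real continuous_intros continuous_on_subset[OF cg[simplified]] continuous_on_subset[OF cj])
    also have "\<dots> = 0"
    proof -
      have "integral {0..1} (\<lambda>x. gauss_sum (1 / s) (complex_of_real x) * cis (2 * pi * of_int n * x)) = exp (- pi * (of_int n)\<^sup>2 * s) * sqrt s"
        using gauss_sum_coeff[of "1 / s" n] s by (simp add: real_sqrt_divide)
      moreover have "integral {0..1} (\<lambda>x. jacobi_sum s (complex_of_real x) * cis (2 * pi * of_int n * x)) = complex_of_real (exp (- pi * (of_int n)\<^sup>2 * s))"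
        using jacobi_sum_coeff[of s n] s by (simp add: mult_ac exp_of_real[symmetric])
      ultimately show ?thesis using s by simp
    qed
    finally show "integral {0..1} (\<lambda>x. H x * cis (2 * pi * of_int n * x)) = 0" .
  qed
  then show ?thesis by (simp add: H_def)
qed

lemma islimpt_reals:
  assumes "x > (0::real)"
  shows "complex_of_real x islimpt {complex_of_real y |y. y > 0}"
  unfolding islimpt_approachable
proof safe
  fix e :: real assume "e > 0"
  then show "\<exists>x'\<in>{complex_of_real y |y. 0 < y}. x' \<noteq> complex_of_real x \<and> dist x' (complex_of_real x) < e"
    using assms by (intro bexI[of _ "complex_of_real (x + e / 2)"]) (auto simp: dist_norm simp flip: of_real_diff of_real_add of_real_divide)
qed

text \<open>Analytic continuation from the positive reals, first in s with y real and then in y. The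
  principal root is holomorphic on Re s > 0, so the branch is settled by its positive values
  there.\<close>

theorem poisson_gauss:
  assumes s: "Re s > 0"
  shows "gauss_sum (1 / s) y = csqrt s * jacobi_sum s y"
proof -
  have inv: "Re (1 / s) > 0" if "Re s > 0" for s
    using that by (simp add: Re_divide sum_power2_gt_zero_iff)
  have realy: "gauss_sum (1 / s) (complex_of_real x) - csqrt s * jacobi_sum s (complex_of_real x) = 0" if s: "Re s > 0" for x s
  proof (rule analytic_continuation[where f = "\<lambda>s. gauss_sum (1 / s) (complex_of_real x) - csqrt s * jacobi_sum s (complex_of_real x)"
        and S = "{s. Re s > 0}" and U = "{complex_of_real y |y. y > 0}" and \<xi> = 1])
    have "(\<lambda>s. gauss_sum (1 / s) (complex_of_real x)) holomorphic_on {s. Re s > 0}"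
      by (rule holomorphic_on_compose_gen[OF _ holomorphic_gauss_sum_left, of "\<lambda>s. 1 / s", unfolded o_def])
        (auto intro!: holomorphic_intros inv)
    then show "(\<lambda>s. gauss_sum (1 / s) (complex_of_real x) - csqrt s * jacobi_sum s (complex_of_real x)) holomorphic_on {s. Re s > 0}"
      by (intro holomorphic_intros holomorphic_jacobi_sum_left) (auto simp: complex_nonpos_Reals_iff)
    show "open {s. 0 < Re s}" by (rule open_halfspace_Re_gt)
    show "connected {s. 0 < Re s}" by (intro convex_connected convex_halfspace_Re_gt)
    show "1 islimpt {complex_of_real y |y. y > 0}" using islimpt_reals[of 1] by simp
    show "gauss_sum (1 / z) (complex_of_real x) - csqrt z * jacobi_sum z (complex_of_real x) = 0"
      if "z \<in> {complex_of_real y |y. y > 0}" for z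
      using that poisson_gauss_real by auto
  qed (use s in auto)
  have "gauss_sum (1 / s) y - csqrt s * jacobi_sum s y = 0"
  proof (rule analytic_continuation[where f = "\<lambda>y. gauss_sum (1 / s) y - csqrt s * jacobi_sum s y"
        and S = UNIV and U = "{complex_of_real y |y. y > 0}" and \<xi> = 1])
    show "(\<lambda>y. gauss_sum (1 / s) y - csqrt s * jacobi_sum s y) holomorphic_on UNIV"
      by (intro holomorphic_intros holomorphic_gauss_sum_right holomorphic_jacobi_sum_right inv s)
    show "1 islimpt {complex_of_real y |y. y > 0}" using islimpt_reals[of 1] by simp
    show "gauss_sum (1 / s) z - csqrt s * jacobi_sum s z = 0"
      if "z \<in> {complex_of_real y |y. y > 0}" for z
      using that realy[OF s] by auto
  qed auto
  then show ?thesis by simp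
qed

section \<open>Modular transformation of theta functions of index \<open>R\<close> in one
  variable\<close>

definition th1 :: "nat \<Rightarrow> complex \<Rightarrow> complex \<Rightarrow> complex \<Rightarrow> complex" where
  "th1 R x \<sigma> w = (\<Sum>\<^sub>\<infinity>k::int. exp (of_real pi * \<i> * of_nat R * (\<sigma> * (of_int k + x)\<^sup>2 + 2 * (of_int k + x) * w)))"

lemma th1_summable:
  assumes "Im \<sigma> > 0" "R > 0"
  shows "(\<lambda>k::int. norm (exp (of_real pi * \<i> * of_nat R * (\<sigma> * (of_int k + x)\<^sup>2 + 2 * (of_int k + x) * w)))) summable_on UNIV"
proof -
  have "Re (- (of_real pi * \<i> * of_nat R * \<sigma>)) > 0" using assms by simp
  from summable_on_gauss_int_complex[OF this, of "of_real pi * \<i> * of_nat R * (2 * \<sigma> * x + 2 * w)"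
      "of_real pi * \<i> * of_nat R * (\<sigma> * x\<^sup>2 + 2 * x * w)"]
  show ?thesis by (simp add: power2_eq_square algebra_simps)
qed

lemma exp_two_pi_i_int: "exp (2 * of_real pi * \<i> * of_int n) = 1"
  using exp_integer_2pi[of "of_int n"] by (simp add: mult_ac)

lemma bij_betw_residues:
  assumes "R > 0"
  shows "bij_betw (\<lambda>(n, k). int R * k + int n) ({..<R} \<times> UNIV) UNIV"
proof (rule bij_betwI[where g = "\<lambda>m. (nat (m mod int R), m div int R)"])
  show "(\<lambda>m. (nat (m mod int R), m div int R)) \<in> UNIV \<rightarrow> {..<R} \<times> UNIV"
    using assms by (auto simp: nat_less_iff)
qed (use assms in \<open>auto simp: nat_mod_distrib\<close>)

lemma infsum_int_residues:
  fixes f :: "int \<Rightarrow> complex"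
  assumes R: "R > 0" and f: "(\<lambda>k. norm (f k)) summable_on UNIV"
  shows "(\<Sum>\<^sub>\<infinity>m. f m) = (\<Sum>n<R. \<Sum>\<^sub>\<infinity>k. f (int R * k + int n))"
proof -
  have fs: "f summable_on UNIV" using f by (rule abs_summable_summable)
  have s: "(\<lambda>(n, k). f (int R * k + int n)) summable_on ({..<R} \<times> UNIV)"
    using summable_on_reindex_bij_betw[OF bij_betw_residues[OF R], of f] fs by (simp add: case_prod_unfold)
  have "(\<Sum>\<^sub>\<infinity>m. f m) = (\<Sum>\<^sub>\<infinity>(n, k)\<in>{..<R} \<times> UNIV. f (int R * k + int n))"
    using infsum_reindex_bij_betw[OF bij_betw_residues[OF R], of f] by (simp add: case_prod_unfold)
  also have "\<dots> = (\<Sum>\<^sub>\<infinity>n\<in>{..<R}. \<Sum>\<^sub>\<infinity>k. f (int R * k + int n))"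
    using infsum_Sigma'_banach[OF s] by simp
  finally show ?thesis by simp
qed

text \<open>Division by a positive real keeps the root in the right half-plane, hence
  principal.\<close>

lemma csqrt_div_of_nat:
  assumes "R > 0" "Re z > 0"
  shows "csqrt (z / of_nat R) = csqrt z / sqrt R"
proof (rule csqrt_unique)
  have "(complex_of_real (sqrt R))\<^sup>2 = of_nat R"
    by (metis of_nat_0_le_iff of_real_of_nat_eq of_real_power real_sqrt_pow2)
  then show "(csqrt z / sqrt R)\<^sup>2 = z / of_nat R" by (simp add: power_divide)
  have "Re (csqrt z) > 0" using assms(2) csqrt_principal[of z]
    by (metis csqrt_of_real_nonneg less_irrefl Re_csqrt order_le_less power2_csqrt complex_nonpos_Reals_iff zero_complex.sel(1) Re_power2 zero_power2 linorder_not_le power2_less_eq_zero_iff diff_ge_0_iff_ge nle_le)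
  then show "0 < Re (csqrt z / sqrt R) \<or> Re (csqrt z / sqrt R) = 0 \<and> 0 \<le> Im (csqrt z / sqrt R)"
    using assms(1) by (simp add: Re_divide_of_real)
qed

text \<open>The exponential in w completes the square and gives a Gaussian sum with parameter 1/s =
  i R/\<sigma>. Poisson summation turns it into a Fourier series, and sorting its index by residues
  modulo R produces the characteristics n'/R.\<close>

lemma th1_inversion:
  assumes \<sigma>: "Im \<sigma> > 0" and R: "R > 0"
  shows "th1 R (of_int n / of_nat R) (- 1 / \<sigma>) (w / \<sigma>) * exp (- (of_real pi * \<i> * of_nat R * w\<^sup>2 / \<sigma>))
    = csqrt (- \<i> * \<sigma>) * (\<Sum>n'<R. exp (- 2 * of_real pi * \<i> * of_int n * of_nat n' / of_nat R) / sqrt R * th1 R (of_nat n' / of_nat R) \<sigma> w)"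
proof -
  define s where "s = - \<i> * \<sigma> / of_nat R"
  have s: "Re s > 0" using \<sigma> R by (simp add: s_def)
  have s0: "\<sigma> \<noteq> 0" using \<sigma> by auto
  have R0: "(of_nat R :: complex) \<noteq> 0" using R by simp
  define y where "y = of_int n / of_nat R - w"
  have "th1 R (of_int n / of_nat R) (- 1 / \<sigma>) (w / \<sigma>) * exp (- (of_real pi * \<i> * of_nat R * w\<^sup>2 / \<sigma>)) = gauss_sum (1 / s) y"
    unfolding th1_def gauss_sum_def infsum_cmult_left'[symmetric] exp_add[symmetric]
  proof (intro infsum_cong arg_cong[where f = exp])
    fix k :: int
    have inv: "1 / s = \<i> * of_nat R / \<sigma>" using s0 R0 by (simp add: s_def field_simps)
    show "of_real pi * \<i> * of_nat R * (- 1 / \<sigma> * (of_int k + of_int n / of_nat R)\<^sup>2 + 2 * (of_int k + of_int n / of_nat R) * (w / \<sigma>)) +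
         - (of_real pi * \<i> * of_nat R * w\<^sup>2 / \<sigma>) = - (of_real pi * (1 / s) * (of_int k + y)\<^sup>2)"
      unfolding y_def inv using s0 R0 by (simp add: field_simps power2_eq_square)
  qed
  also have "\<dots> = csqrt s * jacobi_sum s y" by (rule poisson_gauss[OF s])
  also have "csqrt s = csqrt (- \<i> * \<sigma>) / sqrt R"
    unfolding s_def by (rule csqrt_div_of_nat) (use R \<sigma> in auto)
  \<comment> \<open>The index is reversed so that w gets the sign it has in \<open>th1\<close>,
    because y contains - w.\<close>
  also have "jacobi_sum s y = (\<Sum>\<^sub>\<infinity>m::int. exp (- (of_real pi * s * (of_int m)\<^sup>2) + 2 * of_real pi * \<i> * of_int (- m) * y))"
    unfolding jacobi_sum_def by (rule infsum_reindex_bij_witness[of _ uminus uminus]) auto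
  also have "\<dots> = (\<Sum>n'<R. \<Sum>\<^sub>\<infinity>k. exp (- (of_real pi * s * (of_int (int R * k + int n'))\<^sup>2) + 2 * of_real pi * \<i> * of_int (- (int R * k + int n')) * y))"
    by (rule infsum_int_residues[OF R]) (use jacobi_sum_summable[OF s, of "- y"] in simp)
  also have "\<dots> = (\<Sum>n'<R. exp (- 2 * of_real pi * \<i> * of_int n * of_nat n' / of_nat R) * th1 R (of_nat n' / of_nat R) \<sigma> w)"
    unfolding th1_def infsum_cmult_right'[symmetric]
  proof (intro sum.cong refl infsum_cong)
    fix n' :: nat and k :: int
    have "- (of_real pi * s * (of_int (int R * k + int n'))\<^sup>2) + 2 * of_real pi * \<i> * of_int (- (int R * k + int n')) * y
      = (- 2 * of_real pi * \<i> * of_int n * of_nat n' / of_nat R + of_real pi * \<i> * of_nat R * (\<sigma> * (of_int k + of_nat n' / of_nat R)\<^sup>2 + 2 * (of_int k + of_nat n' / of_nat R) * w))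
        + 2 * of_real pi * \<i> * of_int (- n * k)"
      unfolding s_def y_def using R0 by (simp add: field_simps power2_eq_square)
    then show "exp (- (of_real pi * s * (of_int (int R * k + int n'))\<^sup>2) + 2 * of_real pi * \<i> * of_int (- (int R * k + int n')) * y)
      = exp (- 2 * of_real pi * \<i> * of_int n * of_nat n' / of_nat R) * exp (of_real pi * \<i> * of_nat R * (\<sigma> * (of_int k + of_nat n' / of_nat R)\<^sup>2 + 2 * (of_int k + of_nat n' / of_nat R) * w))"
      unfolding exp_add[symmetric] by (metis exp_add exp_two_pi_i_int mult_1_right)
  qed
  finally show ?thesis by (simp add: sum_distrib_left sum_divide_distrib mult_ac)
qed

text \<open>Evenness of R makes the phase pi i R q k^2 trivial, and the cross term contributes 2 pi
  i q k n; only the phase of the characteristic remains.\<close>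

lemma th1_translation:
  assumes "even R" "R > 0"
  shows "th1 R (of_int n / of_nat R) (\<sigma> + of_int q) w = exp (of_real pi * \<i> * of_int q * (of_int n)\<^sup>2 / of_nat R) * th1 R (of_int n / of_nat R) \<sigma> w"
  unfolding th1_def infsum_cmult_right'[symmetric]
proof (intro infsum_cong)
  fix k :: int
  obtain R' where R': "R = 2 * R'" using assms by auto
  have R0: "(of_nat R' :: complex) \<noteq> 0" using assms R' by simp
  have "of_real pi * \<i> * of_nat R * ((\<sigma> + of_int q) * (of_int k + of_int n / of_nat R)\<^sup>2 + 2 * (of_int k + of_int n / of_nat R) * w)
    = (of_real pi * \<i> * of_int q * (of_int n)\<^sup>2 / of_nat R + of_real pi * \<i> * of_nat R * (\<sigma> * (of_int k + of_int n / of_nat R)\<^sup>2 + 2 * (of_int k + of_int n / of_nat R) * w))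
     + 2 * of_real pi * \<i> * of_int (q * (int R' * k\<^sup>2 + k * n))"
    unfolding R' using R0 by (simp add: field_simps power2_eq_square)
  then show "exp (of_real pi * \<i> * of_nat R * ((\<sigma> + of_int q) * (of_int k + of_int n / of_nat R)\<^sup>2 + 2 * (of_int k + of_int n / of_nat R) * w))
    = exp (of_real pi * \<i> * of_int q * (of_int n)\<^sup>2 / of_nat R) * exp (of_real pi * \<i> * of_nat R * (\<sigma> * (of_int k + of_int n / of_nat R)\<^sup>2 + 2 * (of_int k + of_int n / of_nat R) * w))"
    unfolding exp_add[symmetric] by (metis exp_add exp_two_pi_i_int mult_1_right)
qed

text \<open>\<open>th1_modular a b c d j\<close> says that the theta functions of each even index \<open>R\<close> and characteristic in
  \<open>\<int>/R\<close> are permuted linearly by the matrix with rows \<open>(a, b)\<close>, \<open>(c, d)\<close>, with automorphy factor \<open>j\<close>.\<close>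

definition th1_modular :: "int \<Rightarrow> int \<Rightarrow> int \<Rightarrow> int \<Rightarrow> (complex \<Rightarrow> complex) \<Rightarrow> bool" where
  "th1_modular a b c d j \<longleftrightarrow> (\<forall>R n. even R \<longrightarrow> R > 0 \<longrightarrow> (\<exists>C. \<forall>\<sigma> w. Im \<sigma> > 0 \<longrightarrow>
     th1 R (of_int n / of_nat R) ((of_int a * \<sigma> + of_int b) / (of_int c * \<sigma> + of_int d)) (w / (of_int c * \<sigma> + of_int d))
       * exp (- (of_real pi * \<i> * of_nat R * of_int c * w\<^sup>2 / (of_int c * \<sigma> + of_int d)))
     = j \<sigma> * (\<Sum>n'<R. C n' * th1 R (of_nat n' / of_nat R) \<sigma> w)))"

definition lift_of :: "int \<Rightarrow> int \<Rightarrow> (complex \<Rightarrow> complex) \<Rightarrow> bool" where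
  "lift_of c d j \<longleftrightarrow> j holomorphic_on {\<sigma>. Im \<sigma> > 0} \<and> (\<forall>\<sigma>. Im \<sigma> > 0 \<longrightarrow> (j \<sigma>)\<^sup>2 = of_int c * \<sigma> + of_int d)"

text \<open>Existential in the lift, so that no branch of the root has to be followed through
  Euclid's algorithm; \<open>lift_of_unique\<close> recovers the prescribed lift at the end.\<close>

definition th1_liftable :: "int \<Rightarrow> int \<Rightarrow> int \<Rightarrow> int \<Rightarrow> bool" where
  "th1_liftable a b c d \<longleftrightarrow> (\<exists>j. lift_of c d j \<and> th1_modular a b c d j)"

lemma moebius_Im:
  assumes det: "a * d - b * c = (1::int)" and \<sigma>: "Im \<sigma> > 0"
  shows "of_int c * \<sigma> + of_int d \<noteq> 0" "Im ((of_int a * \<sigma> + of_int b) / (of_int c * \<sigma> + of_int d)) > 0"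
proof -
  show nz: "of_int c * \<sigma> + of_int d \<noteq> 0"
  proof
    assume 0: "of_int c * \<sigma> + of_int d = 0"
    then have "of_int c * Im \<sigma> = 0" by (simp add: complex_eq_iff)
    then have "c = 0" using \<sigma> by simp
    then show False using 0 det by auto
  qed
  have "Im ((of_int a * \<sigma> + of_int b) / (of_int c * \<sigma> + of_int d)) = of_int (a * d - b * c) * Im \<sigma> / (cmod (of_int c * \<sigma> + of_int d))\<^sup>2"
    by (simp add: Im_divide cmod_power2 algebra_simps)
  then show "Im ((of_int a * \<sigma> + of_int b) / (of_int c * \<sigma> + of_int d)) > 0"
    using det nz \<sigma> by simp
qed

text \<open>Even the identity matrix requires an argument: n is an arbitrary integer on the left,
  whereas only residues 0 \<le> n' < R occur on the right.\<close>

lemma th1_liftable_one: "th1_liftable 1 0 0 1"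
  unfolding th1_liftable_def
proof (intro exI conjI)
  show "lift_of 0 1 (\<lambda>_. 1)" by (simp add: lift_of_def)
  show "th1_modular 1 0 0 1 (\<lambda>_. 1)"
    unfolding th1_modular_def
  proof (intro allI impI)
    fix R :: nat and n :: int assume "even R" and R: "R > 0"
    define n0 where "n0 = nat (n mod int R)"
    have n0: "n0 < R" "n = int R * (n div int R) + int n0" using R by (auto simp: n0_def nat_less_iff)
    have "th1 R (of_int n / of_nat R) \<sigma> w = th1 R (of_nat n0 / of_nat R) \<sigma> w" for \<sigma> w
      unfolding th1_def
    proof (rule infsum_reindex_bij_witness[of _ "\<lambda>k. k - n div int R" "\<lambda>k. k + n div int R"])
      fix k :: int
      have "(of_int n :: complex) / of_nat R = of_int (n div int R) + of_nat n0 / of_nat R"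
        using R by (subst n0(2)) (simp add: field_simps)
      then show "exp (of_real pi * \<i> * of_nat R * (\<sigma> * (of_int (k + n div int R) + of_nat n0 / of_nat R)\<^sup>2 + 2 * (of_int (k + n div int R) + of_nat n0 / of_nat R) * w))
        = exp (of_real pi * \<i> * of_nat R * (\<sigma> * (of_int k + of_int n / of_nat R)\<^sup>2 + 2 * (of_int k + of_int n / of_nat R) * w))"
        by (simp add: add.assoc)
    qed auto
    then show "\<exists>C. \<forall>\<sigma> w. 0 < Im \<sigma> \<longrightarrow> th1 R (of_int n / of_nat R) ((of_int 1 * \<sigma> + of_int 0) / (of_int 0 * \<sigma> + of_int 1)) (w / (of_int 0 * \<sigma> + of_int 1))
        * exp (- (of_real pi * \<i> * of_nat R * of_int 0 * w\<^sup>2 / (of_int 0 * \<sigma> + of_int 1))) = 1 * (\<Sum>n'<R. C n' * th1 R (of_nat n' / of_nat R) \<sigma> w)"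
      using n0 by (intro exI[of _ "\<lambda>n'. if n' = n0 then 1 else 0"]) (simp add: if_distrib[of "\<lambda>x. x * _"] sum.delta cong: if_cong)
  qed
qed

lemma th1_liftable_T:
  assumes "th1_liftable a b c d" and det: "a * d - b * c = 1"
  shows "th1_liftable (a + q * c) (b + q * d) c d"
proof -
  obtain j where j: "lift_of c d j" "th1_modular a b c d j" using assms by (auto simp: th1_liftable_def)
  have "th1_modular (a + q * c) (b + q * d) c d j"
    unfolding th1_modular_def
  proof (intro allI impI)
    fix R :: nat and n :: int assume R: "even R" "R > 0"
    then obtain C where C: "\<And>\<sigma> w. Im \<sigma> > 0 \<Longrightarrow> th1 R (of_int n / of_nat R) ((of_int a * \<sigma> + of_int b) / (of_int c * \<sigma> + of_int d)) (w / (of_int c * \<sigma> + of_int d))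
       * exp (- (of_real pi * \<i> * of_nat R * of_int c * w\<^sup>2 / (of_int c * \<sigma> + of_int d)))
     = j \<sigma> * (\<Sum>n'<R. C n' * th1 R (of_nat n' / of_nat R) \<sigma> w)"
      using j(2) unfolding th1_modular_def by meson
    have *: "(of_int (a + q * c) * \<sigma> + of_int (b + q * d)) / (of_int c * \<sigma> + of_int d) = (of_int a * \<sigma> + of_int b) / (of_int c * \<sigma> + of_int d) + of_int q"
      if "Im \<sigma> > 0" for \<sigma>
      using moebius_Im(1)[OF det that] by (simp add: field_simps)
    show "\<exists>C. \<forall>\<sigma> w. 0 < Im \<sigma> \<longrightarrow> th1 R (of_int n / of_nat R) ((of_int (a + q * c) * \<sigma> + of_int (b + q * d)) / (of_int c * \<sigma> + of_int d)) (w / (of_int c * \<sigma> + of_int d))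
       * exp (- (of_real pi * \<i> * of_nat R * of_int c * w\<^sup>2 / (of_int c * \<sigma> + of_int d)))
     = j \<sigma> * (\<Sum>n'<R. C n' * th1 R (of_nat n' / of_nat R) \<sigma> w)"
    proof (intro exI[of _ "\<lambda>n'. exp (of_real pi * \<i> * of_int q * (of_int n)\<^sup>2 / of_nat R) * C n'"] allI impI)
      fix \<sigma> w :: complex assume s: "Im \<sigma> > 0"
      show "th1 R (of_int n / of_nat R) ((of_int (a + q * c) * \<sigma> + of_int (b + q * d)) / (of_int c * \<sigma> + of_int d)) (w / (of_int c * \<sigma> + of_int d))
       * exp (- (of_real pi * \<i> * of_nat R * of_int c * w\<^sup>2 / (of_int c * \<sigma> + of_int d)))
       = j \<sigma> * (\<Sum>n'<R. exp (of_real pi * \<i> * of_int q * (of_int n)\<^sup>2 / of_nat R) * C n' * th1 R (of_nat n' / of_nat R) \<sigma> w)"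
        unfolding *[OF s] th1_translation[OF R] using C[OF s, of w]
        by (simp add: mult.assoc sum_distrib_left[symmetric] mult.left_commute[of "j \<sigma>"])
    qed
  qed
  then show ?thesis using j(1) by (auto simp: th1_liftable_def)
qed

text \<open>Left multiplication by the matrix with rows (0, -1), (1, 0): the inversion formula is
  applied at the point m that the given matrix assigns to \<sigma>.\<close>

lemma th1_liftable_S:
  assumes "th1_liftable a b c d" and det: "a * d - b * c = 1"
  shows "th1_liftable (- c) (- d) a b"
proof -
  obtain j where j: "lift_of c d j" "th1_modular a b c d j" using assms by (auto simp: th1_liftable_def)
  define m where "m \<sigma> = (of_int a * \<sigma> + of_int b) / (of_int c * \<sigma> + of_int d)" for \<sigma> :: complex
  \<comment> \<open>The root is taken of -i m, which lies in the right half-plane where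
    \<open>csqrt\<close> is holomorphic; a root of i restores j'^2 = m (c \<sigma> + d) = a \<sigma>
    + b.\<close>
  define \<alpha> where "\<alpha> = csqrt \<i>"
  have al2: "\<alpha>\<^sup>2 = \<i>" unfolding \<alpha>_def by (rule power2_csqrt)
  have al: "\<alpha>\<^sup>2 = \<i>" "\<alpha> \<noteq> 0" using al2 by auto
  define j' where "j' \<sigma> = \<alpha> * csqrt (- \<i> * m \<sigma>) * j \<sigma>" for \<sigma>
  have lift: "lift_of a b j'"
    unfolding lift_of_def
  proof (intro conjI allI impI)
    have hm: "m holomorphic_on {\<sigma>. Im \<sigma> > 0}" unfolding m_def[abs_def]
      by (intro holomorphic_intros) (use moebius_Im[OF det] in auto)
    have "(\<lambda>\<sigma>. csqrt (- \<i> * m \<sigma>)) holomorphic_on {\<sigma>. Im \<sigma> > 0}"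
    proof (intro holomorphic_on_csqrt' holomorphic_on_mult hm holomorphic_on_const)
      fix \<sigma> :: complex assume "\<sigma> \<in> {\<sigma>. Im \<sigma> > 0}"
      then have "Im (m \<sigma>) > 0" using moebius_Im(2)[OF det] by (simp add: m_def)
      then show "- \<i> * m \<sigma> \<notin> \<real>\<^sub>\<le>\<^sub>0" by (simp add: complex_nonpos_Reals_iff)
    qed
    then show "j' holomorphic_on {\<sigma>. Im \<sigma> > 0}" unfolding j'_def
      using j(1) by (intro holomorphic_on_mult holomorphic_on_const) (auto simp: lift_of_def)
    fix \<sigma> :: complex assume s: "Im \<sigma> > 0"
    have "(j' \<sigma>)\<^sup>2 = \<i> * (- \<i> * m \<sigma>) * (of_int c * \<sigma> + of_int d)"
      using j(1) s by (simp add: j'_def power_mult_distrib al lift_of_def)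
    also have "\<dots> = of_int a * \<sigma> + of_int b"
      using moebius_Im(1)[OF det s] by (simp add: m_def)
    finally show "(j' \<sigma>)\<^sup>2 = of_int a * \<sigma> + of_int b" .
  qed
  have "th1_modular (- c) (- d) a b j'"
    unfolding th1_modular_def
  proof (intro allI impI)
    fix R :: nat and n :: int assume R: "even R" "R > 0"
    have "\<forall>n'. \<exists>C. \<forall>\<sigma> w. Im \<sigma> > 0 \<longrightarrow> th1 R (of_nat n' / of_nat R) (m \<sigma>) (w / (of_int c * \<sigma> + of_int d))
       * exp (- (of_real pi * \<i> * of_nat R * of_int c * w\<^sup>2 / (of_int c * \<sigma> + of_int d)))
     = j \<sigma> * (\<Sum>n''<R. C n'' * th1 R (of_nat n'' / of_nat R) \<sigma> w)"
    proof
      fix n' :: nat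
      show "\<exists>C. \<forall>\<sigma> w. Im \<sigma> > 0 \<longrightarrow> th1 R (of_nat n' / of_nat R) (m \<sigma>) (w / (of_int c * \<sigma> + of_int d))
         * exp (- (of_real pi * \<i> * of_nat R * of_int c * w\<^sup>2 / (of_int c * \<sigma> + of_int d)))
       = j \<sigma> * (\<Sum>n''<R. C n'' * th1 R (of_nat n'' / of_nat R) \<sigma> w)"
        using j(2)[unfolded th1_modular_def, rule_format, of R "int n'"] R by (simp add: m_def)
    qed
    from choice[OF this] obtain C where C: "\<And>n' \<sigma> w. Im \<sigma> > 0 \<Longrightarrow> th1 R (of_nat n' / of_nat R) (m \<sigma>) (w / (of_int c * \<sigma> + of_int d))
       * exp (- (of_real pi * \<i> * of_nat R * of_int c * w\<^sup>2 / (of_int c * \<sigma> + of_int d)))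
     = j \<sigma> * (\<Sum>n''<R. C n' n'' * th1 R (of_nat n'' / of_nat R) \<sigma> w)" by blast
    define D where "D n' = exp (- 2 * of_real pi * \<i> * of_int n * of_nat n' / of_nat R) / sqrt R" for n' :: nat
    show "\<exists>C. \<forall>\<sigma> w. 0 < Im \<sigma> \<longrightarrow> th1 R (of_int n / of_nat R) ((of_int (- c) * \<sigma> + of_int (- d)) / (of_int a * \<sigma> + of_int b)) (w / (of_int a * \<sigma> + of_int b))
       * exp (- (of_real pi * \<i> * of_nat R * of_int a * w\<^sup>2 / (of_int a * \<sigma> + of_int b)))
     = j' \<sigma> * (\<Sum>n'<R. C n' * th1 R (of_nat n' / of_nat R) \<sigma> w)"
    proof (intro exI[of _ "\<lambda>n''. (1 / \<alpha>) * (\<Sum>n'<R. D n' * C n' n'')"] allI impI)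
      fix \<sigma> w :: complex assume s: "Im \<sigma> > 0"
      let ?J = "of_int c * \<sigma> + of_int d" and ?I = "of_int a * \<sigma> + of_int b"
      have J: "?J \<noteq> 0" and m: "Im (m \<sigma>) > 0" using moebius_Im[OF det s] by (auto simp: m_def)
      then have I: "?I \<noteq> 0" by (auto simp: m_def)
      have e1: "(of_int (- c) * \<sigma> + of_int (- d)) / ?I = - 1 / m \<sigma>"
        using J I by (simp add: m_def field_simps)
      have e2: "w / ?I = (w / ?J) / m \<sigma>" using J I by (simp add: m_def)
      \<comment> \<open>The determinant relation. It makes the exponents of the two successive
        transformations add up to that of the product.\<close>
      have "of_int a * ?J = 1 + of_int c * ?I"
      proof -
        have "of_int a * ?J - of_int c * ?I = of_int (a * d - b * c)" by (simp add: algebra_simps)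
        then show ?thesis using det by (simp add: algebra_simps)
      qed
      then have e3: "of_real pi * \<i> * of_nat R * of_int a * w\<^sup>2 / ?I = of_real pi * \<i> * of_nat R * (w / ?J)\<^sup>2 / m \<sigma> + of_real pi * \<i> * of_nat R * of_int c * w\<^sup>2 / ?J"
        using J I by (simp add: m_def divide_simps power2_eq_square) algebra
      have "th1 R (of_int n / of_nat R) ((of_int (- c) * \<sigma> + of_int (- d)) / ?I) (w / ?I) * exp (- (of_real pi * \<i> * of_nat R * of_int a * w\<^sup>2 / ?I))
        = th1 R (of_int n / of_nat R) (- 1 / m \<sigma>) ((w / ?J) / m \<sigma>) * exp (- (of_real pi * \<i> * of_nat R * (w / ?J)\<^sup>2 / m \<sigma>))
            * exp (- (of_real pi * \<i> * of_nat R * of_int c * w\<^sup>2 / ?J))"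
        unfolding e1 e2 e3 by (simp add: exp_add[symmetric] mult.assoc)
      also have "\<dots> = csqrt (- \<i> * m \<sigma>) * (\<Sum>n'<R. D n' * th1 R (of_nat n' / of_nat R) (m \<sigma>) (w / ?J)) * exp (- (of_real pi * \<i> * of_nat R * of_int c * w\<^sup>2 / ?J))"
        unfolding th1_inversion[OF m R(2)] D_def ..
      also have "\<dots> = csqrt (- \<i> * m \<sigma>) * (\<Sum>n'<R. D n' * (j \<sigma> * (\<Sum>n''<R. C n' n'' * th1 R (of_nat n'' / of_nat R) \<sigma> w)))"
        unfolding C[OF s, symmetric] by (simp add: sum_distrib_right mult.assoc)
      also have "\<dots> = csqrt (- \<i> * m \<sigma>) * j \<sigma> * (\<Sum>n'<R. \<Sum>n''<R. D n' * C n' n'' * th1 R (of_nat n'' / of_nat R) \<sigma> w)"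
        by (simp add: sum_distrib_left mult_ac)
      also have "(\<Sum>n'<R. \<Sum>n''<R. D n' * C n' n'' * th1 R (of_nat n'' / of_nat R) \<sigma> w) = (\<Sum>n''<R. (\<Sum>n'<R. D n' * C n' n'') * th1 R (of_nat n'' / of_nat R) \<sigma> w)"
        by (subst sum.swap) (simp add: sum_distrib_right)
      also have "csqrt (- \<i> * m \<sigma>) * j \<sigma> * \<dots> = j' \<sigma> * (\<Sum>n''<R. 1 / \<alpha> * (\<Sum>n'<R. D n' * C n' n'') * th1 R (of_nat n'' / of_nat R) \<sigma> w)"
        using al(2) by (simp add: j'_def sum_distrib_left sum_divide_distrib mult_ac)
      finally show "th1 R (of_int n / of_nat R) ((of_int (- c) * \<sigma> + of_int (- d)) / ?I) (w / ?I) * exp (- (of_real pi * \<i> * of_nat R * of_int a * w\<^sup>2 / ?I)) = \<dots>" .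
    qed
  qed
  then show ?thesis using lift by (auto simp: th1_liftable_def)
qed

lemma th1_liftable_SL2: "a * d - b * c = 1 \<Longrightarrow> th1_liftable a b c d"
proof (induction "nat \<bar>c\<bar>" arbitrary: a b c d rule: less_induct)
  case less
  show ?case
  proof (cases "c = 0")
    case True
    then have "a * d = 1" using less.prems by simp
    then consider "a = 1" "d = 1" | "a = - 1" "d = - 1" by (auto simp: zmult_eq_1_iff)
    then show ?thesis
    proof cases
      case 1
      then show ?thesis using th1_liftable_T[OF th1_liftable_one, of b] True by simp
    next
      case 2
      have "th1_liftable (- 1) 0 0 (- 1)" using th1_liftable_S[OF th1_liftable_S[OF th1_liftable_one]] by simp
      from th1_liftable_T[OF this, of "- b"] show ?thesis using 2 True by simp
    qed
  next
    case False
    define q where "q = a div c"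
    define a' b' where "a' = a - q * c" and "b' = b - q * d"
    have det: "a' * d - b' * c = 1" using less.prems by (simp add: a'_def b'_def algebra_simps)
    have "a' = a mod c" by (simp add: a'_def q_def minus_div_mult_eq_mod)
    then have "\<bar>a'\<bar> < \<bar>c\<bar>" using False by (simp add: abs_mod_less)
    then have "th1_liftable (- c) (- d) a' b'"
      by (intro less.hyps) (use det in \<open>auto simp: algebra_simps\<close>)
    \<comment> \<open>The inversion has order four: three further applications lead from the rows
      (-c, -d), (a', b') back to (a', b'), (c, d), and a translation restores a and b.\<close>
    from th1_liftable_S[OF this] have 1: "th1_liftable (- a') (- b') (- c) (- d)" using det by (simp add: algebra_simps)
    from th1_liftable_S[OF this] have 2: "th1_liftable c d (- a') (- b')" using det by (simp add: algebra_simps)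
    from th1_liftable_S[OF this] have "th1_liftable a' b' c d" using det by (simp add: algebra_simps)
    from th1_liftable_T[OF this det, of q] show ?thesis by (simp add: a'_def b'_def)
  qed
qed

text \<open>The quotient of two lifts is continuous on a connected set and takes values in {1,
  -1}.\<close>

lemma lift_of_unique:
  assumes j: "lift_of c d j" and j': "lift_of c d j'" and det: "a * d - b * c = (1::int)"
  shows "(\<forall>\<sigma>. Im \<sigma> > 0 \<longrightarrow> j' \<sigma> = j \<sigma>) \<or> (\<forall>\<sigma>. Im \<sigma> > 0 \<longrightarrow> j' \<sigma> = - j \<sigma>)"
proof -
  have nz: "j \<sigma> \<noteq> 0" if "Im \<sigma> > 0" for \<sigma>
    using j that moebius_Im(1)[OF det that] by (metis lift_of_def zero_power2)
  define f where "f \<sigma> = j' \<sigma> / j \<sigma>" for \<sigma>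
  have f2: "f \<sigma> = 1 \<or> f \<sigma> = - 1" if "Im \<sigma> > 0" for \<sigma>
  proof -
    have "(f \<sigma>)\<^sup>2 = 1"
      using j j' that moebius_Im(1)[OF det that] by (simp add: f_def power_divide lift_of_def)
    then show ?thesis by (simp add: power2_eq_1_iff)
  qed
  have "f constant_on {\<sigma>. Im \<sigma> > 0}"
  proof (rule continuous_finite_range_constant)
    show "connected {\<sigma>. Im \<sigma> > 0}" by (intro convex_connected convex_halfspace_Im_gt)
    show "continuous_on {\<sigma>. Im \<sigma> > 0} f" unfolding f_def
      using j j' nz by (intro continuous_intros holomorphic_on_imp_continuous_on) (auto simp: lift_of_def)
    have "f ` {\<sigma>. Im \<sigma> > 0} \<subseteq> {1, - 1}" using f2 by auto
    then show "finite (f ` {\<sigma>. Im \<sigma> > 0})" by (rule finite_subset) simp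
  qed
  then obtain e where e: "\<And>\<sigma>. Im \<sigma> > 0 \<Longrightarrow> f \<sigma> = e" by (auto simp: constant_on_def)
  have "e = 1 \<or> e = - 1" using f2[of \<i>] e[of \<i>] by simp
  moreover have "j' \<sigma> = e * j \<sigma>" if "Im \<sigma> > 0" for \<sigma>
    using e[OF that] nz[OF that] by (simp add: f_def field_simps)
  ultimately show ?thesis by auto
qed

theorem th1_modular_all:
  assumes det: "a * d - b * c = 1" and j: "lift_of c d j"
  shows "th1_modular a b c d j"
proof -
  obtain i where i: "lift_of c d i" "th1_modular a b c d i" using th1_liftable_SL2[OF det] by (auto simp: th1_liftable_def)
  consider "\<forall>\<sigma>. Im \<sigma> > 0 \<longrightarrow> j \<sigma> = i \<sigma>" | "\<forall>\<sigma>. Im \<sigma> > 0 \<longrightarrow> j \<sigma> = - i \<sigma>"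
    using lift_of_unique[OF i(1) j det] by blast
  then obtain e where e: "\<And>\<sigma>. Im \<sigma> > 0 \<Longrightarrow> i \<sigma> = e * j \<sigma>"
    by cases (metis mult_1, metis minus_minus mult_minus1)
  show ?thesis
    unfolding th1_modular_def
  proof (intro allI impI)
    fix R :: nat and n :: int assume R: "even R" "R > 0"
    then obtain C where C: "\<And>\<sigma> w. Im \<sigma> > 0 \<Longrightarrow> th1 R (of_int n / of_nat R) ((of_int a * \<sigma> + of_int b) / (of_int c * \<sigma> + of_int d)) (w / (of_int c * \<sigma> + of_int d))
       * exp (- (of_real pi * \<i> * of_nat R * of_int c * w\<^sup>2 / (of_int c * \<sigma> + of_int d)))
     = i \<sigma> * (\<Sum>n'<R. C n' * th1 R (of_nat n' / of_nat R) \<sigma> w)"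
      using i(2) unfolding th1_modular_def by meson
    show "\<exists>C. \<forall>\<sigma> w. 0 < Im \<sigma> \<longrightarrow> th1 R (of_int n / of_nat R) ((of_int a * \<sigma> + of_int b) / (of_int c * \<sigma> + of_int d)) (w / (of_int c * \<sigma> + of_int d))
       * exp (- (of_real pi * \<i> * of_nat R * of_int c * w\<^sup>2 / (of_int c * \<sigma> + of_int d)))
     = j \<sigma> * (\<Sum>n'<R. C n' * th1 R (of_nat n' / of_nat R) \<sigma> w)"
    proof (intro exI[of _ "\<lambda>n'. e * C n'"] allI impI)
      fix \<sigma> w :: complex assume s: "Im \<sigma> > 0"
      show "th1 R (of_int n / of_nat R) ((of_int a * \<sigma> + of_int b) / (of_int c * \<sigma> + of_int d)) (w / (of_int c * \<sigma> + of_int d))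
         * exp (- (of_real pi * \<i> * of_nat R * of_int c * w\<^sup>2 / (of_int c * \<sigma> + of_int d)))
       = j \<sigma> * (\<Sum>n'<R. e * C n' * th1 R (of_nat n' / of_nat R) \<sigma> w)"
        unfolding C[OF s] e[OF s] by (simp add: sum_distrib_left mult_ac)
    qed
  qed
qed

section \<open>The affine root datum\<close>

lemma sum_fun_apply: "(\<Sum>i\<in>A. f i) x = (\<Sum>i\<in>A. f i x)"
  for f :: "'i \<Rightarrow> 'a \<Rightarrow> 'b :: comm_monoid_add"
  by (induction A rule: infinite_finite_induct) auto

lemmas fun_ap = plus_fun_apply zero_fun_apply minus_apply uminus_apply

text \<open>In the four types \<open>a\<^sub>0 = 1\<close> and \<open>e\<^sub>i = a\<^sub>i\<^sup>\<or>/a\<^sub>i\<close> takes only the values \<open>1\<close> and \<open>r\<close>. The last assumption is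
  connectedness of the diagram in the form of an induction rule.\<close>

locale affine_datum =
  fixes C :: gcm and r :: nat and a e :: "nat \<Rightarrow> nat"
  assumes rk_pos: "rk C \<ge> 1"
    and r_gt_1: "r > 1"
    and a_pos: "\<And>i. i \<le> rk C \<Longrightarrow> a i > 0"
    and a_outside: "\<And>i. i > rk C \<Longrightarrow> a i = 0"
    and a0: "a 0 = 1"
    and e_cases: "\<And>i. i \<le> rk C \<Longrightarrow> e i = 1 \<or> e i = r"
    and e0: "e 0 = 1"
    and ent_diag: "\<And>i. i \<le> rk C \<Longrightarrow> ent C i i = 2"
    and ent_nonpos: "\<And>i j. i \<le> rk C \<Longrightarrow> j \<le> rk C \<Longrightarrow> i \<noteq> j \<Longrightarrow> ent C i j \<le> 0"
    and ent_sym: "\<And>i j. i \<le> rk C \<Longrightarrow> j \<le> rk C \<Longrightarrow> int (e i) * ent C i j = int (e j) * ent C j i"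
    and ent_null: "\<And>i. i \<le> rk C \<Longrightarrow> (\<Sum>j\<le>rk C. ent C i j * int (a j)) = 0"
    and ent_connected: "\<And>P i. P 0 \<Longrightarrow> (\<And>i j. i \<le> rk C \<Longrightarrow> j \<le> rk C \<Longrightarrow> P i \<Longrightarrow> ent C i j \<noteq> 0 \<Longrightarrow> P j)
        \<Longrightarrow> i \<le> rk C \<Longrightarrow> P (i :: nat)"
begin

declare One_nat_def [simp del] plus_fun_apply [simp del] zero_fun_apply [simp del] minus_apply [simp del] uminus_apply [simp del]

abbreviation l :: nat where "l \<equiv> rk C"

definition b :: "nat \<Rightarrow> nat \<Rightarrow> int" where "b i j = int (e i) * ent C i j"

lemma e_pos: "i \<le> l \<Longrightarrow> e i > 0"
  using e_cases[of i] r_gt_1 by auto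

lemma b_sym: "i \<le> l \<Longrightarrow> j \<le> l \<Longrightarrow> b i j = b j i"
  using ent_sym by (simp add: b_def)

lemma b_diag: "i \<le> l \<Longrightarrow> b i i = 2 * int (e i)"
  using ent_diag by (simp add: b_def)

lemma b_nonpos: "i \<le> l \<Longrightarrow> j \<le> l \<Longrightarrow> i \<noteq> j \<Longrightarrow> b i j \<le> 0"
  using ent_nonpos by (simp add: b_def mult_nonneg_nonpos)

lemma b_null: "i \<le> l \<Longrightarrow> (\<Sum>j\<le>l. b i j * int (a j)) = 0"
  using ent_null[of i] by (simp add: b_def mult.assoc sum_distrib_left[symmetric])

text \<open>Since \<open>\<Sum>\<^sub>j b\<^sub>i\<^sub>j a\<^sub>j = 0\<close>, the quadratic form is the combination
  \<open>-1/2 \<Sum> b\<^sub>i\<^sub>j a\<^sub>i a\<^sub>j (y\<^sub>i/a\<^sub>i - y\<^sub>j/a\<^sub>j)\<^sup>2\<close> of squares with coefficients \<open>\<ge> 0\<close>.\<close>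

definition Q :: "(nat \<Rightarrow> real) \<Rightarrow> real" where
  "Q y = (\<Sum>i\<le>l. \<Sum>j\<le>l. of_int (b i j) * y i * y j)"

lemma Q_squares:
  "Q y = (\<Sum>i\<le>l. \<Sum>j\<le>l. - real_of_int (b i j) * real (a i) * real (a j) * (y i / a i - y j / a j)\<^sup>2) / 2"
proof -
  have null: "(\<Sum>j\<le>l. of_int (b i j) * real (a j)) = 0" if "i \<le> l" for i
  proof -
    have "(\<Sum>j\<le>l. of_int (b i j) * real (a j)) = of_int (\<Sum>j\<le>l. b i j * int (a j))" by simp
    then show ?thesis using b_null[OF that] by simp
  qed
  have "- real_of_int (b i j) * real (a i) * real (a j) * (y i / a i - y j / a j)\<^sup>2
      = 2 * (of_int (b i j) * y i * y j) - (y i)\<^sup>2 / a i * (real_of_int (b i j) * real (a j)) - (y j)\<^sup>2 / a j * (real_of_int (b j i) * real (a i))"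
    if "i \<le> l" "j \<le> l" for i j
    using a_pos[OF that(1)] a_pos[OF that(2)] b_sym[OF that] by (simp add: field_simps power2_eq_square)
  then have "(\<Sum>i\<le>l. \<Sum>j\<le>l. - real_of_int (b i j) * real (a i) * real (a j) * (y i / a i - y j / a j)\<^sup>2)
     = (\<Sum>i\<le>l. \<Sum>j\<le>l. 2 * (of_int (b i j) * y i * y j) - (y i)\<^sup>2 / a i * (real_of_int (b i j) * real (a j)) - (y j)\<^sup>2 / a j * (real_of_int (b j i) * real (a i)))"
    by (intro sum.cong refl) auto
  also have "\<dots> = 2 * Q y - (\<Sum>i\<le>l. (y i)\<^sup>2 / a i * (\<Sum>j\<le>l. real_of_int (b i j) * real (a j))) - (\<Sum>j\<le>l. (y j)\<^sup>2 / a j * (\<Sum>i\<le>l. real_of_int (b j i) * real (a i)))"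
  proof -
    have "(\<Sum>i\<le>l. \<Sum>j\<le>l. (y j)\<^sup>2 / a j * (real_of_int (b j i) * real (a i))) = (\<Sum>j\<le>l. \<Sum>i\<le>l. (y j)\<^sup>2 / a j * (real_of_int (b j i) * real (a i)))"
      by (rule sum.swap)
    then show ?thesis unfolding sum_subtractf Q_def sum_distrib_left by simp
  qed
  finally show ?thesis by (simp add: null)
qed

lemma Q_summand_nonneg:
  "i \<le> l \<Longrightarrow> j \<le> l \<Longrightarrow> 0 \<le> - real_of_int (b i j) * real (a i) * real (a j) * (y i / a i - y j / a j)\<^sup>2"
proof (cases "i = j")
  case False
  assume "i \<le> l" "j \<le> l"
  then have "0 \<le> - real_of_int (b i j)" using b_nonpos False by simp
  then show ?thesis by (intro mult_nonneg_nonneg) auto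
qed simp

lemma Q_summand_nonpos:
  "i \<le> l \<Longrightarrow> j \<le> l \<Longrightarrow> real_of_int (b i j) * real (a i) * real (a j) * (y i / a i - y j / a j)\<^sup>2 \<le> 0"
  using Q_summand_nonneg by simp

lemma Q_nonneg: "Q y \<ge> 0"
  unfolding Q_squares by (intro divide_nonneg_nonneg sum_nonneg Q_summand_nonneg) (simp_all del: mult_minus_left)

text \<open>Every square in \<open>Q_squares\<close> must vanish. Along an edge its coefficient is
  nonzero, so y_i/a_i does not change, and connectedness carries the value from node 0 to all
  nodes.\<close>

lemma Q_eq_0_imp:
  assumes "Q y = 0" "i \<le> l"
  shows "y i = y 0 * a i"
proof -
  have z0: "(\<Sum>i\<le>l. \<Sum>j\<le>l. - real_of_int (b i j) * real (a i) * real (a j) * (y i / a i - y j / a j)\<^sup>2) = 0"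
    using assms(1) by (simp add: Q_squares)
  then have z: "- real_of_int (b i j) * real (a i) * real (a j) * (y i / a i - y j / a j)\<^sup>2 = 0" if "i \<le> l" "j \<le> l" for i j
  proof -
    have "(\<Sum>j\<le>l. - real_of_int (b i j) * real (a i) * real (a j) * (y i / a i - y j / a j)\<^sup>2) = 0"
      by (rule sum_nonneg_0[OF finite_atMost _ z0]) (use that in \<open>auto intro!: sum_nonneg simp: Q_summand_nonpos\<close>)
    from sum_nonneg_0[OF finite_atMost _ this, of j] show ?thesis
      using that by (auto simp: Q_summand_nonpos)
  qed
  have "y i / a i = y 0 / a 0" using _ _ assms(2)
  proof (rule ent_connected[where P = "\<lambda>i. y i / a i = y 0 / a 0"])
    fix i j assume ij: "i \<le> l" "j \<le> l" "y i / a i = y 0 / a 0" "ent C i j \<noteq> 0"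
    have "b i j \<noteq> 0" using ij e_pos[of i] by (simp add: b_def)
    then have "y i / a i - y j / a j = 0" using z[OF ij(1,2)] a_pos ij(1,2) by fastforce
    then show "y j / a j = y 0 / a 0" using ij(3) by simp
  qed simp
  then show ?thesis using a_pos[OF assms(2)] a0 by (simp add: field_simps)
qed

text \<open>A kernel vector is isotropic for \<open>Q\<close>.\<close>

lemma kernel_proportional:
  fixes y :: "nat \<Rightarrow> real"
  assumes "\<And>i. i \<le> l \<Longrightarrow> (\<Sum>j\<le>l. of_int (b i j) * y j) = 0" and i: "i \<le> l"
  shows "y i = y 0 * a i"
proof (rule Q_eq_0_imp[OF _ i])
  have "Q y = (\<Sum>i\<le>l. y i * (\<Sum>j\<le>l. of_int (b i j) * y j))"
    by (simp add: Q_def sum_distrib_left mult_ac)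
  then show "Q y = 0" using assms(1) by simp
qed

text \<open>A kernel vector is x_0 times v because v_0 = 1; then x_0 divides all its entries, and
  the gcd condition forces x_0 = 1.\<close>

lemma label_unique:
  assumes v: "v 0 = 1" "\<And>i. i \<le> rk D \<Longrightarrow> v i > 0" "\<And>i. i > rk D \<Longrightarrow> v i = 0" "\<And>i. i \<le> rk D \<Longrightarrow> (\<Sum>j\<le>rk D. ent D i j * int (v j)) = 0"
    and ker: "\<And>x i. (\<And>i. i \<le> rk D \<Longrightarrow> (\<Sum>j\<le>rk D. ent D i j * int (x j)) = 0) \<Longrightarrow> i \<le> rk D \<Longrightarrow> x i = x 0 * v i"
  shows "label D = v"
  unfolding label_def
proof (rule the_equality)
  have "Gcd (v ` {..rk D}) dvd v 0" by (intro Gcd_dvd) simp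
  then show "(\<forall>i\<le>rk D. v i > 0) \<and> (\<forall>i>rk D. v i = 0) \<and> Gcd (v ` {..rk D}) = 1 \<and> (\<forall>i\<le>rk D. (\<Sum>j\<le>rk D. ent D i j * int (v j)) = 0)"
    using v by simp
next
  fix x assume x: "(\<forall>i\<le>rk D. x i > 0) \<and> (\<forall>i>rk D. x i = 0) \<and> Gcd (x ` {..rk D}) = 1 \<and> (\<forall>i\<le>rk D. (\<Sum>j\<le>rk D. ent D i j * int (x j)) = 0)"
  then have p: "x i = x 0 * v i" if "i \<le> rk D" for i using ker[of x i] that by blast
  have "x 0 dvd Gcd (x ` {..rk D})"
  proof (rule Gcd_greatest)
    fix y assume "y \<in> x ` {..rk D}"
    then obtain i where "y = x 0 * v i" using p by blast
    then show "x 0 dvd y" by simp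
  qed
  then have "x 0 = 1" using x by simp
  then have "x i = v i" for i using p[of i] x v(3)[of i] by (cases "i \<le> rk D") auto
  then show "x = v" by (rule ext)
qed

lemma label_eq: "label C = a"
proof (rule label_unique)
  fix x i assume x: "\<And>i. i \<le> rk C \<Longrightarrow> (\<Sum>j\<le>rk C. ent C i j * int (x j)) = 0" and i: "i \<le> rk C"
  have "real (x i) = real (x 0) * a i"
  proof (rule kernel_proportional[OF _ i])
    fix i assume i: "i \<le> l"
    have "(\<Sum>j\<le>l. b i j * int (x j)) = 0" using x[OF i] by (simp add: b_def mult.assoc flip: sum_distrib_left)
    from arg_cong[OF this, of real_of_int] show "(\<Sum>j\<le>l. of_int (b i j) * real (x j)) = 0" by simp
  qed
  then show "x i = x 0 * a i" by (metis of_nat_eq_iff of_nat_mult)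
qed (use a0 a_pos a_outside ent_null in auto)

text \<open>Symmetry of e_i a_ij turns the kernel of the matrix into that of its transpose after
  multiplication of the i-th coordinate by e_i.\<close>

lemma colabel_eq: "colabel C i = e i * a i"
proof -
  have "label (transposed C) = (\<lambda>i. e i * a i)"
  proof (rule label_unique)
    have b: "ent (transposed C) i j * int (e j * a j) = b i j * int (a j)" if "i \<le> l" "j \<le> l" for i j
      using b_sym[OF that] by (simp add: transposed_def b_def)
    show "(\<Sum>j\<le>rk (transposed C). ent (transposed C) i j * int (e j * a j)) = 0" if "i \<le> rk (transposed C)" for i
    proof -
      have i: "i \<le> l" using that by (simp add: transposed_def)
      have "(\<Sum>j\<le>l. ent (transposed C) i j * int (e j * a j)) = (\<Sum>j\<le>l. b i j * int (a j))" using b[OF i] by (intro sum.cong) auto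
      then show ?thesis using b_null[OF i] by (simp add: transposed_def)
    qed
    fix x i assume x: "\<And>i. i \<le> rk (transposed C) \<Longrightarrow> (\<Sum>j\<le>rk (transposed C). ent (transposed C) i j * int (x j)) = 0" and i: "i \<le> rk (transposed C)"
    have i: "i \<le> l" using i by (simp add: transposed_def)
    have "real (x i) / e i = real (x 0) / e 0 * a i"
    proof (rule kernel_proportional[of "\<lambda>i. real (x i) / e i", OF _ i])
      fix i assume i: "i \<le> l"
      have "(\<Sum>j\<le>l. of_int (b i j) * (real (x j) / e j)) = (\<Sum>j\<le>l. of_int (ent (transposed C) i j * int (x j)))"
      proof (intro sum.cong refl)
        fix j assume j: "j \<in> {..l}"
        have "b i j = int (e j) * ent C j i" using b_sym[OF i, of j] j by (simp add: b_def)
        then show "of_int (b i j) * (real (x j) / e j) = of_int (ent (transposed C) i j * int (x j))"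
          using e_pos[of j] j by (simp add: transposed_def)
      qed
      also have "\<dots> = of_int (\<Sum>j\<le>l. ent (transposed C) i j * int (x j))" by (simp only: of_int_sum)
      also have "\<dots> = 0" using x[of i] i by (simp add: transposed_def)
      finally show "(\<Sum>j\<le>l. of_int (b i j) * (real (x j) / e j)) = 0" .
    qed
    then have "real (x i) = real (x 0 * (e i * a i))" using e_pos[OF i] by (simp add: e0 field_simps)
    then show "x i = x 0 * (e i * a i)" unfolding of_nat_eq_iff .
  qed (use a0 e0 a_pos e_pos a_outside in \<open>auto simp: transposed_def\<close>)
  then show ?thesis by (simp add: colabel_def)
qed

section \<open>The invariant form and its definiteness on real vectors\<close>

lemma form_expand:
  "form C x y = (\<Sum>i\<le>l. \<Sum>j\<le>l. of_int (b i j) * x i * y j) + (x 0 * y (l + 1) + x (l + 1) * y 0)"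
proof -
  have "of_nat (colabel C i) / of_nat (label C i) * of_int (ent C i j) = (of_int (b i j) :: complex)" if "i \<le> l" for i j
    using a_pos[OF that] by (simp add: label_eq colabel_eq b_def)
  then show ?thesis by (simp add: form_def label_eq a0)
qed

lemma form_add_left: "form C (x + y) z = form C x z + form C y z"
  and form_add_right: "form C z (x + y) = form C z x + form C z y"
  and form_smul_left: "form C (c \<cdot> x) z = c * form C x z"
  and form_smul_right: "form C z (c \<cdot> x) = c * form C z x"
  by (simp_all add: fun_ap form_expand smul_def sum.distrib sum_distrib_left algebra_simps)

lemma form_sym: "form C x y = form C y x"
proof -
  have "(\<Sum>i\<le>l. \<Sum>j\<le>l. of_int (b i j) * x i * y j) = (\<Sum>i\<le>l. \<Sum>j\<le>l. of_int (b i j) * y i * x j)"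
    by (subst sum.swap) (intro sum.cong refl, simp add: b_sym mult_ac)
  then show ?thesis by (simp add: form_expand)
qed

lemma form_zero_left [simp]: "form C 0 y = 0" and form_zero_right [simp]: "form C y 0 = 0"
  by (simp_all add: form_expand fun_ap)

lemma form_minus_left: "form C (- x) y = - form C x y" and form_minus_right: "form C y (- x) = - form C y x"
  by (simp_all add: form_expand sum_negf fun_ap)

lemma form_diff_left: "form C (x - y) z = form C x z - form C y z"
  and form_diff_right: "form C z (x - y) = form C z x - form C z y"
  using form_add_left[of "x - y" y z] form_add_right[of z "x - y" y] by simp_all

lemma form_sum_left: "form C (\<Sum>i\<in>A. f i) z = (\<Sum>i\<in>A. form C (f i) z)"
  by (induction A rule: infinite_finite_induct) (auto simp: form_add_left)

lemma form_sum_right: "form C z (\<Sum>i\<in>A. f i) = (\<Sum>i\<in>A. form C z (f i))"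
  by (induction A rule: infinite_finite_induct) (auto simp: form_add_right)

lemmas form_simps = form_add_left form_add_right form_smul_left form_smul_right
  form_minus_left form_minus_right form_diff_left form_diff_right form_sum_left form_sum_right

lemma form_alpha_right:
  assumes "i \<le> l"
  shows "form C x (alpha i) = (\<Sum>j\<le>l. of_int (b i j) * x j) + (if i = 0 then x (l + 1) else 0)"
proof -
  have "form C x (alpha i) = form C (alpha i) x" by (rule form_sym)
  also have "\<dots> = (\<Sum>j\<le>l. of_int (b i j) * x j) + (if i = 0 then x (l + 1) else 0)"
  proof -
    have "(\<Sum>k\<le>l. \<Sum>j\<le>l. of_int (b k j) * alpha i k * x j) = (\<Sum>k\<le>l. if k = i then (\<Sum>j\<le>l. of_int (b i j) * x j) else 0)"
      by (intro sum.cong) (auto simp: alpha_def)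
    also have "\<dots> = (\<Sum>j\<le>l. of_int (b i j) * x j)" using assms by simp
    finally show ?thesis using assms by (auto simp: form_expand alpha_def)
  qed
  finally show ?thesis .
qed

lemma form_alpha_alpha: "i \<le> l \<Longrightarrow> j \<le> l \<Longrightarrow> form C (alpha i) (alpha j) = of_int (b i j)"
  by (subst form_sym, subst form_alpha_right)
    (auto simp: alpha_def if_distrib cong: if_cong)

lemma delta_apply: "delta C i = of_nat (a i)"
  using a_outside by (auto simp: delta_def sum_fun_apply label_eq smul_def alpha_def not_le if_distrib cong: if_cong)

text \<open>The labels are in the kernel of \<open>b\<close>, so only the pairing with the
  \<Lambda>_0-coordinate survives.\<close>

lemma form_delta_right: "form C x (delta C) = x (l + 1)"
proof -
  have "form C x (delta C) = (\<Sum>i\<le>l. of_nat (a i) * form C x (alpha i))"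
    by (simp add: delta_def form_simps label_eq)
  also have "\<dots> = (\<Sum>i\<le>l. of_nat (a i) * (\<Sum>j\<le>l. of_int (b i j) * x j)) + (\<Sum>i\<le>l. if i = 0 then x (l + 1) else 0)"
    unfolding sum.distrib[symmetric] by (intro sum.cong) (auto simp: form_alpha_right a0)
  also have "(\<Sum>i\<le>l. of_nat (a i) * (\<Sum>j\<le>l. of_int (b i j) * x j)) = (\<Sum>j\<le>l. of_int (\<Sum>i\<le>l. b j i * int (a i)) * x j)"
    unfolding sum_distrib_left of_int_sum sum_distrib_right
    by (subst sum.swap) (intro sum.cong refl, simp add: b_sym mult_ac)
  also have "\<dots> = 0" by (simp add: b_null)
  finally show ?thesis by simp
qed

lemma form_delta_left: "form C (delta C) x = x (l + 1)"
  using form_sym form_delta_right by metis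

lemma coroot_eq: "i \<le> l \<Longrightarrow> coroot C i = (1 / of_nat (e i)) \<cdot> alpha i"
  using a_pos[of i] e_pos[of i] by (simp add: coroot_def label_eq colabel_eq)

lemma canonical_K_eq: "canonical_K C = delta C"
proof -
  have "of_nat (colabel C i) \<cdot> coroot C i = of_nat (a i) \<cdot> alpha i" if "i \<le> l" for i
    using e_pos[OF that] by (simp add: coroot_eq[OF that] colabel_eq)
  then show ?thesis by (simp add: canonical_K_def delta_def label_eq)
qed

lemma level_eq: "level C x = x (l + 1)"
  by (simp add: level_def canonical_K_eq form_delta_right)

lemma theta_apply: "theta_root C i = (if i \<in> {1..l} then of_nat (a i) else 0)"
  using a_outside by (auto simp: fun_ap theta_root_def delta_apply label_eq a0 smul_def alpha_def Suc_le_eq not_le)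

lemma theta_hring: "theta_root C \<in> hring C"
  by (auto simp: hring_def theta_apply)

lemma Lambda0_form: "form C x (Lambda0 C) = x 0"
proof -
  have "(\<Sum>i\<le>l. \<Sum>j\<le>l. of_int (b i j) * x i * Lambda0 C j) = 0"
    by (intro sum.neutral ballI) (simp add: Lambda0_def)
  then show ?thesis by (simp add: form_expand Lambda0_def)
qed

definition real_vec :: "hvec \<Rightarrow> bool" where "real_vec x \<longleftrightarrow> (\<forall>i. x i \<in> \<real>)"

definition rvec :: "hvec set" where "rvec = {x \<in> hring C. real_vec x}"

lemma form_level0_real:
  assumes "x (l + 1) = 0" "real_vec x"
  shows "form C x x = of_real (Q (\<lambda>i. Re (x i)))"
proof -
  have "x i = of_real (Re (x i))" for i using assms(2) by (simp add: real_vec_def)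
  then show ?thesis using assms(1) unfolding form_expand Q_def of_real_sum
    by (simp add: of_real_sum)
qed

lemma hring_outside: "x \<in> hring C \<Longrightarrow> x 0 = 0" "x \<in> hring C \<Longrightarrow> x (Suc l) = 0" "x \<in> hring C \<Longrightarrow> i > l \<Longrightarrow> x i = 0"
  by (auto simp: hring_def)

text \<open>The form is semidefinite with radical spanned by \<delta>, and no nonzero multiple of
  \<delta> has vanishing 0-th coordinate.\<close>

lemma rvec_form_nonneg:
  assumes "x \<in> rvec"
  shows "form C x x \<in> \<real>" "Re (form C x x) \<ge> 0" "form C x x = 0 \<Longrightarrow> x = 0"
proof -
  have x: "x (l + 1) = 0" "real_vec x" "x \<in> hring C" using assms by (auto simp: rvec_def hring_outside)
  note f = form_level0_real[OF x(1,2)]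
  show "form C x x \<in> \<real>" "Re (form C x x) \<ge> 0" using Q_nonneg by (auto simp: f)
  assume "form C x x = 0"
  then have Q0: "Q (\<lambda>i. Re (x i)) = 0" by (simp add: f)
  show "x = 0"
  proof
    fix i show "x i = 0 i"
    proof (cases "i \<le> l")
      case True
      then have "Re (x i) = 0" using Q_eq_0_imp[OF Q0 True] x(3) by (simp add: hring_outside)
      then show ?thesis using x(2) by (metis complex_is_Real_iff complex_eq_iff real_vec_def zero_complex.sel zero_fun_apply)
    qed (use x(3) in \<open>simp add: hring_outside fun_ap\<close>)
  qed
qed

lemma hring_add: "x \<in> hring C \<Longrightarrow> y \<in> hring C \<Longrightarrow> x + y \<in> hring C"
  and hring_diff: "x \<in> hring C \<Longrightarrow> y \<in> hring C \<Longrightarrow> x - y \<in> hring C"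
  and hring_smul: "x \<in> hring C \<Longrightarrow> c \<cdot> x \<in> hring C"
  and hring_zero: "0 \<in> hring C"
  by (auto simp: hring_def smul_def fun_ap)

lemma hring_sum: "(\<And>i. i \<in> A \<Longrightarrow> f i \<in> hring C) \<Longrightarrow> (\<Sum>i\<in>A. f i) \<in> hring C"
  by (induction A rule: infinite_finite_induct) (auto intro: hring_add hring_zero)

lemma hring_alpha: "i \<in> {1..l} \<Longrightarrow> alpha i \<in> hring C"
  by (auto simp: hring_def alpha_def)

lemma hring_expand:
  assumes "x \<in> hring C"
  shows "x = (\<Sum>i=1..l. x i \<cdot> alpha i)"
proof
  fix j
  have "(\<Sum>i=1..l. x i \<cdot> alpha i) j = (\<Sum>i=1..l. if i = j then x j else 0)"
    unfolding sum_fun_apply by (intro sum.cong) (auto simp: smul_def alpha_def)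
  then show "x j = (\<Sum>i=1..l. x i \<cdot> alpha i) j" using assms by (auto simp: hring_def)
qed

section \<open>Simple reflections and the maps given by words in them\<close>

abbreviation s :: "nat \<Rightarrow> hvec \<Rightarrow> hvec" where "s \<equiv> reflection C"

lemma s_eq: "i \<le> l \<Longrightarrow> s i x = x - (form C x (alpha i) / of_nat (e i)) \<cdot> alpha i"
  by (simp add: reflection_def coroot_eq form_simps)

lemma s_apply: "i \<le> l \<Longrightarrow> s i x j = (if j = i then x i - form C x (alpha i) / of_nat (e i) else x j)"
  by (simp add: s_eq smul_def alpha_def fun_ap)

lemma s_add: "s i (x + y) = s i x + s i y"
  and s_smul: "s i (c \<cdot> x) = c \<cdot> s i x"
  by (simp_all add: reflection_def form_add_left form_smul_left cfun.scale_left_distrib cfun.scale_right_diff_distrib)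

lemma s_diff: "s i (x - y) = s i x - s i y"
  using s_add[of i "x - y" y] by simp

lemma s_zero: "s i 0 = 0"
  by (simp add: reflection_def)

lemma s_form: "i \<le> l \<Longrightarrow> form C (s i x) (s i y) = form C x y"
proof -
  assume i: "i \<le> l"
  have "form C (alpha i) (alpha i) = 2 * of_nat (e i)" using i by (simp add: form_alpha_alpha b_diag)
  then show ?thesis using e_pos[OF i] form_sym[of "alpha i" y]
    by (simp add: s_eq[OF i] form_simps field_simps)
qed

lemma s_alpha_self: "i \<le> l \<Longrightarrow> s i (alpha i) = - alpha i"
  using e_pos[of i] by (simp add: s_eq form_alpha_alpha b_diag fun_eq_iff smul_def fun_ap)

lemma s_alpha: "i \<le> l \<Longrightarrow> j \<le> l \<Longrightarrow> s i (alpha j) = alpha j - of_int (ent C i j) \<cdot> alpha i"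
proof -
  assume ij: "i \<le> l" "j \<le> l"
  have "b j i = int (e i) * ent C i j" using ij by (simp add: b_def ent_sym)
  then show ?thesis using ij e_pos[of i] by (simp add: s_eq form_alpha_alpha)
qed

lemma s_invol: "i \<le> l \<Longrightarrow> s i (s i x) = x"
proof -
  assume i: "i \<le> l"
  have "s i (s i x) = s i x - (form C x (alpha i) / of_nat (e i)) \<cdot> s i (alpha i)"
    by (subst (2) s_eq[OF i]) (simp add: s_diff s_smul)
  also have "\<dots> = x" by (simp add: s_alpha_self[OF i]) (simp add: s_eq[OF i])
  finally show ?thesis .
qed

lemma s_move: "i \<le> l \<Longrightarrow> form C (s i x) y = form C x (s i y)"
  using s_form[of i x "s i y"] s_invol[of i y] by simp

lemma s_hring: "i \<in> {1..l} \<Longrightarrow> x \<in> hring C \<Longrightarrow> s i x \<in> hring C"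
  by (auto simp: s_eq intro!: hring_diff hring_smul hring_alpha)

lemma s_hstar: "i \<le> l \<Longrightarrow> x \<in> hstar C \<Longrightarrow> s i x \<in> hstar C"
  by (auto simp: hstar_def s_apply)

abbreviation wm :: "nat list \<Rightarrow> hvec \<Rightarrow> hvec" where "wm \<equiv> word_map C"

lemma wm_Nil [simp]: "wm [] = id" and wm_Cons: "wm (i # is) x = s i (wm is x)"
  by (simp_all add: word_map_def)

lemma wm_append: "wm (is @ js) x = wm is (wm js x)"
  by (induction "is") (simp_all add: wm_Cons)

lemma wm_add: "wm is (x + y) = wm is x + wm is y"
  and wm_smul: "wm is (c \<cdot> x) = c \<cdot> wm is x"
  and wm_diff: "wm is (x - y) = wm is x - wm is y"
  and wm_zero: "wm is 0 = 0"
  by (induction "is") (simp_all add: wm_Cons s_add s_smul s_diff s_zero)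

lemma wm_form: "set is \<subseteq> {..l} \<Longrightarrow> form C (wm is x) (wm is y) = form C x y"
  by (induction "is") (auto simp: wm_Cons s_form)

lemma wm_rev: "set is \<subseteq> {..l} \<Longrightarrow> wm (rev is) (wm is x) = x"
  by (induction "is" arbitrary: x) (auto simp: wm_append wm_Cons s_invol)

lemma wm_rev': "set is \<subseteq> {..l} \<Longrightarrow> wm is (wm (rev is) x) = x"
  using wm_rev[of "rev is" x] by simp

lemma wm_hring: "set is \<subseteq> {1..l} \<Longrightarrow> x \<in> hring C \<Longrightarrow> wm is x \<in> hring C"
  by (induction "is") (auto simp: wm_Cons s_hring)

lemma wm_hstar: "set is \<subseteq> {..l} \<Longrightarrow> x \<in> hstar C \<Longrightarrow> wm is x \<in> hstar C"
  by (induction "is") (auto simp: wm_Cons s_hstar)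

lemma wm_level: "set is \<subseteq> {..l} \<Longrightarrow> wm is x (l + 1) = x (l + 1)"
  by (induction "is") (auto simp: wm_Cons s_apply)

section \<open>The integral span of the finite simple roots and its comparison with M\<close>

definition rlat :: "hvec set" where "rlat = {x \<in> hring C. \<forall>i. x i \<in> \<int>}"

lemma form_alpha_int: "x \<in> rlat \<Longrightarrow> i \<le> l \<Longrightarrow> form C x (alpha i) / of_nat (e i) \<in> \<int>"
proof -
  assume x: "x \<in> rlat" and i: "i \<le> l"
  have "form C x (alpha i) = (\<Sum>j\<le>l. of_int (b i j) * x j)"
    using i x by (simp add: form_alpha_right rlat_def hring_outside)
  also have "\<dots> = of_nat (e i) * (\<Sum>j\<le>l. of_int (ent C i j) * x j)"
    by (simp add: b_def sum_distrib_left mult.assoc)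
  finally show ?thesis using x e_pos[OF i] by (auto simp: rlat_def intro!: Ints_sum Ints_mult)
qed

lemma rlat_zero: "0 \<in> rlat" and rlat_add: "x \<in> rlat \<Longrightarrow> y \<in> rlat \<Longrightarrow> x + y \<in> rlat"
  and rlat_diff: "x \<in> rlat \<Longrightarrow> y \<in> rlat \<Longrightarrow> x - y \<in> rlat"
  and rlat_int_smul: "x \<in> rlat \<Longrightarrow> c \<in> \<int> \<Longrightarrow> c \<cdot> x \<in> rlat"
  by (auto simp: rlat_def hring_add hring_diff hring_smul hring_zero fun_ap) (simp add: smul_def)

lemma rlat_hring: "x \<in> rlat \<Longrightarrow> x \<in> hring C" by (simp add: rlat_def)

lemma rlat_rvec: "x \<in> rlat \<Longrightarrow> x \<in> rvec"
  by (auto simp: rlat_def rvec_def real_vec_def) (metis Ints_cases Reals_of_int)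

lemma rlat_alpha: "i \<in> {1..l} \<Longrightarrow> alpha i \<in> rlat"
  by (auto simp: rlat_def hring_alpha) (auto simp: alpha_def)

lemma rlat_sum: "(\<And>i. i \<in> A \<Longrightarrow> f i \<in> rlat) \<Longrightarrow> (\<Sum>i\<in>A. f i) \<in> rlat"
  by (induction A rule: infinite_finite_induct) (auto intro: rlat_add rlat_zero)

lemma rlat_s: "i \<in> {1..l} \<Longrightarrow> x \<in> rlat \<Longrightarrow> s i x \<in> rlat"
  by (auto simp: s_eq intro!: rlat_diff rlat_int_smul form_alpha_int rlat_alpha)

lemma rlat_wm: "set is \<subseteq> {1..l} \<Longrightarrow> x \<in> rlat \<Longrightarrow> wm is x \<in> rlat"
  by (induction "is") (auto simp: wm_Cons rlat_s)

lemma rlat_theta: "theta_root C \<in> rlat"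
  by (auto simp: rlat_def theta_hring) (auto simp: theta_apply)

lemma latticeM_gen: "latticeM C = group_closure {wm is (theta_root C) |is. set is \<subseteq> {1..l}}"
proof -
  have "(1 / of_nat (label C 0)) \<cdot> theta_root C = theta_root C" by (simp add: label_eq a0)
  then show ?thesis unfolding latticeM_def fin_weyl_def
    by (intro arg_cong[where f = group_closure]) auto
qed

lemma latticeM_add: "x \<in> latticeM C \<Longrightarrow> y \<in> latticeM C \<Longrightarrow> x + y \<in> latticeM C"
  and latticeM_diff: "x \<in> latticeM C \<Longrightarrow> y \<in> latticeM C \<Longrightarrow> x - y \<in> latticeM C"
  and latticeM_zero: "0 \<in> latticeM C"
  unfolding latticeM_def by (auto intro: group_closure_add group_closure.diff)

lemma latticeM_int_smul:
  assumes "x \<in> latticeM C"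
  shows "of_int n \<cdot> x \<in> latticeM C"
proof -
  have nat: "of_nat n \<cdot> x \<in> latticeM C" for n
  proof (induction n)
    case (Suc n)
    have "of_nat (Suc n) \<cdot> x = x + of_nat n \<cdot> x" by (simp add: smul_def fun_eq_iff fun_ap algebra_simps)
    then show ?case using latticeM_add[OF assms Suc] by simp
  qed (use latticeM_zero in simp)
  show ?thesis
  proof (cases "n \<ge> 0")
    case True
    then show ?thesis using nat[of "nat n"] by simp
  next
    case False
    have "of_int n \<cdot> x = 0 - of_nat (nat (- n)) \<cdot> x" using False by (simp add: smul_def fun_eq_iff fun_ap)
    then show ?thesis using nat latticeM_diff latticeM_zero by metis
  qed
qed

lemma theta_latticeM: "theta_root C \<in> latticeM C"
  unfolding latticeM_gen by (rule group_closure.base) (auto intro!: exI[of _ "[]"])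

lemma latticeM_s:
  assumes i: "i \<in> {1..l}" and x: "x \<in> latticeM C"
  shows "s i x \<in> latticeM C"
  using x unfolding latticeM_gen
proof (induction rule: group_closure.induct)
  case (base x)
  then consider "x = 0" | "is" where "x = wm is (theta_root C)" "set is \<subseteq> {1..l}" by auto
  then show ?case
  proof cases
    case 1 then show ?thesis using s_zero by simp
  next
    case (2 "is")
    then have "s i x = wm (i # is) (theta_root C)" "set (i # is) \<subseteq> {1..l}" using i by (auto simp: wm_Cons)
    then show ?thesis by (intro group_closure.base) blast
  qed
qed (simp add: s_diff group_closure.diff)

lemma latticeM_subset_rlat: "latticeM C \<subseteq> rlat"
proof
  fix x assume "x \<in> latticeM C" then show "x \<in> rlat" unfolding latticeM_gen
    by induction (auto intro: rlat_zero rlat_wm rlat_theta rlat_diff)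
qed

text \<open>Since s_i \<alpha>_j = \<alpha>_j + \<alpha>_i, membership in M spreads from node j to
  node i along a bond with a_ij = -1. Each type is treated by walking along its diagram in this
  way.\<close>

lemma alpha_latticeM_step:
  assumes "j \<in> {1..l}" "i \<in> {1..l}" "alpha j \<in> latticeM C" "ent C i j = - 1"
  shows "alpha i \<in> latticeM C"
proof -
  have "alpha i = s i (alpha j) - alpha j" using assms by (simp add: s_alpha)
  then show ?thesis using assms latticeM_s latticeM_diff by metis
qed

lemma theta_form_alpha: "i \<in> {1..l} \<Longrightarrow> form C (theta_root C) (alpha i) = - of_int (b i 0)"
  using form_alpha_alpha[of 0 i] b_sym[of i 0]
  by (auto simp: theta_root_def form_simps form_delta_left alpha_def label_eq a0)

text \<open>The walk starts at a neighbour of node 0, where s_i \<theta> = \<theta> -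
  \<alpha>_i.\<close>

lemma alpha_latticeM_adjacent:
  assumes "i \<in> {1..l}" "ent C i 0 = - 1"
  shows "alpha i \<in> latticeM C"
proof -
  have "form C (theta_root C) (alpha i) / of_nat (e i) = 1"
    using theta_form_alpha[OF assms(1)] assms e_pos[of i] by (simp add: b_def)
  then have "s i (theta_root C) = theta_root C - alpha i" using assms by (simp add: s_eq)
  then have "alpha i = theta_root C - s i (theta_root C)" by simp
  then show ?thesis using latticeM_diff theta_latticeM latticeM_s[OF assms(1)] by metis
qed

end

text \<open>The assumption is the inclusion that depends on the type; together with
  \<open>latticeM_subset_rlat\<close> it identifies M with the root lattice of \<alpha>_1, ...,
  \<alpha>_l.\<close>

locale affine_lattice = affine_datum +
  assumes alpha_latticeM: "\<And>i. i \<in> {1..rk C} \<Longrightarrow> alpha i \<in> latticeM C"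
begin

lemma latticeM_eq: "latticeM C = rlat"
proof
  show "latticeM C \<subseteq> rlat" by (rule latticeM_subset_rlat)
  show "rlat \<subseteq> latticeM C"
  proof
    fix x assume x: "x \<in> rlat"
    have "(\<Sum>i\<in>A. x i \<cdot> alpha i) \<in> latticeM C" if "A \<subseteq> {1..l}" for A
      using finite_subset[OF that finite_atLeastAtMost] that
    proof (induction A rule: finite_induct)
      case (insert i A)
      have "x i \<in> \<int>" using x by (simp add: rlat_def)
      then have "x i \<cdot> alpha i \<in> latticeM C" using insert.prems alpha_latticeM latticeM_int_smul
        by (auto elim!: Ints_cases)
      then show ?case using insert by (simp add: latticeM_add)
    qed (simp add: latticeM_zero)
    from this[of "{1..l}"] show "x \<in> latticeM C" using hring_expand[OF rlat_hring[OF x]] by simp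
  qed
qed

end

section \<open>Theta functions of the lattice M\<close>

lemma even_quadratic:
  fixes c :: "'i \<Rightarrow> 'i \<Rightarrow> int"
  assumes "finite S" "\<And>i j. i \<in> S \<Longrightarrow> j \<in> S \<Longrightarrow> c i j = c j i" "\<And>i. i \<in> S \<Longrightarrow> even (c i i)"
  shows "even (\<Sum>i\<in>S. \<Sum>j\<in>S. c i j * y i * y j)"
  using assms
proof (induction S rule: finite_induct)
  case (insert x S)
  have "(\<Sum>i\<in>insert x S. \<Sum>j\<in>insert x S. c i j * y i * y j)
     = c x x * y x * y x + (\<Sum>j\<in>S. c x j * y x * y j) + (\<Sum>i\<in>S. c i x * y i * y x) + (\<Sum>i\<in>S. \<Sum>j\<in>S. c i j * y i * y j)"
    using insert.hyps by (simp add: sum.distrib add.assoc)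
  also have "(\<Sum>i\<in>S. c i x * y i * y x) = (\<Sum>j\<in>S. c x j * y x * y j)"
    using insert.prems by (intro sum.cong) (auto simp: mult_ac)
  finally show ?case using insert by simp
qed simp

lemma summable_on_norm_prod_PiE:
  fixes f :: "'a \<Rightarrow> int \<Rightarrow> complex"
  assumes "finite A" "\<And>x. x \<in> A \<Longrightarrow> (\<lambda>k. norm (f x k)) summable_on UNIV"
  shows "(\<lambda>g. norm (\<Prod>x\<in>A. f x (g x))) summable_on (PiE A (\<lambda>_. UNIV))"
  using abs_summable_on_prod_PiE[of A "\<lambda>_. UNIV" f] assms by (simp add: abs_summable_equivalent)

context affine_datum
begin

lemma rlat_form_int: "x \<in> rlat \<Longrightarrow> y \<in> rlat \<Longrightarrow> form C x y \<in> \<int>"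
  by (auto simp: form_expand rlat_def hring_outside intro!: Ints_sum Ints_mult)

text \<open>The diagonal entries 2 e_i are even and off-diagonal terms occur in pairs. Evenness of M
  provides the even indices for \<open>th1\<close> and removes a phase in
  \<open>slash_Tr\<close>.\<close>

lemma rlat_form_even:
  assumes "x \<in> rlat"
  obtains n :: int where "form C x x = of_int (2 * n)"
proof -
  have "\<forall>i. \<exists>k. x i = of_int k" using assms by (auto simp: rlat_def elim!: Ints_cases)
  then obtain k where k: "\<And>i. x i = of_int (k i)" by metis
  have "k 0 = 0" using hring_outside(1)[OF rlat_hring[OF assms]] k[of 0] by simp
  then have "form C x x = of_int (\<Sum>i\<le>l. \<Sum>j\<le>l. b i j * k i * k j)"
    by (simp add: form_expand k)
  moreover have "even (\<Sum>i\<le>l. \<Sum>j\<le>l. b i j * k i * k j)"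
    by (rule even_quadratic) (auto simp: b_sym b_diag)
  then obtain n where "(\<Sum>i\<le>l. \<Sum>j\<le>l. b i j * k i * k j) = 2 * n" by (rule evenE)
  ultimately have "form C x x = of_int (2 * n)" by (simp only:)
  then show ?thesis by (rule that)
qed

lemma rlat_form_pos:
  assumes "x \<in> rlat" "x \<noteq> 0"
  obtains n :: nat where "form C x x = of_nat n" "n > 0" "even n"
proof -
  obtain k where k: "form C x x = of_int (2 * k)" using rlat_form_even[OF assms(1)] .
  have "2 * k \<ge> 0" using rvec_form_nonneg(2)[OF rlat_rvec[OF assms(1)]] by (simp add: k)
  moreover have "k \<noteq> 0" using rvec_form_nonneg(3)[OF rlat_rvec[OF assms(1)]] assms(2) k by auto
  ultimately have "form C x x = of_nat (nat (2 * k))" "nat (2 * k) > 0" "even (nat (2 * k))"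
    using k by (auto simp: even_nat_iff)
  then show ?thesis by (rule that)
qed

text \<open>Gram-Schmidt with denominators cleared. The f_i are kept triangular, which shows that
  each new vector is nonzero; D records by how much the simple roots must be multiplied to become
  combinations of the f_j.\<close>

lemma orthogonal_basis_aux:
  "n \<le> l \<Longrightarrow> \<exists>(f :: nat \<Rightarrow> hvec) N (D :: nat) (c :: nat \<Rightarrow> nat \<Rightarrow> int).
     (\<forall>i\<in>{1..n}. f i \<in> rlat \<and> f i i \<noteq> 0 \<and> (\<forall>j>i. f i j = 0) \<and> form C (f i) (f i) = of_nat (N i) \<and> N i > (0::nat) \<and> even (N i))
     \<and> (\<forall>i\<in>{1..n}. \<forall>j\<in>{1..n}. i \<noteq> j \<longrightarrow> form C (f i) (f j) = 0)
     \<and> D > 0 \<and> (\<forall>i\<in>{1..n}. of_nat D \<cdot> alpha i = (\<Sum>j=1..n. of_int (c i j) \<cdot> f j))"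
proof (induction n)
  case 0
  show ?case by (rule exI, rule exI[of _ "\<lambda>_. 1"], rule exI[of _ 1]) simp
next
  case (Suc n)
  have nl: "n \<le> l" using Suc.prems by simp
  obtain f :: "nat \<Rightarrow> hvec" and N and D :: nat and c :: "nat \<Rightarrow> nat \<Rightarrow> int" where
    F: "\<forall>i\<in>{1..n}. f i \<in> rlat \<and> f i i \<noteq> 0 \<and> (\<forall>j>i. f i j = 0) \<and> form C (f i) (f i) = of_nat (N i) \<and> N i > (0::nat) \<and> even (N i)"
    and F2: "\<forall>i\<in>{1..n}. \<forall>j\<in>{1..n}. i \<noteq> j \<longrightarrow> form C (f i) (f j) = 0"
    and F3: "D > 0" and F4: "\<forall>i\<in>{1..n}. of_nat D \<cdot> alpha i = (\<Sum>j=1..n. of_int (c i j) \<cdot> f j)"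
    using Suc.IH[OF nl] by (elim exE conjE)
  have f: "\<And>i. i \<in> {1..n} \<Longrightarrow> f i \<in> rlat" "\<And>i. i \<in> {1..n} \<Longrightarrow> f i i \<noteq> 0"
    "\<And>i j. i \<in> {1..n} \<Longrightarrow> j > i \<Longrightarrow> f i j = 0"
    "\<And>i. i \<in> {1..n} \<Longrightarrow> form C (f i) (f i) = of_nat (N i)" "\<And>i. i \<in> {1..n} \<Longrightarrow> N i > (0::nat)" "\<And>i. i \<in> {1..n} \<Longrightarrow> even (N i)"
    using F by blast+
  have orth: "\<And>i j. i \<in> {1..n} \<Longrightarrow> j \<in> {1..n} \<Longrightarrow> i \<noteq> j \<Longrightarrow> form C (f i) (f j) = 0" using F2 by blast
  have D: "D > (0::nat)" "\<And>i. i \<in> {1..n} \<Longrightarrow> of_nat D \<cdot> alpha i = (\<Sum>j=1..n. of_int (c i j :: int) \<cdot> f j)"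
    using F3 F4 by blast+
  define v where "v = alpha (Suc n)"
  have v: "v \<in> rlat" using Suc.prems by (simp add: v_def rlat_alpha)
  \<comment> \<open>A common multiple of the earlier norms, so that the coefficients P (v, f_i)/N_i
    are integers.\<close>
  define P where "P = (\<Prod>i=1..n. N i)"
  have P: "P > 0" unfolding P_def using f(5) by (intro prod_pos) auto
  have "\<exists>k::int. of_nat P / of_nat (N i) * form C v (f i) = of_int k" if i: "i \<in> {1..n}" for i
  proof -
    have "N i dvd P" unfolding P_def using i by (intro dvd_prodI) auto
    then obtain q where q: "P = N i * q" by (rule dvdE)
    obtain k where "form C v (f i) = of_int k" using rlat_form_int[OF v f(1)[OF i]] by (rule Ints_cases)
    then have "of_nat P / of_nat (N i) * form C v (f i) = of_int (int q * k)" using q f(5)[OF i] by simp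
    then show ?thesis by blast
  qed
  then have "\<forall>i. \<exists>k::int. i \<in> {1..n} \<longrightarrow> of_nat P / of_nat (N i) * form C v (f i) = of_int k" by blast
  then obtain k :: "nat \<Rightarrow> int" where k: "\<And>i. i \<in> {1..n} \<Longrightarrow> of_nat P / of_nat (N i) * form C v (f i) = of_int (k i)"
    by metis
  define g where "g = of_nat P \<cdot> v - (\<Sum>i=1..n. of_int (k i) \<cdot> f i)"
  have g: "g \<in> rlat" unfolding g_def
    by (intro rlat_diff rlat_int_smul v rlat_sum f(1)) auto
  have gcoord: "g j = of_nat P * v j - (\<Sum>i=1..n. of_int (k i) * f i j)" for j
    by (simp add: g_def fun_ap smul_def sum_fun_apply)
  have gS: "g (Suc n) = of_nat P"
    unfolding gcoord using f(3) by (simp add: v_def alpha_def)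
  have gout: "g j = 0" if "j > Suc n" for j
    unfolding gcoord using f(3) that by (simp add: v_def alpha_def)
  have gne: "g \<noteq> 0" using gS P by (auto simp: fun_ap)
  obtain M where M: "form C g g = of_nat M" "M > 0" "even M" using rlat_form_pos[OF g gne] .
  have gorth: "form C g (f i) = 0" if i: "i \<in> {1..n}" for i
  proof -
    have "(\<Sum>j=1..n. of_int (k j) * form C (f j) (f i)) = (\<Sum>j=1..n. if j = i then of_int (k i) * of_nat (N i) else 0)"
      using i orth f(4) by (intro sum.cong) auto
    also have "\<dots> = of_nat P * form C v (f i)" using i f(5)[OF i] by (simp add: k[OF i, symmetric])
    finally show ?thesis by (simp add: g_def form_simps)
  qed
  define f' where "f' = f(Suc n := g)"
  define N' where "N' = N(Suc n := M)"
  \<comment> \<open>Solving g = P v - (sum of k_j f_j) for v and rescaling the older relations by P,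
    all over the common factor D P.\<close>
  define c' where "c' i j = (if i = Suc n then int D * (if j = Suc n then 1 else k j) else if j = Suc n then 0 else int P * c i j)" for i j
  have f'S: "f' (Suc n) = g" and f'n: "i \<in> {1..n} \<Longrightarrow> f' i = f i" for i by (auto simp: f'_def)
  have "of_nat (D * P) \<cdot> alpha i = (\<Sum>j=1..Suc n. of_int (c' i j) \<cdot> f' j)" if "i \<in> {1..Suc n}" for i
  proof (cases "i = Suc n")
    case True
    have "(\<Sum>j=1..Suc n. of_int (c' i j) \<cdot> f' j) = (\<Sum>j=1..n. (of_int (int D * k j)) \<cdot> f j) + of_nat D \<cdot> g"
      using True by (simp add: c'_def f'S f'n)
    also have "(\<Sum>j=1..n. (of_int (int D * k j)) \<cdot> f j) = of_nat D \<cdot> (\<Sum>j=1..n. of_int (k j) \<cdot> f j)"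
      by (simp add: cfun.scale_sum_right)
    finally show ?thesis by (simp add: g_def True v_def cfun.scale_right_diff_distrib)
  next
    case False
    then have i: "i \<in> {1..n}" using that by auto
    have "(\<Sum>j=1..Suc n. of_int (c' i j) \<cdot> f' j) = (\<Sum>j=1..n. (of_int (int P * c i j)) \<cdot> f j)"
      using False by (simp add: c'_def f'n)
    also have "\<dots> = of_nat P \<cdot> (\<Sum>j=1..n. of_int (c i j) \<cdot> f j)" by (simp add: cfun.scale_sum_right)
    also have "\<dots> = of_nat (D * P) \<cdot> alpha i" by (simp add: D(2)[OF i, symmetric] mult.commute)
    finally show ?thesis by simp
  qed
  moreover have "f' i \<in> rlat \<and> f' i i \<noteq> 0 \<and> (\<forall>j>i. f' i j = 0) \<and> form C (f' i) (f' i) = of_nat (N' i) \<and> N' i > 0 \<and> even (N' i)"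
    if "i \<in> {1..Suc n}" for i
  proof (cases "i = Suc n")
    case True
    then show ?thesis using g gS gout M P by (simp add: f'_def N'_def)
  next
    case False
    then have "i \<in> {1..n}" using that by auto
    then show ?thesis using f False by (simp add: f'_def N'_def)
  qed
  moreover have "form C (f' i) (f' j) = 0" if "i \<in> {1..Suc n}" "j \<in> {1..Suc n}" "i \<noteq> j" for i j
    using that orth gorth form_sym[of "f i" g] by (auto simp: f'_def le_Suc_eq)
  moreover have "D * P > 0" using D P by simp
  ultimately show ?case by blast
qed

end

text \<open>An orthogonal sublattice of finite index in \<open>M\<close> splits the theta functions into products of
  one-dimensional ones.\<close>

locale affine_orth = affine_lattice +
  fixes f :: "nat \<Rightarrow> hvec" and N :: "nat \<Rightarrow> nat" and D :: nat and c :: "nat \<Rightarrow> nat \<Rightarrow> int"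
  assumes f_rlat: "\<And>i. i \<in> {1..rk C} \<Longrightarrow> f i \<in> rlat"
    and f_norm: "\<And>i. i \<in> {1..rk C} \<Longrightarrow> form C (f i) (f i) = of_nat (N i)"
    and N_pos: "\<And>i. i \<in> {1..rk C} \<Longrightarrow> N i > 0"
    and N_even: "\<And>i. i \<in> {1..rk C} \<Longrightarrow> even (N i)"
    and f_orth: "\<And>i j. i \<in> {1..rk C} \<Longrightarrow> j \<in> {1..rk C} \<Longrightarrow> i \<noteq> j \<Longrightarrow> form C (f i) (f j) = 0"
    and D_pos: "D > 0"
    and D_alpha: "\<And>i. i \<in> {1..rk C} \<Longrightarrow> of_nat D \<cdot> alpha i = (\<Sum>j=1..rk C. of_int (c i j) \<cdot> f j)"

lemma (in affine_lattice) orthogonal_basis: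
  obtains f N D c where "affine_orth C r a e f N D c"
proof -
  obtain f N D c where *: "\<forall>i\<in>{1..l}. f i \<in> rlat \<and> f i i \<noteq> 0 \<and> (\<forall>j>i. f i j = 0) \<and> form C (f i) (f i) = of_nat (N i) \<and> N i > (0::nat) \<and> even (N i)"
     "\<forall>i\<in>{1..l}. \<forall>j\<in>{1..l}. i \<noteq> j \<longrightarrow> form C (f i) (f j) = 0"
     "D > (0::nat)" "\<forall>i\<in>{1..l}. of_nat D \<cdot> alpha i = (\<Sum>j=1..l. of_int (c i j :: int) \<cdot> f j)"
    using orthogonal_basis_aux[OF order_refl] by (elim exE conjE)
  have "affine_orth C r a e f N D c"
    by unfold_locales (use * in auto)
  then show ?thesis by (rule that)
qed

context affine_orth
begin

lemma f_hring: "i \<in> {1..l} \<Longrightarrow> f i \<in> hring C"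
  using f_rlat rlat_hring by blast

lemma form_f_sum:
  assumes "i \<in> {1..l}"
  shows "form C (\<Sum>j=1..l. x j \<cdot> f j) (f i) = x i * of_nat (N i)"
proof -
  have "form C (\<Sum>j=1..l. x j \<cdot> f j) (f i) = (\<Sum>j=1..l. if j = i then x i * of_nat (N i) else 0)"
    unfolding form_simps using assms f_norm f_orth by (intro sum.cong) auto
  then show ?thesis using assms by simp
qed

text \<open>The multiples D \<alpha>_i are combinations of the f_j, so these span; orthogonality
  then identifies the coefficients.\<close>

lemma f_expand:
  assumes "x \<in> hring C"
  shows "x = (\<Sum>j=1..l. (form C x (f j) / of_nat (N j)) \<cdot> f j)"
proof -
  define t where "t j = (\<Sum>i=1..l. x i * of_int (c i j)) / of_nat D" for j
  have "of_nat D \<cdot> x = (\<Sum>i=1..l. x i \<cdot> (of_nat D \<cdot> alpha i))"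
    by (subst hring_expand[OF assms]) (simp add: cfun.scale_sum_right mult.commute)
  also have "\<dots> = (\<Sum>i=1..l. \<Sum>j=1..l. (x i * of_int (c i j)) \<cdot> f j)"
    by (intro sum.cong refl) (simp add: D_alpha cfun.scale_sum_right)
  also have "\<dots> = (\<Sum>j=1..l. (of_nat D * t j) \<cdot> f j)"
    using D_pos by (subst sum.swap) (simp add: t_def cfun.scale_sum_left)
  also have "\<dots> = of_nat D \<cdot> (\<Sum>j=1..l. t j \<cdot> f j)" by (simp add: cfun.scale_sum_right)
  finally have x: "x = (\<Sum>j=1..l. t j \<cdot> f j)" using D_pos by (simp add: cfun.scale_left_imp_eq)
  have "form C x (f i) / of_nat (N i) = t i" if "i \<in> {1..l}" for i
    unfolding x form_f_sum[OF that] using N_pos[OF that] by simp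
  then have "(\<Sum>j=1..l. (form C x (f j) / of_nat (N j)) \<cdot> f j) = (\<Sum>j=1..l. t j \<cdot> f j)" by simp
  then show ?thesis using x by simp
qed

lemma form_f_expand:
  assumes "x \<in> hring C"
  shows "form C x y = (\<Sum>j=1..l. form C x (f j) * form C y (f j) / of_nat (N j))"
  by (subst f_expand[OF assms]) (simp add: form_simps form_sym[of _ y])

text \<open>Nondegeneracy of the form, made explicit: \<psi> is the functional with values \<phi>_i
  on the simple roots, and x is its representing vector in the orthogonal basis. Weights with
  prescribed pairings are obtained from this.\<close>

lemma riesz_aux: "\<exists>x\<in>hring C. \<forall>i\<in>{1..l}. form C x (alpha i) = \<phi> i"
proof -
  define \<psi> where "\<psi> y = (\<Sum>i=1..l. y i * \<phi> i)" for y :: hvec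
  define x where "x = (\<Sum>j=1..l. (\<psi> (f j) / of_nat (N j)) \<cdot> f j)"
  have "x \<in> hring C" unfolding x_def by (intro hring_sum hring_smul f_hring)
  moreover have "form C x (alpha i) = \<phi> i" if i: "i \<in> {1..l}" for i
  proof -
    have "\<phi> i = (\<Sum>j=1..l. if j = i then \<phi> i else 0)" using i by simp
    also have "\<dots> = \<psi> (alpha i)" unfolding \<psi>_def by (intro sum.cong) (auto simp: alpha_def)
    also have "\<dots> = \<psi> (\<Sum>j=1..l. (form C (alpha i) (f j) / of_nat (N j)) \<cdot> f j)"
      using f_expand[OF hring_alpha[OF i]] by simp
    also have "\<dots> = (\<Sum>j=1..l. (form C (alpha i) (f j) / of_nat (N j)) * \<psi> (f j))"
      unfolding \<psi>_def sum_fun_apply smul_def sum_distrib_right sum_distrib_left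
      by (subst sum.swap) (simp add: mult_ac)
    also have "\<dots> = form C x (alpha i)"
      unfolding x_def form_simps by (intro sum.cong) (auto simp: form_sym[of "alpha i"])
    finally show ?thesis by simp
  qed
  ultimately show ?thesis by blast
qed

end

context affine_lattice
begin

lemma riesz: "\<exists>x\<in>hring C. \<forall>i\<in>{1..l}. form C x (alpha i) = \<phi> i"
proof -
  obtain f N D c where "affine_orth C r a e f N D c" using orthogonal_basis .
  then show ?thesis by (rule affine_orth.riesz_aux)
qed

lemma hring_eqI:
  assumes x: "x \<in> hring C" and y: "y \<in> hring C" and eq: "\<And>i. i \<in> {1..l} \<Longrightarrow> form C x (alpha i) = form C y (alpha i)"
  shows "x = y"
proof -
  obtain f N D c where "affine_orth C r a e f N D c" using orthogonal_basis .
  then interpret affine_orth C r a e f N D c .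
  have "form C z (f j) = (\<Sum>i=1..l. f j i * form C z (alpha i))" if "j \<in> {1..l}" for j z
    using arg_cong[OF hring_expand[OF f_hring[OF that]], of "form C z"] unfolding form_simps .
  then have "form C x (f j) = form C y (f j)" if "j \<in> {1..l}" for j
    using that by (simp add: eq)
  then have "(\<Sum>j=1..l. (form C x (f j) / of_nat (N j)) \<cdot> f j) = (\<Sum>j=1..l. (form C y (f j) / of_nat (N j)) \<cdot> f j)"
    by simp
  then show ?thesis using f_expand[OF x] f_expand[OF y] by simp
qed

end

context affine_datum
begin

lemma rlat_int_coords:
  assumes "x \<in> rlat"
  obtains k :: "nat \<Rightarrow> int" where "\<And>i. x i = of_int (k i)"
proof -
  have "\<exists>k::int. x i = of_int k" for i
  proof -
    have "x i \<in> \<int>" using assms by (simp add: rlat_def)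
    then show ?thesis by (rule Ints_cases) blast
  qed
  then have "\<forall>i. \<exists>k::int. x i = of_int k" by blast
  from choice[OF this] show ?thesis using that by blast
qed

text \<open>In the coordinates \<open>(\<sigma>, z, u)\<close> of \<open>Y\<close> one has \<open>\<Theta>\<^sub>\<mu> = exp (2\<pi>imu) TH m \<gamma> \<sigma> z\<close> where \<open>m\<close> is the level of \<open>\<mu>\<close> and
  \<open>m \<gamma>\<close> is the projection of \<open>\<mu>\<close> to the span of \<open>\<alpha>\<^sub>1, \<dots>, \<alpha>\<^sub>l\<close>; the factor containing \<open>u\<close> is suppressed up to
  the definition of \<open>on_Y\<close>.\<close>

definition E :: "nat \<Rightarrow> hvec \<Rightarrow> complex \<Rightarrow> hvec \<Rightarrow> complex" where
  "E m \<gamma> \<sigma> z = exp (of_real pi * \<i> * of_nat m * (\<sigma> * form C \<gamma> \<gamma> + 2 * form C \<gamma> z))"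

definition TH :: "nat \<Rightarrow> hvec \<Rightarrow> complex \<Rightarrow> hvec \<Rightarrow> complex" where
  "TH m \<gamma> \<sigma> z = (\<Sum>\<^sub>\<infinity>\<beta>\<in>rlat. E m (\<gamma> + \<beta>) \<sigma> z)"

lemma TH_shift:
  assumes "\<beta> \<in> rlat"
  shows "TH m (\<gamma> + \<beta>) \<sigma> z = TH m \<gamma> \<sigma> z"
  unfolding TH_def
  by (rule infsum_reindex_bij_witness[of _ "\<lambda>x. x - \<beta>" "\<lambda>x. x + \<beta>"])
    (use assms in \<open>auto simp: rlat_add rlat_diff algebra_simps\<close>)

end

section \<open>Splitting theta functions of M along the sublattice \<open>L\<close> spanned by the
  f_j\<close>

context affine_orth
begin

definition L :: "hvec set" where
  "L = {x \<in> hring C. \<forall>j\<in>{1..l}. form C x (f j) / of_nat (N j) \<in> \<int>}"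

lemma L_zero: "0 \<in> L" and L_add: "x \<in> L \<Longrightarrow> y \<in> L \<Longrightarrow> x + y \<in> L" and L_diff: "x \<in> L \<Longrightarrow> y \<in> L \<Longrightarrow> x - y \<in> L"
  by (auto simp: L_def hring_zero hring_add hring_diff form_simps add_divide_distrib diff_divide_distrib)

lemma L_hring: "x \<in> L \<Longrightarrow> x \<in> hring C" by (simp add: L_def)

lemma L_subset_rlat: "L \<subseteq> rlat"
proof
  fix x assume x: "x \<in> L"
  have "(\<Sum>j=1..l. (form C x (f j) / of_nat (N j)) \<cdot> f j) \<in> rlat"
    using x by (intro rlat_sum rlat_int_smul f_rlat) (auto simp: L_def)
  then show "x \<in> rlat" using f_expand[OF L_hring[OF x]] by simp
qed

text \<open>With \<open>L_subset_rlat\<close> this places M between L and L/D, whence the index of L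
  in M is finite.\<close>

lemma D_rlat_L:
  assumes "x \<in> rlat"
  shows "of_nat D \<cdot> x \<in> L"
proof -
  have "form C (of_nat D \<cdot> x) (f j) / of_nat (N j) \<in> \<int>" if j: "j \<in> {1..l}" for j
  proof -
    have "of_nat D \<cdot> x = (\<Sum>i=1..l. x i \<cdot> (of_nat D \<cdot> alpha i))"
      by (subst hring_expand[OF rlat_hring[OF assms]]) (simp add: cfun.scale_sum_right mult.commute)
    also have "\<dots> = (\<Sum>i=1..l. x i \<cdot> (\<Sum>k=1..l. of_int (c i k) \<cdot> f k))"
      by (intro sum.cong refl) (simp add: D_alpha)
    finally have "form C (of_nat D \<cdot> x) (f j) = (\<Sum>i=1..l. x i * form C (\<Sum>k=1..l. of_int (c i k) \<cdot> f k) (f j))"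
      by (simp only: form_sum_left[of "\<lambda>i. x i \<cdot> (\<Sum>k=1..l. of_int (c i k) \<cdot> f k)"] form_smul_left)
    also have "\<dots> = of_nat (N j) * (\<Sum>i=1..l. x i * of_int (c i j))"
      by (simp add: form_f_sum[OF j] sum_distrib_left mult_ac)
    finally show ?thesis using assms N_pos[OF j] by (auto simp: rlat_def intro!: Ints_sum Ints_mult)
  qed
  then show ?thesis using assms by (auto simp: L_def hring_smul rlat_hring)
qed

definition lam :: "(nat \<Rightarrow> int) \<Rightarrow> hvec" where "lam k = (\<Sum>j=1..l. of_int (k j) \<cdot> f j)"

lemma form_lam: "j \<in> {1..l} \<Longrightarrow> form C (lam k) (f j) = of_int (k j) * of_nat (N j)"
  unfolding lam_def by (rule form_f_sum)

lemma lam_hring: "lam k \<in> hring C"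
  unfolding lam_def by (intro hring_sum hring_smul f_hring)

lemma bij_lam: "bij_betw lam (PiE {1..l} (\<lambda>_. UNIV)) L"
proof (rule bij_betw_imageI)
  show "inj_on lam (PiE {1..l} (\<lambda>_. UNIV))"
  proof
    fix k k' assume k: "k \<in> PiE {1..l} (\<lambda>_. UNIV)" "k' \<in> PiE {1..l} (\<lambda>_. UNIV)" and eq: "lam k = lam k'"
    have "k j = k' j" if "j \<in> {1..l}" for j
      using form_lam[OF that, of k] form_lam[OF that, of k'] eq N_pos[OF that] by simp
    then show "k = k'" using k by (intro PiE_ext) auto
  qed
  show "lam ` PiE {1..l} (\<lambda>_. UNIV) = L"
  proof (intro equalityI subsetI)
    fix x assume "x \<in> lam ` PiE {1..l} (\<lambda>_. UNIV)"
    then obtain k where x: "x = lam k" by auto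
    have "form C x (f j) / of_nat (N j) = of_int (k j)" if "j \<in> {1..l}" for j
      unfolding x form_lam[OF that] using N_pos[OF that] by simp
    then show "x \<in> L" by (simp add: L_def lam_hring x)
  next
    fix x assume x: "x \<in> L"
    have "\<forall>j. \<exists>k. j \<in> {1..l} \<longrightarrow> form C x (f j) / of_nat (N j) = of_int k"
      using x unfolding L_def by (blast elim: Ints_cases)
    from choice[OF this] obtain k where k: "\<And>j. j \<in> {1..l} \<Longrightarrow> form C x (f j) / of_nat (N j) = of_int (k j)" by blast
    define k' where "k' = restrict k {1..l}"
    have "x = (\<Sum>j=1..l. (form C x (f j) / of_nat (N j)) \<cdot> f j)" by (rule f_expand[OF L_hring[OF x]])
    also have "\<dots> = lam k'" unfolding lam_def by (intro sum.cong refl) (simp add: k k'_def)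
    finally show "x \<in> lam ` PiE {1..l} (\<lambda>_. UNIV)" by (auto simp: k'_def)
  qed
qed

definition crd :: "hvec \<Rightarrow> nat \<Rightarrow> complex" where "crd x j = form C x (f j) / of_nat (N j)"

definition E1 :: "nat \<Rightarrow> hvec \<Rightarrow> complex \<Rightarrow> hvec \<Rightarrow> nat \<Rightarrow> int \<Rightarrow> complex" where
  "E1 m \<gamma> \<sigma> z j k = exp (of_real pi * \<i> * of_nat (m * N j) * (\<sigma> * (of_int k + crd \<gamma> j)\<^sup>2 + 2 * (of_int k + crd \<gamma> j) * crd z j))"

lemma E1_summable:
  assumes "Im \<sigma> > 0" "m > 0" "j \<in> {1..l}"
  shows "(\<lambda>k. norm (E1 m \<gamma> \<sigma> z j k)) summable_on UNIV"
  unfolding E1_def by (rule th1_summable) (use assms N_pos in auto)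

text \<open>Orthogonality of the f_j splits the quadratic exponent into one summand for each
  coordinate.\<close>

lemma E_lam:
  assumes \<gamma>: "\<gamma> \<in> hring C" and z: "z \<in> hring C"
  shows "E m (\<gamma> + lam k) \<sigma> z = (\<Prod>j=1..l. E1 m \<gamma> \<sigma> z j (k j))"
proof -
  let ?y = "\<gamma> + lam k"
  have y: "?y \<in> hring C" using \<gamma> lam_hring by (rule hring_add)
  have yf: "form C ?y (f j) = of_nat (N j) * (of_int (k j) + crd \<gamma> j)" if "j \<in> {1..l}" for j
    using that N_pos[OF that] by (simp add: form_simps form_lam crd_def field_simps)
  have zf: "form C z (f j) = of_nat (N j) * crd z j" if "j \<in> {1..l}" for j
    using N_pos[OF that] by (simp add: crd_def)
  have 1: "form C ?y ?y = (\<Sum>j=1..l. of_nat (N j) * (of_int (k j) + crd \<gamma> j)\<^sup>2)"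
    using N_pos by (subst form_f_expand[OF y]) (intro sum.cong refl, simp add: yf power2_eq_square)
  have 2: "form C ?y z = (\<Sum>j=1..l. of_nat (N j) * ((of_int (k j) + crd \<gamma> j) * crd z j))"
    using N_pos by (subst form_f_expand[OF y]) (intro sum.cong refl, simp add: yf zf)
  show ?thesis
    unfolding E_def E1_def 1 2 exp_sum[OF finite_atLeastAtMost, symmetric]
    by (intro arg_cong[where f = exp]) (simp add: sum_distrib_left sum.distrib[symmetric] algebra_simps)
qed

definition THL :: "nat \<Rightarrow> hvec \<Rightarrow> complex \<Rightarrow> hvec \<Rightarrow> complex" where
  "THL m \<gamma> \<sigma> z = (\<Sum>\<^sub>\<infinity>\<beta>\<in>L. E m (\<gamma> + \<beta>) \<sigma> z)"

lemma THL_prod: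
  assumes "\<gamma> \<in> hring C" "z \<in> hring C" "Im \<sigma> > 0" "m > 0"
  shows "THL m \<gamma> \<sigma> z = (\<Prod>j=1..l. th1 (m * N j) (crd \<gamma> j) \<sigma> (crd z j))"
proof -
  have 1: "THL m \<gamma> \<sigma> z = (\<Sum>\<^sub>\<infinity>k\<in>PiE {1..l} (\<lambda>_. UNIV). E m (\<gamma> + lam k) \<sigma> z)"
    unfolding THL_def by (rule infsum_reindex_bij_betw[OF bij_lam, symmetric])
  have 2: "(\<Sum>\<^sub>\<infinity>k\<in>PiE {1..l} (\<lambda>_. UNIV). E m (\<gamma> + lam k) \<sigma> z) = (\<Prod>j=1..l. infsum (E1 m \<gamma> \<sigma> z j) UNIV)"
    unfolding E_lam[OF assms(1,2)]
    by (rule infsum_prod_PiE_abs[of "{1..l}" "E1 m \<gamma> \<sigma> z" "\<lambda>_. UNIV"]) (use E1_summable assms in auto)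
  have 3: "infsum (E1 m \<gamma> \<sigma> z j) UNIV = th1 (m * N j) (crd \<gamma> j) \<sigma> (crd z j)" for j
    by (simp only: th1_def E1_def[abs_def])
  show ?thesis by (simp only: 1 2 3)
qed

lemma E_summable_L:
  assumes "\<gamma> \<in> hring C" "z \<in> hring C" "Im \<sigma> > 0" "m > 0"
  shows "(\<lambda>\<beta>. norm (E m (\<gamma> + \<beta>) \<sigma> z)) summable_on L"
proof -
  have "(\<lambda>k. norm (E m (\<gamma> + lam k) \<sigma> z)) summable_on (PiE {1..l} (\<lambda>_. UNIV))"
    unfolding E_lam[OF assms(1,2)]
    by (rule summable_on_norm_prod_PiE[of "{1..l}" "E1 m \<gamma> \<sigma> z"]) (use E1_summable assms in auto)
  then show ?thesis
    by (rule iffD1[OF summable_on_reindex_bij_betw[OF bij_lam, where f = "\<lambda>\<beta>. norm (E m (\<gamma> + \<beta>) \<sigma> z)"]])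
qed

text \<open>The condition depends on x only through its coset of L, so the choice is constant on
  cosets; see \<open>coset_rep_cong\<close>.\<close>

definition coset_rep :: "hvec \<Rightarrow> hvec" where "coset_rep x = (SOME y. y \<in> rlat \<and> x - y \<in> L)"

lemma coset_rep: "x \<in> rlat \<Longrightarrow> coset_rep x \<in> rlat" "x \<in> rlat \<Longrightarrow> x - coset_rep x \<in> L"
proof -
  assume "x \<in> rlat"
  then have "\<exists>y. y \<in> rlat \<and> x - y \<in> L" using L_zero by (intro exI[of _ x]) simp
  from someI_ex[OF this] have "coset_rep x \<in> rlat \<and> x - coset_rep x \<in> L" unfolding coset_rep_def .
  then show "coset_rep x \<in> rlat" "x - coset_rep x \<in> L" by blast+
qed

lemma coset_rep_cong:
  assumes "x - x' \<in> L"
  shows "coset_rep x = coset_rep x'"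
proof -
  have "x - y \<in> L \<longleftrightarrow> x' - y \<in> L" for y
    using L_diff[OF _ assms, of "x - y"] L_add[OF _ assms, of "x' - y"] by auto
  then show ?thesis by (simp add: coset_rep_def)
qed

definition coset_reps :: "hvec set" where "coset_reps = coset_rep ` rlat"

lemma coset_reps_rlat: "x \<in> coset_reps \<Longrightarrow> x \<in> rlat"
  by (auto simp: coset_reps_def coset_rep)

text \<open>Reducing coordinates modulo D does not change the coset, because D M is contained in
  L.\<close>

lemma finite_coset_reps: "finite coset_reps"
proof -
  define box where "box n = (\<Sum>i=1..l. of_nat (n i) \<cdot> alpha i)" for n :: "nat \<Rightarrow> nat"
  have "coset_reps \<subseteq> (\<lambda>n. coset_rep (box n)) ` PiE {1..l} (\<lambda>_. {..<D})"
  proof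
    fix y assume "y \<in> coset_reps"
    then obtain x where x: "x \<in> rlat" "y = coset_rep x" by (auto simp: coset_reps_def)
    obtain k where k: "\<And>i. x i = of_int (k i)" by (rule rlat_int_coords[OF x(1)]) (rule that)
    define n where "n = restrict (\<lambda>i. nat (k i mod int D)) {1..l}"
    define q where "q = (\<Sum>i=1..l. of_int (k i div int D) \<cdot> alpha i)"
    have nk: "of_nat (n i) + of_nat D * of_int (k i div int D) = x i" if "i \<in> {1..l}" for i
    proof -
      have "int (n i) + int D * (k i div int D) = k i" using that D_pos by (simp add: n_def)
      then show ?thesis unfolding k by (metis of_int_add of_int_mult of_int_of_nat_eq)
    qed
    have "box n + of_nat D \<cdot> q = (\<Sum>i=1..l. (of_nat (n i) + of_nat D * of_int (k i div int D)) \<cdot> alpha i)"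
      by (simp add: box_def q_def cfun.scale_sum_right sum.distrib cfun.scale_left_distrib)
    also have "\<dots> = (\<Sum>i=1..l. x i \<cdot> alpha i)" by (intro sum.cong refl) (simp add: nk)
    also have "\<dots> = x" by (rule hring_expand[OF rlat_hring[OF x(1)], symmetric])
    finally have "x - box n = of_nat D \<cdot> q" by (simp add: algebra_simps)
    moreover have "q \<in> rlat" unfolding q_def by (intro rlat_sum rlat_int_smul rlat_alpha) auto
    ultimately have "x - box n \<in> L" using D_rlat_L by simp
    then have "y = coset_rep (box n)" using coset_rep_cong x(2) by simp
    moreover have "n \<in> PiE {1..l} (\<lambda>_. {..<D})" using D_pos by (auto simp: n_def nat_less_iff)
    ultimately show "y \<in> (\<lambda>n. coset_rep (box n)) ` PiE {1..l} (\<lambda>_. {..<D})" by blast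
  qed
  then show ?thesis by (rule finite_subset) (intro finite_imageI finite_PiE, auto)
qed

lemma coset_reps_ne: "card coset_reps > 0"
  using finite_coset_reps rlat_zero by (auto simp: card_gt_0_iff coset_reps_def)

lemma coset_rep_idem:
  assumes "y \<in> coset_reps" "\<beta> \<in> L"
  shows "coset_rep (y + \<beta>) = y"
proof -
  obtain x where x: "x \<in> rlat" "y = coset_rep x" using assms by (auto simp: coset_reps_def)
  have "(y + \<beta>) - x = \<beta> - (x - coset_rep x)" by (simp add: x)
  then have "(y + \<beta>) - x \<in> L" using L_diff[OF assms(2) coset_rep(2)[OF x(1)]] by (simp only:)
  then have "coset_rep (y + \<beta>) = coset_rep x" by (rule coset_rep_cong)
  then show ?thesis using x by simp
qed

lemma bij_cosets: "bij_betw (\<lambda>(c, \<beta>). c + \<beta>) (coset_reps \<times> L) rlat"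
proof (rule bij_betwI[where g = "\<lambda>x. (coset_rep x, x - coset_rep x)"])
  show "(\<lambda>(c, \<beta>). c + \<beta>) \<in> coset_reps \<times> L \<rightarrow> rlat"
    using L_subset_rlat coset_reps_rlat by (auto intro: rlat_add)
  show "(\<lambda>x. (coset_rep x, x - coset_rep x)) \<in> rlat \<rightarrow> coset_reps \<times> L"
    using coset_rep by (auto simp: coset_reps_def)
qed (auto simp: coset_rep_idem)

lemma E_summable_aux:
  assumes "\<gamma> \<in> hring C" "z \<in> hring C" "Im \<sigma> > 0" "m > 0"
  shows "(\<lambda>\<beta>. norm (E m (\<gamma> + \<beta>) \<sigma> z)) summable_on rlat"
proof -
  have "(\<lambda>p. norm (E m (\<gamma> + (case p of (c, \<beta>) \<Rightarrow> c + \<beta>)) \<sigma> z)) summable_on (coset_reps \<times> L)"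
  proof (rule iffD2[OF Infinite_Sum.abs_summable_on_Sigma_iff], intro conjI ballI)
    fix c assume "c \<in> coset_reps"
    then have "\<gamma> + c \<in> hring C" using assms coset_reps_rlat rlat_hring hring_add by blast
    from E_summable_L[OF this assms(2-)]
    show "(\<lambda>\<beta>. norm (E m (\<gamma> + (case (c, \<beta>) of (c, \<beta>) \<Rightarrow> c + \<beta>)) \<sigma> z)) summable_on L" by (simp add: add.assoc)
  qed (simp add: finite_coset_reps)
  then show ?thesis
    by (rule iffD1[OF summable_on_reindex_bij_betw[OF bij_cosets, where f = "\<lambda>\<beta>. norm (E m (\<gamma> + \<beta>) \<sigma> z)"]])
qed

lemma TH_cosets:
  assumes "\<gamma> \<in> hring C" "z \<in> hring C" "Im \<sigma> > 0" "m > 0"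
  shows "TH m \<gamma> \<sigma> z = (\<Sum>c\<in>coset_reps. THL m (\<gamma> + c) \<sigma> z)"
proof -
  have s: "(\<lambda>\<beta>. E m (\<gamma> + \<beta>) \<sigma> z) summable_on rlat"
    using E_summable_aux[OF assms] by (rule abs_summable_summable)
  have s': "(\<lambda>(c, \<beta>). E m (\<gamma> + c + \<beta>) \<sigma> z) summable_on (coset_reps \<times> L)"
    using summable_on_reindex_bij_betw[OF bij_cosets, of "\<lambda>\<beta>. E m (\<gamma> + \<beta>) \<sigma> z"] s
    by (simp add: case_prod_unfold add.assoc)
  have "TH m \<gamma> \<sigma> z = (\<Sum>\<^sub>\<infinity>(c, \<beta>)\<in>coset_reps \<times> L. E m (\<gamma> + c + \<beta>) \<sigma> z)"
    unfolding TH_def using infsum_reindex_bij_betw[OF bij_cosets, of "\<lambda>\<beta>. E m (\<gamma> + \<beta>) \<sigma> z"]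
    by (simp add: case_prod_unfold add.assoc)
  also have "\<dots> = (\<Sum>\<^sub>\<infinity>c\<in>coset_reps. \<Sum>\<^sub>\<infinity>\<beta>\<in>L. E m (\<gamma> + c + \<beta>) \<sigma> z)"
    using infsum_Sigma'_banach[OF s'] by simp
  finally show ?thesis by (simp add: finite_coset_reps THL_def)
qed

text \<open>A product of l one-dimensional transformations, each contributing one factor j.\<close>

lemma THL_modular:
  assumes det: "a' * d' - b' * c' = (1::int)" and j: "lift_of c' d' j"
    and m: "m > 0" and \<gamma>: "\<gamma> \<in> hring C" and int: "\<And>i. i \<in> {1..l} \<Longrightarrow> of_nat m * form C \<gamma> (f i) \<in> \<int>"
  shows "\<exists>K. \<forall>\<sigma> z. Im \<sigma> > 0 \<longrightarrow> z \<in> hring C \<longrightarrow>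
     THL m \<gamma> ((of_int a' * \<sigma> + of_int b') / (of_int c' * \<sigma> + of_int d')) ((1 / (of_int c' * \<sigma> + of_int d')) \<cdot> z)
       * exp (- (of_real pi * \<i> * of_nat m * of_int c' * form C z z / (of_int c' * \<sigma> + of_int d')))
     = j \<sigma> ^ l * (\<Sum>n\<in>PiE {1..l} (\<lambda>i. {..<m * N i}). K n * THL m (\<Sum>i=1..l. (of_nat (n i) / of_nat (m * N i)) \<cdot> f i) \<sigma> z)"
proof -
  let ?M = "\<lambda>\<sigma>. (of_int a' * \<sigma> + of_int b') / (of_int c' * \<sigma> + of_int d')"
  let ?J = "\<lambda>\<sigma>. of_int c' * \<sigma> + of_int d'"
  have "\<exists>K. \<forall>\<sigma> w. Im \<sigma> > 0 \<longrightarrow> th1 (m * N i) (crd \<gamma> i) (?M \<sigma>) (w / ?J \<sigma>)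
       * exp (- (of_real pi * \<i> * of_nat (m * N i) * of_int c' * w\<^sup>2 / ?J \<sigma>))
     = j \<sigma> * (\<Sum>n'<m * N i. K n' * th1 (m * N i) (of_nat n' / of_nat (m * N i)) \<sigma> w)" if i: "i \<in> {1..l}" for i
  proof -
    obtain n where "of_nat m * form C \<gamma> (f i) = of_int n" using int[OF i] by (rule Ints_cases)
    then have "crd \<gamma> i = of_int n / of_nat (m * N i)" using m N_pos[OF i] by (simp add: crd_def field_simps)
    moreover have "even (m * N i)" "m * N i > 0" using N_even[OF i] N_pos[OF i] m by auto
    ultimately show ?thesis using th1_modular_all[OF det j, unfolded th1_modular_def, rule_format, of "m * N i" n] by simp
  qed
  then have "\<forall>i. \<exists>K. i \<in> {1..l} \<longrightarrow> (\<forall>\<sigma> w. Im \<sigma> > 0 \<longrightarrow> th1 (m * N i) (crd \<gamma> i) (?M \<sigma>) (w / ?J \<sigma>)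
       * exp (- (of_real pi * \<i> * of_nat (m * N i) * of_int c' * w\<^sup>2 / ?J \<sigma>))
     = j \<sigma> * (\<Sum>n'<m * N i. K n' * th1 (m * N i) (of_nat n' / of_nat (m * N i)) \<sigma> w))" by blast
  from choice[OF this] obtain K where K: "\<And>i \<sigma> w. i \<in> {1..l} \<Longrightarrow> Im \<sigma> > 0 \<Longrightarrow> th1 (m * N i) (crd \<gamma> i) (?M \<sigma>) (w / ?J \<sigma>)
       * exp (- (of_real pi * \<i> * of_nat (m * N i) * of_int c' * w\<^sup>2 / ?J \<sigma>))
     = j \<sigma> * (\<Sum>n'<m * N i. K i n' * th1 (m * N i) (of_nat n' / of_nat (m * N i)) \<sigma> w)" by blast
  show ?thesis
  proof (intro exI[of _ "\<lambda>n. \<Prod>i=1..l. K i (n i)"] allI impI)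
    fix \<sigma> z assume s: "Im \<sigma> > 0" and z: "z \<in> hring C"
    have Ms: "Im (?M \<sigma>) > 0" by (rule moebius_Im(2)[OF det s])
    have z': "(1 / ?J \<sigma>) \<cdot> z \<in> hring C" by (rule hring_smul[OF z])
    have zz: "form C z z = (\<Sum>i=1..l. of_nat (N i) * (crd z i)\<^sup>2)"
      using N_pos by (subst form_f_expand[OF z]) (intro sum.cong refl, simp add: crd_def power2_eq_square)
    have ez: "exp (- (of_real pi * \<i> * of_nat m * of_int c' * form C z z / ?J \<sigma>))
      = (\<Prod>i=1..l. exp (- (of_real pi * \<i> * of_nat (m * N i) * of_int c' * (crd z i)\<^sup>2 / ?J \<sigma>)))"
      unfolding zz exp_sum[OF finite_atLeastAtMost, symmetric]
      by (intro arg_cong[where f = exp]) (simp add: sum_distrib_left sum_divide_distrib sum_negf mult_ac)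
    have crdz: "crd ((1 / ?J \<sigma>) \<cdot> z) i = crd z i / ?J \<sigma>" for i
      by (simp add: crd_def form_simps)
    have g: "(\<Sum>i=1..l. (of_nat (n i) / of_nat (m * N i)) \<cdot> f i) \<in> hring C" for n :: "nat \<Rightarrow> nat"
      by (intro hring_sum hring_smul f_hring)
    have crdg: "crd (\<Sum>i=1..l. (of_nat (n i) / of_nat (m * N i)) \<cdot> f i) i = of_nat (n i) / of_nat (m * N i)"
      if "i \<in> {1..l}" for i and n :: "nat \<Rightarrow> nat"
      unfolding crd_def form_f_sum[OF that] using N_pos[OF that] by simp
    have "THL m \<gamma> (?M \<sigma>) ((1 / ?J \<sigma>) \<cdot> z) * exp (- (of_real pi * \<i> * of_nat m * of_int c' * form C z z / ?J \<sigma>))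
      = (\<Prod>i=1..l. th1 (m * N i) (crd \<gamma> i) (?M \<sigma>) (crd z i / ?J \<sigma>) * exp (- (of_real pi * \<i> * of_nat (m * N i) * of_int c' * (crd z i)\<^sup>2 / ?J \<sigma>)))"
      unfolding THL_prod[OF \<gamma> z' Ms m] ez crdz prod.distrib ..
    also have "\<dots> = (\<Prod>i=1..l. j \<sigma> * (\<Sum>n'<m * N i. K i n' * th1 (m * N i) (of_nat n' / of_nat (m * N i)) \<sigma> (crd z i)))"
      by (intro prod.cong refl K s)
    also have "\<dots> = j \<sigma> ^ l * (\<Prod>i=1..l. \<Sum>n'<m * N i. K i n' * th1 (m * N i) (of_nat n' / of_nat (m * N i)) \<sigma> (crd z i))"
      by (simp add: prod.distrib)
    also have "(\<Prod>i=1..l. \<Sum>n'<m * N i. K i n' * th1 (m * N i) (of_nat n' / of_nat (m * N i)) \<sigma> (crd z i))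
      = (\<Sum>n\<in>PiE {1..l} (\<lambda>i. {..<m * N i}). \<Prod>i=1..l. K i (n i) * th1 (m * N i) (of_nat (n i) / of_nat (m * N i)) \<sigma> (crd z i))"
      by (rule prod_sum_PiE) auto
    also have "\<dots> = (\<Sum>n\<in>PiE {1..l} (\<lambda>i. {..<m * N i}). (\<Prod>i=1..l. K i (n i)) * THL m (\<Sum>i=1..l. (of_nat (n i) / of_nat (m * N i)) \<cdot> f i) \<sigma> z)"
      unfolding prod.distrib THL_prod[OF g z s m]
      by (intro sum.cong refl arg_cong2[where f = "(*)"] prod.cong) (simp_all only: crdg)
    finally show "THL m \<gamma> (?M \<sigma>) ((1 / ?J \<sigma>) \<cdot> z) * exp (- (of_real pi * \<i> * of_nat m * of_int c' * form C z z / ?J \<sigma>))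
      = j \<sigma> ^ l * (\<Sum>n\<in>PiE {1..l} (\<lambda>i. {..<m * N i}). (\<Prod>i=1..l. K i (n i)) * THL m (\<Sum>i=1..l. (of_nat (n i) / of_nat (m * N i)) \<cdot> f i) \<sigma> z)" .
  qed
qed

text \<open>The result is not yet closed: the right-hand side consists of theta functions of L whose
  characteristics run through 1/m times the dual lattice of L. \<open>TH_slash_aux\<close> repairs
  this.\<close>

lemma TH_modular_aux:
  assumes det: "a' * d' - b' * c' = (1::int)" and j: "lift_of c' d' j"
    and m: "m > 0" and \<gamma>: "\<gamma> \<in> hring C" and int: "\<And>\<beta>. \<beta> \<in> rlat \<Longrightarrow> of_nat m * form C \<gamma> \<beta> \<in> \<int>"
  shows "\<exists>K. \<forall>\<sigma> z. Im \<sigma> > 0 \<longrightarrow> z \<in> hring C \<longrightarrow>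
     TH m \<gamma> ((of_int a' * \<sigma> + of_int b') / (of_int c' * \<sigma> + of_int d')) ((1 / (of_int c' * \<sigma> + of_int d')) \<cdot> z)
       * exp (- (of_real pi * \<i> * of_nat m * of_int c' * form C z z / (of_int c' * \<sigma> + of_int d')))
     = j \<sigma> ^ l * (\<Sum>n\<in>PiE {1..l} (\<lambda>i. {..<m * N i}). K n * THL m (\<Sum>i=1..l. (of_nat (n i) / of_nat (m * N i)) \<cdot> f i) \<sigma> z)"
proof -
  let ?M = "\<lambda>\<sigma>. (of_int a' * \<sigma> + of_int b') / (of_int c' * \<sigma> + of_int d')"
  let ?J = "\<lambda>\<sigma>. of_int c' * \<sigma> + of_int d'"
  let ?G = "\<lambda>n. (\<Sum>i=1..l. (of_nat (n i) / of_nat (m * N i)) \<cdot> f i)"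
  let ?I = "PiE {1..l} (\<lambda>i. {..<m * N i})"
  have hr: "\<gamma> + x \<in> hring C" if "x \<in> coset_reps" for x using \<gamma> that coset_reps_rlat rlat_hring hring_add by blast
  have "\<exists>K. \<forall>\<sigma> z. Im \<sigma> > 0 \<longrightarrow> z \<in> hring C \<longrightarrow>
     THL m (\<gamma> + x) (?M \<sigma>) ((1 / ?J \<sigma>) \<cdot> z) * exp (- (of_real pi * \<i> * of_nat m * of_int c' * form C z z / ?J \<sigma>))
     = j \<sigma> ^ l * (\<Sum>n\<in>?I. K n * THL m (?G n) \<sigma> z)" if x: "x \<in> coset_reps" for x
  proof (rule THL_modular[OF det j m hr[OF x]])
    fix i assume i: "i \<in> {1..l}"
    have "of_nat m * form C x (f i) \<in> \<int>" using rlat_form_int[OF coset_reps_rlat[OF x] f_rlat[OF i]] by (intro Ints_mult) auto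
    then show "of_nat m * form C (\<gamma> + x) (f i) \<in> \<int>" using int[OF f_rlat[OF i]] by (simp add: form_simps distrib_left)
  qed
  then have "\<forall>x. \<exists>K. x \<in> coset_reps \<longrightarrow> (\<forall>\<sigma> z. Im \<sigma> > 0 \<longrightarrow> z \<in> hring C \<longrightarrow>
     THL m (\<gamma> + x) (?M \<sigma>) ((1 / ?J \<sigma>) \<cdot> z) * exp (- (of_real pi * \<i> * of_nat m * of_int c' * form C z z / ?J \<sigma>))
     = j \<sigma> ^ l * (\<Sum>n\<in>?I. K n * THL m (?G n) \<sigma> z))" by blast
  from choice[OF this] obtain K where K: "\<And>x \<sigma> z. x \<in> coset_reps \<Longrightarrow> Im \<sigma> > 0 \<Longrightarrow> z \<in> hring C \<Longrightarrow>
     THL m (\<gamma> + x) (?M \<sigma>) ((1 / ?J \<sigma>) \<cdot> z) * exp (- (of_real pi * \<i> * of_nat m * of_int c' * form C z z / ?J \<sigma>))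
     = j \<sigma> ^ l * (\<Sum>n\<in>?I. K x n * THL m (?G n) \<sigma> z)" by blast
  show ?thesis
  proof (intro exI[of _ "\<lambda>n. \<Sum>x\<in>coset_reps. K x n"] allI impI)
    fix \<sigma> z assume s: "Im \<sigma> > 0" and z: "z \<in> hring C"
    have "TH m \<gamma> (?M \<sigma>) ((1 / ?J \<sigma>) \<cdot> z) * exp (- (of_real pi * \<i> * of_nat m * of_int c' * form C z z / ?J \<sigma>))
      = (\<Sum>x\<in>coset_reps. j \<sigma> ^ l * (\<Sum>n\<in>?I. K x n * THL m (?G n) \<sigma> z))"
      unfolding TH_cosets[OF \<gamma> hring_smul[OF z] moebius_Im(2)[OF det s] m] sum_distrib_right
      by (intro sum.cong refl K s z)
    also have "\<dots> = j \<sigma> ^ l * (\<Sum>n\<in>?I. (\<Sum>x\<in>coset_reps. K x n) * THL m (?G n) \<sigma> z)"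
      unfolding sum_distrib_left[symmetric] sum_distrib_right by (subst sum.swap) (rule refl)
    finally show "TH m \<gamma> (?M \<sigma>) ((1 / ?J \<sigma>) \<cdot> z) * exp (- (of_real pi * \<i> * of_nat m * of_int c' * form C z z / ?J \<sigma>))
      = j \<sigma> ^ l * (\<Sum>n\<in>?I. (\<Sum>x\<in>coset_reps. K x n) * THL m (?G n) \<sigma> z)" .
  qed
qed

end

lemma (in affine_lattice) E_summable:
  assumes "\<gamma> \<in> hring C" "z \<in> hring C" "Im \<sigma> > 0" "m > 0"
  shows "(\<lambda>\<beta>. norm (E m (\<gamma> + \<beta>) \<sigma> z)) summable_on rlat"
proof -
  obtain f N D c where "affine_orth C r a e f N D c" using orthogonal_basis .
  then show ?thesis using assms by (rule affine_orth.E_summable_aux)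
qed

section \<open>Translations and averaging over them\<close>

lemma geometric_root_of_unity:
  fixes w :: complex
  assumes "w ^ q = 1"
  shows "(\<Sum>j<q. w ^ j) = (if w = 1 then of_nat q else 0)"
  using assms by (simp add: sum_gp_strict)

text \<open>F equals its mean over the first q iterates of S. The same mean kills each G n with
  eigenvalue w n \<noteq> 1, a root of unity of order dividing q, and preserves the others.\<close>

lemma eigen_projection:
  fixes F :: "'p \<Rightarrow> complex"
  assumes F: "\<And>p. p \<in> P \<Longrightarrow> F p = (\<Sum>n\<in>I. k n * G n p)"
    and S: "\<And>p. p \<in> P \<Longrightarrow> S p \<in> P" and FS: "\<And>p. p \<in> P \<Longrightarrow> F (S p) = F p"
    and G: "\<And>n p. n \<in> I \<Longrightarrow> p \<in> P \<Longrightarrow> G n (S p) = w n * G n p"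
    and w: "\<And>n. n \<in> I \<Longrightarrow> w n ^ q = 1" and q: "q > (0::nat)" and I: "finite I" and p: "p \<in> P"
  shows "F p = (\<Sum>n | n \<in> I \<and> w n = 1. k n * G n p)"
proof -
  have it: "(S ^^ j) p \<in> P \<and> F ((S ^^ j) p) = F p \<and> (\<forall>n\<in>I. G n ((S ^^ j) p) = w n ^ j * G n p)" for j
    by (induction j) (auto simp: p S FS G)
  have "of_nat q * F p = (\<Sum>j<q. F ((S ^^ j) p))" using it by simp
  also have "\<dots> = (\<Sum>j<q. \<Sum>n\<in>I. k n * (w n ^ j * G n p))"
  proof (intro sum.cong refl)
    fix j
    have "F ((S ^^ j) p) = (\<Sum>n\<in>I. k n * G n ((S ^^ j) p))" using it by (intro F) blast
    then show "F ((S ^^ j) p) = (\<Sum>n\<in>I. k n * (w n ^ j * G n p))" using it by simp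
  qed
  also have "\<dots> = (\<Sum>n\<in>I. k n * G n p * (\<Sum>j<q. w n ^ j))"
    by (subst sum.swap) (simp add: sum_distrib_left mult_ac)
  also have "\<dots> = (\<Sum>n\<in>I. if w n = 1 then of_nat q * (k n * G n p) else 0)"
    by (intro sum.cong refl) (simp add: geometric_root_of_unity w)
  also have "\<dots> = of_nat q * (\<Sum>n | n \<in> I \<and> w n = 1. k n * G n p)"
    using I by (simp add: sum.If_cases sum_distrib_left Int_def)
  finally show ?thesis using q by simp
qed

text \<open>The G n are common eigenfunctions of all shifts, so the shifts can be handled one after
  another, each deleting terms from the same sum.\<close>

lemma eigen_projections:
  fixes F :: "'p \<Rightarrow> complex"
  assumes F: "\<And>p. p \<in> P \<Longrightarrow> F p = (\<Sum>n\<in>I. k n * G n p)"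
    and S: "\<And>i p. i \<in> A \<Longrightarrow> p \<in> P \<Longrightarrow> S i p \<in> P" and FS: "\<And>i p. i \<in> A \<Longrightarrow> p \<in> P \<Longrightarrow> F (S i p) = F p"
    and G: "\<And>i n p. i \<in> A \<Longrightarrow> n \<in> I \<Longrightarrow> p \<in> P \<Longrightarrow> G n (S i p) = w i n * G n p"
    and w: "\<And>i n. i \<in> A \<Longrightarrow> n \<in> I \<Longrightarrow> w i n ^ q i = 1" and q: "\<And>i. i \<in> A \<Longrightarrow> q i > (0::nat)"
    and I: "finite I" and A: "finite A"
  shows "\<forall>p\<in>P. F p = (\<Sum>n | n \<in> I \<and> (\<forall>i\<in>A. w i n = 1). k n * G n p)"
  using A S FS G w q
proof (induction A rule: finite_induct)
  case (insert i A)
  have IH: "\<And>p. p \<in> P \<Longrightarrow> F p = (\<Sum>n | n \<in> I \<and> (\<forall>i\<in>A. w i n = 1). k n * G n p)"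
    using insert by simp
  have "F p = (\<Sum>n | n \<in> {n. n \<in> I \<and> (\<forall>i\<in>A. w i n = 1)} \<and> w i n = 1. k n * G n p)" if p: "p \<in> P" for p
    by (rule eigen_projection[where S = "S i" and q = "q i" and P = P]) (use insert.prems IH I p in auto)
  moreover have "{n. n \<in> {n. n \<in> I \<and> (\<forall>i\<in>A. w i n = 1)} \<and> w i n = 1} = {n. n \<in> I \<and> (\<forall>i\<in>insert i A. w i n = 1)}"
    by auto
  ultimately show ?case by simp
qed (use F in simp)

lemma exp_2pi_Ints: "x \<in> \<int> \<Longrightarrow> exp (2 * of_real pi * \<i> * x) = 1"
  using exp_two_pi_i_int by (auto elim!: Ints_cases)

lemma exp_2pi_eq_1D: "exp (2 * of_real pi * \<i> * x) = 1 \<Longrightarrow> x \<in> \<int>"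
proof -
  assume "exp (2 * of_real pi * \<i> * x) = 1"
  then obtain n :: int where "Re (2 * of_real pi * \<i> * x) = 0" "Im (2 * of_real pi * \<i> * x) = of_int (2 * n) * pi"
    unfolding exp_eq_1 by blast
  then have "x = of_int n" by (simp add: complex_eq_iff)
  then show "x \<in> \<int>" by simp
qed

context affine_datum
begin

text \<open>Translation of z by \<beta> acts by a character, whereas in \<open>E_Tr\<close>
  translation by \<sigma> \<beta> moves the characteristic: the two commuting-up-to-phase families
  of a Heisenberg group.\<close>

lemma E_Sh: "E m \<gamma> \<sigma> (z + \<beta>) = exp (2 * of_real pi * \<i> * (of_nat m * form C \<gamma> \<beta>)) * E m \<gamma> \<sigma> z"
  unfolding E_def exp_add[symmetric] by (simp add: form_simps algebra_simps)

lemma E_Tr: "E m (\<gamma> + \<beta>) \<sigma> z = E m \<gamma> \<sigma> (z + \<sigma> \<cdot> \<beta>) * exp (of_real pi * \<i> * of_nat m * (\<sigma> * form C \<beta> \<beta> + 2 * form C \<beta> z))"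
  unfolding E_def exp_add[symmetric] by (simp add: form_simps form_sym[of \<beta> \<gamma>] algebra_simps)

lemma infsum_E_Sh:
  assumes "\<And>x. x \<in> A \<Longrightarrow> of_nat m * form C x \<beta> \<in> \<int>"
  shows "(\<Sum>\<^sub>\<infinity>x\<in>A. E m (\<gamma> + x) \<sigma> (z + \<beta>)) = exp (2 * of_real pi * \<i> * (of_nat m * form C \<gamma> \<beta>)) * (\<Sum>\<^sub>\<infinity>x\<in>A. E m (\<gamma> + x) \<sigma> z)"
  unfolding infsum_cmult_right'[symmetric]
proof (intro infsum_cong)
  fix x assume "x \<in> A"
  have "exp (2 * of_real pi * \<i> * (of_nat m * form C (\<gamma> + x) \<beta>)) = exp (2 * of_real pi * \<i> * (of_nat m * form C \<gamma> \<beta>)) * exp (2 * of_real pi * \<i> * (of_nat m * form C x \<beta>))"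
    unfolding exp_add[symmetric] by (simp add: form_simps algebra_simps)
  also have "exp (2 * of_real pi * \<i> * (of_nat m * form C x \<beta>)) = 1" by (rule exp_2pi_Ints[OF assms[OF \<open>x \<in> A\<close>]])
  finally show "E m (\<gamma> + x) \<sigma> (z + \<beta>) = exp (2 * of_real pi * \<i> * (of_nat m * form C \<gamma> \<beta>)) * E m (\<gamma> + x) \<sigma> z"
    by (simp add: E_Sh)
qed

lemma infsum_E_Tr:
  "(\<Sum>\<^sub>\<infinity>x\<in>A. E m (\<gamma> + \<beta> + x) \<sigma> z) = (\<Sum>\<^sub>\<infinity>x\<in>A. E m (\<gamma> + x) \<sigma> (z + \<sigma> \<cdot> \<beta>)) * exp (of_real pi * \<i> * of_nat m * (\<sigma> * form C \<beta> \<beta> + 2 * form C \<beta> z))"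
  unfolding infsum_cmult_left'[symmetric]
  by (intro infsum_cong) (metis E_Tr add.assoc add.commute)

lemma TH_Sh_int:
  assumes "\<And>x. x \<in> rlat \<Longrightarrow> of_nat m * form C x \<beta> \<in> \<int>" "of_nat m * form C \<gamma> \<beta> \<in> \<int>"
  shows "TH m \<gamma> \<sigma> (z + \<beta>) = TH m \<gamma> \<sigma> z"
  using infsum_E_Sh[of rlat m \<beta> \<gamma> \<sigma> z, OF assms(1)] exp_2pi_Ints[OF assms(2)] by (simp add: TH_def)

lemma TH_Tr:
  assumes "\<beta> \<in> rlat"
  shows "TH m \<gamma> \<sigma> (z + \<sigma> \<cdot> \<beta>) = TH m \<gamma> \<sigma> z * exp (- (of_real pi * \<i> * of_nat m * (\<sigma> * form C \<beta> \<beta> + 2 * form C \<beta> z)))"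
proof -
  have "TH m \<gamma> \<sigma> z = TH m \<gamma> \<sigma> (z + \<sigma> \<cdot> \<beta>) * exp (of_real pi * \<i> * of_nat m * (\<sigma> * form C \<beta> \<beta> + 2 * form C \<beta> z))"
    using TH_shift[OF assms, of m \<gamma> \<sigma> z] infsum_E_Tr[of m \<gamma> \<beta> \<sigma> z rlat] by (simp add: TH_def)
  then show ?thesis by (simp add: mult.assoc exp_minus)
qed

text \<open>The exponential is what the shift of \<open>u\<close> in the action of \<open>X\<close> contributes at level \<open>m\<close>; the factor \<open>j(\<sigma>)\<^sup>-\<^sup>l\<close>
  is left out.\<close>

definition slash :: "nat \<Rightarrow> int \<Rightarrow> int \<Rightarrow> int \<Rightarrow> int \<Rightarrow> (complex \<Rightarrow> hvec \<Rightarrow> complex) \<Rightarrow> complex \<Rightarrow> hvec \<Rightarrow> complex" where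
  "slash m a' b' c' d' F \<sigma> z = F ((of_int a' * \<sigma> + of_int b') / (of_int c' * \<sigma> + of_int d')) ((1 / (of_int c' * \<sigma> + of_int d')) \<cdot> z)
     * exp (- (of_real pi * \<i> * of_nat m * of_int c' * form C z z / (of_int c' * \<sigma> + of_int d')))"

text \<open>In the transformed variable the shift by \<beta> becomes the shift by a \<beta> - c
  \<sigma>' \<beta>. The second part is a lattice translation only if c \<beta> lies in M, and the
  remaining phase is trivial if c (\<beta>, \<beta>)/2 is an integer.\<close>

lemma slash_Sh:
  assumes det: "a' * d' - b' * c' = (1::int)" and \<sigma>: "Im \<sigma> > 0"
    and int: "\<And>x. x \<in> rlat \<Longrightarrow> form C x \<beta> \<in> \<int>" and int\<gamma>: "of_nat m * form C \<gamma> \<beta> \<in> \<int>"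
    and c\<beta>: "of_int c' \<cdot> \<beta> \<in> rlat" and c\<beta>\<beta>: "of_int c' * form C \<beta> \<beta> / 2 \<in> \<int>"
  shows "slash m a' b' c' d' (TH m \<gamma>) \<sigma> (z + \<beta>) = slash m a' b' c' d' (TH m \<gamma>) \<sigma> z"
proof -
  define J where "J = of_int c' * \<sigma> + of_int d'"
  define \<sigma>' where "\<sigma>' = (of_int a' * \<sigma> + of_int b') / J"
  have J: "J \<noteq> 0" using moebius_Im(1)[OF det \<sigma>] by (simp add: J_def)
  define u where "u = 1 / J"
  have "of_int a' * J - of_int c' * (of_int a' * \<sigma> + of_int b') = (of_int (a' * d' - b' * c') :: complex)"
    by (simp add: J_def algebra_simps)
  \<comment> \<open>This is \<beta>/J = a \<beta> - c \<sigma>' \<beta> in disguise, with u =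
    1/J.\<close>
  then have cs: "of_int c' * \<sigma>' = of_int a' - u" using J unfolding det by (simp add: \<sigma>'_def u_def field_simps)
  define \<kappa> where "\<kappa> = (- of_int c') \<cdot> \<beta>"
  have \<kappa>: "\<kappa> \<in> rlat" using rlat_int_smul[OF c\<beta>, of "- 1"] by (simp add: \<kappa>_def)
  define w where "w = u \<cdot> z + of_int a' \<cdot> \<beta>"
  have "u \<cdot> \<beta> = (of_int a' - of_int c' * \<sigma>') \<cdot> \<beta>" using cs by simp
  also have "\<dots> = of_int a' \<cdot> \<beta> + \<sigma>' \<cdot> \<kappa>" by (simp add: \<kappa>_def cfun.scale_left_diff_distrib mult.commute)
  finally have uz: "u \<cdot> (z + \<beta>) = w + \<sigma>' \<cdot> \<kappa>" by (simp add: w_def cfun.scale_right_distrib)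
  have "TH m \<gamma> \<sigma>' w = TH m \<gamma> \<sigma>' (u \<cdot> z)" unfolding w_def
  proof (rule TH_Sh_int)
    show "of_nat m * form C x (of_int a' \<cdot> \<beta>) \<in> \<int>" if "x \<in> rlat" for x
      using int[OF that] by (auto simp: form_simps intro!: Ints_mult)
    have "of_int a' * (of_nat m * form C \<gamma> \<beta>) \<in> \<int>" by (rule Ints_mult[OF Ints_of_int int\<gamma>])
    moreover have "of_nat m * form C \<gamma> (of_int a' \<cdot> \<beta>) = of_int a' * (of_nat m * form C \<gamma> \<beta>)" by (simp add: form_simps)
    ultimately show "of_nat m * form C \<gamma> (of_int a' \<cdot> \<beta>) \<in> \<int>" by (simp only:)
  qed
  then have 1: "TH m \<gamma> \<sigma>' (u \<cdot> (z + \<beta>)) = TH m \<gamma> \<sigma>' (u \<cdot> z) * exp (- (of_real pi * \<i> * of_nat m * (\<sigma>' * form C \<kappa> \<kappa> + 2 * form C \<kappa> w)))"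
    unfolding uz TH_Tr[OF \<kappa>] by simp
  have "of_int a' * of_nat m * (of_int c' * form C \<beta> \<beta> / 2) \<in> \<int>" using c\<beta>\<beta> by (intro Ints_mult) auto
  then have e1: "exp (2 * of_real pi * \<i> * (of_int a' * of_nat m * (of_int c' * form C \<beta> \<beta> / 2))) = 1" by (rule exp_2pi_Ints)
  have kk: "\<sigma>' * form C \<kappa> \<kappa> = (of_int a' - u) * of_int c' * form C \<beta> \<beta>"
    unfolding \<kappa>_def form_simps cs[symmetric] by (simp add: mult_ac)
  have kw: "form C \<kappa> w = - of_int c' * (u * form C \<beta> z + of_int a' * form C \<beta> \<beta>)"
    unfolding \<kappa>_def w_def form_simps by (simp add: algebra_simps)
  have zz: "form C (z + \<beta>) (z + \<beta>) = form C z z + 2 * form C \<beta> z + form C \<beta> \<beta>"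
    unfolding form_simps using form_sym[of z \<beta>] by simp
  have "- (of_real pi * \<i> * of_nat m * (\<sigma>' * form C \<kappa> \<kappa> + 2 * form C \<kappa> w)) + - (of_real pi * \<i> * of_nat m * of_int c' * form C (z + \<beta>) (z + \<beta>) * u)
    = - (of_real pi * \<i> * of_nat m * of_int c' * form C z z * u) + 2 * of_real pi * \<i> * (of_int a' * of_nat m * (of_int c' * form C \<beta> \<beta> / 2))"
    unfolding kk kw zz by (simp add: algebra_simps)
  then have "exp (- (of_real pi * \<i> * of_nat m * (\<sigma>' * form C \<kappa> \<kappa> + 2 * form C \<kappa> w))) * exp (- (of_real pi * \<i> * of_nat m * of_int c' * form C (z + \<beta>) (z + \<beta>) * u))
    = exp (- (of_real pi * \<i> * of_nat m * of_int c' * form C z z * u))"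
    unfolding exp_add[symmetric] by (simp only: exp_add e1 mult_1_right)
  then have "TH m \<gamma> \<sigma>' (u \<cdot> (z + \<beta>)) * exp (- (of_real pi * \<i> * of_nat m * of_int c' * form C (z + \<beta>) (z + \<beta>) * u))
    = TH m \<gamma> \<sigma>' (u \<cdot> z) * exp (- (of_real pi * \<i> * of_nat m * of_int c' * form C z z * u))"
    unfolding 1 mult.assoc by simp
  then show ?thesis by (simp add: slash_def u_def \<sigma>'_def J_def)
qed

text \<open>The companion of \<open>slash_Sh\<close>: \<sigma> \<beta>/J = d \<sigma>' \<beta> - b
  \<beta>, so a translation by \<sigma> \<beta> with \<beta> in M is again a combination of lattice
  translations.\<close>

lemma slash_Tr:
  assumes det: "a' * d' - b' * c' = (1::int)" and \<sigma>: "Im \<sigma> > 0"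
    and \<beta>: "\<beta> \<in> rlat" and int\<gamma>: "of_nat m * form C \<gamma> \<beta> \<in> \<int>"
  shows "slash m a' b' c' d' (TH m \<gamma>) \<sigma> (z + \<sigma> \<cdot> \<beta>) * exp (of_real pi * \<i> * of_nat m * (\<sigma> * form C \<beta> \<beta> + 2 * form C \<beta> z))
    = slash m a' b' c' d' (TH m \<gamma>) \<sigma> z"
proof -
  define J where "J = of_int c' * \<sigma> + of_int d'"
  define \<sigma>' where "\<sigma>' = (of_int a' * \<sigma> + of_int b') / J"
  have J: "J \<noteq> 0" using moebius_Im(1)[OF det \<sigma>] by (simp add: J_def)
  define u where "u = 1 / J"
  have "of_int d' * (of_int a' * \<sigma> + of_int b') - of_int b' * J = of_int (a' * d' - b' * c') * \<sigma>"
    by (simp add: J_def algebra_simps)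
  then have su: "\<sigma> * u = of_int d' * \<sigma>' - of_int b'" using J unfolding det by (simp add: \<sigma>'_def u_def field_simps)
  have cJ: "of_int c' * \<sigma> * u = 1 - of_int d' * u"
    using J by (simp add: u_def J_def field_simps)
  define \<kappa> where "\<kappa> = of_int d' \<cdot> \<beta>"
  have \<kappa>: "\<kappa> \<in> rlat" using rlat_int_smul[OF \<beta>] by (simp add: \<kappa>_def)
  define w where "w = u \<cdot> z + (- of_int b') \<cdot> \<beta>"
  have "(\<sigma> * u) \<cdot> \<beta> = (- of_int b') \<cdot> \<beta> + \<sigma>' \<cdot> \<kappa>" unfolding su by (simp add: \<kappa>_def cfun.scale_left_diff_distrib mult.commute)
  then have uz: "u \<cdot> (z + \<sigma> \<cdot> \<beta>) = w + \<sigma>' \<cdot> \<kappa>" by (simp add: w_def cfun.scale_right_distrib mult.commute)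
  have "TH m \<gamma> \<sigma>' w = TH m \<gamma> \<sigma>' (u \<cdot> z)" unfolding w_def
  proof (rule TH_Sh_int)
    show "of_nat m * form C x ((- of_int b') \<cdot> \<beta>) \<in> \<int>" if "x \<in> rlat" for x
      using rlat_form_int[OF that \<beta>] by (auto simp: form_simps intro!: Ints_mult)
    have "- of_int b' * (of_nat m * form C \<gamma> \<beta>) \<in> \<int>" by (rule Ints_mult[OF Ints_minus[OF Ints_of_int] int\<gamma>])
    moreover have "of_nat m * form C \<gamma> ((- of_int b') \<cdot> \<beta>) = - of_int b' * (of_nat m * form C \<gamma> \<beta>)"
      unfolding form_simps by (rule mult.left_commute)
    ultimately show "of_nat m * form C \<gamma> ((- of_int b') \<cdot> \<beta>) \<in> \<int>" by (simp only:)
  qed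
  then have 1: "TH m \<gamma> \<sigma>' (u \<cdot> (z + \<sigma> \<cdot> \<beta>)) = TH m \<gamma> \<sigma>' (u \<cdot> z) * exp (- (of_real pi * \<i> * of_nat m * (\<sigma>' * form C \<kappa> \<kappa> + 2 * form C \<kappa> w)))"
    unfolding uz TH_Tr[OF \<kappa>] by simp
  \<comment> \<open>The leftover phase pi i m b d (\<beta>, \<beta>) is trivial because M is
    even.\<close>
  obtain B where B: "form C \<beta> \<beta> = of_int (2 * B)" using rlat_form_even[OF \<beta>] .
  have e1: "exp (2 * of_real pi * \<i> * of_int (int m * b' * d' * B)) = 1" by (rule exp_two_pi_i_int)
  have kk: "\<sigma>' * form C \<kappa> \<kappa> = (\<sigma> * u + of_int b') * of_int d' * form C \<beta> \<beta>"
    unfolding \<kappa>_def form_simps su by (simp add: algebra_simps)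
  have kw: "form C \<kappa> w = of_int d' * (u * form C \<beta> z - of_int b' * form C \<beta> \<beta>)"
    unfolding \<kappa>_def w_def form_simps by (simp add: algebra_simps)
  have zz: "form C (z + \<sigma> \<cdot> \<beta>) (z + \<sigma> \<cdot> \<beta>) = form C z z + 2 * \<sigma> * form C \<beta> z + \<sigma> * \<sigma> * form C \<beta> \<beta>"
    unfolding form_simps using form_sym[of z \<beta>] by (simp add: algebra_simps)
  have "of_int c' * form C (z + \<sigma> \<cdot> \<beta>) (z + \<sigma> \<cdot> \<beta>) * u = of_int c' * form C z z * u + (of_int c' * \<sigma> * u) * (2 * form C \<beta> z + \<sigma> * form C \<beta> \<beta>)"
    unfolding zz by (simp add: algebra_simps)
  then have czz: "of_int c' * form C (z + \<sigma> \<cdot> \<beta>) (z + \<sigma> \<cdot> \<beta>) * u = of_int c' * form C z z * u + (1 - of_int d' * u) * (2 * form C \<beta> z + \<sigma> * form C \<beta> \<beta>)"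
    unfolding cJ .
  have "- (of_real pi * \<i> * of_nat m * (\<sigma>' * form C \<kappa> \<kappa> + 2 * form C \<kappa> w)) + - (of_real pi * \<i> * of_nat m * (of_int c' * form C (z + \<sigma> \<cdot> \<beta>) (z + \<sigma> \<cdot> \<beta>) * u))
      + of_real pi * \<i> * of_nat m * (\<sigma> * form C \<beta> \<beta> + 2 * form C \<beta> z)
    = - (of_real pi * \<i> * of_nat m * (of_int c' * form C z z * u)) + of_real pi * \<i> * of_nat m * of_int b' * of_int d' * form C \<beta> \<beta>"
    unfolding kk kw czz by (simp add: algebra_simps)
  also have "of_real pi * \<i> * of_nat m * of_int b' * of_int d' * form C \<beta> \<beta> = 2 * of_real pi * \<i> * of_int (int m * b' * d' * B)"
    unfolding B by (simp add: mult_ac)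
  finally have "exp (- (of_real pi * \<i> * of_nat m * (\<sigma>' * form C \<kappa> \<kappa> + 2 * form C \<kappa> w))) * exp (- (of_real pi * \<i> * of_nat m * (of_int c' * form C (z + \<sigma> \<cdot> \<beta>) (z + \<sigma> \<cdot> \<beta>) * u)))
      * exp (of_real pi * \<i> * of_nat m * (\<sigma> * form C \<beta> \<beta> + 2 * form C \<beta> z)) = exp (- (of_real pi * \<i> * of_nat m * (of_int c' * form C z z * u)))"
    unfolding exp_add[symmetric] by (simp only: exp_add e1 mult_1_right)
  then have "TH m \<gamma> \<sigma>' (u \<cdot> (z + \<sigma> \<cdot> \<beta>)) * exp (- (of_real pi * \<i> * of_nat m * (of_int c' * form C (z + \<sigma> \<cdot> \<beta>) (z + \<sigma> \<cdot> \<beta>) * u)))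
      * exp (of_real pi * \<i> * of_nat m * (\<sigma> * form C \<beta> \<beta> + 2 * form C \<beta> z))
    = TH m \<gamma> \<sigma>' (u \<cdot> z) * exp (- (of_real pi * \<i> * of_nat m * (of_int c' * form C z z * u)))"
    unfolding 1 mult.assoc by simp
  then show ?thesis by (simp add: slash_def u_def \<sigma>'_def J_def mult_ac)
qed

text \<open>For \<open>h = 1\<close> the condition \<open>fint h m \<gamma>\<close> says that \<open>m \<gamma>\<close> is integral on \<open>M\<close>, for \<open>h = e\<close> that it is integral on
  the coroots.\<close>

definition valid :: "(nat \<Rightarrow> nat) \<Rightarrow> bool" where
  "valid h \<longleftrightarrow> (\<forall>i\<in>{1..l}. h i > 0 \<and> h i dvd e i)"

definition fint :: "(nat \<Rightarrow> nat) \<Rightarrow> nat \<Rightarrow> hvec \<Rightarrow> bool" where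
  "fint h m \<gamma> \<longleftrightarrow> \<gamma> \<in> hring C \<and> (\<forall>i\<in>{1..l}. of_nat m * form C \<gamma> (alpha i) / of_nat (h i) \<in> \<int>)"

lemma fint_rlat:
  assumes "valid h" "fint h m \<gamma>" "\<beta> \<in> rlat"
  shows "of_nat m * form C \<gamma> \<beta> \<in> \<int>"
proof -
  have "form C \<gamma> \<beta> = form C \<gamma> (\<Sum>i=1..l. \<beta> i \<cdot> alpha i)"
    by (rule arg_cong[OF hring_expand[OF rlat_hring[OF assms(3)]]])
  also have "of_nat m * \<dots> = (\<Sum>i=1..l. \<beta> i * of_nat (h i) * (of_nat m * form C \<gamma> (alpha i) / of_nat (h i)))"
    unfolding form_simps sum_distrib_left
  proof (intro sum.cong refl)
    fix i assume "i \<in> {1..l}"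
    then have "h i \<noteq> 0" using assms(1) by (auto simp: valid_def)
    then show "of_nat m * (\<beta> i * form C \<gamma> (alpha i)) = \<beta> i * of_nat (h i) * (of_nat m * form C \<gamma> (alpha i) / of_nat (h i))"
      by simp
  qed
  also have "\<dots> \<in> \<int>" using assms(2,3) by (intro Ints_sum Ints_mult) (auto simp: fint_def rlat_def)
  finally show ?thesis .
qed

text \<open>Since h_i divides e_i, the vector \<alpha>_i/h_i belongs to the dual lattice of
  M.\<close>

lemma valid_rlat:
  assumes "valid h" "x \<in> rlat" "i \<in> {1..l}"
  shows "form C x ((1 / of_nat (h i)) \<cdot> alpha i) \<in> \<int>"
proof -
  have "h i dvd e i" using assms(1,3) by (auto simp: valid_def)
  then obtain q where q: "e i = h i * q" by (rule dvdE)
  have "form C x ((1 / of_nat (h i)) \<cdot> alpha i) = of_nat q * (form C x (alpha i) / of_nat (e i))"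
    using assms(1,3) e_pos[of i] unfolding q by (simp add: form_simps valid_def q)
  also have "\<dots> \<in> \<int>" using form_alpha_int[OF assms(2), of i] assms(3) by (intro Ints_mult) auto
  finally show ?thesis .
qed

end

text \<open>By \<open>slash_Sh\<close> and \<open>slash_Tr\<close> the transform is invariant under the translations by \<open>\<alpha>\<^sub>i/h\<^sub>i\<close> and by \<open>\<sigma> \<beta>\<close>, \<open>\<beta> \<in> M\<close>.
  Averaging over the former removes the terms whose characteristic is not \<open>h\<close>-integral, averaging over the latter
  turns theta functions of the sublattice into those of \<open>M\<close>.\<close>

lemma (in affine_orth) TH_slash_aux:
  assumes det: "a' * d' - b' * c' = (1::int)" and j: "lift_of c' d' j" and m: "m > 0"
    and h: "valid h" and \<gamma>: "fint h m \<gamma>"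
    and hc: "\<And>i. i \<in> {1..l} \<Longrightarrow> int (h i) dvd c'" "\<And>i. i \<in> {1..l} \<Longrightarrow> (int (h i))\<^sup>2 dvd c' * int (e i)"
  shows "\<exists>(I :: (nat \<Rightarrow> nat) set) K G. finite I \<and> (\<forall>n\<in>I. fint h m (G n)) \<and> (\<forall>\<sigma> z. Im \<sigma> > 0 \<longrightarrow> z \<in> hring C \<longrightarrow>
      slash m a' b' c' d' (TH m \<gamma>) \<sigma> z = j \<sigma> ^ l * (\<Sum>n\<in>I. K n * TH m (G n) \<sigma> z))"
proof -
  define G where "G n = (\<Sum>i=1..l. (of_nat (n i) / of_nat (m * N i)) \<cdot> f i)" for n :: "nat \<Rightarrow> nat"
  define I where "I = PiE {1..l} (\<lambda>i. {..<m * N i})"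
  have I: "finite I" unfolding I_def by (intro finite_PiE) auto
  have Gh: "G n \<in> hring C" for n unfolding G_def by (intro hring_sum hring_smul f_hring)
  have \<gamma>h: "\<gamma> \<in> hring C" using \<gamma> by (simp add: fint_def)
  obtain K where K: "\<And>\<sigma> z. Im \<sigma> > 0 \<Longrightarrow> z \<in> hring C \<Longrightarrow> slash m a' b' c' d' (TH m \<gamma>) \<sigma> z = j \<sigma> ^ l * (\<Sum>n\<in>I. K n * THL m (G n) \<sigma> z)"
    using TH_modular_aux[OF det j m \<gamma>h fint_rlat[OF h \<gamma>]] unfolding slash_def G_def I_def by blast
  have j0: "j \<sigma> \<noteq> 0" if "Im \<sigma> > 0" for \<sigma>
    using j that moebius_Im(1)[OF det that] unfolding lift_of_def by (metis zero_power2)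
  define F where "F p = slash m a' b' c' d' (TH m \<gamma>) (fst p) (snd p) / j (fst p) ^ l" for p
  define P where "P = {p :: complex \<times> hvec. Im (fst p) > 0 \<and> snd p \<in> hring C}"
  have FK: "F p = (\<Sum>n\<in>I. K n * THL m (G n) (fst p) (snd p))" if "p \<in> P" for p
    using that K[of "fst p" "snd p"] j0[of "fst p"] by (simp add: F_def P_def)
  define \<beta> where "\<beta> i = (1 / of_nat (h i)) \<cdot> alpha i" for i
  have \<beta>h: "\<beta> i \<in> hring C" if "i \<in> {1..l}" for i using that by (simp add: \<beta>_def hring_smul hring_alpha)
  define w where "w i n = exp (2 * of_real pi * \<i> * (of_nat m * form C (G n) (\<beta> i)))" for i n
  have proj: "\<forall>p\<in>P. F p = (\<Sum>n | n \<in> I \<and> (\<forall>i\<in>{1..l}. w i n = 1). K n * THL m (G n) (fst p) (snd p))"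
  \<comment> \<open>The eigenvalue has order dividing D h_i: the vector D h_i \<beta>_i = D
    \<alpha>_i is an integral combination of the f_k, and m (G n, f_k) = n_k is an integer.\<close>
  proof (rule eigen_projections[where S = "\<lambda>i p. (fst p, snd p + \<beta> i)" and q = "\<lambda>i. D * h i" and P = P])
    fix i p assume i: "i \<in> {1..l}" and p: "p \<in> P"
    show "(fst p, snd p + \<beta> i) \<in> P" using p \<beta>h[OF i] by (auto simp: P_def intro: hring_add)
    have hi: "h i > 0" using h i by (simp add: valid_def)
    obtain q where q: "c' = int (h i) * q" using hc(1)[OF i] by (rule dvdE)
    obtain q2 where q2: "c' * int (e i) = (int (h i))\<^sup>2 * q2" using hc(2)[OF i] by (rule dvdE)
    have "slash m a' b' c' d' (TH m \<gamma>) (fst p) (snd p + \<beta> i) = slash m a' b' c' d' (TH m \<gamma>) (fst p) (snd p)"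
    proof (rule slash_Sh[OF det])
      show "0 < Im (fst p)" using p by (simp add: P_def)
      show "form C x (\<beta> i) \<in> \<int>" if "x \<in> rlat" for x unfolding \<beta>_def by (rule valid_rlat[OF h that i])
      show "of_nat m * form C \<gamma> (\<beta> i) \<in> \<int>" using \<gamma> i by (simp add: fint_def \<beta>_def form_simps)
      have "of_int c' \<cdot> \<beta> i = of_int q \<cdot> alpha i" using hi by (simp add: \<beta>_def q)
      then show "of_int c' \<cdot> \<beta> i \<in> rlat" using i by (simp add: rlat_int_smul rlat_alpha)
      have "of_int c' * form C (\<beta> i) (\<beta> i) / 2 = of_int (c' * int (e i)) / of_int ((int (h i))\<^sup>2)"
        using i by (simp add: \<beta>_def form_simps form_alpha_alpha b_diag power2_eq_square)
      also have "\<dots> = of_int q2" unfolding q2 using hi by simp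
      finally show "of_int c' * form C (\<beta> i) (\<beta> i) / 2 \<in> \<int>" by simp
    qed
    then show "F (fst p, snd p + \<beta> i) = F p" by (simp add: F_def)
    fix n assume n: "n \<in> I"
    have "of_nat m * form C x (\<beta> i) \<in> \<int>" if "x \<in> L" for x
      using valid_rlat[OF h _ i, of x] that L_subset_rlat unfolding \<beta>_def by (intro Ints_mult) auto
    from infsum_E_Sh[OF this, of L]
    show "THL m (G n) (fst (fst p, snd p + \<beta> i)) (snd (fst p, snd p + \<beta> i)) = w i n * THL m (G n) (fst p) (snd p)"
      by (simp add: THL_def w_def)
  next
    fix i n assume i: "i \<in> {1..l}" and n: "n \<in> I"
    have hi: "h i > 0" using h i by (simp add: valid_def)
    have "of_nat (D * h i) * form C (G n) (\<beta> i) = form C (G n) (of_nat D \<cdot> alpha i)"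
      using hi by (simp add: \<beta>_def form_simps)
    also have "\<dots> = (\<Sum>k=1..l. of_int (c i k) * form C (G n) (f k))"
      unfolding D_alpha[OF i] form_simps ..
    also have "of_nat m * \<dots> = (\<Sum>k=1..l. of_int (c i k) * of_nat (n k))"
      unfolding sum_distrib_left
    proof (intro sum.cong refl)
      fix k assume k: "k \<in> {1..l}"
      have "form C (G n) (f k) = of_nat (n k) / of_nat (m * N k) * of_nat (N k)"
        unfolding G_def by (rule form_f_sum[OF k])
      then show "of_nat m * (of_int (c i k) * form C (G n) (f k)) = of_int (c i k) * of_nat (n k)"
        using N_pos[OF k] m by simp
    qed
    finally have "of_nat (D * h i) * (of_nat m * form C (G n) (\<beta> i)) = (\<Sum>k=1..l. of_int (c i k) * of_nat (n k))"
      by (simp only: mult.left_commute)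
    then have "of_nat (D * h i) * (of_nat m * form C (G n) (\<beta> i)) \<in> \<int>"
      by (simp only:) (intro Ints_sum Ints_mult Ints_of_int Ints_of_nat)
    from exp_2pi_Ints[OF this] show "w i n ^ (D * h i) = 1"
      unfolding w_def exp_of_nat_mult[symmetric] by (simp add: mult_ac)
  next
    fix i assume "i \<in> {1..l}" then show "0 < D * h i" using h D_pos by (simp add: valid_def)
  qed (use FK I in auto)
  define I' where "I' = {n. n \<in> I \<and> (\<forall>i\<in>{1..l}. w i n = 1)}"
  have fin: "finite I'" using I by (simp add: I'_def)
  have G': "fint h m (G n)" if "n \<in> I'" for n
    using that exp_2pi_eq_1D Gh unfolding I'_def w_def fint_def \<beta>_def by (force simp: form_simps)
  have avg: "F (\<sigma>, z) = (\<Sum>n\<in>I'. (K n / of_nat (card coset_reps)) * TH m (G n) \<sigma> z)" if s: "Im \<sigma> > 0" and z: "z \<in> hring C" for \<sigma> z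
  proof -
    define X where "X \<beta> = exp (of_real pi * \<i> * of_nat m * (\<sigma> * form C \<beta> \<beta> + 2 * form C \<beta> z))" for \<beta>
    have "F (\<sigma>, z + \<sigma> \<cdot> \<beta>) * X \<beta> = F (\<sigma>, z)" if "\<beta> \<in> rlat" for \<beta>
      using slash_Tr[OF det s that fint_rlat[OF h \<gamma> that], of z] by (simp add: F_def X_def)
    then have "of_nat (card coset_reps) * F (\<sigma>, z) = (\<Sum>\<beta>\<in>coset_reps. F (\<sigma>, z + \<sigma> \<cdot> \<beta>) * X \<beta>)"
      using coset_reps_rlat by simp
    also have "\<dots> = (\<Sum>\<beta>\<in>coset_reps. \<Sum>n\<in>I'. K n * (THL m (G n) \<sigma> (z + \<sigma> \<cdot> \<beta>) * X \<beta>))"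
    proof (intro sum.cong refl)
      fix \<beta> assume "\<beta> \<in> coset_reps"
      then have "(\<sigma>, z + \<sigma> \<cdot> \<beta>) \<in> P" using s z coset_reps_rlat rlat_hring by (auto simp: P_def intro!: hring_add hring_smul)
      from bspec[OF proj this] show "F (\<sigma>, z + \<sigma> \<cdot> \<beta>) * X \<beta> = (\<Sum>n\<in>I'. K n * (THL m (G n) \<sigma> (z + \<sigma> \<cdot> \<beta>) * X \<beta>))"
        by (simp add: I'_def sum_distrib_right mult.assoc)
    qed
    also have "\<dots> = (\<Sum>\<beta>\<in>coset_reps. \<Sum>n\<in>I'. K n * THL m (G n + \<beta>) \<sigma> z)"
      unfolding THL_def infsum_E_Tr X_def ..
    also have "\<dots> = (\<Sum>n\<in>I'. K n * TH m (G n) \<sigma> z)"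
      by (subst sum.swap) (simp add: TH_cosets[OF Gh z s m] sum_distrib_left)
    finally have "F (\<sigma>, z) = (\<Sum>n\<in>I'. K n * TH m (G n) \<sigma> z) / of_nat (card coset_reps)" using coset_reps_ne by (simp add: field_simps)
    then show ?thesis by (simp add: sum_divide_distrib)
  qed
  have "slash m a' b' c' d' (TH m \<gamma>) \<sigma> z = j \<sigma> ^ l * (\<Sum>n\<in>I'. (K n / of_nat (card coset_reps)) * TH m (G n) \<sigma> z)"
    if s: "Im \<sigma> > 0" and z: "z \<in> hring C" for \<sigma> z
    using avg[OF s z] j0[OF s] by (simp add: F_def field_simps)
  then show ?thesis using fin G'
    by (intro exI[of _ I'] exI[of _ "\<lambda>n. K n / of_nat (card coset_reps)"] exI[of _ G]) auto
qed

theorem (in affine_lattice) TH_slash: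
  assumes "a' * d' - b' * c' = (1::int)" "lift_of c' d' j" "m > 0"
    and "valid h" "fint h m \<gamma>"
    and "\<And>i. i \<in> {1..l} \<Longrightarrow> int (h i) dvd c'" "\<And>i. i \<in> {1..l} \<Longrightarrow> (int (h i))\<^sup>2 dvd c' * int (e i)"
  shows "\<exists>(I :: (nat \<Rightarrow> nat) set) K G. finite I \<and> (\<forall>n\<in>I. fint h m (G n)) \<and> (\<forall>\<sigma> z. Im \<sigma> > 0 \<longrightarrow> z \<in> hring C \<longrightarrow>
      slash m a' b' c' d' (TH m \<gamma>) \<sigma> z = j \<sigma> ^ l * (\<Sum>n\<in>I. K n * TH m (G n) \<sigma> z))"
proof -
  obtain f N D c where "affine_orth C r a e f N D c" using orthogonal_basis .
  then show ?thesis by (rule affine_orth.TH_slash_aux) (fact assms)+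
qed

section \<open>Roots and signs\<close>

lemma finite_of_summable_const:
  assumes "(\<lambda>_. c) summable_on S" "c > (0::real)"
  shows "finite S"
proof (rule ccontr)
  assume "infinite S"
  define B where "B = infsum (\<lambda>_. c) S"
  obtain n :: nat where n: "of_nat n * c > B" using assms(2) by (metis reals_Archimedean3)
  obtain F where F: "F \<subseteq> S" "finite F" "card F = n" using infinite_arbitrarily_large[OF \<open>infinite S\<close>] by metis
  have "sum (\<lambda>_. c) F \<le> B"
    unfolding B_def using assms F by (intro finite_sum_le_infsum) auto
  then show False using n F by simp
qed

context affine_lattice
begin

text \<open>In the theta series at \<sigma> = i, z = 0 all vectors of the same norm contribute the
  same positive amount, so convergence permits only finitely many of them.\<close>

lemma finite_rlat_norm: "finite {x \<in> rlat. form C x x = of_real q}"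
proof -
  let ?S = "{x \<in> rlat. form C x x = of_real q}"
  have "(\<lambda>\<beta>. norm (E 1 (0 + \<beta>) \<i> 0)) summable_on rlat"
    by (rule E_summable) (auto simp: hring_zero)
  then have "(\<lambda>\<beta>. norm (E 1 (0 + \<beta>) \<i> 0)) summable_on ?S"
    by (rule summable_on_subset_banach) auto
  moreover have "norm (E 1 (0 + \<beta>) \<i> 0) = exp (- pi * q)" if "\<beta> \<in> ?S" for \<beta>
    using that by (simp add: E_def)
  ultimately have "(\<lambda>_. exp (- pi * q)) summable_on ?S"
    by (subst (asm) summable_on_cong[of ?S _ "\<lambda>_. exp (- pi * q)"]) auto
  then show ?thesis by (rule finite_of_summable_const) simp
qed

section \<open>Weights and their projection to the span of the finite simple roots\<close>

lemma weight_exists: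
  obtains x where "x \<in> hstar C" "\<And>j. j \<le> l \<Longrightarrow> form C x (alpha j) = \<phi> j" "form C x (Lambda0 C) = 0"
proof -
  obtain y where y: "y \<in> hring C" "\<And>j. j \<in> {1..l} \<Longrightarrow> form C y (alpha j) = \<phi> j" using riesz by metis
  \<comment> \<open>The level forced by \<delta> = (sum of a_j \<alpha>_j). With this multiple of
    \<Lambda>_0 the condition at node 0 follows from those at the other nodes.\<close>
  define m where "m = (\<Sum>j\<le>l. of_nat (a j) * \<phi> j)"
  define x where "x = y + m \<cdot> Lambda0 C"
  have xl: "x (l + 1) = m" using y(1) by (simp add: x_def fun_ap smul_def Lambda0_def hring_outside)
  have L0: "form C (Lambda0 C) v = v 0" for v using Lambda0_form form_sym by metis
  have 1: "form C x (alpha j) = \<phi> j" if "j \<in> {1..l}" for j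
    using that y(2)[OF that] by (simp add: x_def form_simps L0) (simp add: alpha_def)
  have "form C x (delta C) = (\<Sum>j\<le>l. of_nat (a j) * form C x (alpha j))"
    by (simp add: delta_def form_simps label_eq)
  also have "\<dots> = form C x (alpha 0) + (\<Sum>j=1..l. of_nat (a j) * form C x (alpha j))"
    by (simp add: atMost_atLeast0 sum.atLeast_Suc_atMost a0 One_nat_def)
  also have "(\<Sum>j=1..l. of_nat (a j) * form C x (alpha j)) = (\<Sum>j=1..l. of_nat (a j) * \<phi> j)"
    using 1 by (intro sum.cong) auto
  finally have "m = form C x (alpha 0) + (\<Sum>j=1..l. of_nat (a j) * \<phi> j)" by (simp add: form_delta_right xl)
  moreover have "m = \<phi> 0 + (\<Sum>j=1..l. of_nat (a j) * \<phi> j)"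
    by (simp add: m_def atMost_atLeast0 sum.atLeast_Suc_atMost a0 One_nat_def)
  ultimately have 0: "form C x (alpha 0) = \<phi> 0" by simp
  show ?thesis
  proof (rule that)
    show "x \<in> hstar C" using y(1) by (auto simp: x_def hstar_def fun_ap smul_def Lambda0_def hring_outside)
    show "form C x (alpha j) = \<phi> j" if "j \<le> l" for j using 0 1 that by (cases "j = 0") (auto simp: Suc_le_eq One_nat_def)
    show "form C x (Lambda0 C) = 0" unfolding Lambda0_form using y(1) by (simp add: x_def fun_ap smul_def Lambda0_def hring_outside)
  qed
qed

lemma level_sum: "x (l + 1) = (\<Sum>j\<le>l. of_nat (a j) * form C x (alpha j))"
proof -
  have "form C x (delta C) = (\<Sum>j\<le>l. of_nat (a j) * form C x (alpha j))"
    by (simp add: delta_def form_simps label_eq)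
  then show ?thesis by (simp add: form_delta_right)
qed

text \<open>The orthogonal projection along \<Lambda>_0 and \<delta>. As a_0 = 1, the coefficient of
  \<delta> is the 0-th coordinate.\<close>

definition bar :: "hvec \<Rightarrow> hvec" where
  "bar x = (\<lambda>i. if i \<in> {1..l} then x i - x 0 * of_nat (a i) else 0)"

lemma bar_hring: "bar x \<in> hring C" by (auto simp: bar_def hring_def)

lemma bar_decomp: "x \<in> hstar C \<Longrightarrow> x = bar x + x (l + 1) \<cdot> Lambda0 C + x 0 \<cdot> delta C"
proof
  fix i assume x: "x \<in> hstar C"
  have "i = 0 \<or> i \<in> {1..l} \<or> i = l + 1 \<or> i > l + 1" by auto
  then show "x i = (bar x + x (l + 1) \<cdot> Lambda0 C + x 0 \<cdot> delta C) i"
    using x a_outside a0 by (auto simp: bar_def fun_ap smul_def Lambda0_def delta_apply hstar_def)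
qed

lemma form_bar_hring: "y \<in> hring C \<Longrightarrow> x \<in> hstar C \<Longrightarrow> form C (bar x) y = form C x y"
proof -
  assume y: "y \<in> hring C" and x: "x \<in> hstar C"
  have L0: "form C (Lambda0 C) v = v 0" for v using Lambda0_form form_sym by metis
  have "form C x y = form C (bar x + x (l + 1) \<cdot> Lambda0 C + x 0 \<cdot> delta C) y"
    using bar_decomp[OF x] by (rule arg_cong)
  also have "\<dots> = form C (bar x) y" using y by (simp add: form_simps L0 form_delta_left hring_outside)
  finally show ?thesis by simp
qed

text \<open>The pairings with all simple roots determine a vector up to multiples of \<delta>, which
  \<open>bar\<close> ignores.\<close>

lemma hstar_eq_bar:
  assumes "x \<in> hstar C" "y \<in> hstar C" "\<And>j. j \<le> l \<Longrightarrow> form C x (alpha j) = form C y (alpha j)"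
  shows "x (l + 1) = y (l + 1)" "bar x = bar y"
proof -
  show "x (l + 1) = y (l + 1)" using assms(3) by (simp add: level_sum)
  show "bar x = bar y"
    by (rule hring_eqI) (use assms in \<open>auto simp: bar_hring form_bar_hring hring_alpha\<close>)
qed

lemma fund_weight:
  assumes "i \<le> l"
  shows "fund_weight C i \<in> hstar C" "\<And>j. j \<le> l \<Longrightarrow> form C (fund_weight C i) (alpha j) = (if j = i then of_nat (e i) else 0)"
    "form C (fund_weight C i) (Lambda0 C) = 0"
proof -
  let ?P = "\<lambda>x. x \<in> hstar C \<and> (\<forall>j\<le>l. form C x (coroot C j) = (if j = i then 1 else 0)) \<and> form C x (Lambda0 C) = 0"
  have Pe: "?P x \<longleftrightarrow> x \<in> hstar C \<and> (\<forall>j\<le>l. form C x (alpha j) = (if j = i then of_nat (e i) else 0)) \<and> form C x (Lambda0 C) = 0" for x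
    using e_pos by (auto simp: coroot_eq form_simps field_simps)
  obtain x where x: "x \<in> hstar C" "\<And>j. j \<le> l \<Longrightarrow> form C x (alpha j) = (if j = i then of_nat (e i) else 0)" "form C x (Lambda0 C) = 0"
    using weight_exists[of "\<lambda>j. if j = i then of_nat (e i) else 0"] by metis
  have "?P x" unfolding Pe using x by blast
  moreover have "y = x" if "?P y" for y
  proof -
    have y: "y \<in> hstar C" "\<And>j. j \<le> l \<Longrightarrow> form C y (alpha j) = form C x (alpha j)" "form C y (Lambda0 C) = 0"
      using that[unfolded Pe] x(2) by auto
    have "y 0 = x 0" using y(3) x(3) by (simp add: Lambda0_form)
    then show ?thesis using bar_decomp[OF x(1)] bar_decomp[OF y(1)] hstar_eq_bar[OF y(1) x(1) y(2)] by metis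
  qed
  ultimately have "?P (fund_weight C i)" unfolding fund_weight_def by (rule theI)
  then show "fund_weight C i \<in> hstar C" "\<And>j. j \<le> l \<Longrightarrow> form C (fund_weight C i) (alpha j) = (if j = i then of_nat (e i) else 0)"
    "form C (fund_weight C i) (Lambda0 C) = 0" unfolding Pe by blast+
qed

lemma hstar_add: "x \<in> hstar C \<Longrightarrow> y \<in> hstar C \<Longrightarrow> x + y \<in> hstar C"
  and hstar_diff: "x \<in> hstar C \<Longrightarrow> y \<in> hstar C \<Longrightarrow> x - y \<in> hstar C"
  and hstar_smul: "x \<in> hstar C \<Longrightarrow> k \<cdot> x \<in> hstar C"
  and hstar_zero: "0 \<in> hstar C"
  by (auto simp: hstar_def fun_ap smul_def)

lemma hstar_sum: "(\<And>i. i \<in> A \<Longrightarrow> g i \<in> hstar C) \<Longrightarrow> (\<Sum>i\<in>A. g i) \<in> hstar C"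
  by (induction A rule: infinite_finite_induct) (auto intro: hstar_add hstar_zero)

lemma rho_hstar: "rho C \<in> hstar C"
  unfolding rho_def by (intro hstar_sum fund_weight) auto

lemma rho_alpha: "j \<le> l \<Longrightarrow> form C (rho C) (alpha j) = of_nat (e j)"
  unfolding rho_def form_simps by (simp add: fund_weight)

lemma rho_level: "rho C (l + 1) = of_nat (dual_coxeter C)"
  unfolding level_sum by (simp add: rho_alpha dual_coxeter_def colabel_eq mult.commute)

lemma dual_coxeter_pos: "dual_coxeter C > 0"
  unfolding dual_coxeter_def using a_pos[of 0] e_pos[of 0] by (intro sum_pos2[of _ 0]) (auto simp: colabel_eq)

end

text \<open>The vectors of norm \<open>2/M\<close> in the lattice spanned by the \<open>\<alpha>\<^sub>i/h\<^sub>i\<close> are the short roots for \<open>h = 1\<close>, \<open>M = 1\<close>,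
  and the coroots of the long roots for \<open>h = e\<close>, \<open>M = r\<close>.\<close>

locale affine_roots = affine_lattice +
  fixes h :: "nat \<Rightarrow> nat" and M :: nat
  assumes M_pos: "M > 0"
    and h_pos: "\<And>i. i \<le> rk C \<Longrightarrow> h i > 0"
    and h_e: "\<And>i. i \<le> rk C \<Longrightarrow> h i dvd e i"
    and h_M: "\<And>i j. i \<le> rk C \<Longrightarrow> j \<le> rk C \<Longrightarrow> int (h i) * int (h j) dvd int M * b i j"
    and h_M_diag: "\<And>i. i \<le> rk C \<Longrightarrow> 2 * int (h i) * int (h i) dvd int M * b i i"
    and h_step: "\<And>i j. i \<le> rk C \<Longrightarrow> j \<le> rk C \<Longrightarrow> int (h j) * int (e i) dvd int (h i) * b j i"
begin

text \<open>The matrix of M times the form in the basis \<alpha>_i/h_i, node 0 included, so that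
  \<open>qnorm\<close> also measures affine roots.\<close>

definition gram :: "nat \<Rightarrow> nat \<Rightarrow> int" where "gram i j = int M * b i j div (int (h i) * int (h j))"

lemma gram: "i \<le> l \<Longrightarrow> j \<le> l \<Longrightarrow> int M * b i j = gram i j * (int (h i) * int (h j))"
  using h_M by (simp add: gram_def)

lemma gram_sym: "i \<le> l \<Longrightarrow> j \<le> l \<Longrightarrow> gram i j = gram j i"
  by (simp add: gram_def b_sym mult.commute)

lemma gram_nonpos: "i \<le> l \<Longrightarrow> j \<le> l \<Longrightarrow> i \<noteq> j \<Longrightarrow> gram i j \<le> 0"
proof -
  assume ij: "i \<le> l" "j \<le> l" "i \<noteq> j"
  have "int M * b i j \<le> 0" using b_nonpos[OF ij] by (simp add: mult_nonneg_nonpos)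
  then show ?thesis using h_pos[OF ij(1)] h_pos[OF ij(2)] unfolding gram[OF ij(1,2)] by (auto simp: mult_le_0_iff)
qed

lemma gram_even: "i \<le> l \<Longrightarrow> even (gram i i)"
proof -
  assume i: "i \<le> l"
  obtain k where "int M * b i i = 2 * int (h i) * int (h i) * k" using h_M_diag[OF i] by (rule dvdE)
  then have "gram i i * (int (h i) * int (h i)) = 2 * k * (int (h i) * int (h i))" using gram[OF i i] by (simp add: mult_ac)
  then show ?thesis using h_pos[OF i] by simp
qed

definition qnorm :: "(nat \<Rightarrow> int) \<Rightarrow> int" where "qnorm y = (\<Sum>i\<le>l. \<Sum>j\<le>l. gram i j * y i * y j)"

lemma qnorm_even: "even (qnorm y)"
  unfolding qnorm_def by (rule even_quadratic) (auto simp: gram_sym gram_even)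

lemma qnorm_Q: "of_int (qnorm y) = real M * Q (\<lambda>i. of_int (y i) / of_nat (h i))"
proof -
  have "real_of_int (gram i j * y i * y j) = real M * (of_int (b i j) * (of_int (y i) / of_nat (h i)) * (of_int (y j) / of_nat (h j)))"
    if "i \<le> l" "j \<le> l" for i j
  proof -
    have "real M * of_int (b i j) = of_int (gram i j) * (of_nat (h i) * of_nat (h j))"
      using arg_cong[OF gram[OF that], of real_of_int] by simp
    then show ?thesis using h_pos that by (simp add: field_simps)
  qed
  then show ?thesis unfolding qnorm_def Q_def sum_distrib_left of_int_sum by (intro sum.cong refl) auto
qed

lemma qnorm_nonneg: "qnorm y \<ge> 0"
  using Q_nonneg M_pos qnorm_Q[of y] by (metis mult_nonneg_nonneg of_int_0_le_iff of_nat_0_le_iff)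

text \<open>The radical of \<open>Q\<close> is spanned by the labels, all of which are positive, so
  a nonzero vector with a zero coordinate is not in it. Evenness improves positive to at least
  2.\<close>

lemma qnorm_pos:
  assumes "i \<le> l" "y i \<noteq> 0" "j \<le> l" "y j = 0"
  shows "qnorm y \<ge> 2"
proof -
  have "qnorm y \<noteq> 0"
  proof
    assume "qnorm y = 0"
    then have z: "Q (\<lambda>i. of_int (y i) / of_nat (h i)) = 0" using qnorm_Q[of y] M_pos by simp
    have "real_of_int (y 0) / of_nat (h 0) * of_nat (a j) = 0" using Q_eq_0_imp[OF z assms(3)] assms(4) by simp
    then have y0: "real_of_int (y 0) / of_nat (h 0) = 0" using a_pos[OF assms(3)] by simp
    have "real_of_int (y i) / of_nat (h i) = 0" unfolding Q_eq_0_imp[OF z assms(1)] y0 by simp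
    then show False using assms(2) h_pos[OF assms(1)] by simp
  qed
  then show ?thesis using qnorm_nonneg[of y] qnorm_even[of y] by presburger
qed

text \<open>Write y = p - n with disjoint supports. Off-diagonal entries are nonpositive, so qnorm p
  + qnorm n \<le> qnorm y = 2, whereas each summand would be at least 2 if both signs
  occurred.\<close>

lemma sign_definite:
  assumes "qnorm y = 2"
  shows "(\<forall>i\<le>l. y i \<ge> 0) \<or> (\<forall>i\<le>l. y i \<le> 0)"
proof (rule ccontr)
  assume "\<not> ?thesis"
  then obtain i j where ij: "i \<le> l" "y i < 0" "j \<le> l" "y j > 0" by (auto simp: not_le)
  define p n where "p i = max (y i) 0" and "n i = max (- y i) 0" for i
  have y: "y i = p i - n i" and pn: "p i * n i = 0" "p i \<ge> 0" "n i \<ge> 0" for i by (auto simp: p_def n_def)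
  have cross: "(\<Sum>i\<le>l. \<Sum>j\<le>l. gram i j * p i * n j) \<le> 0"
  proof (intro sum_nonpos)
    fix i j assume "i \<in> {..l}" "j \<in> {..l}"
    then show "gram i j * p i * n j \<le> 0"
      using gram_nonpos[of i j] pn(1)[of i] pn(2)[of i] pn(3)[of j] by (cases "i = j") (auto simp: mult.assoc mult_nonpos_nonneg)
  qed
  have "qnorm y = qnorm p + qnorm n - (\<Sum>i\<le>l. \<Sum>j\<le>l. gram i j * p i * n j) - (\<Sum>i\<le>l. \<Sum>j\<le>l. gram i j * n i * p j)"
    unfolding qnorm_def y sum.distrib[symmetric] sum_subtractf[symmetric] by (intro sum.cong refl) (simp add: algebra_simps)
  also have "(\<Sum>i\<le>l. \<Sum>j\<le>l. gram i j * n i * p j) = (\<Sum>i\<le>l. \<Sum>j\<le>l. gram i j * p i * n j)"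
    by (subst sum.swap) (intro sum.cong refl, simp add: gram_sym)
  finally have "qnorm p + qnorm n \<le> 2" using cross assms by linarith
  moreover have "qnorm p \<ge> 2" using ij by (intro qnorm_pos[of j p i]) (auto simp: p_def)
  moreover have "qnorm n \<ge> 2" using ij by (intro qnorm_pos[of i n j]) (auto simp: n_def)
  ultimately show False by linarith
qed

lemma form_qnorm:
  assumes "x (l + 1) = 0" "\<And>i. i \<le> l \<Longrightarrow> of_nat (h i) * x i = of_int (y i)"
  shows "of_nat M * form C x x = of_int (qnorm y)"
proof -
  have "of_nat M * (of_int (b i j) * x i * x j) = of_int (gram i j * y i * y j)" if "i \<le> l" "j \<le> l" for i j
  proof -
    have "(of_nat M * of_int (b i j) :: complex) = of_int (gram i j) * (of_nat (h i) * of_nat (h j))"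
      using arg_cong[OF gram[OF that], of complex_of_int] by simp
    then have "of_nat M * (of_int (b i j) * x i * x j) = of_int (gram i j) * (of_nat (h i) * x i) * (of_nat (h j) * x j)"
      by (simp add: mult_ac)
    then show ?thesis using assms(2) that by simp
  qed
  then show ?thesis
    using assms(1) unfolding form_expand qnorm_def sum_distrib_left of_int_sum by (simp add: sum_distrib_left)
qed

definition R :: "hvec set" where
  "R = {x \<in> hring C. (\<forall>i\<in>{1..l}. of_nat (h i) * x i \<in> \<int>) \<and> of_nat M * form C x x = 2}"

definition Rpos :: "hvec set" where "Rpos = {x \<in> R. \<forall>i\<in>{1..l}. Re (x i) \<ge> 0}"

lemma R_coords:
  assumes "x \<in> R"
  obtains y where "\<And>i. i \<le> l \<Longrightarrow> of_nat (h i) * x i = of_int (y i)" "qnorm y = 2" "y 0 = 0"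
    "\<And>i. i \<le> l \<Longrightarrow> x i = of_int (y i) / of_nat (h i)"
proof -
  have "\<exists>k. of_nat (h i) * x i = of_int k \<and> (i = 0 \<longrightarrow> k = 0)" if "i \<le> l" for i
  proof (cases "i = 0")
    case True
    then show ?thesis using assms by (intro exI[of _ 0]) (simp add: R_def hring_outside)
  next
    case False
    then have "of_nat (h i) * x i \<in> \<int>" using assms that by (simp add: R_def One_nat_def Suc_le_eq)
    then show ?thesis using False by (elim Ints_cases) auto
  qed
  then have "\<forall>i. \<exists>k. i \<le> l \<longrightarrow> of_nat (h i) * x i = of_int k \<and> (i = 0 \<longrightarrow> k = 0)" by blast
  from choice[OF this] obtain y where y: "\<And>i. i \<le> l \<Longrightarrow> of_nat (h i) * x i = of_int (y i)" "y 0 = 0" by blast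
  have x: "x (l + 1) = 0" using assms by (simp add: R_def hring_outside)
  have "(of_int (qnorm y) :: complex) = of_int 2" using form_qnorm[of x y, OF x y(1)] assms by (simp add: R_def)
  then have "qnorm y = 2" unfolding of_int_eq_iff .
  moreover have "x i = of_int (y i) / of_nat (h i)" if "i \<le> l" for i
    using y(1)[OF that] h_pos[OF that] by (simp add: field_simps)
  ultimately show ?thesis using y that by blast
qed

text \<open>As h_i divides e_i and e_i divides r, multiplication by r takes \<open>R\<close> into
  lattice vectors of one fixed norm.\<close>

lemma R_finite: "finite R"
proof -
  have "R \<subseteq> (\<lambda>v. (1 / of_nat r) \<cdot> v) ` {x \<in> rlat. form C x x = of_real (2 * r\<^sup>2 / M)}"
  proof
    fix x assume x: "x \<in> R"
    have "h i dvd r" if "i \<le> l" for i using h_e[OF that] e_cases[OF that] by (auto intro: dvd_trans)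
    have "of_nat r * x i \<in> \<int>" for i
    proof (cases "i \<in> {1..l}")
      case True
      then have "h i dvd r" using h_e[of i] e_cases[of i] by (auto intro: dvd_trans)
      then obtain k where "r = h i * k" by (rule dvdE)
      then have eq: "of_nat r * x i = of_nat k * (of_nat (h i) * x i)" by simp
      have "of_nat (h i) * x i \<in> \<int>" using x True by (simp add: R_def)
      then show ?thesis unfolding eq by (rule Ints_mult[OF Ints_of_nat])
    qed (use x in \<open>auto simp: R_def hring_def\<close>)
    then have "of_nat r \<cdot> x \<in> rlat" using x by (simp add: R_def rlat_def hring_smul) (simp add: smul_def)
    moreover have "form C (of_nat r \<cdot> x) (of_nat r \<cdot> x) = of_real (2 * r\<^sup>2 / M)"
    proof -
      have "form C x x = 2 / of_nat M" using x M_pos by (simp add: R_def field_simps)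
      then show ?thesis by (simp add: form_simps power2_eq_square)
    qed
    moreover have "x = (1 / of_nat r) \<cdot> (of_nat r \<cdot> x)" using r_gt_1 by simp
    ultimately show "x \<in> (\<lambda>v. (1 / of_nat r) \<cdot> v) ` {x \<in> rlat. form C x x = of_real (2 * r\<^sup>2 / M)}" by blast
  qed
  then show ?thesis by (rule finite_subset) (intro finite_imageI finite_rlat_norm)
qed

text \<open>The first integrality makes \<open>s i\<close> preserve the lattice spanned by the
  \<alpha>_j/h_j; the second makes a translation by \<alpha>_i change each sine only by a
  sign.\<close>

lemma R_form_alpha: "x \<in> R \<Longrightarrow> i \<le> l \<Longrightarrow> of_nat (h i) * form C x (alpha i) / of_nat (e i) \<in> \<int>"
  and R_form_alpha_int: "x \<in> R \<Longrightarrow> i \<le> l \<Longrightarrow> form C x (alpha i) \<in> \<int>"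
proof -
  assume x: "x \<in> R" and i: "i \<le> l"
  obtain y where y: "\<And>i. i \<le> l \<Longrightarrow> x i = of_int (y i) / of_nat (h i)" using R_coords[OF x] by metis
  have f: "form C x (alpha i) = (\<Sum>j\<le>l. of_int (b j i) * (of_int (y j) / of_nat (h j)))"
    using i x y b_sym[of i] by (simp add: form_alpha_right R_def hring_outside)
  have "of_nat (h i) * form C x (alpha i) / of_nat (e i) = (\<Sum>j\<le>l. of_int (y j) * (of_int (int (h i) * b j i) / of_int (int (h j) * int (e i))))"
    unfolding f sum_distrib_left sum_divide_distrib by (intro sum.cong refl) simp
  also have "\<dots> \<in> \<int>"
  proof (intro Ints_sum Ints_mult Ints_of_int)
    fix j assume "j \<in> {..l}"
    then obtain k where k: "int (h i) * b j i = int (h j) * int (e i) * k" using h_step[of i j] i by auto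
    show "of_int (int (h i) * b j i) / of_int (int (h j) * int (e i)) \<in> (\<int> :: complex set)"
      unfolding k using h_pos[of j] e_pos[OF i] \<open>j \<in> {..l}\<close> by simp
  qed
  finally show "of_nat (h i) * form C x (alpha i) / of_nat (e i) \<in> \<int>" .
  show "form C x (alpha i) \<in> \<int>" unfolding f
  proof (intro Ints_sum)
    fix j assume j: "j \<in> {..l}"
    then obtain k where k: "e j = h j * k" using h_e[of j] by auto
    have "of_int (b j i) * (of_int (y j) / of_nat (h j)) = (of_int (int k * ent C j i * y j) :: complex)"
      using h_pos[of j] j by (simp add: b_def k)
    then show "of_int (b j i) * (of_int (y j) / of_nat (h j)) \<in> (\<int> :: complex set)" by simp
  qed
qed

lemma R_s: "x \<in> R \<Longrightarrow> i \<in> {1..l} \<Longrightarrow> s i x \<in> R"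
proof -
  assume x: "x \<in> R" and i: "i \<in> {1..l}"
  have "of_nat (h j) * s i x j \<in> \<int>" if "j \<in> {1..l}" for j
    using x that i R_form_alpha[OF x, of i] by (auto simp: s_apply R_def right_diff_distrib)
  then show ?thesis using x i by (simp add: R_def s_hring s_form)
qed

text \<open>Expresses that \<alpha>_i/h_i has norm 2/M, hence itself belongs to
  \<open>R\<close>.\<close>

definition simple :: "nat \<Rightarrow> bool" where "simple i \<longleftrightarrow> M * e i = h i * h i"

definition scaled_root :: "nat \<Rightarrow> hvec" where "scaled_root i = (1 / of_nat (h i)) \<cdot> alpha i"

definition Rrest :: "nat \<Rightarrow> hvec set" where "Rrest i = {x \<in> Rpos. \<exists>j\<in>{1..l}. j \<noteq> i \<and> x j \<noteq> 0}"

lemma scaled_root_R: "i \<in> {1..l} \<Longrightarrow> simple i \<Longrightarrow> scaled_root i \<in> Rpos"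
proof -
  assume i: "i \<in> {1..l}" and simp: "simple i"
  have "(of_nat M * of_nat (e i) :: complex) = of_nat (h i) * of_nat (h i)"
    using simp unfolding simple_def by (metis of_nat_mult)
  then have "of_nat M * form C (scaled_root i) (scaled_root i) = 2" using i h_pos[of i]
    by (simp add: scaled_root_def form_simps form_alpha_alpha b_diag field_simps)
  then show ?thesis using i h_pos[of i]
    by (auto simp: Rpos_def R_def scaled_root_def hring_smul hring_alpha) (auto simp: smul_def alpha_def)
qed

text \<open>For x supported at i put y_i = h_i x_i; the norm condition reads q y_i^2 = 1 with the
  integer q = M e_i/h_i^2, and both factors must be 1.\<close>

lemma Rpos_split:
  assumes i: "i \<in> {1..l}" and x: "x \<in> Rpos" and nr: "x \<notin> Rrest i"
  shows "simple i" "x = scaled_root i"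
proof -
  have xR: "x \<in> R" and pos: "Re (x i) \<ge> 0" using x i by (auto simp: Rpos_def)
  obtain y where y: "\<And>i. i \<le> l \<Longrightarrow> x i = of_int (y i) / of_nat (h i)" using R_coords[OF xR] by metis
  have z: "x j = 0" if "j \<noteq> i" for j
    using nr x that xR by (cases "j \<in> {1..l}") (auto simp: Rrest_def R_def hring_def)
  have xa: "x = x i \<cdot> alpha i" using z by (auto simp: fun_eq_iff smul_def alpha_def)
  have "of_nat M * form C x x = of_nat M * (x i * x i * (2 * of_nat (e i)))"
    by (subst (1 2) xa) (use i in \<open>simp add: form_simps form_alpha_alpha b_diag\<close>)
  also have "\<dots> = 2 * (of_nat M * (x i * x i * of_nat (e i)))" by (simp add: algebra_simps)
  also have "of_nat M * form C x x = 2" using xR by (simp add: R_def)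
  finally have 1: "of_nat M * (x i * x i * of_nat (e i)) = 1" by (metis mult_cancel_left1 zero_neq_numeral)
  have hi: "h i > 0" using h_pos i by simp
  have "2 * int (h i) * int (h i) dvd int M * b i i" using h_M_diag i by simp
  then have "int (h i) * int (h i) dvd int M * int (e i)" using i by (simp add: b_diag mult_ac)
  then obtain q where q: "int M * int (e i) = int (h i) * int (h i) * q" by (rule dvdE)
  have qc: "(of_nat M * of_nat (e i) :: complex) = of_nat (h i) * of_nat (h i) * of_int q"
    using arg_cong[OF q, of complex_of_int] by simp
  have "of_nat M * (x i * x i * of_nat (e i)) = (of_nat M * of_nat (e i)) * (x i * x i)" by (simp add: mult_ac)
  also have "\<dots> = of_int (q * y i * y i)" unfolding qc using y[of i] i hi by (simp add: field_simps)
  finally have "(of_int (q * y i * y i) :: complex) = of_int 1" using 1 by simp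
  then have qy: "q * y i * y i = 1" unfolding of_int_eq_iff .
  have "y i \<ge> 0"
  proof -
    have "0 \<le> real_of_int (y i) / real (h i)" using pos y[of i] i by simp
    then show ?thesis using hi by (simp add: zero_le_divide_iff)
  qed
  moreover have "y i dvd 1" using qy by (metis dvd_triv_right)
  ultimately have "y i = 1" by simp
  then have "q = 1" using qy by simp
  then show "simple i" unfolding simple_def using q by (metis mult_1_right of_nat_eq_iff of_nat_mult)
  show "x = scaled_root i" using xa y[of i] i \<open>y i = 1\<close> by (simp add: scaled_root_def)
qed

lemma scaled_root_Rrest: "scaled_root i \<notin> Rrest i"
  by (auto simp: Rrest_def scaled_root_def smul_def alpha_def)

lemma Rpos_eq: "i \<in> {1..l} \<Longrightarrow> Rpos = (if simple i then insert (scaled_root i) (Rrest i) else Rrest i)"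
proof -
  assume i: "i \<in> {1..l}"
  have sub: "Rrest i \<subseteq> Rpos" by (auto simp: Rrest_def)
  show ?thesis
  proof (cases "simple i")
    case True
    have "Rpos = insert (scaled_root i) (Rrest i)" using Rpos_split(2)[OF i] scaled_root_R[OF i True] sub by blast
    then show ?thesis using True by simp
  next
    case False
    have "Rpos = Rrest i" using Rpos_split(1)[OF i] False sub by blast
    then show ?thesis using False by simp
  qed
qed

lemma Rpos_finite: "finite Rpos" and Rrest_finite: "finite (Rrest i)"
  using R_finite by (auto simp: Rpos_def Rrest_def)

text \<open>A simple reflection changes only one coordinate. Another coordinate stays positive, and
  \<open>sign_definite\<close> makes the changed one nonnegative as well.\<close>

lemma Rrest_s:
  assumes i: "i \<in> {1..l}" and x: "x \<in> Rrest i"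
  shows "s i x \<in> Rrest i"
proof -
  have xR: "x \<in> R" using x by (simp add: Rrest_def Rpos_def)
  then have sR: "s i x \<in> R" using i R_s by blast
  obtain j where j: "j \<in> {1..l}" "j \<noteq> i" "x j \<noteq> 0" using x by (auto simp: Rrest_def)
  have sxj: "s i x j = x j" using i j by (simp add: s_apply)
  obtain y where y: "qnorm y = 2" "\<And>k. k \<le> l \<Longrightarrow> s i x k = of_int (y k) / of_nat (h k)"
    using R_coords[OF sR] by metis
  have "Re (x j) \<ge> 0" using x j by (auto simp: Rrest_def Rpos_def)
  moreover have xj: "x j = of_int (y j) / of_nat (h j)" using y(2)[of j] sxj j by simp
  ultimately have "real_of_int (y j) / real (h j) \<ge> 0" by simp
  then have "y j > 0" using xj j h_pos[of j] by (cases "y j = 0") (auto simp: zero_le_divide_iff)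
  then have "\<forall>k\<le>l. y k \<ge> 0" using sign_definite[OF y(1)] j by fastforce
  then have "\<forall>k\<in>{1..l}. Re (s i x k) \<ge> 0" using y(2) by simp
  then show ?thesis using sR j sxj by (auto simp: Rrest_def Rpos_def)
qed

lemma bij_Rrest: "i \<in> {1..l} \<Longrightarrow> bij_betw (s i) (Rrest i) (Rrest i)"
  by (rule bij_betwI[where g = "s i"]) (auto simp: Rrest_s s_invol)

text \<open>Up to a constant, the part of the Weyl denominator that comes from the roots in
  \<open>R\<close>.\<close>

definition sine_product :: "hvec \<Rightarrow> complex" where "sine_product \<gamma> = (\<Prod>x\<in>Rpos. sin (of_real pi * form C \<gamma> x))"

lemma sine_product_s:
  assumes i: "i \<in> {1..l}"
  shows "sine_product (s i \<gamma>) = (if simple i then - sine_product \<gamma> else sine_product \<gamma>)"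
proof -
  have rest: "(\<Prod>x\<in>Rrest i. sin (of_real pi * form C (s i \<gamma>) x)) = (\<Prod>x\<in>Rrest i. sin (of_real pi * form C \<gamma> x))"
    using i prod.reindex_bij_betw[OF bij_Rrest[OF i], of "\<lambda>x. sin (of_real pi * form C \<gamma> x)"] by (simp add: s_move)
  have scaled_root: "sin (of_real pi * form C (s i \<gamma>) (scaled_root i)) = - sin (of_real pi * form C \<gamma> (scaled_root i))"
    using i by (simp add: s_move scaled_root_def s_smul s_alpha_self form_simps)
  show ?thesis
    unfolding sine_product_def Rpos_eq[OF i] using rest scaled_root by (simp add: Rrest_finite scaled_root_Rrest)
qed

text \<open>The translation multiplies the product by exp (pi i S), where S is the sum of
  (\<alpha>_i, x) over \<open>Rpos\<close>. Reflection by s_i cancels the contribution of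
  \<open>Rrest i\<close>, and what may remain is 2 e_i/h_i, an even integer.\<close>

lemma sine_product_alpha:
  assumes i: "i \<in> {1..l}"
  shows "sine_product (\<gamma> + alpha i) = sine_product \<gamma>"
proof -
  have int: "form C (alpha i) x \<in> \<int>" if "x \<in> Rpos" for x
    using R_form_alpha_int[of x i] that i form_sym[of "alpha i" x] by (simp add: Rpos_def)
  have "sin (of_real pi * form C (\<gamma> + alpha i) x) = exp (\<i> * of_real pi * form C (alpha i) x) * sin (of_real pi * form C \<gamma> x)"
    if x: "x \<in> Rpos" for x
  proof -
    obtain k where k: "form C (alpha i) x = of_int k" using int[OF x] by (rule Ints_cases)
    have s0: "sin (of_real pi * of_int k :: complex) = 0" by (metis of_real_mult of_real_of_int_eq sin_of_real sin_npi_int mult.commute of_real_0 sin_int_times_real)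
    have "exp (\<i> * (of_real pi * of_int k)) = cos (of_real pi * of_int k) + \<i> * sin (of_real pi * of_int k)"
      by (rule exp_Euler)
    then show ?thesis using s0 by (simp add: form_simps distrib_left sin_add k mult.assoc)
  qed
  then have "sine_product (\<gamma> + alpha i) = exp (\<Sum>x\<in>Rpos. \<i> * of_real pi * form C (alpha i) x) * sine_product \<gamma>"
    unfolding sine_product_def exp_sum[OF Rpos_finite] prod.distrib[symmetric] by (intro prod.cong refl) auto
  also have "(\<Sum>x\<in>Rpos. \<i> * of_real pi * form C (alpha i) x) = \<i> * of_real pi * (\<Sum>x\<in>Rpos. form C (alpha i) x)"
    by (simp add: sum_distrib_left)
  also have "(\<Sum>x\<in>Rpos. form C (alpha i) x) = (if simple i then form C (alpha i) (scaled_root i) else 0)"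
  proof -
    have "(\<Sum>x\<in>Rrest i. form C (alpha i) x) = (\<Sum>x\<in>Rrest i. form C (alpha i) (s i x))"
      by (rule sum.reindex_bij_betw[OF bij_Rrest[OF i], symmetric])
    also have "\<dots> = - (\<Sum>x\<in>Rrest i. form C (alpha i) x)"
      using i by (simp add: s_move[symmetric] s_alpha_self form_simps sum_negf)
    finally have "(\<Sum>x\<in>Rrest i. form C (alpha i) x) = 0" by simp
    then show ?thesis unfolding Rpos_eq[OF i] by (simp add: Rrest_finite scaled_root_Rrest)
  qed
  also have "exp (\<i> * of_real pi * (if simple i then form C (alpha i) (scaled_root i) else 0)) = 1"
  proof (cases "simple i")
    case True
    obtain k where k: "e i = h i * k" using h_e[of i] i by auto
    have eq: "\<i> * of_real pi * form C (alpha i) (scaled_root i) = 2 * of_real pi * \<i> * of_int (int k)"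
      using i h_pos[of i] by (simp add: scaled_root_def form_simps form_alpha_alpha b_diag k)
    show ?thesis unfolding if_P[OF True] eq by (rule exp_two_pi_i_int)
  qed simp
  finally show ?thesis by simp
qed

text \<open>A vanishing sine means (\<rho>, x) = k h^vee, so that the affine root x - k \<delta> is
  orthogonal to \<rho>. Its coordinates have one sign and \<rho> is positive on every simple root,
  which would make it zero.\<close>

lemma sine_product_rho:
  "sine_product ((1 / of_nat (dual_coxeter C)) \<cdot> bar (rho C)) \<noteq> 0"
proof
  assume "sine_product ((1 / of_nat (dual_coxeter C)) \<cdot> bar (rho C)) = 0"
  then obtain x where x: "x \<in> Rpos" "sin (of_real pi * form C ((1 / of_nat (dual_coxeter C)) \<cdot> bar (rho C)) x) = 0"
    using Rpos_finite by (auto simp: sine_product_def)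
  have xR: "x \<in> R" and xh: "x \<in> hring C" using x by (auto simp: Rpos_def R_def)
  obtain k :: int where "of_real pi * form C ((1 / of_nat (dual_coxeter C)) \<cdot> bar (rho C)) x = of_int k * of_real pi"
    using x(2) unfolding Complex_Transcendental.sin_eq_0 by auto
  then have k: "form C (rho C) x = of_int k * of_nat (dual_coxeter C)"
    using dual_coxeter_pos by (simp add: form_simps form_bar_hring[OF xh rho_hstar] field_simps)
  define x' where "x' = x - of_int k \<cdot> delta C"
  have rx': "form C (rho C) x' = 0"
    using k by (simp add: x'_def form_simps form_delta_right rho_level[unfolded One_nat_def add_0_right] rho_level)
  have x'l: "x' (l + 1) = 0" using xh a_outside by (simp add: x'_def fun_ap smul_def delta_apply hring_outside)
  obtain y where y: "\<And>i. i \<le> l \<Longrightarrow> of_nat (h i) * x i = of_int (y i)" using R_coords[OF xR] by metis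
  define y' where "y' i = y i - k * int (a i * h i)" for i
  have y': "of_nat (h i) * x' i = of_int (y' i)" if "i \<le> l" for i
    using y[OF that] by (simp add: x'_def fun_ap smul_def delta_apply y'_def algebra_simps)
  have "form C x' x' = form C x x"
    using xh x'l unfolding x'_def by (simp add: form_diff_left form_diff_right form_smul_left form_smul_right form_delta_left form_delta_right hring_outside)
  then have "of_nat M * form C x' x' = 2" using xR by (simp add: R_def)
  then have "(of_int (qnorm y') :: complex) = of_int 2" using form_qnorm[of x' y', OF x'l y'] by simp
  then have qnorm: "qnorm y' = 2" unfolding of_int_eq_iff .
  have x'y: "x' i = of_int (y' i) / of_nat (h i)" if "i \<le> l" for i
    using y'[OF that] h_pos[OF that] by (simp add: field_simps)
  have "x' = (\<Sum>i\<le>l. x' i \<cdot> alpha i)"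
  proof
    fix j
    have "(\<Sum>i\<le>l. x' i \<cdot> alpha i) j = (\<Sum>i\<le>l. if i = j then x' j else 0)"
      unfolding sum_fun_apply by (intro sum.cong) (auto simp: smul_def alpha_def)
    then show "x' j = (\<Sum>i\<le>l. x' i \<cdot> alpha i) j"
      using xh a_outside by (auto simp: x'_def fun_ap smul_def delta_apply hring_outside)
  qed
  then have "form C (rho C) x' = form C (rho C) (\<Sum>i\<le>l. x' i \<cdot> alpha i)" by (rule arg_cong)
  also have "\<dots> = (\<Sum>i\<le>l. of_int (y' i) / of_nat (h i) * of_nat (e i))"
    unfolding form_simps by (intro sum.cong refl) (simp add: x'y rho_alpha)
  finally have "of_real (\<Sum>i\<le>l. of_int (y' i) / of_nat (h i) * of_nat (e i)) = (0 :: complex)" using rx' by simp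
  then have 0: "(\<Sum>i\<le>l. real_of_int (y' i) / of_nat (h i) * of_nat (e i)) = 0" unfolding of_real_eq_0_iff .
  have "\<forall>i\<le>l. y' i = 0"
    using sign_definite[OF qnorm]
  proof
    assume p: "\<forall>i\<le>l. y' i \<ge> 0"
    have "real_of_int (y' i) / of_nat (h i) * of_nat (e i) = 0" if "i \<le> l" for i
      using sum_nonneg_0[OF finite_atMost _ 0, of i] p that by simp
    then show ?thesis using h_pos e_pos by fastforce
  next
    assume p: "\<forall>i\<le>l. y' i \<le> 0"
    have neg0: "(\<Sum>i\<le>l. - (real_of_int (y' i) / of_nat (h i) * of_nat (e i))) = 0" using 0 by (simp add: sum_negf)
    have "- (real_of_int (y' i) / of_nat (h i) * of_nat (e i)) = 0" if "i \<le> l" for i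
      using sum_nonneg_0[OF finite_atMost _ neg0, of i] p that by (simp add: divide_nonpos_nonneg mult_nonpos_nonneg)
    then show ?thesis using h_pos e_pos by fastforce
  qed
  then have "qnorm y' = 0" by (simp add: qnorm_def)
  then show False using qnorm by simp
qed

end

section \<open>Parity of words, finiteness of the Weyl group and alternating sums\<close>

context affine_lattice
begin

lemma rlat_induct:
  assumes x: "x \<in> rlat" and 0: "P 0" and alpha: "\<And>i. i \<in> {1..l} \<Longrightarrow> P (alpha i)"
    and diff: "\<And>x y. P x \<Longrightarrow> P y \<Longrightarrow> P (x - y)"
  shows "P (x :: hvec)"
proof -
  have minus: "P (- y)" if "P y" for y using diff[OF 0 that] by simp
  have add: "P (y + z)" if "P y" "P z" for y z using diff[OF that(1) minus[OF that(2)]] by simp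
  have nat: "P (of_nat n \<cdot> y)" if "P y" for n y
  proof (induction n)
    case (Suc n)
    have "of_nat (Suc n) \<cdot> y = y + of_nat n \<cdot> y" by (simp add: cfun.scale_left_distrib)
    then show ?case using add[OF that Suc] by (simp only:)
  qed (simp add: 0)
  have int: "P (of_int k \<cdot> y)" if "P y" for k y
  proof (cases "k \<ge> 0")
    case True
    then show ?thesis using nat[OF that, of "nat k"] by simp
  next
    case False
    have "of_int k \<cdot> y = - (of_nat (nat (- k)) \<cdot> y)" using False by simp
    then show ?thesis using minus[OF nat[OF that, of "nat (- k)"]] by (simp only:)
  qed
  obtain k where k: "\<And>i. x i = of_int (k i)" by (rule rlat_int_coords[OF x]) (rule that)
  have "P (\<Sum>i\<in>A. of_int (k i) \<cdot> alpha i)" if "A \<subseteq> {1..l}" for A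
    using finite_subset[OF that finite_atLeastAtMost] that
  proof (induction A rule: finite_induct)
    case (insert i A)
    then have "P (of_int (k i) \<cdot> alpha i + (\<Sum>i\<in>A. of_int (k i) \<cdot> alpha i))"
      by (intro add int alpha) auto
    then show ?case using insert.hyps by simp
  qed (simp add: 0)
  from this[OF order_refl] show ?thesis using hring_expand[OF rlat_hring[OF x]] by (simp add: k)
qed

lemma short_roots: "affine_roots C r a e (\<lambda>_. 1) 1"
proof unfold_locales
  fix i j assume ij: "i \<le> l" "j \<le> l"
  have "b j i = int (e i) * ent C i j" using b_sym[OF ij] by (simp add: b_def)
  then show "int 1 * int (e i) dvd int 1 * b j i" by simp
qed (auto simp: b_diag)

lemma long_roots: "affine_roots C r a e e r"
proof unfold_locales
  have er: "e i dvd r" if "i \<le> l" for i using e_cases[OF that] by auto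
  fix i assume i: "i \<le> l"
  have "2 * int (e i) * int (e i) dvd 2 * int (e i) * int r" using er[OF i] by (intro mult_dvd_mono) auto
  then show "2 * int (e i) * int (e i) dvd int r * b i i" using i by (simp add: b_diag mult_ac)
  fix j assume j: "j \<le> l"
  have "int (e i) * int (e j) dvd (int (e i) * ent C i j) * int r" using er[OF j] by (intro mult_dvd_mono) auto
  then show "int (e i) * int (e j) dvd int r * b i j" by (simp add: b_def mult_ac)
  show "int (e j) * int (e i) dvd int (e i) * b j i" by (simp add: b_def)
qed (use r_gt_1 e_pos in auto)

text \<open>The function \<open>\<gamma> \<mapsto> \<Prod> sin (\<pi> (\<gamma>, x))\<close> over the positive short roots and long coroots changes sign
  under simple reflections, and so detects the parity of a word without a theory of lengths.\<close>

lemma sign_function: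
  obtains g :: "hvec \<Rightarrow> complex" where "\<And>i \<gamma>. i \<in> {1..l} \<Longrightarrow> g (s i \<gamma>) = - g \<gamma>"
    "\<And>\<beta> \<gamma>. \<beta> \<in> rlat \<Longrightarrow> g (\<gamma> + \<beta>) = g \<gamma>" "g ((1 / of_nat (dual_coxeter C)) \<cdot> bar (rho C)) \<noteq> 0"
proof -
  interpret short: affine_roots C r a e "\<lambda>_. 1" 1 by (rule short_roots)
  interpret long: affine_roots C r a e e r by (rule long_roots)
  define g where "g \<gamma> = short.sine_product \<gamma> * long.sine_product \<gamma>" for \<gamma>
  have 1: "g (s i \<gamma>) = - g \<gamma>" if i: "i \<in> {1..l}" for i \<gamma>
  proof -
    \<comment> \<open>Each simple root is counted by exactly one of the two products, according to
      its length, so g picks up exactly one sign.\<close>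
    have "short.simple i \<longleftrightarrow> \<not> long.simple i"
      using e_cases[of i] i r_gt_1 by (auto simp: short.simple_def long.simple_def)
    then show ?thesis by (simp add: g_def short.sine_product_s[OF i] long.sine_product_s[OF i])
  qed
  have a: "g (\<gamma> + alpha i) = g \<gamma>" if i: "i \<in> {1..l}" for i \<gamma>
    by (simp add: g_def short.sine_product_alpha[OF i] long.sine_product_alpha[OF i])
  have 2: "g (\<gamma> + \<beta>) = g \<gamma>" if "\<beta> \<in> rlat" for \<beta> \<gamma>
  proof -
    have "\<forall>\<gamma>. g (\<gamma> + \<beta>) = g \<gamma>" using that
    proof (rule rlat_induct[where P = "\<lambda>\<beta>. \<forall>\<gamma>. g (\<gamma> + \<beta>) = g \<gamma>"])
      fix x y assume x: "\<forall>\<gamma>. g (\<gamma> + x) = g \<gamma>" and y: "\<forall>\<gamma>. g (\<gamma> + y) = g \<gamma>"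
      show "\<forall>\<gamma>. g (\<gamma> + (x - y)) = g \<gamma>"
      proof
        fix \<gamma>
        have "g (\<gamma> + (x - y)) = g (\<gamma> + (x - y) + y)" using y by (simp only:)
        also have "\<dots> = g (\<gamma> + x)" by simp
        finally show "g (\<gamma> + (x - y)) = g \<gamma>" using x by simp
      qed
    qed (auto simp: a)
    then show ?thesis by blast
  qed
  have 3: "g ((1 / of_nat (dual_coxeter C)) \<cdot> bar (rho C)) \<noteq> 0"
    using short.sine_product_rho long.sine_product_rho by (simp add: g_def)
  show ?thesis using that 1 2 3 by blast
qed

lemma sign_function_wm:
  assumes "\<And>i \<gamma>. i \<in> {1..l} \<Longrightarrow> g (s i \<gamma>) = - g \<gamma>" "set is \<subseteq> {1..l}"
  shows "(g :: hvec \<Rightarrow> complex) (wm is \<gamma>) = (- 1) ^ length is * g \<gamma>"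
  using assms(2) by (induction "is") (auto simp: wm_Cons assms(1))

abbreviation W :: "(hvec \<Rightarrow> hvec) set" where "W \<equiv> fin_weyl C"

text \<open>Evaluating g at a point where it is nonzero shows that two words for the same map have
  equal parity; this is applied to the given word and one of minimal length.\<close>

lemma weyl_sign_wm:
  assumes "set is \<subseteq> {1..l}"
  shows "weyl_sign C (wm is) = (- 1) ^ length is"
proof -
  obtain g where g: "\<And>i \<gamma>. i \<in> {1..l} \<Longrightarrow> (g :: hvec \<Rightarrow> complex) (s i \<gamma>) = - g \<gamma>" "g ((1 / of_nat (dual_coxeter C)) \<cdot> bar (rho C)) \<noteq> 0"
    using sign_function by metis
  let ?p = "(1 / of_nat (dual_coxeter C)) \<cdot> bar (rho C)"
  let ?P = "\<lambda>n. \<exists>js. set js \<subseteq> {1..l} \<and> length js = n \<and> wm js = wm is"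
  have "?P (weyl_length C (wm is))" unfolding weyl_length_def by (rule LeastI[of ?P]) (use assms in blast)
  then obtain js where js: "set js \<subseteq> {1..l}" "length js = weyl_length C (wm is)" "wm js = wm is" by blast
  have "(- 1) ^ length js * g ?p = (- 1) ^ length is * g ?p"
    using sign_function_wm[of g js ?p, OF g(1) js(1)] sign_function_wm[of g "is" ?p, OF g(1) assms] js(3) by simp
  then show ?thesis using g(2) js(2) by (simp add: weyl_sign_def)
qed

lemma W_wm: "set is \<subseteq> {1..l} \<Longrightarrow> wm is \<in> W" and W_cases: "w \<in> W \<Longrightarrow> \<exists>is. w = wm is \<and> set is \<subseteq> {1..l}"
  by (auto simp: fin_weyl_def)

lemma id_W: "id \<in> W" using W_wm[of "[]"] by simp

text \<open>Group elements are maps on all coordinate sequences, not only on the span of the simple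
  roots. The difference of two of them takes values in \<open>hring\<close> and is orthogonal to
  every simple root, hence zero.\<close>

lemma wm_eqI:
  assumes i: "set is \<subseteq> {1..l}" and j: "set js \<subseteq> {1..l}" and eq: "\<And>i. i \<in> {1..l} \<Longrightarrow> wm is (alpha i) = wm js (alpha i)"
  shows "wm is = wm js"
proof
  fix x
  have move: "wm ks v - v \<in> hring C" if "set ks \<subseteq> {1..l}" for ks v
    using that
  proof (induction ks)
    case (Cons k ks)
    have *: "wm (k # ks) v - v = (wm ks v - v) - (form C (wm ks v) (alpha k) / of_nat (e k)) \<cdot> alpha k"
      using Cons.prems by (simp add: wm_Cons s_eq algebra_simps)
    show ?case unfolding * using Cons by (intro hring_diff[of "wm ks v - v"] hring_smul hring_alpha) auto
  qed (simp add: hring_zero)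
  have lin: "wm is v = wm js v" if v: "v \<in> hring C" for v
  proof -
    have sum: "wm ks (\<Sum>i\<in>A. g i) = (\<Sum>i\<in>A. wm ks (g i))" for ks A and g :: "nat \<Rightarrow> hvec"
      by (induction A rule: infinite_finite_induct) (auto simp: wm_add wm_zero)
    have "wm ks v = (\<Sum>i=1..l. v i \<cdot> wm ks (alpha i))" for ks
    proof -
      have "wm ks v = wm ks (\<Sum>i=1..l. v i \<cdot> alpha i)" by (rule arg_cong[OF hring_expand[OF v]])
      then show ?thesis by (simp add: sum wm_smul)
    qed
    then show ?thesis by (simp add: eq)
  qed
  have i': "set is \<subseteq> {..l}" and j': "set js \<subseteq> {..l}" using i j by auto
  define d where "d = wm is x - wm js x"
  have "d = (wm is x - x) - (wm js x - x)" by (simp add: d_def)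
  then have d: "d \<in> hring C" using hring_diff[OF move[OF i] move[OF j]] by (simp only:)
  have "d = 0"
  proof (rule hring_eqI[OF d hring_zero])
    fix k assume k: "k \<in> {1..l}"
    define v where "v = wm (rev is) (alpha k)"
    have v: "v \<in> hring C" unfolding v_def using i k by (intro wm_hring hring_alpha) auto
    have vk: "wm is v = alpha k" unfolding v_def by (rule wm_rev'[OF i'])
    have "form C d (alpha k) = form C (wm is x) (wm is v) - form C (wm js x) (wm js v)"
      unfolding d_def form_simps lin[OF v, symmetric] vk ..
    then show "form C d (alpha k) = form C 0 (alpha k)" by (simp add: wm_form[OF i'] wm_form[OF j'])
  qed
  then show "wm is x = wm js x" by (simp add: d_def)
qed

text \<open>An element is determined by the images of the simple roots, which are lattice vectors of
  norm 2 e_i.\<close>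

lemma finite_W: "finite W"
proof -
  define T where "T = (\<Pi>\<^sub>E i\<in>{1..l}. {x \<in> rlat. form C x x = of_real (2 * real (e i))})"
  have T: "finite T" unfolding T_def by (intro finite_PiE finite_rlat_norm) auto
  have "inj_on (\<lambda>w. restrict (\<lambda>i. w (alpha i)) {1..l}) W"
  proof
    fix w w' assume ww: "w \<in> W" "w' \<in> W" and eq: "restrict (\<lambda>i. w (alpha i)) {1..l} = restrict (\<lambda>i. w' (alpha i)) {1..l}"
    obtain "is" js where w: "w = wm is" "set is \<subseteq> {1..l}" "w' = wm js" "set js \<subseteq> {1..l}" using W_cases ww by metis
    have "wm is = wm js"
    proof (rule wm_eqI[OF w(2,4)])
      fix i assume i: "i \<in> {1..l}"
      show "wm is (alpha i) = wm js (alpha i)" using fun_cong[OF eq, of i] i by (simp add: w)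
    qed
    then show "w = w'" by (simp add: w)
  qed
  moreover have "(\<lambda>w. restrict (\<lambda>i. w (alpha i)) {1..l}) ` W \<subseteq> T"
  proof
    fix t assume "t \<in> (\<lambda>w. restrict (\<lambda>i. w (alpha i)) {1..l}) ` W"
    then obtain "is" where t: "t = restrict (\<lambda>i. wm is (alpha i)) {1..l}" "set is \<subseteq> {1..l}" using W_cases by blast
    have i': "set is \<subseteq> {..l}" using t(2) by auto
    show "t \<in> T" unfolding T_def t(1) using t(2)
      by (auto simp: rlat_wm rlat_alpha wm_form[OF i'] form_alpha_alpha b_diag)
  qed
  ultimately show ?thesis using T by (meson finite_imageD finite_subset)
qed

definition AT :: "nat \<Rightarrow> hvec \<Rightarrow> complex \<Rightarrow> hvec \<Rightarrow> complex" where
  "AT m \<gamma> \<sigma> z = (\<Sum>w\<in>W. weyl_sign C w * TH m (w \<gamma>) \<sigma> z)"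

lemma sum_W_right:
  assumes "set is \<subseteq> {1..l}"
  shows "(\<Sum>w\<in>W. F (w \<circ> wm is)) = (\<Sum>w\<in>W. F w)"
proof (rule sum.reindex_bij_witness[of _ "\<lambda>w. w \<circ> wm (rev is)" "\<lambda>w. w \<circ> wm is"])
  have i': "set is \<subseteq> {..l}" using assms by auto
  fix w assume "w \<in> W"
  then obtain js where js: "w = wm js" "set js \<subseteq> {1..l}" using W_cases by blast
  show "(w \<circ> wm is) \<circ> wm (rev is) = w" "(w \<circ> wm (rev is)) \<circ> wm is = w"
    by (rule ext, simp add: wm_rev[OF i'] wm_rev'[OF i'])+
  have "w \<circ> wm is = wm (js @ is)" "w \<circ> wm (rev is) = wm (js @ rev is)" by (auto simp: js wm_append fun_eq_iff)
  then show "w \<circ> wm is \<in> W" "w \<circ> wm (rev is) \<in> W" using W_wm[of "js @ is"] W_wm[of "js @ rev is"] js assms by auto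
qed simp

lemma weyl_sign_comp:
  assumes "set is \<subseteq> {1..l}" "w \<in> W"
  shows "weyl_sign C (w \<circ> wm is) = (- 1) ^ length is * weyl_sign C w"
proof -
  obtain js where js: "w = wm js" "set js \<subseteq> {1..l}" using W_cases assms by blast
  have "w \<circ> wm is = wm (js @ is)" by (auto simp: js wm_append fun_eq_iff)
  moreover have "set (js @ is) \<subseteq> {1..l}" using js assms by simp
  ultimately show ?thesis using weyl_sign_wm[of "js @ is"] weyl_sign_wm[OF js(2)] js(1) by (simp add: power_add)
qed

lemma sign_square: "(- 1) ^ n * ((- 1) ^ n * x) = (x :: complex)"
  by (simp add: mult.assoc[symmetric] power_add[symmetric] mult_2[symmetric])

lemma AT_wm:
  assumes "set is \<subseteq> {1..l}"
  shows "AT m (wm is \<gamma>) \<sigma> z = (- 1) ^ length is * AT m \<gamma> \<sigma> z"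
proof -
  have "(- 1) ^ length is * AT m (wm is \<gamma>) \<sigma> z = (\<Sum>w\<in>W. weyl_sign C (w \<circ> wm is) * TH m ((w \<circ> wm is) \<gamma>) \<sigma> z)"
    unfolding AT_def sum_distrib_left by (intro sum.cong refl) (simp add: weyl_sign_comp[OF assms])
  also have "\<dots> = AT m \<gamma> \<sigma> z" unfolding AT_def by (rule sum_W_right[OF assms])
  finally have "(- 1) ^ length is * ((- 1) ^ length is * AT m (wm is \<gamma>) \<sigma> z) = (- 1) ^ length is * AT m \<gamma> \<sigma> z" by (rule arg_cong)
  then show ?thesis unfolding sign_square .
qed

lemma TH_wm:
  assumes "set is \<subseteq> {1..l}"
  shows "TH m (wm is \<gamma>) \<sigma> (wm is z) = TH m \<gamma> \<sigma> z"
proof -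
  have i': "set is \<subseteq> {..l}" "set (rev is) \<subseteq> {1..l}" using assms by auto
  show ?thesis unfolding TH_def
  proof (rule infsum_reindex_bij_witness[of _ "wm is" "wm (rev is)"])
    fix x assume x: "x \<in> rlat"
    have "wm is \<gamma> + x = wm is (\<gamma> + wm (rev is) x)" by (simp add: wm_add wm_rev'[OF i'(1)])
    then show "E m (\<gamma> + wm (rev is) x) \<sigma> z = E m (wm is \<gamma> + x) \<sigma> (wm is z)"
      by (simp add: E_def wm_form[OF i'(1)])
  qed (use rlat_wm assms i' wm_rev[OF i'(1)] wm_rev'[OF i'(1)] in auto)
qed

lemma AT_z:
  assumes "set is \<subseteq> {1..l}"
  shows "AT m \<gamma> \<sigma> (wm is z) = (- 1) ^ length is * AT m \<gamma> \<sigma> z"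
proof -
  have i': "set is \<subseteq> {..l}" using assms by auto
  have "AT m \<gamma> \<sigma> (wm is z) = (\<Sum>w\<in>W. weyl_sign C w * TH m (w \<gamma>) \<sigma> (wm is z))" by (simp add: AT_def)
  also have "\<dots> = (\<Sum>w\<in>(\<lambda>w. wm is \<circ> w) ` W. weyl_sign C w * TH m (w \<gamma>) \<sigma> (wm is z))"
  proof (rule arg_cong[where f = "sum _"])
    show "W = (\<lambda>w. wm is \<circ> w) ` W"
    proof (intro equalityI subsetI)
      fix w assume "w \<in> W"
      then obtain js where js: "w = wm js" "set js \<subseteq> {1..l}" using W_cases by blast
      have "w = wm is \<circ> wm (rev is @ js)" by (auto simp: fun_eq_iff wm_append wm_rev'[OF i'] js)
      moreover have "wm (rev is @ js) \<in> W" using W_wm[of "rev is @ js"] js assms by auto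
      ultimately show "w \<in> (\<lambda>w. wm is \<circ> w) ` W" by blast
    next
      fix w assume "w \<in> (\<lambda>w. wm is \<circ> w) ` W"
      then obtain js where js: "w = wm is \<circ> wm js" "set js \<subseteq> {1..l}" using W_cases by blast
      have "w = wm (is @ js)" by (auto simp: fun_eq_iff wm_append js)
      then show "w \<in> W" using W_wm[of "is @ js"] js assms by auto
    qed
  qed
  also have "\<dots> = (\<Sum>w\<in>W. weyl_sign C (wm is \<circ> w) * TH m ((wm is \<circ> w) \<gamma>) \<sigma> (wm is z))"
  proof (subst sum.reindex)
    show "inj_on (\<lambda>w. wm is \<circ> w) W"
    proof
      fix w w' assume "wm is \<circ> w = wm is \<circ> w'"
      then have "wm (rev is) (wm is (w x)) = wm (rev is) (wm is (w' x))" for x by (metis comp_apply)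
      then show "w = w'" by (simp add: wm_rev[OF i'] fun_eq_iff)
    qed
  qed simp
  also have "\<dots> = (\<Sum>w\<in>W. (- 1) ^ length is * (weyl_sign C w * TH m (w \<gamma>) \<sigma> z))"
  proof (intro sum.cong refl)
    fix w assume "w \<in> W"
    then obtain js where js: "w = wm js" "set js \<subseteq> {1..l}" using W_cases by blast
    have "wm is \<circ> w = wm (is @ js)" by (auto simp: fun_eq_iff wm_append js)
    moreover have "set (is @ js) \<subseteq> {1..l}" using js assms by simp
    ultimately have "weyl_sign C (wm is \<circ> w) = (- 1) ^ length is * weyl_sign C w"
      using weyl_sign_wm[of "is @ js"] weyl_sign_wm[OF js(2)] js(1) by (simp add: power_add)
    then show "weyl_sign C (wm is \<circ> w) * TH m ((wm is \<circ> w) \<gamma>) \<sigma> (wm is z) = (- 1) ^ length is * (weyl_sign C w * TH m (w \<gamma>) \<sigma> z)"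
      by (simp add: TH_wm[OF assms])
  qed
  finally show ?thesis by (simp add: AT_def sum_distrib_left)
qed

lemma AT_shift:
  assumes "\<beta> \<in> rlat"
  shows "AT m (\<gamma> + \<beta>) \<sigma> z = AT m \<gamma> \<sigma> z"
  unfolding AT_def
proof (intro sum.cong refl)
  fix w assume "w \<in> W"
  then obtain js where js: "w = wm js" "set js \<subseteq> {1..l}" using W_cases by blast
  show "weyl_sign C w * TH m (w (\<gamma> + \<beta>)) \<sigma> z = weyl_sign C w * TH m (w \<gamma>) \<sigma> z"
    using TH_shift[OF rlat_wm[OF js(2) assms], of m "w \<gamma>" \<sigma> z] by (simp add: js wm_add)
qed

text \<open>\<theta> has norm 2, so descent by height conjugates it to a simple root with e_i = 1.
  The reflection in \<theta> is then w s_i w^-1, a word of odd length.\<close>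

lemma theta_reflection:
  obtains ts where "set ts \<subseteq> {1..l}" "odd (length ts)" "\<And>x. wm ts x = x - form C x (theta_root C) \<cdot> theta_root C"
proof -
  interpret short: affine_roots C r a e "\<lambda>_. 1" 1 by (rule short_roots)
  have descent: "\<exists>is i. set is \<subseteq> {1..l} \<and> i \<in> {1..l} \<and> e i = 1 \<and> x = wm is (alpha i)"
    if "x \<in> short.Rpos" "(\<Sum>i=1..l. Re (x i)) = of_nat n" for x n
    using that
  proof (induction n arbitrary: x rule: less_induct)
    case (less n)
    have xR: "x \<in> short.R" and xh: "x \<in> hring C" and pos: "\<And>i. i \<in> {1..l} \<Longrightarrow> Re (x i) \<ge> 0" and nrm: "form C x x = 2"
      using less.prems by (auto simp: short.Rpos_def short.R_def)
    have xint: "x i \<in> \<int>" if "i \<in> {1..l}" for i using xR that by (simp add: short.R_def)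
    have xr: "x i = of_real (Re (x i))" if "i \<in> {1..l}" for i using xint[OF that] by (auto elim!: Ints_cases)
    have "form C x x = form C x (\<Sum>i=1..l. x i \<cdot> alpha i)" by (rule arg_cong[OF hring_expand[OF xh]])
    also have "\<dots> = (\<Sum>i=1..l. x i * form C x (alpha i))" by (simp add: form_simps)
    finally have "Re (\<Sum>i=1..l. x i * form C x (alpha i)) = 2" using nrm by simp
    then have "(\<Sum>i=1..l. Re (x i * form C x (alpha i))) > 0" by simp
    \<comment> \<open>Such an index exists because (x, x) > 0. The reflection s_i lowers the height,
      and it stays among positive roots unless x is \<alpha>_i.\<close>
    then obtain i where i: "i \<in> {1..l}" "Re (x i * form C x (alpha i)) > 0"
      by (meson not_le sum_nonpos)
    obtain k where k: "form C x (alpha i) / of_nat (e i) = of_int k"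
      using short.R_form_alpha[OF xR, of i] i by (auto elim!: Ints_cases)
    have ei: "e i > 0" using e_pos i by simp
    have fk: "form C x (alpha i) = of_int (k * int (e i))" using k ei by (simp add: field_simps)
    have "Re (x i) * of_int (k * int (e i)) > 0" using i(2) unfolding fk by (subst (asm) xr[OF i(1)]) simp
    then have "k > 0" using pos[OF i(1)] ei by (simp add: zero_less_mult_iff)
    show ?case
    proof (cases "x \<in> short.Rrest i")
      case False
      from short.Rpos_split[OF i(1) less.prems(1) False] have "e i = 1" "x = alpha i"
        by (auto simp: short.simple_def short.scaled_root_def)
      then show ?thesis using i by (intro exI[of _ "[]"] exI[of _ i]) simp
    next
      case True
      have sR: "s i x \<in> short.Rpos" using short.Rrest_s[OF i(1) True] by (simp add: short.Rrest_def)
      have "s i x j = (if j = i then x j - of_int k else x j)" for j using i by (simp add: s_apply k)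
      then have "(\<Sum>j=1..l. Re (s i x j)) = (\<Sum>j=1..l. Re (x j) - (if j = i then of_int k else 0))"
        by (intro sum.cong) auto
      also have "\<dots> = of_nat n - of_int k" using i less.prems(2) by (simp add: sum_subtractf)
      finally have h: "(\<Sum>j=1..l. Re (s i x j)) = of_int (int n - k)" by simp
      have "(\<Sum>j=1..l. Re (s i x j)) \<ge> 0" using sR by (intro sum_nonneg) (auto simp: short.Rpos_def)
      then have "int n - k \<ge> 0" unfolding h by simp
      then have "(\<Sum>j=1..l. Re (s i x j)) = of_nat (nat (int n - k))" "nat (int n - k) < n" using h \<open>k > 0\<close> by auto
      from less.IH[OF this(2) sR this(1)] obtain "is" i' where
        *: "set is \<subseteq> {1..l}" "i' \<in> {1..l}" "e i' = 1" "s i x = wm is (alpha i')" by blast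
      have "x = wm (i # is) (alpha i')" using s_invol[of i x] i *(4) by (simp add: wm_Cons)
      then show ?thesis using * i by (intro exI[of _ "i # is"] exI[of _ i']) auto
    qed
  qed
  have th: "theta_root C \<in> short.Rpos"
  proof -
    have "theta_root C = delta C - alpha 0" by (simp add: theta_root_def label_eq a0)
    have "form C (theta_root C) (theta_root C) = form C (theta_root C) (delta C) - form C (theta_root C) (alpha 0)"
      by (simp add: \<open>theta_root C = delta C - alpha 0\<close> form_simps)
    also have "form C (theta_root C) (delta C) = 0" by (simp add: form_delta_right theta_apply)
    also have "form C (theta_root C) (alpha 0) = form C (delta C) (alpha 0) - form C (alpha 0) (alpha 0)"
      by (simp add: \<open>theta_root C = delta C - alpha 0\<close> form_simps)
    finally have "form C (theta_root C) (theta_root C) = 2"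
      by (simp add: form_delta_left form_alpha_alpha b_diag e0) (simp add: alpha_def)
    then show ?thesis by (auto simp: short.Rpos_def short.R_def theta_hring) (auto simp: theta_apply)
  qed
  have "(\<Sum>i=1..l. Re (theta_root C i)) = of_nat (\<Sum>i=1..l. a i)" by (simp add: theta_apply)
  from descent[OF th this] obtain "is" i where *: "set is \<subseteq> {1..l}" "i \<in> {1..l}" "e i = 1" "theta_root C = wm is (alpha i)" by blast
  have i': "set is \<subseteq> {..l}" using * by auto
  show ?thesis
  proof (rule that[of "is @ i # rev is"])
    show "wm (is @ i # rev is) x = x - form C x (theta_root C) \<cdot> theta_root C" for x
    proof -
      have "form C (wm (rev is) x) (alpha i) = form C x (theta_root C)"
        using wm_form[OF i', of "wm (rev is) x" "alpha i"] by (simp add: wm_rev'[OF i'] *(4))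
      then show ?thesis using * by (simp add: wm_append wm_Cons s_eq wm_diff wm_smul wm_rev'[OF i'])
    qed
  qed (use * in auto)
qed

section \<open>Affine reflections of the weight in an alternating sum\<close>

lemma bar_diff: "bar (x - y) = bar x - bar y" and bar_smul: "bar (k \<cdot> x) = k \<cdot> bar x"
  by (auto simp: bar_def fun_eq_iff fun_ap smul_def algebra_simps)

lemma bar_alpha0: "bar (alpha 0) = - theta_root C"
  by (auto simp: bar_def alpha_def theta_apply fun_eq_iff fun_ap)

lemma bar_hring_id: "x \<in> hring C \<Longrightarrow> bar x = x"
  by (auto simp: bar_def fun_eq_iff hring_def)

lemma bar_s: "i \<in> {1..l} \<Longrightarrow> \<mu> \<in> hstar C \<Longrightarrow> bar (s i \<mu>) = s i (bar \<mu>)"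
  by (simp add: s_eq bar_diff bar_smul bar_hring_id[OF hring_alpha] form_bar_hring[OF hring_alpha])

definition AM :: "nat \<Rightarrow> hvec \<Rightarrow> complex \<Rightarrow> hvec \<Rightarrow> complex" where
  "AM m \<mu> = AT m ((1 / of_nat m) \<cdot> bar \<mu>)"

text \<open>On projections s_0 acts as the reflection in \<theta> followed by translation by m
  \<theta>. The latter is invisible to theta functions of level m, and the former is odd.\<close>

lemma AM_s:
  assumes i: "i \<le> l" and \<mu>: "\<mu> \<in> hstar C" and lev: "\<mu> (l + 1) = of_nat m" and m: "m > 0"
  shows "AM m (s i \<mu>) \<sigma> z = - AM m \<mu> \<sigma> z"
proof (cases "i = 0")
  case False
  then have i1: "i \<in> {1..l}" using i by auto
  have "AM m (s i \<mu>) \<sigma> z = AT m (wm [i] ((1 / of_nat m) \<cdot> bar \<mu>)) \<sigma> z"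
    by (simp add: AM_def bar_s[OF i1 \<mu>] wm_Cons s_smul)
  also have "\<dots> = - AM m \<mu> \<sigma> z" using AT_wm[of "[i]" m] i1 by (simp add: AM_def)
  finally show ?thesis .
next
  case True
  obtain ts where ts: "set ts \<subseteq> {1..l}" "odd (length ts)" "\<And>x. wm ts x = x - form C x (theta_root C) \<cdot> theta_root C"
    using theta_reflection by metis
  have "form C \<mu> (alpha 0) = form C \<mu> (delta C - theta_root C)"
    by (simp add: theta_root_def label_eq a0)
  also have "\<dots> = of_nat m - form C (bar \<mu>) (theta_root C)"
    using lev by (simp add: form_simps form_delta_right form_bar_hring[OF theta_hring \<mu>])
  finally have f0: "form C \<mu> (alpha 0) = of_nat m - form C (bar \<mu>) (theta_root C)" .
  have "bar (s 0 \<mu>) = bar \<mu> + (of_nat m - form C (bar \<mu>) (theta_root C)) \<cdot> theta_root C"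
    by (simp add: s_eq e0 bar_diff bar_smul bar_alpha0 f0)
  also have "\<dots> = wm ts (bar \<mu>) + of_nat m \<cdot> theta_root C"
    by (simp add: ts(3) cfun.scale_left_diff_distrib)
  finally have "(1 / of_nat m) \<cdot> bar (s 0 \<mu>) = wm ts ((1 / of_nat m) \<cdot> bar \<mu>) + theta_root C"
    using m by (simp add: cfun.scale_right_distrib wm_smul)
  then have "AM m (s 0 \<mu>) \<sigma> z = AT m (wm ts ((1 / of_nat m) \<cdot> bar \<mu>) + theta_root C) \<sigma> z"
    by (simp add: AM_def)
  also have "\<dots> = - AM m \<mu> \<sigma> z"
    using AT_shift[OF rlat_theta] AT_wm[OF ts(1)] ts(2) by (simp add: AM_def)
  finally show ?thesis using True by simp
qed

text \<open>The orthogonal basis has rational integer coordinates, so real pairings yield real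
  coordinates; positivity is available only for the latter.\<close>

lemma rvecI:
  assumes y: "y \<in> hring C" and re: "\<And>i. i \<in> {1..l} \<Longrightarrow> form C y (alpha i) \<in> \<real>"
  shows "y \<in> rvec"
proof -
  obtain f N D c where "affine_orth C r a e f N D c" using orthogonal_basis .
  then interpret affine_orth C r a e f N D c .
  have fr: "form C y (f j) \<in> \<real>" if "j \<in> {1..l}" for j
  proof -
    have "form C y (f j) = form C y (\<Sum>i=1..l. f j i \<cdot> alpha i)" by (rule arg_cong[OF hring_expand[OF f_hring[OF that]]])
    also have "\<dots> = (\<Sum>i=1..l. f j i * form C y (alpha i))" by (simp add: form_simps)
    also have "\<dots> \<in> \<real>" using re rlat_rvec[OF f_rlat[OF that]] by (intro sum_in_Reals Reals_mult) (auto simp: rvec_def real_vec_def)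
    finally show ?thesis .
  qed
  have "(\<Sum>j=1..l. (form C y (f j) / of_nat (N j)) \<cdot> f j) i \<in> \<real>" for i
    unfolding sum_fun_apply smul_def using fr rlat_rvec[OF f_rlat]
    by (intro sum_in_Reals Reals_mult Reals_divide) (auto simp: rvec_def real_vec_def)
  then show ?thesis using f_expand[OF y] y by (simp add: rvec_def real_vec_def)
qed

lemma rho_bar_rvec: "bar (rho C) \<in> rvec"
  by (rule rvecI) (auto simp: bar_hring form_bar_hring hring_alpha rho_hstar rho_alpha)

lemma form_level0_bar: "x \<in> hstar C \<Longrightarrow> x (l + 1) = 0 \<Longrightarrow> form C x x = form C (bar x) (bar x)"
proof -
  assume x: "x \<in> hstar C" "x (l + 1) = 0"
  define y where "y = bar x"
  have y: "y (Suc l) = 0" "y (l + 1) = 0" using bar_hring[of x] by (simp_all add: y_def hring_def)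
  have "x = y + x 0 \<cdot> delta C" using bar_decomp[OF x(1)] x(2) by (simp add: y_def)
  then obtain q where q: "x = y + q \<cdot> delta C" by blast
  have z: "(y + q \<cdot> delta C) (l + 1) = 0" using y by (simp add: fun_ap smul_def delta_apply a_outside)
  have "form C x x = form C y (y + q \<cdot> delta C) + q * form C (delta C) (y + q \<cdot> delta C)"
    unfolding q by (simp only: form_add_left form_smul_left)
  also have "\<dots> = form C y y + q * form C y (delta C)"
    unfolding form_delta_left z by (simp add: form_add_right form_smul_right)
  also have "\<dots> = form C y y" using y by (simp add: form_delta_right)
  finally have "form C x x = form C y y" .
  then show ?thesis by (simp add: y_def)
qed

end

section \<open>Reduction of weights to the dominant chamber\<close>

context affine_roots
begin

text \<open>For h = e these are the integral weights; for h = 1 they are the vectors that \<tau>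
  maps to integral weights of the transposed algebra.\<close>

definition wint :: "hvec \<Rightarrow> bool" where
  "wint \<mu> \<longleftrightarrow> \<mu> \<in> hstar C \<and> (\<forall>i\<le>l. form C \<mu> (alpha i) / of_nat (h i) \<in> \<int>)"

lemma wint_alpha_int: "wint \<mu> \<Longrightarrow> i \<le> l \<Longrightarrow> form C \<mu> (alpha i) \<in> \<int>"
proof -
  assume w: "wint \<mu>" "i \<le> l"
  then have "form C \<mu> (alpha i) / of_nat (h i) \<in> \<int>" by (simp add: wint_def)
  then have "of_nat (h i) * (form C \<mu> (alpha i) / of_nat (h i)) \<in> \<int>" by (intro Ints_mult) auto
  then show ?thesis using h_pos[OF w(2)] by simp
qed

lemma wint_s:
  assumes \<mu>: "wint \<mu>" and i: "i \<le> l"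
  shows "wint (s i \<mu>)"
proof -
  have "form C (s i \<mu>) (alpha j) / of_nat (h j) \<in> \<int>" if j: "j \<le> l" for j
  proof -
    obtain k where k: "int (h i) * b j i = int (h j) * int (e i) * k" using h_step[OF i j] by (rule dvdE)
    have "(of_nat (h i) * of_int (b i j) :: complex) = of_nat (h j) * of_nat (e i) * of_int k"
      using arg_cong[OF k, of complex_of_int] b_sym[OF i j] by simp
    then have "of_int (b i j) / of_nat (e i) / of_nat (h j) = (of_int k / of_nat (h i) :: complex)"
      using h_pos[OF i] h_pos[OF j] e_pos[OF i] by (simp add: field_simps)
    then have "form C (s i \<mu>) (alpha j) / of_nat (h j) = form C \<mu> (alpha j) / of_nat (h j) - (form C \<mu> (alpha i) / of_nat (h i)) * of_int k"
      using i j by (simp add: s_eq form_simps form_alpha_alpha diff_divide_distrib) (metis (no_types, lifting) divide_divide_eq_left mult.commute times_divide_eq_right)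
    also have "\<dots> \<in> \<int>" using \<mu> i j by (intro Ints_diff Ints_mult) (auto simp: wint_def)
    finally show ?thesis .
  qed
  then show ?thesis using \<mu> i by (simp add: wint_def s_hstar)
qed

lemma bar_rvec: "wint \<mu> \<Longrightarrow> bar \<mu> \<in> rvec"
proof (rule rvecI)
  fix i assume \<mu>: "wint \<mu>" and i: "i \<in> {1..l}"
  have "form C \<mu> (alpha i) \<in> \<int>" using wint_alpha_int[OF \<mu>] i by simp
  then show "form C (bar \<mu>) (alpha i) \<in> \<real>" using \<mu> i by (auto simp: form_bar_hring[OF hring_alpha] wint_def elim!: Ints_cases)
qed (rule bar_hring)

text \<open>Reflecting in a wall on the wrong side moves \<open>\<nu>\<close> towards \<open>\<rho>\<close>: the integer part of \<open>(\<nu>, \<rho>)\<close> grows, and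
  it is bounded because \<open>\<nu> - t \<rho>\<close> has level zero for a suitable \<open>t\<close>.\<close>

theorem dominant_reduction:
  assumes "wint \<mu>" "\<mu> (l + 1) = of_nat m" "m > 0"
  shows "\<exists>\<nu> k. wint \<nu> \<and> \<nu> (l + 1) = of_nat m \<and> (\<forall>i\<le>l. Re (form C \<nu> (alpha i)) \<ge> 0) \<and> (k :: complex) * k = 1 \<and> (\<forall>\<sigma> z. AM m \<mu> \<sigma> z = k * AM m \<nu> \<sigma> z)"
proof -
  define t where "t = real m / real (dual_coxeter C)"
  have t: "t > 0" using assms(3) dual_coxeter_pos by (simp add: t_def)
  \<comment> \<open>Obtained from 0 \<le> (\<nu> - t \<rho>, \<nu> - t \<rho>), since reflections
    keep (\<nu>, \<nu>) = (\<mu>, \<mu>).\<close>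
  define K where "K = (Re (form C \<mu> \<mu>) + t\<^sup>2 * Re (form C (rho C) (rho C))) / (2 * t)"
  have bound: "Re (form C \<nu> (rho C)) \<le> K" if \<nu>: "wint \<nu>" "\<nu> (l + 1) = of_nat m" "form C \<nu> \<nu> = form C \<mu> \<mu>" for \<nu>
  proof -
    define x where "x = \<nu> - of_real t \<cdot> rho C"
    have xs: "x \<in> hstar C" using \<nu> rho_hstar by (simp add: x_def wint_def hstar_diff hstar_smul)
    have "complex_of_real t * of_nat (dual_coxeter C) = of_nat m"
    proof -
      have "t * real (dual_coxeter C) = real m" using dual_coxeter_pos by (simp add: t_def)
      then show ?thesis by (metis of_real_mult of_real_of_nat_eq)
    qed
    then have xl: "x (l + 1) = 0" using \<nu>(2) rho_level by (simp add: x_def fun_ap smul_def)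
    have "bar x \<in> rvec" unfolding x_def bar_diff bar_smul
      using bar_rvec[OF \<nu>(1)] rho_bar_rvec
      by (auto simp: rvec_def real_vec_def hring_diff hring_smul fun_ap) (auto simp: smul_def intro!: Reals_diff Reals_mult)
    then have "Re (form C x x) \<ge> 0" unfolding form_level0_bar[OF xs xl] by (rule rvec_form_nonneg(2))
    also have "form C x x = form C \<mu> \<mu> - 2 * of_real t * form C \<nu> (rho C) + (of_real t)\<^sup>2 * form C (rho C) (rho C)"
      unfolding x_def form_simps \<nu>(3) form_sym[of "rho C" \<nu>] by (simp add: power2_eq_square algebra_simps)
    also have "Re \<dots> = Re (form C \<mu> \<mu>) - 2 * t * Re (form C \<nu> (rho C)) + t\<^sup>2 * Re (form C (rho C) (rho C))"
      by (simp add: power2_eq_square)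
    finally have "Re (form C \<nu> (rho C)) * (2 * t) \<le> Re (form C \<mu> \<mu>) + t\<^sup>2 * Re (form C (rho C) (rho C))" by (simp add: mult.commute[of "Re (form C \<nu> (rho C))"])
    then show ?thesis using t by (simp add: K_def field_simps)
  qed
  have "\<exists>\<nu>' k. wint \<nu>' \<and> \<nu>' (l + 1) = of_nat m \<and> (\<forall>i\<le>l. Re (form C \<nu>' (alpha i)) \<ge> 0) \<and> (k :: complex) * k = 1 \<and> (\<forall>\<sigma> z. AM m \<nu> \<sigma> z = k * AM m \<nu>' \<sigma> z)"
    if "wint \<nu>" "\<nu> (l + 1) = of_nat m" "form C \<nu> \<nu> = form C \<mu> \<mu>" "n = nat \<lfloor>K - Re (form C \<nu> (rho C))\<rfloor>" for \<nu> n
    using that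
  proof (induction n arbitrary: \<nu> rule: less_induct)
    case (less n)
    note \<nu> = less.prems
    have \<nu>s: "\<nu> \<in> hstar C" using \<nu>(1) by (simp add: wint_def)
    show ?case
    proof (cases "\<forall>i\<le>l. Re (form C \<nu> (alpha i)) \<ge> 0")
      case True
      then show ?thesis using \<nu> by (intro exI[of _ \<nu>] exI[of _ 1]) simp
    next
      case False
      then obtain i where i: "i \<le> l" "Re (form C \<nu> (alpha i)) < 0" by (auto simp: not_le)
      obtain q where q: "form C \<nu> (alpha i) = of_int q" using wint_alpha_int[OF \<nu>(1) i(1)] by (rule Ints_cases)
      have q1: "q \<le> - 1" using i(2) q by simp
      have "form C (s i \<nu>) (rho C) = form C \<nu> (rho C) - of_int q"
        using i e_pos[of i] form_sym[of "alpha i" "rho C"] by (simp add: s_eq form_simps rho_alpha q)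
      then have R: "Re (form C (s i \<nu>) (rho C)) = Re (form C \<nu> (rho C)) - of_int q" by simp
      have s: "wint (s i \<nu>)" "s i \<nu> (l + 1) = of_nat m" "form C (s i \<nu>) (s i \<nu>) = form C \<mu> \<mu>"
        using \<nu> i wint_s by (auto simp: s_apply s_form)
      have "K - Re (form C (s i \<nu>) (rho C)) \<ge> 0" using bound[OF s] by simp
      then have "nat \<lfloor>K - Re (form C (s i \<nu>) (rho C))\<rfloor> < n" unfolding \<nu>(4) R using q1 by linarith
      from less.IH[OF this s refl] obtain \<nu>' k where
        *: "wint \<nu>'" "\<nu>' (l + 1) = of_nat m" "\<forall>i\<le>l. Re (form C \<nu>' (alpha i)) \<ge> 0" "(k :: complex) * k = 1" "\<forall>\<sigma> z. AM m (s i \<nu>) \<sigma> z = k * AM m \<nu>' \<sigma> z" by blast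
      have "AM m \<nu> \<sigma> z = - k * AM m \<nu>' \<sigma> z" for \<sigma> z
        using *(5) AM_s[OF i(1) \<nu>s \<nu>(2) assms(3), of \<sigma> z] by (metis mult_minus_left minus_equation_iff)
      then show ?thesis using * by (intro exI[of _ \<nu>'] exI[of _ "- k"]) auto
    qed
  qed
  from this[OF assms(1,2) refl refl] show ?thesis .
qed

lemma AM_wall:
  assumes "wint \<nu>" "\<nu> (l + 1) = of_nat m" "m > 0" "i \<le> l" "form C \<nu> (alpha i) = 0"
  shows "AM m \<nu> \<sigma> z = 0"
proof -
  have "s i \<nu> = \<nu>" using assms by (simp add: s_eq)
  then have "AM m \<nu> \<sigma> z = - AM m \<nu> \<sigma> z" using AM_s[of i \<nu> m \<sigma> z] assms by (simp add: wint_def)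
  then show ?thesis by simp
qed

text \<open>A dominant weight on a wall is fixed by an odd reflection, which kills the alternating
  sum. Off the walls the nonnegative integers (\<nu>, \<alpha>_i)/h_i are at least 1.\<close>

corollary regular_reduction:
  assumes "wint \<mu>" "\<mu> (l + 1) = of_nat m" "m > 0"
  shows "(\<forall>\<sigma> z. AM m \<mu> \<sigma> z = 0) \<or> (\<exists>\<nu> k. wint \<nu> \<and> \<nu> (l + 1) = of_nat m \<and> (\<forall>i\<le>l. Re (form C \<nu> (alpha i) / of_nat (h i)) \<ge> 1) \<and> (\<forall>\<sigma> z. AM m \<mu> \<sigma> z = k * AM m \<nu> \<sigma> z))"
proof -
  obtain \<nu> and k :: complex where *: "wint \<nu>" "\<nu> (l + 1) = of_nat m" "\<forall>i\<le>l. Re (form C \<nu> (alpha i)) \<ge> 0" "\<forall>\<sigma> z. AM m \<mu> \<sigma> z = k * AM m \<nu> \<sigma> z"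
    using dominant_reduction[OF assms] by metis
  show ?thesis
  proof (cases "\<exists>i\<le>l. form C \<nu> (alpha i) = 0")
    case True
    then show ?thesis using AM_wall[OF *(1,2) assms(3)] *(4) by auto
  next
    case False
    have "Re (form C \<nu> (alpha i) / of_nat (h i)) \<ge> 1" if i: "i \<le> l" for i
    proof -
      obtain q where q: "form C \<nu> (alpha i) / of_nat (h i) = of_int q" using *(1) i by (auto simp: wint_def elim!: Ints_cases)
      then have f: "form C \<nu> (alpha i) = of_int q * of_nat (h i)" using h_pos[OF i] by (simp add: field_simps)
      then have "q \<noteq> 0" "real_of_int q * of_nat (h i) \<ge> 0" using False i *(3) by auto
      then have "q \<ge> 1" using h_pos[OF i] by (simp add: zero_le_mult_iff)
      then show ?thesis unfolding q by simp
    qed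
    then show ?thesis using * by blast
  qed
qed

end

section \<open>Nonvanishing of A_\<rho> and the absence of zero divisors\<close>

context affine_lattice
begin

lemma rlat_norm_ge_2: "x \<in> rlat \<Longrightarrow> x \<noteq> 0 \<Longrightarrow> Re (form C x x) \<ge> 2"
  by (erule (1) rlat_form_pos) (auto elim!: evenE)

lemma rvec_add: "x \<in> rvec \<Longrightarrow> y \<in> rvec \<Longrightarrow> x + y \<in> rvec"
  by (auto simp: rvec_def real_vec_def hring_add fun_ap)

lemma rvec_smul_real: "x \<in> rvec \<Longrightarrow> of_real q \<cdot> x \<in> rvec"
  by (auto simp: rvec_def real_vec_def hring_smul) (simp add: smul_def)

text \<open>Follows from s_i \<rho> = \<rho> - \<alpha>_i; it supplies the lattice hypothesis of
  \<open>TH_imaginary_limit\<close> for \<gamma> = w p.\<close>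

lemma wm_rho_move:
  assumes "set is \<subseteq> {1..l}"
  shows "wm is (bar (rho C)) - bar (rho C) \<in> rlat"
  using assms
proof (induction "is")
  case (Cons i js)
  let ?R = "bar (rho C)"
  have i: "i \<in> {1..l}" and js: "set js \<subseteq> {1..l}" using Cons.prems by auto
  have "s i ?R = ?R - alpha i"
    using i e_pos[of i] by (simp add: s_eq form_bar_hring[OF hring_alpha rho_hstar] rho_alpha)
  then have "wm (i # js) ?R - ?R = s i (wm js ?R - ?R) - alpha i"
    by (simp add: wm_Cons s_diff)
  then show ?case using rlat_diff[OF rlat_s[OF i Cons.IH[OF js]] rlat_alpha[OF i]] by simp
qed (simp add: rlat_zero)

text \<open>Completing the square: with z = - \<sigma> p the terms become Gaussians centred at p,
  after a factor common to all of them.\<close>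

lemma E_imaginary:
  "E m \<gamma> (\<i> * of_real t) (- (\<i> * of_real t) \<cdot> p)
    = exp (of_real pi * of_nat m * of_real t * form C p p) * exp (- (of_real pi * of_nat m * of_real t * form C (\<gamma> - p) (\<gamma> - p)))"
proof -
  have "of_real pi * \<i> * of_nat m * (\<i> * of_real t * form C \<gamma> \<gamma> + 2 * form C \<gamma> (- (\<i> * of_real t) \<cdot> p))
    = of_real pi * of_nat m * of_real t * form C p p + - (of_real pi * of_nat m * of_real t * form C (\<gamma> - p) (\<gamma> - p))"
    unfolding form_simps form_sym[of p \<gamma>] by (simp add: algebra_simps)
  then show ?thesis unfolding E_def exp_add[symmetric] by (rule arg_cong)
qed

text \<open>After normalization only a term with \<gamma> + \<beta> = p keeps the value 1; the
  others decay uniformly because their norms are bounded away from zero.\<close>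

lemma TH_imaginary_limit:
  assumes \<gamma>: "\<gamma> \<in> rvec" and p: "p \<in> rvec" and m: "m > 0" and mp: "of_nat m \<cdot> (\<gamma> - p) \<in> rlat"
  shows "((\<lambda>t. exp (- (of_real pi * of_nat m * of_real t * form C p p)) * TH m \<gamma> (\<i> * of_real t) (- (\<i> * of_real t) \<cdot> p))
    \<longlongrightarrow> (if p - \<gamma> \<in> rlat then 1 else 0)) at_top"
proof -
  define n where "n \<beta> = Re (form C (\<gamma> + \<beta> - p) (\<gamma> + \<beta> - p))" for \<beta>
  have rv: "\<gamma> + \<beta> - p \<in> rvec" if "\<beta> \<in> rlat" for \<beta>
    using \<gamma> p rlat_rvec[OF that] by (auto simp: rvec_def real_vec_def hring_add hring_diff fun_ap)
  have fn: "form C (\<gamma> + \<beta> - p) (\<gamma> + \<beta> - p) = of_real (n \<beta>)" if "\<beta> \<in> rlat" for \<beta>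
    using rvec_form_nonneg(1)[OF rv[OF that]] by (simp add: n_def)
  have hr: "\<gamma> \<in> hring C" "p \<in> hring C" using \<gamma> p by (auto simp: rvec_def)
  define g where "g t \<beta> = exp (- (pi * real m * t * n \<beta>))" for t \<beta>
  have Eg: "exp (- (of_real pi * of_nat m * of_real t * form C p p)) * E m (\<gamma> + \<beta>) (\<i> * of_real t) (- (\<i> * of_real t) \<cdot> p) = of_real (g t \<beta>)"
    if "\<beta> \<in> rlat" for t \<beta>
    unfolding E_imaginary fn[OF that] g_def exp_of_real[symmetric] by (simp add: exp_minus)
  have eq: "exp (- (of_real pi * of_nat m * of_real t * form C p p)) * TH m \<gamma> (\<i> * of_real t) (- (\<i> * of_real t) \<cdot> p)
     = (\<Sum>\<^sub>\<infinity>\<beta>\<in>rlat. of_real (g t \<beta>))" for t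
    unfolding TH_def infsum_cmult_right'[symmetric] by (intro infsum_cong Eg)
  have summ: "(\<lambda>\<beta>. g t \<beta>) summable_on rlat" if t: "t > 0" for t
  proof -
    have "(\<lambda>\<beta>. norm (E m (\<gamma> + \<beta>) (\<i> * of_real t) (- (\<i> * of_real t) \<cdot> p))) summable_on rlat"
      by (rule E_summable) (use hr t m in \<open>auto intro: hring_smul simp del: cfun.scale_minus_left\<close>)
    from summable_on_cmult_right[OF this, of "norm (exp (- (of_real pi * of_nat m * of_real t * form C p p)))"]
    have "(\<lambda>\<beta>. norm (exp (- (of_real pi * of_nat m * of_real t * form C p p)) * E m (\<gamma> + \<beta>) (\<i> * of_real t) (- (\<i> * of_real t) \<cdot> p))) summable_on rlat"
      by (simp only: norm_mult)
    moreover have "norm (exp (- (of_real pi * of_nat m * of_real t * form C p p)) * E m (\<gamma> + \<beta>) (\<i> * of_real t) (- (\<i> * of_real t) \<cdot> p)) = g t \<beta>"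
      if "\<beta> \<in> rlat" for \<beta> unfolding Eg[OF that] by (simp add: g_def)
    ultimately show ?thesis by (subst (asm) summable_on_cong[of rlat _ "g t"]) auto
  qed
  define S where "S = {\<beta> \<in> rlat. \<gamma> + \<beta> = p}"
  have S: "S = (if p - \<gamma> \<in> rlat then {p - \<gamma>} else {})" unfolding S_def by (auto simp: algebra_simps)
  have finS: "finite S" unfolding S by simp
  \<comment> \<open>The vector m (\<gamma> + \<beta> - p) is a nonzero element of M, hence of norm
    at least 2.\<close>
  define q where "q = 2 / (real m)\<^sup>2"
  have q: "q > 0" using m by (simp add: q_def)
  have gap: "n \<beta> \<ge> q" if \<beta>: "\<beta> \<in> rlat - S" for \<beta>
  proof -
    define y where "y = of_nat m \<cdot> (\<gamma> + \<beta> - p)"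
    have "y = of_nat m \<cdot> (\<gamma> - p) + of_int (int m) \<cdot> \<beta>" by (simp add: y_def cfun.scale_right_distrib cfun.scale_right_diff_distrib)
    then have yr: "y \<in> rlat" using mp \<beta> by (auto intro!: rlat_add rlat_int_smul)
    have ny: "form C y y = of_real ((real m)\<^sup>2 * n \<beta>)"
      using fn[of \<beta>] \<beta> by (simp add: y_def form_smul_left form_smul_right power2_eq_square mult.assoc)
    have "y \<noteq> 0"
    proof
      assume "y = 0"
      then have "\<gamma> + \<beta> - p = 0" using m by (simp add: y_def)
      then have "\<gamma> + \<beta> = p" by (simp only: right_minus_eq)
      then show False using \<beta> by (simp add: S_def)
    qed
    then have y2: "Re (form C y y) \<ge> 2" using rlat_norm_ge_2[OF yr] by simp
    then have "(real m)\<^sup>2 * n \<beta> \<ge> 2" unfolding ny by simp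
    then show ?thesis using m by (simp add: q_def field_simps)
  qed
  define K where "K = (\<Sum>\<^sub>\<infinity>\<beta>\<in>rlat - S. g 1 \<beta>)"
  have sub: "(\<lambda>\<beta>. g t \<beta>) summable_on (rlat - S)" if "t > 0" for t
    using summable_on_subset_banach[OF summ[OF that]] by auto
  \<comment> \<open>Only t - 1 of the exponent is spent on the decay; the part at t = 1 is kept for
    the convergent sum K.\<close>
  have bnd: "norm ((\<Sum>\<^sub>\<infinity>\<beta>\<in>rlat. of_real (g t \<beta>)) - (if p - \<gamma> \<in> rlat then 1 else 0 :: complex)) \<le> exp (- (pi * real m * (t - 1) * q)) * K" if t: "t \<ge> 1" for t
  proof -
    have t0: "t > 0" using t by simp
    have "(\<Sum>\<^sub>\<infinity>\<beta>\<in>rlat. g t \<beta>) = (\<Sum>\<^sub>\<infinity>\<beta>\<in>S \<union> (rlat - S). g t \<beta>)" by (rule infsum_cong_neutral) (auto simp: S_def)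
    also have "\<dots> = (\<Sum>\<^sub>\<infinity>\<beta>\<in>S. g t \<beta>) + (\<Sum>\<^sub>\<infinity>\<beta>\<in>rlat - S. g t \<beta>)"
      by (rule infsum_Un_disjoint) (use finS sub[OF t0] in auto)
    also have "(\<Sum>\<^sub>\<infinity>\<beta>\<in>S. g t \<beta>) = (\<Sum>\<beta>\<in>S. 1)"
      using finS by (auto simp: g_def n_def S_def intro!: sum.cong)
    also have "\<dots> = (if p - \<gamma> \<in> rlat then 1 else 0)" by (simp add: S)
    finally have split: "(\<Sum>\<^sub>\<infinity>\<beta>\<in>rlat. g t \<beta>) - (if p - \<gamma> \<in> rlat then 1 else 0) = (\<Sum>\<^sub>\<infinity>\<beta>\<in>rlat - S. g t \<beta>)" by simp
    have "(\<Sum>\<^sub>\<infinity>\<beta>\<in>rlat - S. g t \<beta>) \<le> (\<Sum>\<^sub>\<infinity>\<beta>\<in>rlat - S. exp (- (pi * real m * (t - 1) * q)) * g 1 \<beta>)"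
    proof (rule infsum_mono)
      fix \<beta> assume \<beta>: "\<beta> \<in> rlat - S"
      have "pi * real m * (t - 1) * q \<le> pi * real m * (t - 1) * n \<beta>" using gap[OF \<beta>] t by (intro mult_left_mono) auto
      then show "g t \<beta> \<le> exp (- (pi * real m * (t - 1) * q)) * g 1 \<beta>"
        unfolding g_def exp_add[symmetric] by (simp add: algebra_simps)
    qed (use sub[OF t0] sub[of 1] in \<open>auto intro: summable_on_cmult_right\<close>)
    also have "\<dots> = exp (- (pi * real m * (t - 1) * q)) * K" by (simp add: K_def infsum_cmult_right')
    finally have le: "(\<Sum>\<^sub>\<infinity>\<beta>\<in>rlat - S. g t \<beta>) \<le> exp (- (pi * real m * (t - 1) * q)) * K" .
    have ge: "(\<Sum>\<^sub>\<infinity>\<beta>\<in>rlat - S. g t \<beta>) \<ge> 0" by (rule infsum_nonneg) (simp add: g_def)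
    have "(\<Sum>\<^sub>\<infinity>\<beta>\<in>rlat. complex_of_real (g t \<beta>)) - (if p - \<gamma> \<in> rlat then 1 else 0) = of_real (\<Sum>\<^sub>\<infinity>\<beta>\<in>rlat - S. g t \<beta>)"
      unfolding infsumI[OF has_sum_of_real[OF has_sum_infsum[OF summ[OF t0]]]] split[symmetric] by simp
    then show ?thesis using le ge by simp
  qed
  have lim: "((\<lambda>t. exp (- (pi * real m * (t - 1) * q)) * K) \<longlongrightarrow> 0) at_top"
    using q m by real_asymp
  have "((\<lambda>t. (\<Sum>\<^sub>\<infinity>\<beta>\<in>rlat. of_real (g t \<beta>)) - (if p - \<gamma> \<in> rlat then 1 else 0 :: complex)) \<longlongrightarrow> 0) at_top"
    by (rule Lim_null_comparison[OF _ lim]) (use bnd in \<open>auto intro!: eventually_at_top_linorderI[of 1]\<close>)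
  then show ?thesis unfolding eq by (rule LIM_zero_cancel)
qed

text \<open>Along \<open>\<sigma> = it\<close>, \<open>z = - it \<rho>/h\<^sup>\<or>\<close> with \<open>t \<rightarrow> \<infinity>\<close> only the terms with \<open>w \<rho> \<equiv> \<rho>\<close> modulo \<open>h\<^sup>\<or> M\<close> survive, and they all
  carry the sign \<open>+1\<close>.\<close>

theorem AM_rho_nonzero: "\<exists>\<sigma> z. Im \<sigma> > 0 \<and> z \<in> hring C \<and> AM (dual_coxeter C) (rho C) \<sigma> z \<noteq> 0"
proof (rule ccontr)
  assume contra: "\<not> ?thesis"
  define m where "m = dual_coxeter C"
  have m: "m > 0" using dual_coxeter_pos by (simp add: m_def)
  define p where "p = (1 / of_nat m) \<cdot> bar (rho C)"
  have mp: "of_nat m \<cdot> p = bar (rho C)" using m by (simp add: p_def)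
  have pr: "p \<in> rvec" unfolding p_def using rvec_smul_real[OF rho_bar_rvec, of "1 / real m"] by simp
  obtain g where g: "\<And>i \<gamma>. i \<in> {1..l} \<Longrightarrow> (g :: hvec \<Rightarrow> complex) (s i \<gamma>) = - g \<gamma>"
    "\<And>\<beta> \<gamma>. \<beta> \<in> rlat \<Longrightarrow> g (\<gamma> + \<beta>) = g \<gamma>" "g p \<noteq> 0"
    using sign_function unfolding p_def m_def by metis
  let ?x = "\<lambda>t. exp (- (of_real pi * of_nat m * of_real t * form C p p))"
  have W: "w p \<in> rvec \<and> of_nat m \<cdot> (w p - p) \<in> rlat \<and> (p - w p \<in> rlat \<longrightarrow> weyl_sign C w = 1)" if "w \<in> W" for w
  proof -
    obtain "is" where w: "w = wm is" and i: "set is \<subseteq> {1..l}" using W_cases \<open>w \<in> W\<close> by blast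
    have "of_nat m \<cdot> (w p - p) = wm is (bar (rho C)) - bar (rho C)"
      by (simp add: w cfun.scale_right_diff_distrib wm_smul[symmetric] mp)
    then have 1: "of_nat m \<cdot> (w p - p) \<in> rlat" using wm_rho_move[OF i] by simp
    have "w p = (1 / of_nat m) \<cdot> (of_nat m \<cdot> (w p - p)) + p" using m by simp
    moreover have "(1 / of_nat m) \<cdot> (of_nat m \<cdot> (w p - p)) + p \<in> rvec"
      using rvec_add[OF rvec_smul_real[OF rlat_rvec[OF 1], of "1 / real m"] pr] by simp
    ultimately have 2: "w p \<in> rvec" by (simp only:)
    \<comment> \<open>The lattice-periodic alternating function g takes the same nonzero value at p
      and w p, which excludes an odd w.\<close>
    have "weyl_sign C w = 1" if d: "p - w p \<in> rlat"
    proof -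
      have "g (w p + (p - w p)) = g (w p)" by (rule g(2)[OF d])
      then have "g p = (- 1) ^ length is * g p" using sign_function_wm[of g "is" p, OF g(1) i] by (simp add: w)
      then show ?thesis using g(3) weyl_sign_wm[OF i] by (simp add: w)
    qed
    then show ?thesis using 1 2 by blast
  qed
  have "((\<lambda>t. \<Sum>w\<in>W. weyl_sign C w * (?x t * TH m (w p) (\<i> * of_real t) (- (\<i> * of_real t) \<cdot> p)))
     \<longlongrightarrow> (\<Sum>w\<in>W. weyl_sign C w * (if p - w p \<in> rlat then 1 else 0))) at_top"
    using W by (intro tendsto_sum tendsto_mult tendsto_const TH_imaginary_limit pr m) auto
  moreover have "(\<Sum>w\<in>W. weyl_sign C w * (?x t * TH m (w p) (\<i> * of_real t) (- (\<i> * of_real t) \<cdot> p))) = 0" if "t > 0" for t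
  proof -
    have "(\<Sum>w\<in>W. weyl_sign C w * (?x t * TH m (w p) (\<i> * of_real t) (- (\<i> * of_real t) \<cdot> p)))
      = ?x t * AM m (rho C) (\<i> * of_real t) (- (\<i> * of_real t) \<cdot> p)"
      by (simp add: AM_def AT_def p_def[symmetric] sum_distrib_left mult_ac)
    also have "AM m (rho C) (\<i> * of_real t) (- (\<i> * of_real t) \<cdot> p) = 0"
    proof -
      have "- (\<i> * of_real t) \<cdot> p \<in> hring C" using pr by (intro hring_smul) (simp add: rvec_def)
      then show ?thesis using contra that unfolding m_def by (metis Im_i_times Re_complex_of_real)
    qed
    finally show ?thesis by simp
  qed
  ultimately have "((\<lambda>t. 0) \<longlongrightarrow> (\<Sum>w\<in>W. weyl_sign C w * (if p - w p \<in> rlat then 1 else 0))) (at_top :: real filter)"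
    by (elim Lim_transform_eventually) (intro eventually_mono[OF eventually_gt_at_top[of "0::real"]])
  then have "0 = (\<Sum>w\<in>W. weyl_sign C w * (if p - w p \<in> rlat then 1 else 0))"
    using tendsto_unique[OF trivial_limit_at_top_linorder tendsto_const] by blast
  also have "\<dots> = (\<Sum>w\<in>{w \<in> W. p - w p \<in> rlat}. 1)"
    using W finite_W by (intro sum.mono_neutral_cong_right) auto
  finally have "card {w \<in> W. p - w p \<in> rlat} = 0" by simp
  then show False using finite_W id_W by (auto simp: rlat_zero)
qed

text \<open>Holomorphy in several variables is replaced by holomorphy on complex lines, which
  suffices for an identity theorem and stays within one variable.\<close>

definition line_holomorphic :: "(complex \<Rightarrow> hvec \<Rightarrow> complex) \<Rightarrow> bool" where
  "line_holomorphic F \<longleftrightarrow> (\<forall>\<sigma> \<tau> z w. z \<in> hring C \<longrightarrow> w \<in> hring C \<longrightarrow>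
     (\<lambda>s. F (\<sigma> + s * \<tau>) (z + s \<cdot> w)) holomorphic_on {s. Im (\<sigma> + s * \<tau>) > 0})"

lemma open_line_domain: "open {s. Im (\<sigma> + s * \<tau>) > 0}"
  by (intro open_Collect_less continuous_intros)

lemma TH_line_holomorphic:
  assumes "\<gamma> \<in> hring C" "m > 0"
  shows "line_holomorphic (TH m \<gamma>)"
  unfolding line_holomorphic_def
proof (intro allI impI)
  fix \<sigma> \<tau> z w assume zw: "z \<in> hring C" "w \<in> hring C"
  define A where "A \<beta> = of_real pi * \<i> * of_nat m * (\<sigma> * form C (\<gamma> + \<beta>) (\<gamma> + \<beta>) + 2 * form C (\<gamma> + \<beta>) z)" for \<beta>
  define B where "B \<beta> = of_real pi * \<i> * of_nat m * (\<tau> * form C (\<gamma> + \<beta>) (\<gamma> + \<beta>) + 2 * form C (\<gamma> + \<beta>) w)" for \<beta>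
  have E: "E m (\<gamma> + \<beta>) (\<sigma> + s * \<tau>) (z + s \<cdot> w) = exp (A \<beta> + B \<beta> * s)" for s \<beta>
    unfolding E_def A_def B_def form_add_right form_smul_right by (rule arg_cong[of _ _ exp]) (simp add: algebra_simps)
  have "(\<lambda>s. \<Sum>\<^sub>\<infinity>\<beta>\<in>rlat. exp (A \<beta> + B \<beta> * s)) holomorphic_on {s. Im (\<sigma> + s * \<tau>) > 0}"
  proof (rule holomorphic_infsum_exp[OF open_line_domain])
    fix s assume "s \<in> {s. Im (\<sigma> + s * \<tau>) > 0}"
    then show "(\<lambda>\<beta>. norm (exp (A \<beta> + B \<beta> * s))) summable_on rlat"
      unfolding E[symmetric] using assms zw by (intro E_summable) (auto intro: hring_add hring_smul)
  qed
  then show "(\<lambda>s. TH m \<gamma> (\<sigma> + s * \<tau>) (z + s \<cdot> w)) holomorphic_on {s. Im (\<sigma> + s * \<tau>) > 0}"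
    unfolding TH_def E .
qed

lemma line_holomorphic_sum:
  assumes "\<And>i. i \<in> I \<Longrightarrow> line_holomorphic (F i)"
  shows "line_holomorphic (\<lambda>\<sigma> z. \<Sum>i\<in>I. k i * F i \<sigma> z)"
  using assms unfolding line_holomorphic_def by (auto intro!: holomorphic_on_sum holomorphic_on_mult)

lemma AT_line_holomorphic: "\<gamma> \<in> hring C \<Longrightarrow> m > 0 \<Longrightarrow> line_holomorphic (AT m \<gamma>)"
proof -
  assume *: "\<gamma> \<in> hring C" "m > 0"
  have "line_holomorphic (\<lambda>\<sigma> z. \<Sum>w\<in>W. weyl_sign C w * TH m (w \<gamma>) \<sigma> z)"
  proof (intro line_holomorphic_sum TH_line_holomorphic *(2))
    fix w assume "w \<in> W"
    then show "w \<gamma> \<in> hring C" using W_cases wm_hring *(1) by blast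
  qed
  then show ?thesis unfolding AT_def[abs_def] .
qed

lemma AM_line_holomorphic: "m > 0 \<Longrightarrow> line_holomorphic (AM m \<mu>)"
  unfolding AM_def by (intro AT_line_holomorphic hring_smul bar_hring)

text \<open>The complex line through the given point (s = 0) and the point where G \<noteq> 0 (s =
  1) meets the domain in a convex set. There F vanishes on the nonempty open set where G does not,
  hence throughout.\<close>

lemma line_holomorphic_domain:
  assumes F: "line_holomorphic F" and G: "line_holomorphic G"
    and FG: "\<And>\<sigma> z. Im \<sigma> > 0 \<Longrightarrow> z \<in> hring C \<Longrightarrow> F \<sigma> z * G \<sigma> z = 0"
    and nz: "Im \<sigma>1 > 0" "z1 \<in> hring C" "G \<sigma>1 z1 \<noteq> 0"
    and p: "Im \<sigma> > 0" "z \<in> hring C"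
  shows "F \<sigma> z = 0"
proof -
  define \<tau> w where "\<tau> = \<sigma>1 - \<sigma>" and "w = z1 - z"
  have w: "w \<in> hring C" unfolding w_def using nz(2) p(2) by (rule hring_diff)
  define U where "U = {s. Im (\<sigma> + s * \<tau>) > 0}"
  define f g where "f s = F (\<sigma> + s * \<tau>) (z + s \<cdot> w)" and "g s = G (\<sigma> + s * \<tau>) (z + s \<cdot> w)" for s
  have hol: "f holomorphic_on U" "g holomorphic_on U"
    using F G p(2) w unfolding line_holomorphic_def U_def f_def g_def by blast+
  have U: "open U" unfolding U_def by (rule open_line_domain)
  have "convex U"
  proof (rule convexI)
    fix x y u v assume xy: "x \<in> U" "y \<in> U" and uv: "0 \<le> u" "0 \<le> v" "u + v = (1::real)"
    have "\<sigma> + (u *\<^sub>R x + v *\<^sub>R y) * \<tau> = u *\<^sub>R (\<sigma> + x * \<tau>) + v *\<^sub>R (\<sigma> + y * \<tau>)"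
      using uv(3) by (simp add: scaleR_conv_of_real algebra_simps flip: of_real_add distrib_right) (metis mult.commute mult_1 of_real_1 of_real_add distrib_right)
    then have "Im (\<sigma> + (u *\<^sub>R x + v *\<^sub>R y) * \<tau>) = u * Im (\<sigma> + x * \<tau>) + v * Im (\<sigma> + y * \<tau>)" by simp
    also have "\<dots> > 0" using xy uv unfolding U_def
      using uv(3) by (cases "u = 0") (auto intro!: add_pos_nonneg)
    finally show "u *\<^sub>R x + v *\<^sub>R y \<in> U" by (simp add: U_def)
  qed
  then have conn: "connected U" by (rule convex_connected)
  have g1: "1 \<in> U" "g 1 \<noteq> 0" using nz by (auto simp: U_def g_def \<tau>_def w_def)
  have opn: "open {s \<in> U. g s \<noteq> 0}"
  proof -
    have "open (U \<inter> g -` (- {0}))"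
      by (rule continuous_open_preimage[OF holomorphic_on_imp_continuous_on[OF hol(2)] U]) auto
    moreover have "U \<inter> g -` (- {0}) = {s \<in> U. g s \<noteq> 0}" by auto
    ultimately show ?thesis by simp
  qed
  have f0: "f s = 0" if "s \<in> {s \<in> U. g s \<noteq> 0}" for s
    using FG[of "\<sigma> + s * \<tau>" "z + s \<cdot> w"] that p(2) w by (auto simp: U_def f_def g_def hring_add hring_smul)
  have "f 0 = 0"
  proof (rule analytic_continuation_open[where f = f and g = "\<lambda>_. 0" and z = 0, OF opn U _ conn _ hol(1)])
    show "{s \<in> U. g s \<noteq> 0} \<noteq> {}" using g1 by blast
    show "0 \<in> U" using p(1) by (simp add: U_def)
    show "(\<lambda>_. 0) holomorphic_on U" by simp
  qed (use f0 in auto)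
  then show ?thesis by (simp add: f_def)
qed

end

section \<open>Linear combinations and antisymmetrization\<close>

context affine_lattice
begin

text \<open>Membership in a span, with equality demanded only for Im \<sigma> > 0 and z in
  \<open>hring\<close>. The inductive form allows the generating family to be exchanged term by
  term.\<close>

inductive lincomb :: "('x \<Rightarrow> complex \<Rightarrow> hvec \<Rightarrow> complex) \<Rightarrow> ('x \<Rightarrow> bool) \<Rightarrow> (complex \<Rightarrow> hvec \<Rightarrow> complex) \<Rightarrow> bool"
  for B :: "'x \<Rightarrow> complex \<Rightarrow> hvec \<Rightarrow> complex" and P :: "'x \<Rightarrow> bool" where
  zero: "(\<And>\<sigma> z. Im \<sigma> > 0 \<Longrightarrow> z \<in> hring C \<Longrightarrow> F \<sigma> z = 0) \<Longrightarrow> lincomb B P F"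
| step: "lincomb B P F \<Longrightarrow> P x \<Longrightarrow> (\<And>\<sigma> z. Im \<sigma> > 0 \<Longrightarrow> z \<in> hring C \<Longrightarrow> G \<sigma> z = F \<sigma> z + k * B x \<sigma> z) \<Longrightarrow> lincomb B P G"

lemma lincomb_cong: "lincomb B P F \<Longrightarrow> (\<And>\<sigma> z. Im \<sigma> > 0 \<Longrightarrow> z \<in> hring C \<Longrightarrow> G \<sigma> z = F \<sigma> z) \<Longrightarrow> lincomb B P G"
proof (induction rule: lincomb.induct)
  case (step F x F' k)
  show ?case by (rule lincomb.step[where F = F, OF step.hyps(1,2)]) (use step in auto)
qed (auto intro: lincomb.zero)

lemma lincomb_add: "lincomb B P F \<Longrightarrow> lincomb B P G \<Longrightarrow> lincomb B P (\<lambda>\<sigma> z. F \<sigma> z + G \<sigma> z)"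
proof (induction rule: lincomb.induct)
  case (zero F)
  then show ?case by (auto intro: lincomb_cong[OF zero.prems])
next
  case (step F x F' k)
  show ?case by (rule lincomb.step[OF step.IH[OF step.prems] step.hyps(2)]) (use step.hyps(3) in auto)
qed

lemma lincomb_scale: "lincomb B P F \<Longrightarrow> lincomb B P (\<lambda>\<sigma> z. q * F \<sigma> z)"
proof (induction rule: lincomb.induct)
  case (step F x F' k)
  show ?case by (rule lincomb.step[OF step.IH step.hyps(2), of _ "q * k"]) (use step.hyps(3) in \<open>auto simp: algebra_simps\<close>)
qed (auto intro: lincomb.zero)

lemma lincomb_base: "P x \<Longrightarrow> lincomb B P (B x)"
  by (rule lincomb.step[where F = "\<lambda>_ _. 0" and k = 1]) (auto intro: lincomb.zero)

lemma lincomb_sum: "(\<And>i. i \<in> I \<Longrightarrow> lincomb B P (F i)) \<Longrightarrow> lincomb B P (\<lambda>\<sigma> z. \<Sum>i\<in>I. k i * F i \<sigma> z)"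
proof (induction I rule: infinite_finite_induct)
  case (insert i I)
  then show ?case using lincomb_add[OF lincomb_scale[of B P "F i" "k i"] insert.IH] by simp
qed (auto intro: lincomb.zero)

lemma lincomb_trans: "lincomb B P F \<Longrightarrow> (\<And>x. P x \<Longrightarrow> lincomb B' P' (B x)) \<Longrightarrow> lincomb B' P' F"
proof (induction rule: lincomb.induct)
  case (step F x F' k)
  show ?case
    by (rule lincomb_cong[OF lincomb_add[OF step.IH[OF step.prems] lincomb_scale[OF step.prems[OF step.hyps(2)], of k]]])
      (use step.hyps(3) in auto)
qed (auto intro: lincomb.zero)

lemma sum_W_inv:
  "(\<Sum>w\<in>W. F (inv w) w) = (\<Sum>w\<in>W. F w (inv w))"
proof -
  have inv: "inv w \<in> W \<and> inv (inv w) = w" if "w \<in> W" for w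
  proof -
    obtain "is" where w: "w = wm is" and i: "set is \<subseteq> {1..l}" using W_cases \<open>w \<in> W\<close> by blast
    have i': "set is \<subseteq> {..l}" using i by auto
    have "bij w" unfolding w by (rule o_bij[of "wm (rev is)"]) (auto simp: fun_eq_iff wm_rev[OF i'] wm_rev'[OF i'] simp del: split_paired_All)
    moreover have "inv w = wm (rev is)" unfolding w by (rule inv_equality) (auto simp: wm_rev[OF i'] wm_rev'[OF i'])
    ultimately show ?thesis using W_wm[of "rev is"] i by (metis inv_inv_eq set_rev)
  qed
  show ?thesis by (rule sum.reindex_bij_witness[of _ inv inv]) (use inv in auto)
qed

definition average :: "(complex \<Rightarrow> hvec \<Rightarrow> complex) \<Rightarrow> complex \<Rightarrow> hvec \<Rightarrow> complex" where
  "average F \<sigma> z = (\<Sum>w\<in>W. weyl_sign C w * F \<sigma> (w z))"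

text \<open>The Weyl group preserves M and the form, so acting on z is acting inversely on the
  characteristic; w and its inverse have the same sign.\<close>

lemma average_TH: "average (TH m \<gamma>) = AT m \<gamma>"
proof (intro ext)
  fix \<sigma> z
  have W: "weyl_sign C (inv w) = weyl_sign C w \<and> TH m \<gamma> \<sigma> (w z) = TH m (inv w \<gamma>) \<sigma> z" if "w \<in> W" for w
  proof -
    obtain "is" where w: "w = wm is" and i: "set is \<subseteq> {1..l}" using W_cases \<open>w \<in> W\<close> by blast
    have i': "set is \<subseteq> {..l}" using i by auto
    have inv: "inv w = wm (rev is)" unfolding w by (rule inv_equality) (auto simp: wm_rev[OF i'] wm_rev'[OF i'])
    have "TH m (wm is (wm (rev is) \<gamma>)) \<sigma> (wm is z) = TH m (wm (rev is) \<gamma>) \<sigma> z" by (rule TH_wm[OF i])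
    then have "TH m \<gamma> \<sigma> (w z) = TH m (inv w \<gamma>) \<sigma> z" unfolding inv by (simp add: w wm_rev'[OF i'])
    moreover have "weyl_sign C (inv w) = weyl_sign C w" unfolding inv using w weyl_sign_wm[of "rev is"] weyl_sign_wm[OF i] i by simp
    ultimately show ?thesis by blast
  qed
  have "average (TH m \<gamma>) \<sigma> z = (\<Sum>w\<in>W. weyl_sign C (inv w) * TH m (inv w \<gamma>) \<sigma> z)"
    unfolding average_def by (intro sum.cong refl) (simp add: W)
  also have "\<dots> = AT m \<gamma> \<sigma> z"
    unfolding AT_def using sum_W_inv[of "\<lambda>w _. weyl_sign C w * TH m (w \<gamma>) \<sigma> z"] sum_W_inv[of "\<lambda>_ w. weyl_sign C w * TH m (w \<gamma>) \<sigma> z"] by simp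
  finally show "average (TH m \<gamma>) \<sigma> z = AT m \<gamma> \<sigma> z" .
qed

lemma W_hring: "w \<in> W \<Longrightarrow> z \<in> hring C \<Longrightarrow> w z \<in> hring C"
  using W_cases wm_hring by blast

lemma lincomb_average: "lincomb (TH m) P F \<Longrightarrow> lincomb (AT m) P (average F)"
proof (induction rule: lincomb.induct)
  case (zero F)
  then show ?case by (intro lincomb.zero) (simp add: average_def W_hring)
next
  case (step F x G k)
  show ?case
  proof (rule lincomb.step[where F = "average F" and x = x and k = k])
    fix \<sigma> z assume "Im \<sigma> > 0" "z \<in> hring C"
    then have "average G \<sigma> z = (\<Sum>w\<in>W. weyl_sign C w * (F \<sigma> (w z) + k * TH m x \<sigma> (w z)))"
      unfolding average_def by (intro sum.cong refl) (simp add: W_hring step.hyps(3))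
    also have "\<dots> = average F \<sigma> z + k * average (TH m x) \<sigma> z"
      by (simp add: average_def algebra_simps sum.distrib sum_distrib_left)
    finally show "average G \<sigma> z = average F \<sigma> z + k * AT m x \<sigma> z" by (simp add: average_TH)
  qed (use step in auto)
qed

lemma alternating_average:
  assumes "\<And>is. set is \<subseteq> {1..l} \<Longrightarrow> F \<sigma> (wm is z) = (- 1) ^ length is * F \<sigma> z"
  shows "average F \<sigma> z = of_nat (card W) * F \<sigma> z"
proof -
  have "weyl_sign C w * F \<sigma> (w z) = F \<sigma> z" if "w \<in> W" for w
  proof -
    obtain "is" where w: "w = wm is" and i: "set is \<subseteq> {1..l}" using W_cases \<open>w \<in> W\<close> by blast
    show ?thesis unfolding w weyl_sign_wm[OF i] assms[OF i] by (rule sign_square)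
  qed
  then show ?thesis by (simp add: average_def)
qed

lemma lift_nonzero:
  assumes "a' * d' - b' * c' = (1::int)" "lift_of c' d' j" "Im \<sigma> > 0"
  shows "j \<sigma> \<noteq> 0" "of_int c' * \<sigma> + of_int d' \<noteq> 0"
proof -
  show "of_int c' * \<sigma> + of_int d' \<noteq> (0::complex)" by (rule moebius_Im(1)[OF assms(1,3)])
  then show "j \<sigma> \<noteq> 0" using assms(2,3) by (auto simp: lift_of_def)
qed

end

section \<open>Modular transformation of alternating sums\<close>

context affine_roots
begin

definition regular :: "nat \<Rightarrow> hvec \<Rightarrow> bool" where
  "regular m \<nu> \<longleftrightarrow> wint \<nu> \<and> \<nu> (l + 1) = of_nat m \<and> (\<forall>i\<le>l. Re (form C \<nu> (alpha i) / of_nat (h i)) \<ge> 1)"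

lemma wint_wm: "set is \<subseteq> {..l} \<Longrightarrow> wint \<mu> \<Longrightarrow> wint (wm is \<mu>)"
  by (induction "is") (auto simp: wm_Cons wint_s)

lemma bar_wm: "set is \<subseteq> {1..l} \<Longrightarrow> \<mu> \<in> hstar C \<Longrightarrow> bar (wm is \<mu>) = wm is (bar \<mu>)"
proof (induction "is")
  case (Cons i js)
  then have "wm js \<mu> \<in> hstar C" by (intro wm_hstar) auto
  then show ?case using Cons by (simp add: wm_Cons bar_s)
qed simp

lemma fint_bar:
  assumes "wint \<mu>" "m > 0"
  shows "fint h m ((1 / of_nat m) \<cdot> bar \<mu>)"
  using assms by (auto simp: fint_def wint_def hring_smul bar_hring form_simps form_bar_hring[OF hring_alpha])

text \<open>Adding m \<Lambda>_0 gives the right level. Integrality at node 0 is inherited from the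
  other nodes: (\<gamma>, \<delta>) = 0 expresses (\<gamma>, \<alpha>_0) through them, and h_0
  divides e_0 = 1.\<close>

lemma fint_weight:
  assumes \<gamma>: "fint h m \<gamma>" and m: "m > 0"
  obtains \<nu> where "wint \<nu>" "\<nu> (l + 1) = of_nat m" "AM m \<nu> = AT m \<gamma>"
proof
  define \<nu> where "\<nu> = of_nat m \<cdot> \<gamma> + of_nat m \<cdot> Lambda0 C"
  have \<gamma>h: "\<gamma> \<in> hring C" using \<gamma> by (simp add: fint_def)
  show "\<nu> (l + 1) = of_nat m" using \<gamma>h by (simp add: \<nu>_def fun_ap smul_def Lambda0_def hring_def)
  have "bar \<nu> = of_nat m \<cdot> \<gamma>" using \<gamma>h by (auto simp: bar_def \<nu>_def fun_ap smul_def Lambda0_def hring_def fun_eq_iff)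
  then show "AM m \<nu> = AT m \<gamma>" using m by (simp add: AM_def)
  have hs: "\<nu> \<in> hstar C" using \<gamma>h by (auto simp: \<nu>_def hstar_def hring_def fun_ap smul_def Lambda0_def)
  have f: "form C \<nu> (alpha i) = of_nat m * form C \<gamma> (alpha i) + (if i = 0 then of_nat m else 0)" for i
    by (simp add: \<nu>_def form_simps form_sym[of "Lambda0 C"] Lambda0_form alpha_def)
  have pos: "of_nat m * form C \<gamma> (alpha i) / of_nat (h i) \<in> \<int>" if "i \<in> {1..l}" for i using \<gamma> that by (simp add: fint_def)
  have "h 0 = 1" using h_e[of 0] e0 by simp
  have "0 = form C \<gamma> (delta C)" using \<gamma>h by (simp add: form_delta_right hring_def)
  also have "\<dots> = (\<Sum>i\<le>l. of_nat (a i) * form C \<gamma> (alpha i))" by (simp add: delta_def form_simps label_eq)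
  also have "{..l} = insert 0 {1..l}" by auto
  finally have "form C \<gamma> (alpha 0) = - (\<Sum>i=1..l. of_nat (a i) * form C \<gamma> (alpha i))" by (simp add: a0 eq_neg_iff_add_eq_0)
  then have "of_nat m * form C \<gamma> (alpha 0) = - (\<Sum>i=1..l. of_nat (a i) * (of_nat m * form C \<gamma> (alpha i)))"
    by (simp add: sum_distrib_left mult_ac)
  also have "\<dots> \<in> \<int>"
  proof (rule Ints_minus[OF Ints_sum], rule Ints_mult[OF Ints_of_nat])
    fix i assume i: "i \<in> {1..l}"
    have "of_nat (h i) * (of_nat m * form C \<gamma> (alpha i) / of_nat (h i)) \<in> \<int>" by (rule Ints_mult[OF Ints_of_nat pos[OF i]])
    then show "of_nat m * form C \<gamma> (alpha i) \<in> \<int>" using h_pos[of i] i by simp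
  qed
  finally have "of_nat m * form C \<gamma> (alpha 0) \<in> \<int>" .
  then have "form C \<nu> (alpha i) / of_nat (h i) \<in> \<int>" if "i \<le> l" for i
    using pos[of i] that \<open>h 0 = 1\<close> by (cases "i = 0") (auto simp: f)
  then show "wint \<nu>" using hs by (simp add: wint_def)
qed

text \<open>\<open>TH_slash\<close> transforms the summands into theta functions with unrelated
  characteristics. Their combination is alternating, so it equals its own antisymmetrization up to
  the factor |W|, which replaces each theta function by an alternating sum.\<close>

theorem AM_slash:
  assumes det: "a' * d' - b' * c' = (1::int)" and j: "lift_of c' d' j" and m: "m > 0"
    and \<mu>: "wint \<mu>" "\<mu> (l + 1) = of_nat m"
    and hc: "\<And>i. i \<in> {1..l} \<Longrightarrow> int (h i) dvd c'" "\<And>i. i \<in> {1..l} \<Longrightarrow> (int (h i))\<^sup>2 dvd c' * int (e i)"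
  obtains F where "lincomb (AM m) (regular m) F"
    "\<And>\<sigma> z. Im \<sigma> > 0 \<Longrightarrow> z \<in> hring C \<Longrightarrow> slash m a' b' c' d' (AM m \<mu>) \<sigma> z = j \<sigma> ^ l * F \<sigma> z"
proof -
  have val: "valid h" using h_pos h_e by (auto simp: valid_def)
  have \<mu>s: "\<mu> \<in> hstar C" using \<mu>(1) by (simp add: wint_def)
  define \<gamma> where "\<gamma> = (1 / of_nat m) \<cdot> bar \<mu>"
  have "\<exists>F. lincomb (TH m) (fint h m) F \<and> (\<forall>\<sigma> z. Im \<sigma> > 0 \<longrightarrow> z \<in> hring C \<longrightarrow> slash m a' b' c' d' (TH m (w \<gamma>)) \<sigma> z = j \<sigma> ^ l * F \<sigma> z)"
    if w: "w \<in> W" for w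
  proof -
    obtain "is" where w: "w = wm is" and i: "set is \<subseteq> {1..l}" using W_cases \<open>w \<in> W\<close> by blast
    have "wint (wm is \<mu>)" using i by (intro wint_wm \<mu>) auto
    moreover have "w \<gamma> = (1 / of_nat m) \<cdot> bar (wm is \<mu>)" by (simp add: w \<gamma>_def wm_smul bar_wm[OF i \<mu>s])
    ultimately have "fint h m (w \<gamma>)" using fint_bar m by simp
    from TH_slash[OF det j m val this hc] obtain I :: "(nat \<Rightarrow> nat) set" and K G where
      *: "finite I" "\<forall>n\<in>I. fint h m (G n)" "\<forall>\<sigma> z. Im \<sigma> > 0 \<longrightarrow> z \<in> hring C \<longrightarrow>
      slash m a' b' c' d' (TH m (w \<gamma>)) \<sigma> z = j \<sigma> ^ l * (\<Sum>n\<in>I. K n * TH m (G n) \<sigma> z)" by blast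
    have "lincomb (TH m) (fint h m) (\<lambda>\<sigma> z. \<Sum>n\<in>I. K n * TH m (G n) \<sigma> z)"
      using *(2) by (intro lincomb_sum lincomb_base) auto
    then show ?thesis using *(3) by blast
  qed
  then obtain F where F: "\<And>w. w \<in> W \<Longrightarrow> lincomb (TH m) (fint h m) (F w)"
    "\<And>w \<sigma> z. w \<in> W \<Longrightarrow> Im \<sigma> > 0 \<Longrightarrow> z \<in> hring C \<Longrightarrow> slash m a' b' c' d' (TH m (w \<gamma>)) \<sigma> z = j \<sigma> ^ l * F w \<sigma> z"
    by metis
  define G where "G \<sigma> z = (\<Sum>w\<in>W. weyl_sign C w * F w \<sigma> z)" for \<sigma> z
  have G: "slash m a' b' c' d' (AM m \<mu>) \<sigma> z = j \<sigma> ^ l * G \<sigma> z" if "Im \<sigma> > 0" "z \<in> hring C" for \<sigma> z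
  proof -
    have "slash m a' b' c' d' (AM m \<mu>) \<sigma> z = (\<Sum>w\<in>W. weyl_sign C w * slash m a' b' c' d' (TH m (w \<gamma>)) \<sigma> z)"
      by (simp add: slash_def AM_def AT_def \<gamma>_def sum_distrib_right sum_distrib_left mult_ac)
    also have "\<dots> = (\<Sum>w\<in>W. weyl_sign C w * (j \<sigma> ^ l * F w \<sigma> z))"
      using that by (intro sum.cong refl) (simp add: F(2))
    finally show ?thesis by (simp add: G_def sum_distrib_left mult_ac)
  qed
  \<comment> \<open>In the slash operation z occurs linearly and through the invariant form, so the
    sign behaviour in z survives.\<close>
  have alt: "G \<sigma> (wm is z) = (- 1) ^ length is * G \<sigma> z" if \<sigma>: "Im \<sigma> > 0" and z: "z \<in> hring C" and i: "set is \<subseteq> {1..l}" for \<sigma> z "is"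
  proof -
    have i': "set is \<subseteq> {..l}" using i by auto
    have "slash m a' b' c' d' (AM m \<mu>) \<sigma> (wm is z) = (- 1) ^ length is * slash m a' b' c' d' (AM m \<mu>) \<sigma> z"
      unfolding slash_def AM_def wm_form[OF i'] wm_smul[symmetric] AT_z[OF i] by simp
    then have "j \<sigma> ^ l * G \<sigma> (wm is z) = j \<sigma> ^ l * ((- 1) ^ length is * G \<sigma> z)"
      using G[OF \<sigma> z] G[OF \<sigma> wm_hring[OF i z]] by simp
    then show ?thesis using lift_nonzero(1)[OF det j \<sigma>] by simp
  qed
  have cW: "card W > 0" using finite_W id_W card_gt_0_iff by blast
  have "lincomb (TH m) (fint h m) G" unfolding G_def by (intro lincomb_sum F(1))
  then have "lincomb (AT m) (fint h m) (\<lambda>\<sigma> z. (1 / of_nat (card W)) * average G \<sigma> z)"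
    by (intro lincomb_scale lincomb_average)
  then have cAT: "lincomb (AT m) (fint h m) G"
    by (rule lincomb_cong) (use alternating_average[of G] alt cW in auto)
  have "lincomb (AM m) (regular m) G"
  proof (rule lincomb_trans[OF cAT])
    fix \<gamma>' assume "fint h m \<gamma>'"
    then obtain \<nu> where \<nu>: "wint \<nu>" "\<nu> (l + 1) = of_nat m" "AM m \<nu> = AT m \<gamma>'" using fint_weight m by metis
    show "lincomb (AM m) (regular m) (AT m \<gamma>')"
      using regular_reduction[OF \<nu>(1,2) m]
    proof
      assume "\<forall>\<sigma> z. AM m \<nu> \<sigma> z = 0"
      then show ?thesis by (intro lincomb.zero) (simp add: \<nu>(3))
    next
      assume "\<exists>\<nu>' k. wint \<nu>' \<and> \<nu>' (l + 1) = of_nat m \<and> (\<forall>i\<le>l. Re (form C \<nu>' (alpha i) / of_nat (h i)) \<ge> 1) \<and> (\<forall>\<sigma> z. AM m \<nu> \<sigma> z = k * AM m \<nu>' \<sigma> z)"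
      then obtain \<nu>' k where "regular m \<nu>'" "\<forall>\<sigma> z. AM m \<nu> \<sigma> z = k * AM m \<nu>' \<sigma> z" unfolding regular_def by blast
      then show ?thesis using lincomb_cong[OF lincomb_scale[OF lincomb_base[of "regular m" \<nu>' "AM m"], of k]] by (simp add: \<nu>(3))
    qed
  qed
  then show ?thesis using that G by blast
qed

text \<open>At the level of \<open>\<rho>\<^sub>h\<close> the only regular weight is \<open>\<rho>\<^sub>h\<close> itself, up to multiples of \<open>\<delta>\<close>.\<close>

lemma regular_minimal:
  assumes \<nu>: "regular m \<nu>" and m: "m = (\<Sum>i\<le>l. a i * h i)"
    and ro: "ro \<in> hstar C" "\<And>i. i \<le> l \<Longrightarrow> form C ro (alpha i) = of_nat (h i)"
  shows "AM m \<nu> = AM m ro"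
proof -
  have nh: "\<nu> \<in> hstar C" and int: "\<And>i. i \<le> l \<Longrightarrow> form C \<nu> (alpha i) / of_nat (h i) \<in> \<int>"
    and ge: "\<And>i. i \<le> l \<Longrightarrow> Re (form C \<nu> (alpha i) / of_nat (h i)) \<ge> 1" and lev: "\<nu> (l + 1) = of_nat m"
    using \<nu> by (auto simp: regular_def wint_def)
  define x where "x i = Re (form C \<nu> (alpha i) / of_nat (h i))" for i
  have x: "form C \<nu> (alpha i) = of_nat (h i) * of_real (x i)" if "i \<le> l" for i
    using int[OF that] h_pos[OF that] by (auto simp: x_def field_simps elim!: Ints_cases)
  have "complex_of_real (\<Sum>i\<le>l. real (a i * h i) * x i) = (\<Sum>i\<le>l. of_nat (a i) * form C \<nu> (alpha i))"
    unfolding of_real_sum by (intro sum.cong refl) (simp add: x mult.assoc)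
  also have "\<dots> = of_real (\<Sum>i\<le>l. real (a i * h i))" using level_sum[of \<nu>] lev by (simp add: m)
  finally have "(\<Sum>i\<le>l. real (a i * h i) * x i) = (\<Sum>i\<le>l. real (a i * h i))" unfolding of_real_eq_iff .
  then have s0: "(\<Sum>i\<le>l. real (a i * h i) * (x i - 1)) = 0" by (simp add: algebra_simps sum_subtractf)
  have "x i = 1" if i: "i \<le> l" for i
  proof -
    have "real (a i * h i) * (x i - 1) = 0"
      using sum_nonneg_0[OF finite_atMost _ s0, of i] ge i by (auto simp: x_def)
    then show ?thesis using a_pos[OF i] h_pos[OF i] by simp
  qed
  then have "bar \<nu> = bar ro" using x ro by (intro hstar_eq_bar(2) nh) auto
  then show ?thesis by (simp add: AM_def)
qed

text \<open>Used for h = e and \<rho>, where m is the dual Coxeter number, and for h = 1 and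
  \<rho>', where m is the Coxeter number.\<close>

corollary AM_minimal_slash:
  assumes det: "a' * d' - b' * c' = (1::int)" and j: "lift_of c' d' j"
    and m: "m = (\<Sum>i\<le>l. a i * h i)"
    and ro: "ro \<in> hstar C" "\<And>i. i \<le> l \<Longrightarrow> form C ro (alpha i) = of_nat (h i)"
    and hc: "\<And>i. i \<in> {1..l} \<Longrightarrow> int (h i) dvd c'" "\<And>i. i \<in> {1..l} \<Longrightarrow> (int (h i))\<^sup>2 dvd c' * int (e i)"
  obtains q where "\<And>\<sigma> z. Im \<sigma> > 0 \<Longrightarrow> z \<in> hring C \<Longrightarrow> slash m a' b' c' d' (AM m ro) \<sigma> z = j \<sigma> ^ l * q * AM m ro \<sigma> z"
proof -
  have "m \<ge> a 0 * h 0" unfolding m by (rule member_le_sum) auto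
  then have m0: "m > 0" using a_pos[of 0] h_pos[of 0] by (metis bot_nat_0.extremum le_zero_eq mult_is_0 neq0_conv)
  have w: "wint ro" using ro h_pos by (simp add: wint_def)
  have lev: "ro (l + 1) = of_nat m" using level_sum[of ro] ro by (simp add: m)
  obtain F where F: "lincomb (AM m) (regular m) F"
    "\<And>\<sigma> z. Im \<sigma> > 0 \<Longrightarrow> z \<in> hring C \<Longrightarrow> slash m a' b' c' d' (AM m ro) \<sigma> z = j \<sigma> ^ l * F \<sigma> z"
    by (rule AM_slash[OF det j m0 w lev hc]) (assumption | rule that)+
  have "\<exists>q. \<forall>\<sigma> z. Im \<sigma> > 0 \<longrightarrow> z \<in> hring C \<longrightarrow> F \<sigma> z = q * AM m ro \<sigma> z"
    using F(1)
  proof (induction rule: lincomb.induct)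
    case (step F \<nu> G k)
    then obtain q where "\<forall>\<sigma> z. Im \<sigma> > 0 \<longrightarrow> z \<in> hring C \<longrightarrow> F \<sigma> z = q * AM m ro \<sigma> z" by blast
    then show ?case using step.hyps(3) regular_minimal[OF step.hyps(2) m ro] by (intro exI[of _ "q + k"]) (auto simp: algebra_simps)
  qed (auto intro!: exI[of _ 0])
  then show ?thesis using that F(2) by (metis mult.assoc)
qed

text \<open>X is invertible: at \<sigma>' = X^-1 \<sigma> and z' = (c \<sigma>' + d) z the transform
  evaluates F at a point where it is nonzero.\<close>

lemma slash_scalar_nonzero:
  assumes det: "a' * d' - b' * c' = (1::int)"
    and q: "\<And>\<sigma> z. Im \<sigma> > 0 \<Longrightarrow> z \<in> hring C \<Longrightarrow> slash m a' b' c' d' F \<sigma> z = j \<sigma> ^ l * q * F \<sigma> z"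
    and nz: "Im \<sigma> > 0" "z \<in> hring C" "F \<sigma> z \<noteq> 0"
  shows "q \<noteq> 0"
proof
  assume "q = 0"
  define \<sigma>' where "\<sigma>' = (of_int d' * \<sigma> - of_int b') / (- of_int c' * \<sigma> + of_int a')"
  have J: "- of_int c' * \<sigma> + of_int a' \<noteq> (0::complex)"
  proof
    assume 0: "- of_int c' * \<sigma> + of_int a' = (0::complex)"
    then have "Im (- of_int c' * \<sigma> + of_int a') = 0" by simp
    then have "c' = 0" using nz(1) by simp
    then show False using 0 det by simp
  qed
  have "of_int d' * of_int a' - of_int b' * of_int c' = (1 :: complex)"
    using arg_cong[OF det, of complex_of_int] by (simp add: mult.commute)
  note detc = this
  have "of_int c' * (of_int d' * \<sigma> - of_int b') + of_int d' * (- of_int c' * \<sigma> + of_int a') = (1::complex)"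
    using detc by (simp add: algebra_simps)
  then have K: "of_int c' * \<sigma>' + of_int d' = 1 / (- of_int c' * \<sigma> + of_int a')"
    using J by (simp add: \<sigma>'_def field_simps)
  have "of_int a' * (of_int d' * \<sigma> - of_int b') + of_int b' * (- of_int c' * \<sigma> + of_int a') = \<sigma>"
    using arg_cong[OF detc, of "\<lambda>x. x * \<sigma>"] by (simp add: algebra_simps)
  then have "of_int a' * \<sigma>' + of_int b' = \<sigma> / (- of_int c' * \<sigma> + of_int a')"
    using J by (simp add: \<sigma>'_def field_simps)
  then have inv_pt: "(of_int a' * \<sigma>' + of_int b') / (of_int c' * \<sigma>' + of_int d') = \<sigma>"
    unfolding K using J by simp
  have im: "Im \<sigma>' > 0" unfolding \<sigma>'_def
    using moebius_Im[of d' a' "- b'" "- c'" \<sigma>] det nz(1) by (simp add: algebra_simps)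
  define z' where "z' = (of_int c' * \<sigma>' + of_int d') \<cdot> z"
  have z': "z' \<in> hring C" using nz(2) by (simp add: z'_def hring_smul)
  have "(1 / (of_int c' * \<sigma>' + of_int d')) \<cdot> z' = z" using J by (simp add: z'_def K)
  then have "slash m a' b' c' d' F \<sigma>' z' \<noteq> 0" unfolding slash_def inv_pt using nz(3) by simp
  then show False using q[OF im z'] \<open>q = 0\<close> by simp
qed

end

section \<open>The transposed algebra\<close>

lemma group_closure_image:
  fixes f :: "'a :: ab_group_add \<Rightarrow> 'b :: ab_group_add"
  assumes diff: "\<And>x y. f (x - y) = f x - f y"
  shows "group_closure (f ` S) = f ` group_closure S"
proof (intro equalityI subsetI)
  have zero: "f 0 = 0" using diff[of 0 0] by simp
  fix x
  show "x \<in> f ` group_closure S" if "x \<in> group_closure (f ` S)"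
    using that
  proof induction
    case (base s)
    then obtain s' where "s' \<in> insert 0 S" "s = f s'" using zero by force
    then show ?case by (blast intro: group_closure.base)
  next
    case (diff s t)
    then obtain s' t' where "s = f s'" "t = f t'" "s' \<in> group_closure S" "t' \<in> group_closure S" by blast
    then show ?case by (auto simp: assms[symmetric] intro: group_closure.diff)
  qed
  show "x \<in> group_closure (f ` S)" if x: "x \<in> f ` group_closure S"
  proof -
    obtain y where y: "x = f y" "y \<in> group_closure S" using x by blast
    have "f y \<in> group_closure (f ` S)" using y(2)
    proof induction
      case (base s)
      then show ?case using zero by (auto intro: group_closure.base)
    next
      case (diff s t)
      then show ?case by (simp add: assms group_closure.diff)
    qed
    then show ?thesis by (simp add: y)
  qed
qed

context affine_lattice
begin

abbreviation Ct :: gcm where "Ct \<equiv> transposed C"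

text \<open>\<open>up\<close> extends \<open>\<tau>\<close> from \<open>\<hh>\<^sup>*\<close> to a bijection of all coordinate sequences, on which the Weyl groups are defined.\<close>

definition up :: "hvec \<Rightarrow> hvec" where "up x = (\<lambda>i. if i \<le> l then of_nat (e i) * x i else x i)"

definition dn :: "hvec \<Rightarrow> hvec" where "dn x = (\<lambda>i. if i \<le> l then x i / of_nat (e i) else x i)"

lemma up_dn [simp]: "up (dn x) = x" and dn_up [simp]: "dn (up x) = x"
  using e_pos by (auto simp: up_def dn_def fun_eq_iff)

lemma inj_up: "inj up" by (metis injI dn_up)

lemma up_add: "up (x + y) = up x + up y" and up_diff: "up (x - y) = up x - up y" and up_smul: "up (k \<cdot> x) = k \<cdot> up x"
  by (auto simp: up_def dn_def fun_ap smul_def fun_eq_iff algebra_simps)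

lemma up_hstar: "up x \<in> hstar Ct \<longleftrightarrow> x \<in> hstar C" and up_hring: "up x \<in> hring Ct \<longleftrightarrow> x \<in> hring C"
proof -
  show "up x \<in> hstar Ct \<longleftrightarrow> x \<in> hstar C"
    by (auto simp: up_def hstar_def transposed_def)
  have "up x i = 0 \<longleftrightarrow> x i = 0" for i using e_pos[of i] by (auto simp: up_def)
  then show "up x \<in> hring Ct \<longleftrightarrow> x \<in> hring C" by (auto simp: hring_def transposed_def)
qed

lemma rk_Ct [simp]: "rk Ct = l" by (simp add: transposed_def)

lemma ent_Ct: "ent Ct i j = ent C j i" by (simp add: transposed_def)

lemma label_Ct: "label Ct i = e i * a i"
  using colabel_eq by (simp add: colabel_def)

lemma colabel_Ct: "colabel Ct i = a i"
proof -
  have "transposed Ct = C" by (cases C) (simp add: transposed_def)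
  then show ?thesis by (simp add: colabel_def label_eq)
qed

lemma tau_eq: "x \<in> hstar C \<Longrightarrow> tau C x = up x"
proof
  fix j assume x: "x \<in> hstar C"
  have "(\<Sum>i\<le>l. (of_nat (colabel C i) / of_nat (label C i) * x i) \<cdot> alpha i) j = (\<Sum>i\<le>l. if i = j then of_nat (e j) * x j else 0)"
    unfolding sum_fun_apply using a_pos by (intro sum.cong refl) (auto simp: smul_def alpha_def colabel_eq label_eq)
  then show "tau C x j = up x j"
    using x by (auto simp: tau_def fun_ap smul_def Lambda0_def up_def hstar_def e0 a0 colabel_eq label_eq)
qed

lemma form_up: "form Ct (up x) (up y) = form C x y"
proof -
  have "(\<Sum>i\<le>l. \<Sum>j\<le>l. of_nat (colabel Ct i) / of_nat (label Ct i) * of_int (ent Ct i j) * up x i * up y j)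
    = (\<Sum>i\<le>l. \<Sum>j\<le>l. of_nat (colabel C i) / of_nat (label C i) * of_int (ent C i j) * x i * y j)"
  proof (intro sum.cong refl)
    fix i j assume ij: "i \<in> {..l}" "j \<in> {..l}"
    have "(of_int (int (e j) * ent C j i) :: complex) = of_int (int (e i) * ent C i j)" using ent_sym[of j i] ij by simp
    then have *: "(of_nat (e j) * of_int (ent C j i) :: complex) = of_nat (e i) * of_int (ent C i j)" by simp
    have "of_nat (colabel Ct i) / of_nat (label Ct i) * of_int (ent Ct i j) * up x i * up y j = (of_nat (e j) * of_int (ent C j i)) * x i * y j"
      using ij e_pos[of i] a_pos[of i] by (simp add: label_Ct colabel_Ct up_def ent_Ct)
    also have "\<dots> = of_nat (colabel C i) / of_nat (label C i) * of_int (ent C i j) * x i * y j"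
      unfolding * using ij a_pos[of i] by (simp add: label_eq colabel_eq)
    finally show "of_nat (colabel Ct i) / of_nat (label Ct i) * of_int (ent Ct i j) * up x i * up y j
      = of_nat (colabel C i) / of_nat (label C i) * of_int (ent C i j) * x i * y j" .
  qed
  moreover have "(up x 0 * up y (l + 1) + up x (l + 1) * up y 0) / of_nat (label Ct 0) = (x 0 * y (l + 1) + x (l + 1) * y 0) / of_nat (label C 0)"
    by (simp add: up_def e0 a0 label_Ct label_eq)
  ultimately show ?thesis unfolding form_def rk_Ct by simp
qed

lemma coroot_Ct: "i \<le> l \<Longrightarrow> coroot Ct i = up (alpha i)"
  using a_pos[of i] by (auto simp: coroot_def label_Ct colabel_Ct up_def smul_def alpha_def fun_eq_iff)

lemma alpha_dn: "i \<le> l \<Longrightarrow> alpha i = up (coroot C i)"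
  using e_pos[of i] by (auto simp: coroot_eq up_def smul_def alpha_def fun_eq_iff)

lemma delta_Ct: "delta Ct = up (delta C)"
proof
  fix j
  have "delta Ct j = (\<Sum>i\<le>l. if i = j then of_nat (e j * a j) else 0)"
    unfolding delta_def sum_fun_apply rk_Ct by (intro sum.cong) (auto simp: smul_def alpha_def label_Ct)
  then show "delta Ct j = up (delta C) j" using a_outside[of j] by (auto simp: up_def delta_apply)
qed

lemma Lambda0_Ct: "Lambda0 Ct = up (Lambda0 C)"
  by (auto simp: Lambda0_def up_def fun_eq_iff)

lemma level_Ct: "level Ct (up x) = level C x"
proof -
  have "canonical_K Ct = delta Ct"
    unfolding canonical_K_def delta_def rk_Ct
  proof (intro sum.cong refl)
    fix i assume "i \<in> {..l}"
    then show "of_nat (colabel Ct i) \<cdot> coroot Ct i = of_nat (label Ct i) \<cdot> alpha i"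
      using a_pos[of i] by (simp add: coroot_def colabel_Ct label_Ct)
  qed
  then show ?thesis by (simp add: level_def delta_Ct form_up canonical_K_eq)
qed

lemma reflection_Ct: "i \<le> l \<Longrightarrow> reflection Ct i (up x) = up (s i x)"
proof -
  assume i: "i \<le> l"
  have al: "alpha i = (1 / of_nat (e i)) \<cdot> up (alpha i)"
    using alpha_dn[OF i] unfolding coroot_eq[OF i] up_smul .
  have "reflection Ct i (up x) = up x - form C x (alpha i) \<cdot> alpha i"
    by (simp add: reflection_def coroot_Ct[OF i] form_up)
  moreover have "up (s i x) = up x - form C x (alpha i) \<cdot> ((1 / of_nat (e i)) \<cdot> up (alpha i))"
    by (simp add: s_eq[OF i] up_diff up_smul)
  ultimately show ?thesis unfolding al[symmetric] by simp
qed

lemma word_map_Ct: "set is \<subseteq> {1..l} \<Longrightarrow> word_map Ct is = up \<circ> wm is \<circ> dn"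
proof (induction "is")
  case (Cons i js)
  then have "word_map Ct (i # js) x = reflection Ct i (up (wm js (dn x)))" for x by (simp add: word_map_def)
  then show ?case using Cons.prems by (auto simp: reflection_Ct wm_Cons fun_eq_iff)
qed (auto simp: word_map_def)

lemma word_map_Ct_eq:
  assumes "set is \<subseteq> {1..l}" "set js \<subseteq> {1..l}"
  shows "word_map Ct is = word_map Ct js \<longleftrightarrow> wm is = wm js"
proof
  assume eq: "word_map Ct is = word_map Ct js"
  show "wm is = wm js"
  proof
    fix x
    have "up (wm is (dn (up x))) = up (wm js (dn (up x)))"
      using fun_cong[OF eq[unfolded word_map_Ct[OF assms(1)] word_map_Ct[OF assms(2)]], of "up x"] by simp
    then show "wm is x = wm js x" by (simp add: inj_eq[OF inj_up])
  qed
qed (simp add: word_map_Ct assms)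

lemma fin_weyl_Ct: "fin_weyl Ct = (\<lambda>w. up \<circ> w \<circ> dn) ` W"
proof -
  have "fin_weyl Ct = (\<lambda>is. word_map Ct is) ` {is. set is \<subseteq> {1..l}}" by (auto simp: fin_weyl_def)
  also have "\<dots> = (\<lambda>is. up \<circ> wm is \<circ> dn) ` {is. set is \<subseteq> {1..l}}" by (intro image_cong refl) (simp add: word_map_Ct)
  also have "\<dots> = (\<lambda>w. up \<circ> w \<circ> dn) ` W" by (auto simp: fin_weyl_def)
  finally show ?thesis .
qed

text \<open>Conjugation by \<open>up\<close> respects equality of words, hence minimal
  lengths.\<close>

lemma weyl_sign_Ct: "w \<in> W \<Longrightarrow> weyl_sign Ct (up \<circ> w \<circ> dn) = weyl_sign C w"
proof -
  assume "w \<in> W"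
  then obtain "is" where w: "w = wm is" "set is \<subseteq> {1..l}" using W_cases by blast
  have "up \<circ> w \<circ> dn = word_map Ct is" by (simp add: w word_map_Ct)
  moreover have "word_map Ct js = word_map Ct is \<longleftrightarrow> wm js = wm is" if "set js \<subseteq> {1..l}" for js
    by (rule word_map_Ct_eq[OF that w(2)])
  then have "weyl_length Ct (word_map Ct is) = weyl_length C (wm is)"
    unfolding weyl_length_def rk_Ct by (intro arg_cong[of _ _ Least] ext) blast
  ultimately show ?thesis by (simp add: weyl_sign_def w)
qed

lemma inj_conj: "inj_on (\<lambda>w. up \<circ> w \<circ> dn) W"
proof
  fix w w' assume eq: "up \<circ> w \<circ> dn = up \<circ> w' \<circ> dn"
  show "w = w'"
  proof
    fix x
    have "dn ((up \<circ> w \<circ> dn) (up x)) = dn ((up \<circ> w' \<circ> dn) (up x))" by (simp only: eq)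
    then show "w x = w' x" by simp
  qed
qed

lemma theta_root_Ct: "theta_root Ct = up (theta_root C)"
proof -
  have "alpha 0 = up (alpha 0)" by (auto simp: up_def alpha_def e0 fun_eq_iff)
  then show ?thesis by (simp add: theta_root_def delta_Ct up_diff label_Ct label_eq e0 a0 up_smul)
qed

lemma latticeM_Ct: "latticeM Ct = up ` latticeM C"
proof -
  have "{w ((1 / of_nat (label Ct 0)) \<cdot> theta_root Ct) |w. w \<in> fin_weyl Ct} = up ` {w ((1 / of_nat (label C 0)) \<cdot> theta_root C) |w. w \<in> fin_weyl C}"
    unfolding fin_weyl_Ct Setcompr_eq_image image_image by (simp add: label_Ct label_eq e0 a0 theta_root_Ct)
  then show ?thesis unfolding latticeM_def by (simp only: group_closure_image[of up, OF up_diff])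
qed

lemma Y_Ct: "v \<in> Y Ct \<longleftrightarrow> dn v \<in> Y C"
  using up_hstar[of "dn v"] form_up[of "dn v" "delta C"] by (simp add: Y_def delta_Ct)

lemma translation_Ct: "translation Ct (up \<beta>) (up x) = up (translation C \<beta> x)"
  by (simp add: translation_def level_Ct form_up up_add up_diff up_smul delta_Ct)

lemma Theta_Ct: "Theta Ct (up \<mu>) v = Theta C \<mu> (dn v)"
proof (cases "v \<in> Y Ct")
  case True
  have f: "form Ct (up x) v = form C x (dn v)" for x using form_up[of x "dn v"] by simp
  have "(\<Sum>\<^sub>\<infinity>\<beta>\<in>latticeM Ct. exp (form Ct (translation Ct \<beta> (up \<mu>)) v))
    = (\<Sum>\<^sub>\<infinity>\<beta>\<in>latticeM C. exp (form C (translation C \<beta> \<mu>) (dn v)))"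
    unfolding latticeM_Ct using inj_up by (subst infsum_reindex) (auto simp: o_def translation_Ct f inj_on_def)
  then show ?thesis using True Y_Ct[of v] by (simp add: Theta_def form_up level_Ct delta_Ct f)
qed (simp add: Theta_def Y_Ct)

lemma alt_theta_Ct: "alt_theta Ct (up \<mu>) v = alt_theta C \<mu> (dn v)"
proof -
  have "alt_theta Ct (up \<mu>) v = (\<Sum>w\<in>W. (weyl_sign Ct (up \<circ> w \<circ> dn) \<cdot> Theta Ct ((up \<circ> w \<circ> dn) (up \<mu>))) v)"
    unfolding alt_theta_def sum_fun_apply fin_weyl_Ct by (subst sum.reindex[OF inj_conj]) simp
  also have "\<dots> = (\<Sum>w\<in>W. (weyl_sign C w \<cdot> Theta C (w \<mu>)) (dn v))"
    by (intro sum.cong refl) (simp add: smul_def weyl_sign_Ct Theta_Ct)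
  finally show ?thesis by (simp add: alt_theta_def sum_fun_apply)
qed

section \<open>Points of Y in the coordinates (\<sigma>, z, u)\<close>

lemma hring_Ct_iff: "z \<in> hring Ct \<longleftrightarrow> dn z \<in> hring C"
  using up_hring[of "dn z"] by simp

lemma point_Ct: "point Ct (\<sigma>, z, u) = up (point C (\<sigma>, dn z, u))"
  by (simp add: point_def up_smul up_add up_diff Lambda0_Ct delta_Ct)

lemma act_Ct: "act Ct X (\<sigma>, up z, u) = (case act C X (\<sigma>, z, u) of (\<sigma>', z', u') \<Rightarrow> (\<sigma>', up z', u'))"
  by (simp add: act_def up_smul form_up)

lemma point_apply: "point C (\<sigma>, z, u) = (2 * of_real pi * \<i>) \<cdot> (z - \<sigma> \<cdot> Lambda0 C + u \<cdot> delta C)"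
  by (simp add: point_def)

lemma point_coords:
  assumes "z \<in> hring C"
  shows "point C (\<sigma>, z, u) (l + 1) = - (2 * of_real pi * \<i> * \<sigma>)" "point C (\<sigma>, z, u) 0 = 2 * of_real pi * \<i> * u"
    "bar (point C (\<sigma>, z, u)) = (2 * of_real pi * \<i>) \<cdot> z"
  using assms by (auto simp: point_def bar_def smul_def fun_ap Lambda0_def delta_apply a_outside a0 hring_def fun_eq_iff algebra_simps)

lemma inj_point: "inj_on (point C) (coord_domain C)"
proof
  fix p p' assume "p \<in> coord_domain C" "p' \<in> coord_domain C" and eq: "point C p = point C p'"
  then obtain \<sigma> z u \<sigma>' z' u' where p: "p = (\<sigma>, z, u)" "z \<in> hring C" "p' = (\<sigma>', z', u')" "z' \<in> hring C"
    by (auto simp: coord_domain_def)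
  have nz: "(2 * of_real pi * \<i> :: complex) \<noteq> 0" by simp
  note c = point_coords[OF p(2), of \<sigma> u] point_coords[OF p(4), of \<sigma>' u']
  have "2 * of_real pi * \<i> * \<sigma> = 2 * of_real pi * \<i> * \<sigma>'" "2 * of_real pi * \<i> * u = 2 * of_real pi * \<i> * u'"
    "(2 * of_real pi * \<i>) \<cdot> z = (2 * of_real pi * \<i>) \<cdot> z'"
    using c eq unfolding p(1,3) by (metis minus_equation_iff)+
  then show "p = p'" using nz unfolding p(1,3) by (metis mult_cancel_left cfun.scale_left_imp_eq)
qed

lemma coords_of_point: "p \<in> coord_domain C \<Longrightarrow> coords_of C (point C p) = p"
  unfolding coords_of_def by (rule inv_into_f_f[OF inj_point])

lemma point_Y: "p \<in> coord_domain C \<Longrightarrow> point C p \<in> Y C"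
proof -
  assume "p \<in> coord_domain C"
  then obtain \<sigma> z u where p: "p = (\<sigma>, z, u)" "Im \<sigma> > 0" "z \<in> hring C" by (auto simp: coord_domain_def)
  have "point C p \<in> hstar C" using p(3) by (auto simp: p(1) point_def hstar_def hring_def smul_def fun_ap Lambda0_def delta_apply a_outside)
  moreover have "form C (point C p) (delta C) = - (2 * of_real pi * \<i> * \<sigma>)" unfolding form_delta_right p(1) by (rule point_coords(1)[OF p(3)])
  ultimately show ?thesis using p(2) by (simp add: Y_def)
qed

lemma Y_cases:
  assumes "v \<in> Y C"
  obtains \<sigma> z u where "v = point C (\<sigma>, z, u)" "Im \<sigma> > 0" "z \<in> hring C" "coords_of C v = (\<sigma>, z, u)"
proof -
  let ?c = "2 * of_real pi * \<i> :: complex"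
  have v: "v \<in> hstar C" "Re (v (l + 1)) > 0" using assms by (auto simp: Y_def form_delta_right)
  define \<sigma> z u where "\<sigma> = - v (l + 1) / ?c" and "z = (1 / ?c) \<cdot> bar v" and "u = v 0 / ?c"
  have z: "z \<in> hring C" by (simp add: z_def hring_smul bar_hring)
  have "v = bar v + v (l + 1) \<cdot> Lambda0 C + v 0 \<cdot> delta C" by (rule bar_decomp[OF v(1)])
  also have "\<dots> = ?c \<cdot> (z - \<sigma> \<cdot> Lambda0 C + u \<cdot> delta C)"
    by (auto simp: z_def \<sigma>_def u_def smul_def fun_ap fun_eq_iff field_simps)
  also have "\<dots> = point C (\<sigma>, z, u)" by (simp only: point_apply)
  finally have pt: "v = point C (\<sigma>, z, u)" .
  have "\<sigma> = \<i> * v (l + 1) / (2 * of_real pi)" by (simp add: \<sigma>_def field_simps)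
  then have "Im \<sigma> = Re (v (l + 1)) / (2 * pi)" by (simp add: Im_divide_of_real[of _ "2 * pi", simplified])
  then have "Im \<sigma> > 0" using v(2) by simp
  then show ?thesis using that pt z coords_of_point[of "(\<sigma>, z, u)"] by (auto simp: coord_domain_def)
qed

lemma coords_of_up: "v \<in> Y Ct \<Longrightarrow> coords_of Ct v = (case coords_of C (dn v) of (\<sigma>, z, u) \<Rightarrow> (\<sigma>, up z, u))"
proof -
  assume "v \<in> Y Ct"
  then have "dn v \<in> Y C" by (simp add: Y_Ct)
  then obtain \<sigma> z u where p: "dn v = point C (\<sigma>, z, u)" "Im \<sigma> > 0" "z \<in> hring C" "coords_of C (dn v) = (\<sigma>, z, u)" by (rule Y_cases)
  have "inj_on (point Ct) (coord_domain Ct)"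
  proof
    fix p p' assume pp: "p \<in> coord_domain Ct" "p' \<in> coord_domain Ct" and eq: "point Ct p = point Ct p'"
    obtain \<sigma> z u \<sigma>' z' u' where p: "p = (\<sigma>, z, u)" "p' = (\<sigma>', z', u')" by (metis surj_pair)
    have "point C (\<sigma>, dn z, u) = point C (\<sigma>', dn z', u')" using eq inj_up by (simp add: p point_Ct inj_eq)
    then have "(\<sigma>, dn z, u) = (\<sigma>', dn z', u')"
      using pp by (intro inj_onD[OF inj_point]) (auto simp: coord_domain_def p hring_Ct_iff)
    then show "p = p'" using up_dn by (metis p prod.inject)
  qed
  moreover have "v = point Ct (\<sigma>, up z, u)" using p(1) by (simp add: point_Ct p(1)[symmetric])
  moreover have "(\<sigma>, up z, u) \<in> coord_domain Ct" using p(2,3) by (simp add: coord_domain_def up_hring)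
  ultimately show ?thesis using p(4) by (simp add: coords_of_def inv_into_f_f)
qed

lemma slash_theta_Ct: "slash_theta Ct X j (\<lambda>v. f (dn v)) = (\<lambda>v. slash_theta C X j f (dn v))"
proof
  fix v
  show "slash_theta Ct X j (\<lambda>v. f (dn v)) v = slash_theta C X j f (dn v)"
  proof (cases "v \<in> Y Ct")
    case True
    obtain \<sigma> z u where p: "coords_of C (dn v) = (\<sigma>, z, u)" by (metis surj_pair)
    show ?thesis using True Y_Ct[of v] p
      by (simp add: slash_theta_def coords_of_up act_Ct point_Ct split: prod.splits)
  qed (simp add: slash_theta_def Y_Ct)
qed

lemma slash_char_Ct: "slash_char Ct X (\<lambda>v. f (dn v)) = (\<lambda>v. slash_char C X f (dn v))"
proof
  fix v
  show "slash_char Ct X (\<lambda>v. f (dn v)) v = slash_char C X f (dn v)"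
  proof (cases "v \<in> Y Ct")
    case True
    obtain \<sigma> z u where p: "coords_of C (dn v) = (\<sigma>, z, u)" by (metis surj_pair)
    show ?thesis using True Y_Ct[of v] p
      by (simp add: slash_char_def coords_of_up act_Ct point_Ct split: prod.splits)
  qed (simp add: slash_char_def Y_Ct)
qed

text \<open>The coroots of the transposed algebra are the images of the roots \<alpha>_j. Hence the
  pullback of \<rho>^t has pairing 1 with each \<alpha>_j, where \<rho> has e_j.\<close>

lemma rho_Ct:
  "rho Ct \<in> hstar Ct" "\<And>j. j \<le> l \<Longrightarrow> form C (dn (rho Ct)) (alpha j) = 1"
proof -
  have fw: "fund_weight Ct i \<in> hstar Ct \<and> (\<forall>j\<le>l. form C (dn (fund_weight Ct i)) (alpha j) = (if j = i then 1 else 0))"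
    if i: "i \<le> l" for i
  proof -
    let ?P = "\<lambda>x. x \<in> hstar Ct \<and> (\<forall>j\<le>rk Ct. form Ct x (coroot Ct j) = (if j = i then 1 else 0)) \<and> form Ct x (Lambda0 Ct) = 0"
    have Pe: "?P x \<longleftrightarrow> dn x \<in> hstar C \<and> (\<forall>j\<le>l. form C (dn x) (alpha j) = (if j = i then 1 else 0)) \<and> form C (dn x) (Lambda0 C) = 0" for x
    proof -
      have "form Ct x (up y) = form C (dn x) y" for y using form_up[of "dn x" y] by simp
      then show ?thesis using up_hstar[of "dn x"] by (simp add: coroot_Ct Lambda0_Ct)
    qed
    obtain x where x: "x \<in> hstar C" "\<And>j. j \<le> l \<Longrightarrow> form C x (alpha j) = (if j = i then 1 else 0)" "form C x (Lambda0 C) = 0"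
      using weight_exists[of "\<lambda>j. if j = i then 1 else 0"] by metis
    have "?P (up x)" unfolding Pe using x by simp
    moreover have "y = up x" if "?P y" for y
    proof -
      have y: "dn y \<in> hstar C" "\<And>j. j \<le> l \<Longrightarrow> form C (dn y) (alpha j) = form C x (alpha j)" "form C (dn y) (Lambda0 C) = 0"
        using that[unfolded Pe] x(2) by auto
      have "dn y 0 = x 0" using y(3) x(3) by (simp add: Lambda0_form)
      then have "dn y = x" using bar_decomp[OF x(1)] bar_decomp[OF y(1)] hstar_eq_bar[OF y(1) x(1) y(2)] by metis
      then show ?thesis by (metis up_dn)
    qed
    ultimately have "?P (fund_weight Ct i)" unfolding fund_weight_def by (rule theI)
    then show ?thesis unfolding Pe using up_hstar[of "dn (fund_weight Ct i)"] by simp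
  qed
  have dn_sum: "dn (\<Sum>i\<in>A. g i) = (\<Sum>i\<in>A. dn (g i))" for A and g :: "nat \<Rightarrow> hvec"
    by (auto simp: dn_def fun_eq_iff sum_fun_apply sum_divide_distrib)
  have "(\<Sum>i\<le>l. fund_weight Ct i) \<in> hstar Ct"
    using fw by (auto simp: hstar_def sum_fun_apply intro!: sum.neutral)
  then show "rho Ct \<in> hstar Ct" by (simp add: rho_def)
  show "form C (dn (rho Ct)) (alpha j) = 1" if "j \<le> l" for j
    unfolding rho_def rk_Ct dn_sum form_simps using fw that by simp
qed

end

no_notation fps_nth (infixl "$" 75)

section \<open>Comparison of the two modular actions\<close>

text \<open>Generators and prescribed values arise from one family F through linear maps p and q, so
  the extension has to be q composed with an inverse of p. This is well defined if q vanishes on the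
  kernel of p inside the span of F.\<close>

lemma linear_extension_eq:
  fixes p q :: "(hvec \<Rightarrow> complex) \<Rightarrow> hvec \<Rightarrow> complex"
  assumes p: "\<And>f g. p (f + g) = p f + p g" "\<And>k f. p (k \<cdot> f) = k \<cdot> p f"
    and q: "\<And>f g. q (f + g) = q f + q g" "\<And>k f. q (k \<cdot> f) = k \<cdot> q f"
    and b: "\<And>i. i \<in> I \<Longrightarrow> b i = p (F i)" and c: "\<And>i. i \<in> I \<Longrightarrow> c i = q (F i)"
    and inj: "\<And>f. f \<in> cfun.span (F ` I) \<Longrightarrow> p f = 0 \<Longrightarrow> q f = 0"
    and G: "G \<in> cfun.span (F ` I)"
  shows "linear_extension I b c (p G) = q G"
proof -
  define V where "V = cfun.span (F ` I)"
  define B where "B = cfun.span (b ` I)"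
  have p0: "p 0 = 0" using p(2)[of 0 0] by simp
  have q0: "q 0 = 0" using q(2)[of 0 0] by simp
  have diff: "p (f - g) = p f - p g" "q (f - g) = q f - q g" for f g
    using p(1)[of f "(- 1) \<cdot> g"] p(2)[of "- 1" g] q(1)[of f "(- 1) \<cdot> g"] q(2)[of "- 1" g] by simp_all
  have V: "0 \<in> V" "f \<in> V \<Longrightarrow> g \<in> V \<Longrightarrow> f + g \<in> V" "f \<in> V \<Longrightarrow> k \<cdot> f \<in> V" "f \<in> V \<Longrightarrow> g \<in> V \<Longrightarrow> f - g \<in> V" "i \<in> I \<Longrightarrow> F i \<in> V" for f g k i
    unfolding V_def by (auto intro: cfun.span_zero cfun.span_add cfun.span_scale cfun.span_diff cfun.span_base)
  have B: "0 \<in> B" "f \<in> B \<Longrightarrow> g \<in> B \<Longrightarrow> f + g \<in> B" "f \<in> B \<Longrightarrow> k \<cdot> f \<in> B" "i \<in> I \<Longrightarrow> b i \<in> B" for f g k i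
    unfolding B_def by (auto intro: cfun.span_zero cfun.span_add cfun.span_scale cfun.span_base)
  have pV: "p f \<in> B" if "f \<in> V" for f
  proof -
    have "V \<subseteq> {f. p f \<in> B}" unfolding V_def
      by (rule cfun.span_minimal) (use B b in \<open>auto simp: cfun.subspace_def p p0\<close>)
    then show ?thesis using that by blast
  qed
  have Bp: "\<exists>g\<in>V. p g = f" if "f \<in> B" for f
  proof -
    have "B \<subseteq> p ` V" unfolding B_def
    proof (rule cfun.span_minimal)
      show "cfun.subspace (p ` V)" unfolding cfun.subspace_def
      proof (intro conjI ballI allI)
        show "0 \<in> p ` V" using V(1) p0 by (metis imageI)
        fix x assume "x \<in> p ` V"
        then obtain x' where x: "x = p x'" "x' \<in> V" by blast
        show "k \<cdot> x \<in> p ` V" for k using V(3)[OF x(2)] by (auto simp: x(1) p(2)[symmetric])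
        fix y assume "y \<in> p ` V"
        then obtain y' where y: "y = p y'" "y' \<in> V" by blast
        show "x + y \<in> p ` V" using V(2)[OF x(2) y(2)] by (auto simp: x(1) y(1) p(1)[symmetric])
      qed
    qed (use b V(5) in auto)
    then show ?thesis using that by blast
  qed
  \<comment> \<open>The choice of a preimage is harmless: two of them differ by an element of the
    kernel of p, where q is zero.\<close>
  define T where "T f = (if f \<in> B then q (SOME g. g \<in> V \<and> p g = f) else 0)" for f
  have Tp: "T (p f) = q f" if f: "f \<in> V" for f
  proof -
    define g where "g = (SOME g. g \<in> V \<and> p g = p f)"
    have g: "g \<in> V \<and> p g = p f" unfolding g_def by (rule someI[of _ f]) (use f in simp)
    have "q (g - f) = 0" using inj[of "g - f"] V(4)[of g f] g f by (simp add: V_def[symmetric] diff)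
    then show ?thesis using pV[OF f] by (simp add: T_def g_def[symmetric] diff)
  qed
  define P where "P T \<longleftrightarrow> (\<forall>f\<in>B. \<forall>g\<in>B. T (f + g) = T f + T g) \<and> (\<forall>k. \<forall>f\<in>B. T (k \<cdot> f) = k \<cdot> T f)
     \<and> (\<forall>i\<in>I. T (b i) = c i) \<and> (\<forall>f. f \<notin> B \<longrightarrow> T f = 0)" for T :: "(hvec \<Rightarrow> complex) \<Rightarrow> hvec \<Rightarrow> complex"
  have PT: "P T"
    unfolding P_def
  proof (intro conjI ballI allI impI)
    fix f assume "f \<in> B"
    then obtain f' where f: "f' \<in> V" "p f' = f" using Bp by blast
    show "T (k \<cdot> f) = k \<cdot> T f" for k using Tp[OF V(3)[OF f(1)], of k] Tp[OF f(1)] by (simp add: p q f)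
    fix g assume "g \<in> B"
    then obtain g' where g: "g' \<in> V" "p g' = g" using Bp by blast
    show "T (f + g) = T f + T g" using Tp[OF V(2)[OF f(1) g(1)]] Tp[OF f(1)] Tp[OF g(1)] by (simp add: p q f g)
  next
    show "T (b i) = c i" if "i \<in> I" for i using Tp[OF V(5)[OF that]] by (simp add: b[OF that] c[OF that])
    show "T f = 0" if "f \<notin> B" for f using that by (simp add: T_def)
  qed
  have uniq: "T' = T" if P': "P T'" for T'
  proof
    fix f
    have add: "T' (f + g) = T' f + T' g" if "f \<in> B" "g \<in> B" for f g using P' that by (simp add: P_def)
    have smul: "T' (k \<cdot> f) = k \<cdot> T' f" if "f \<in> B" for k f using P' that by (simp add: P_def)
    have T0: "T' 0 = 0" using smul[OF B(1), of 0] by simp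
    have bi: "T' (b i) = c i" if "i \<in> I" for i using P' that by (simp add: P_def)
    show "T' f = T f"
    proof (cases "f \<in> B")
      case True
      then obtain f' where f: "f' \<in> V" "p f' = f" using Bp by blast
      have "V \<subseteq> {g \<in> V. T' (p g) = q g}" unfolding V_def
      proof (rule cfun.span_minimal, goal_cases)
        case 1
        have "T' (p (F i)) = q (F i)" if "i \<in> I" for i using bi[OF that] by (simp only: b[OF that] c[OF that])
        then show ?case using V(5) by (auto simp: V_def[symmetric])
      next
        case 2
        show ?case unfolding cfun.subspace_def V_def[symmetric]
        proof (intro conjI ballI allI)
          show "0 \<in> {g \<in> V. T' (p g) = q g}" using V(1) by (simp add: p0 q0 T0)
          fix x assume x: "x \<in> {g \<in> V. T' (p g) = q g}"
          then show "k \<cdot> x \<in> {g \<in> V. T' (p g) = q g}" for k using smul[OF pV, of x k] V(3) by (simp add: p q)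
          fix y assume y: "y \<in> {g \<in> V. T' (p g) = q g}"
          then show "x + y \<in> {g \<in> V. T' (p g) = q g}" using x add[OF pV pV, of x y] V(2) by (simp add: p q)
        qed
      qed
      from subsetD[OF this f(1)] have "T' (p f') = q f'" by simp
      then show ?thesis using Tp[OF f(1)] by (simp only: f(2))
    next
      case False
      have "T' f = 0" using P' False unfolding P_def by blast
      then show ?thesis using False by (simp add: T_def)
    qed
  qed
  have "linear_extension I b c = The P" unfolding linear_extension_def P_def B_def ..
  also have "\<dots> = T" by (rule the_equality[of P, OF PT uniq])
  finally show ?thesis using Tp G by (simp add: V_def)
qed

section \<open>Functions on Y of level m, described by functions of \<sigma> and z\<close>

context affine_lattice
begin

definition on_Y :: "nat \<Rightarrow> (complex \<Rightarrow> hvec \<Rightarrow> complex) \<Rightarrow> hvec \<Rightarrow> complex" where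
  "on_Y m F v = (if v \<in> Y C then (case coords_of C v of (\<sigma>, z, u) \<Rightarrow> exp (2 * of_real pi * \<i> * of_nat m * u) * F \<sigma> z) else 0)"

lemma on_Y_point: "Im \<sigma> > 0 \<Longrightarrow> z \<in> hring C \<Longrightarrow> on_Y m F (point C (\<sigma>, z, u)) = exp (2 * of_real pi * \<i> * of_nat m * u) * F \<sigma> z"
  using point_Y[of "(\<sigma>, z, u)"] coords_of_point[of "(\<sigma>, z, u)"] by (simp add: on_Y_def coord_domain_def)

lemma on_Y_eqI:
  assumes "\<And>v. v \<notin> Y C \<Longrightarrow> f v = 0"
    and "\<And>\<sigma> z u. Im \<sigma> > 0 \<Longrightarrow> z \<in> hring C \<Longrightarrow> f (point C (\<sigma>, z, u)) = exp (2 * of_real pi * \<i> * of_nat m * u) * F \<sigma> z"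
  shows "f = on_Y m F"
proof
  fix v
  show "f v = on_Y m F v"
  proof (cases "v \<in> Y C")
    case True
    then obtain \<sigma> z u where p: "v = point C (\<sigma>, z, u)" "Im \<sigma> > 0" "z \<in> hring C" by (rule Y_cases)
    then show ?thesis using assms(2) on_Y_point by simp
  qed (simp add: assms(1) on_Y_def)
qed

lemma on_Y_cong: "(\<And>\<sigma> z. Im \<sigma> > 0 \<Longrightarrow> z \<in> hring C \<Longrightarrow> F \<sigma> z = G \<sigma> z) \<Longrightarrow> on_Y m F = on_Y m G"
  by (rule on_Y_eqI, simp add: on_Y_def, simp add: on_Y_point)

lemma on_Y_add: "on_Y m (\<lambda>\<sigma> z. F \<sigma> z + G \<sigma> z) = on_Y m F + on_Y m G" and on_Y_scale: "on_Y m (\<lambda>\<sigma> z. k * F \<sigma> z) = k \<cdot> on_Y m F"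
  by (auto simp: on_Y_def fun_eq_iff fun_ap smul_def algebra_simps split: prod.splits)

lemma on_Y_zero: "(\<And>\<sigma> z. Im \<sigma> > 0 \<Longrightarrow> z \<in> hring C \<Longrightarrow> F \<sigma> z = 0) \<Longrightarrow> on_Y m F = 0"
  using on_Y_cong[of F "\<lambda>_ _. 0" m] by (auto simp: on_Y_def fun_eq_iff fun_ap split: prod.splits)

lemma lincomb_on_Y:
  assumes "lincomb B P F" "cfun.subspace S" "\<And>x. P x \<Longrightarrow> on_Y m (B x) \<in> S"
  shows "on_Y m F \<in> S"
  using assms(1)
proof (induction rule: lincomb.induct)
  case (zero F)
  then show ?case using on_Y_zero[of F m] assms(2) by (simp add: cfun.subspace_def)
next
  case (step F x G k)
  have "on_Y m G = on_Y m F + k \<cdot> on_Y m (B x)"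
    unfolding on_Y_scale[symmetric] on_Y_add[symmetric] by (rule on_Y_cong) (rule step.hyps(3))
  then show ?case using step.IH assms(3)[OF step.hyps(2)] assms(2) by (simp add: cfun.subspace_def)
qed

text \<open>Since (\<mu>, \<mu>) is the norm of the projection plus 2 m \<mu>_0, the prefactor of
  \<Theta> cancels the \<delta>-component of \<mu> and supplies the constant term of (\<gamma> +
  \<beta>, \<gamma> + \<beta>).\<close>

lemma Theta_on_Y:
  assumes \<mu>: "\<mu> \<in> hstar C" "\<mu> (l + 1) = of_nat m" and m: "m > 0"
  shows "Theta C \<mu> = on_Y m (TH m ((1 / of_nat m) \<cdot> bar \<mu>))"
proof (rule on_Y_eqI)
  show "Theta C \<mu> v = 0" if "v \<notin> Y C" for v using that by (simp add: Theta_def)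
next
  fix \<sigma> z u assume \<sigma>: "Im \<sigma> > 0" and z: "z \<in> hring C"
  let ?v = "point C (\<sigma>, z, u)" and ?\<gamma> = "(1 / of_nat m) \<cdot> bar \<mu>"
  have M: "(of_nat m :: complex) \<noteq> 0" using m by simp
  have vY: "?v \<in> Y C" using \<sigma> z by (intro point_Y) (simp add: coord_domain_def)
  have fv: "form C x ?v = 2 * of_real pi * \<i> * (form C x z - \<sigma> * x 0 + u * x (l + 1))" for x
    by (simp add: point_apply form_smul_right form_add_right form_diff_right Lambda0_form form_delta_right)
  have \<mu>\<mu>: "form C \<mu> \<mu> = form C (bar \<mu>) (bar \<mu>) + 2 * of_nat m * \<mu> 0"
  proof -
    define y where "y = bar \<mu>"
    have y: "y (l + 1) = 0" "y 0 = 0" using bar_hring[of \<mu>] by (simp_all add: y_def hring_def)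
    have "\<mu> = y + of_nat m \<cdot> Lambda0 C + \<mu> 0 \<cdot> delta C" using bar_decomp[OF \<mu>(1)] unfolding \<mu>(2) y_def .
    then have "form C \<mu> \<mu> = form C \<mu> (y + of_nat m \<cdot> Lambda0 C + \<mu> 0 \<cdot> delta C)" by (rule arg_cong)
    also have "\<dots> = form C \<mu> y + 2 * of_nat m * \<mu> 0"
      unfolding form_add_right form_smul_right Lambda0_form form_delta_right \<mu>(2) by simp
    also have "form C \<mu> y = form C y y" using form_bar_hring[OF bar_hring \<mu>(1), of \<mu>] by (simp add: y_def)
    finally show ?thesis by (simp add: y_def)
  qed
  have trm: "exp (- (form C \<mu> \<mu> / (2 * level C \<mu>)) * form C (delta C) ?v) * exp (form C (translation C \<beta> \<mu>) ?v)
    = exp (2 * of_real pi * \<i> * of_nat m * u) * E m (?\<gamma> + \<beta>) \<sigma> z" if \<beta>: "\<beta> \<in> rlat" for \<beta>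
  proof -
    have bh: "\<beta> \<in> hring C" using rlat_hring[OF \<beta>] .
    have b0: "\<beta> 0 = 0" "\<beta> (l + 1) = 0" using bh by (simp_all add: hring_def)
    have b\<mu>: "form C \<mu> \<beta> = form C (bar \<mu>) \<beta>" "form C \<mu> z = form C (bar \<mu>) z"
      using form_bar_hring[OF bh \<mu>(1)] form_bar_hring[OF z \<mu>(1)] by simp_all
    have dv: "form C (delta C) ?v = - (2 * of_real pi * \<i> * \<sigma>)"
      unfolding form_delta_left by (rule point_coords(1)[OF z])
    have tv: "form C (translation C \<beta> \<mu>) ?v = form C \<mu> ?v + of_nat m * form C \<beta> ?v
       - (form C \<mu> \<beta> + form C \<beta> \<beta> / 2 * of_nat m) * form C (delta C) ?v"
      by (simp add: translation_def level_eq \<mu>(2) form_add_left form_diff_left form_smul_left)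
    have "- (form C \<mu> \<mu> / (2 * level C \<mu>)) * form C (delta C) ?v + form C (translation C \<beta> \<mu>) ?v
      = 2 * of_real pi * \<i> * of_nat m * u + of_real pi * \<i> * of_nat m * (\<sigma> * form C (?\<gamma> + \<beta>) (?\<gamma> + \<beta>) + 2 * form C (?\<gamma> + \<beta>) z)"
      unfolding tv dv fv[of \<mu>] fv[of \<beta>] \<mu>\<mu> b\<mu> b0 level_eq \<mu>(2) form_add_left form_add_right form_smul_left form_smul_right form_sym[of \<beta> "bar \<mu>"]
      using M by (simp add: field_simps)
    then show ?thesis unfolding E_def exp_add[symmetric] by (rule arg_cong)
  qed
  have "Theta C \<mu> ?v = (\<Sum>\<^sub>\<infinity>\<beta>\<in>rlat. exp (- (form C \<mu> \<mu> / (2 * level C \<mu>)) * form C (delta C) ?v) * exp (form C (translation C \<beta> \<mu>) ?v))"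
    unfolding infsum_cmult_right' using vY by (simp add: Theta_def latticeM_eq)
  also have "\<dots> = (\<Sum>\<^sub>\<infinity>\<beta>\<in>rlat. exp (2 * of_real pi * \<i> * of_nat m * u) * E m (?\<gamma> + \<beta>) \<sigma> z)"
    by (intro infsum_cong trm)
  finally show "Theta C \<mu> ?v = exp (2 * of_real pi * \<i> * of_nat m * u) * TH m ?\<gamma> \<sigma> z"
    unfolding infsum_cmult_right' TH_def .
qed

lemma alt_theta_on_Y:
  assumes \<mu>: "\<mu> \<in> hstar C" "\<mu> (l + 1) = of_nat m" and m: "m > 0"
  shows "alt_theta C \<mu> = on_Y m (AM m \<mu>)"
proof (rule on_Y_eqI)
  show "alt_theta C \<mu> v = 0" if "v \<notin> Y C" for v
    using that by (simp add: alt_theta_def sum_fun_apply smul_def Theta_def)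
next
  interpret short: affine_roots C r a e "\<lambda>_. 1" 1 by (rule short_roots)
  fix \<sigma> z u assume \<sigma>: "Im \<sigma> > 0" and z: "z \<in> hring C"
  have "Theta C (w \<mu>) = on_Y m (TH m (w ((1 / of_nat m) \<cdot> bar \<mu>)))" if "w \<in> W" for w
  proof -
    obtain "is" where w: "w = wm is" and i: "set is \<subseteq> {1..l}" using W_cases \<open>w \<in> W\<close> by blast
    have i': "set is \<subseteq> {..l}" using i by auto
    show ?thesis using Theta_on_Y[of "wm is \<mu>" m] wm_hstar[OF i' \<mu>(1)] wm_level[OF i'] \<mu>(2) m
      by (simp add: w short.bar_wm[OF i \<mu>(1)] wm_smul)
  qed
  then show "alt_theta C \<mu> (point C (\<sigma>, z, u)) = exp (2 * of_real pi * \<i> * of_nat m * u) * AM m \<mu> \<sigma> z"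
    by (simp add: alt_theta_def sum_fun_apply smul_def on_Y_point[OF \<sigma> z] AM_def AT_def sum_distrib_left mult_ac)
qed

lemma slash_theta_on_Y:
  fixes X :: "int^2^2"
  assumes det: "X $ 1 $ 1 * X $ 2 $ 2 - X $ 1 $ 2 * X $ 2 $ 1 = 1"
  shows "slash_theta C X j (on_Y m F) = on_Y m (\<lambda>\<sigma> z. slash m (X $ 1 $ 1) (X $ 1 $ 2) (X $ 2 $ 1) (X $ 2 $ 2) F \<sigma> z / j \<sigma> ^ l)"
proof (rule on_Y_eqI)
  show "slash_theta C X j (on_Y m F) v = 0" if "v \<notin> Y C" for v using that by (simp add: slash_theta_def)
next
  fix \<sigma> z u assume \<sigma>: "Im \<sigma> > 0" and z: "z \<in> hring C"
  define J where "J = autom X \<sigma>"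
  have im: "Im ((of_int (X $ 1 $ 1) * \<sigma> + of_int (X $ 1 $ 2)) / J) > 0"
    unfolding J_def autom_def by (rule moebius_Im(2)[OF det \<sigma>])
  have p: "(\<sigma>, z, u) \<in> coord_domain C" using \<sigma> z by (simp add: coord_domain_def)
  have "slash_theta C X j (on_Y m F) (point C (\<sigma>, z, u)) = j \<sigma> powi (- int l) *
     on_Y m F (point C ((of_int (X $ 1 $ 1) * \<sigma> + of_int (X $ 1 $ 2)) / J, (1 / J) \<cdot> z, u - of_int (X $ 2 $ 1) * form C z z / (2 * J)))"
    using point_Y[OF p] coords_of_point[OF p] by (simp add: slash_theta_def act_def J_def)
  also have "\<dots> = j \<sigma> powi (- int l) * (exp (2 * of_real pi * \<i> * of_nat m * (u - of_int (X $ 2 $ 1) * form C z z / (2 * J))) *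
     F ((of_int (X $ 1 $ 1) * \<sigma> + of_int (X $ 1 $ 2)) / J) ((1 / J) \<cdot> z))"
    using on_Y_point[OF im hring_smul[OF z]] by simp
  also have "2 * of_real pi * \<i> * of_nat m * (u - of_int (X $ 2 $ 1) * form C z z / (2 * J))
    = 2 * of_real pi * \<i> * of_nat m * u + - (of_real pi * \<i> * of_nat m * of_int (X $ 2 $ 1) * form C z z / J)"
    by (simp add: algebra_simps)
  also have "exp (2 * of_real pi * \<i> * of_nat m * u + - (of_real pi * \<i> * of_nat m * of_int (X $ 2 $ 1) * form C z z / J))
    = exp (2 * of_real pi * \<i> * of_nat m * u) * exp (- (of_real pi * \<i> * of_nat m * of_int (X $ 2 $ 1) * form C z z / J))" by (rule exp_add)
  also have "j \<sigma> powi (- int l) = 1 / j \<sigma> ^ l" by (simp add: power_int_minus divide_inverse)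
  finally show "slash_theta C X j (on_Y m F) (point C (\<sigma>, z, u)) = exp (2 * of_real pi * \<i> * of_nat m * u) *
     (slash m (X $ 1 $ 1) (X $ 1 $ 2) (X $ 2 $ 1) (X $ 2 $ 2) F \<sigma> z / j \<sigma> ^ l)"
    by (simp add: slash_def J_def autom_def mult_ac)
qed

text \<open>The power of j is common to numerator and denominator and cancels.\<close>

lemma slash_char_quotient:
  assumes j: "\<And>\<sigma>. Im \<sigma> > 0 \<Longrightarrow> j \<sigma> \<noteq> 0"
  shows "slash_char C X (\<lambda>v. f v / g v) = (\<lambda>v. slash_theta C X j f v / slash_theta C X j g v)"
proof
  fix v
  show "slash_char C X (\<lambda>v. f v / g v) v = slash_theta C X j f v / slash_theta C X j g v"
  proof (cases "v \<in> Y C")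
    case True
    then obtain \<sigma> z u where p: "v = point C (\<sigma>, z, u)" "Im \<sigma> > 0" "z \<in> hring C" "coords_of C v = (\<sigma>, z, u)" by (rule Y_cases)
    show ?thesis using True p(4) j[OF p(2)] by (simp add: slash_char_def slash_theta_def)
  qed (simp add: slash_char_def slash_theta_def)
qed

section \<open>Numerators of characters\<close>

lemma weight_shift:
  assumes "lam \<in> weights C k"
  shows "affine_roots.wint C e (lam + rho C)" "(lam + rho C) (l + 1) = of_nat (k + dual_coxeter C)" "lam + rho C \<in> hstar C"
proof -
  interpret long: affine_roots C r a e e r by (rule long_roots)
  have lam: "lam \<in> hstar C" "\<And>i. i \<le> l \<Longrightarrow> form C lam (alpha i) / of_nat (e i) \<in> \<int>" "lam (l + 1) = of_nat k"
    using assms by (auto simp: weights_def coroot_eq form_smul_right level_eq)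
  show h: "lam + rho C \<in> hstar C" by (rule hstar_add[OF lam(1) rho_hstar])
  show "(lam + rho C) (l + 1) = of_nat (k + dual_coxeter C)" using lam(3) rho_level by (simp add: fun_ap)
  have "form C (lam + rho C) (alpha i) / of_nat (e i) = form C lam (alpha i) / of_nat (e i) + 1" if "i \<le> l" for i
    using e_pos[OF that] by (simp add: form_add_left rho_alpha[OF that] add_divide_distrib)
  then show "long.wint (lam + rho C)" using h lam(2) by (simp add: long.wint_def)
qed

lemma regular_dominant:
  assumes "affine_roots.regular C e (k + dual_coxeter C) \<nu>"
  shows "\<nu> - rho C \<in> dominant_weights C k"
proof -
  interpret long: affine_roots C r a e e r by (rule long_roots)
  have \<nu>: "\<nu> \<in> hstar C" "\<And>i. i \<le> l \<Longrightarrow> form C \<nu> (alpha i) / of_nat (e i) \<in> \<int>" "\<nu> (l + 1) = of_nat (k + dual_coxeter C)"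
    "\<And>i. i \<le> l \<Longrightarrow> Re (form C \<nu> (alpha i) / of_nat (e i)) \<ge> 1"
    using assms by (auto simp: long.regular_def long.wint_def)
  have f: "form C (\<nu> - rho C) (coroot C i) = form C \<nu> (alpha i) / of_nat (e i) - 1" if "i \<le> l" for i
    using e_pos[OF that] by (simp add: coroot_eq[OF that] form_smul_right form_diff_left rho_alpha[OF that] diff_divide_distrib)
  have "(\<nu> - rho C) (l + 1) = of_nat k" using \<nu>(3) rho_level by (simp add: fun_ap)
  then show ?thesis using \<nu> f hstar_diff[OF \<nu>(1) rho_hstar] by (auto simp: dominant_weights_def weights_def level_eq)
qed

lemma wm_theta_weight:
  assumes lam: "lam \<in> weights C k" and i: "set is \<subseteq> {1..l}"
  shows "wm is (lam + rho C) \<in> theta_weights C (real (k + dual_coxeter C))"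
proof -
  interpret long: affine_roots C r a e e r by (rule long_roots)
  have i': "set is \<subseteq> {..l}" using i by auto
  note \<mu> = weight_shift[OF lam]
  define \<nu> where "\<nu> = wm is (lam + rho C)"
  have w: "long.wint \<nu>" unfolding \<nu>_def by (rule long.wint_wm[OF i' \<mu>(1)])
  have h: "\<nu> \<in> hstar C" unfolding \<nu>_def by (rule wm_hstar[OF i' \<mu>(3)])
  have "form C \<nu> \<beta> \<in> \<int>" if "\<beta> \<in> latticeM C" for \<beta>
  proof -
    have \<beta>: "\<beta> \<in> rlat" using that by (simp add: latticeM_eq)
    have "form C \<nu> \<beta> = form C \<nu> (\<Sum>i=1..l. \<beta> i \<cdot> alpha i)" by (rule arg_cong[OF hring_expand[OF rlat_hring[OF \<beta>]]])
    also have "\<dots> = (\<Sum>i=1..l. \<beta> i * form C \<nu> (alpha i))" by (simp add: form_sum_right form_smul_right)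
    also have "\<dots> \<in> \<int>" using \<beta> long.wint_alpha_int[OF w] by (intro Ints_sum Ints_mult) (auto simp: rlat_def)
    finally show ?thesis .
  qed
  then show ?thesis using h wm_level[OF i'] \<mu>(2) unfolding \<nu>_def[symmetric] by (simp add: theta_weights_def level_eq \<nu>_def)
qed

lemma alt_theta_Th: "lam \<in> weights C k \<Longrightarrow> alt_theta C (lam + rho C) \<in> Th C (real (k + dual_coxeter C))"
proof -
  assume lam: "lam \<in> weights C k"
  show ?thesis unfolding alt_theta_def Th_def
  proof (intro cfun.span_sum cfun.span_scale cfun.span_base imageI)
    fix w assume "w \<in> W"
    then show "w (lam + rho C) \<in> theta_weights C (real (k + dual_coxeter C))" using W_cases wm_theta_weight[OF lam] by blast
  qed
qed

lemma dominant_weights_subset: "lam \<in> dominant_weights C k \<Longrightarrow> lam \<in> weights C k"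
  by (simp add: dominant_weights_def)

abbreviation Alt :: "nat \<Rightarrow> (hvec \<Rightarrow> complex) set" where
  "Alt k \<equiv> cfun.span ((\<lambda>lam. alt_theta C (lam + rho C)) ` dominant_weights C k)"

lemma Alt_Th: "f \<in> Alt k \<Longrightarrow> f \<in> Th C (real (k + dual_coxeter C))"
proof -
  have "Alt k \<subseteq> Th C (real (k + dual_coxeter C))"
    unfolding Th_def by (rule cfun.span_minimal) (use alt_theta_Th dominant_weights_subset cfun.subspace_span in \<open>auto simp: Th_def\<close>)
  then show "f \<in> Alt k \<Longrightarrow> f \<in> Th C (real (k + dual_coxeter C))" by blast
qed

lemma regular_Alt:
  assumes "affine_roots.regular C e (k + dual_coxeter C) \<nu>"
  shows "on_Y (k + dual_coxeter C) (AM (k + dual_coxeter C) \<nu>) \<in> Alt k"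
proof -
  have d: "\<nu> - rho C \<in> dominant_weights C k" by (rule regular_dominant[OF assms])
  have "alt_theta C (\<nu> - rho C + rho C) \<in> Alt k" using d by (intro cfun.span_base imageI)
  moreover have "alt_theta C (\<nu> - rho C + rho C) = on_Y (k + dual_coxeter C) (AM (k + dual_coxeter C) (\<nu> - rho C + rho C))"
    using weight_shift[OF dominant_weights_subset[OF d]] dual_coxeter_pos by (intro alt_theta_on_Y) auto
  ultimately show ?thesis by simp
qed

text \<open>For \<lambda> that is not dominant, affine reflections make the numerator zero or a
  multiple of one with dominant \<lambda>.\<close>

lemma alt_theta_Alt:
  assumes "lam \<in> weights C k"
  shows "alt_theta C (lam + rho C) \<in> Alt k"
proof -
  interpret long: affine_roots C r a e e r by (rule long_roots)
  let ?m = "k + dual_coxeter C"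
  have m: "?m > 0" using dual_coxeter_pos by simp
  note \<mu> = weight_shift[OF assms]
  have on_Y: "alt_theta C (lam + rho C) = on_Y ?m (AM ?m (lam + rho C))" by (rule alt_theta_on_Y[OF \<mu>(3,2) m])
  show ?thesis using long.regular_reduction[OF \<mu>(1,2) m]
  proof
    assume "\<forall>\<sigma> z. AM ?m (lam + rho C) \<sigma> z = 0"
    then show ?thesis unfolding on_Y using on_Y_zero[of "AM ?m (lam + rho C)" ?m] cfun.span_zero by simp
  next
    assume "\<exists>\<nu> q. long.wint \<nu> \<and> \<nu> (l + 1) = of_nat ?m \<and> (\<forall>i\<le>l. Re (form C \<nu> (alpha i) / of_nat (e i)) \<ge> 1) \<and> (\<forall>\<sigma> z. AM ?m (lam + rho C) \<sigma> z = q * AM ?m \<nu> \<sigma> z)"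
    then obtain \<nu> q where \<nu>: "long.regular ?m \<nu>" "\<forall>\<sigma> z. AM ?m (lam + rho C) \<sigma> z = q * AM ?m \<nu> \<sigma> z"
      unfolding long.regular_def by blast
    have "AM ?m (lam + rho C) = (\<lambda>\<sigma> z. q * AM ?m \<nu> \<sigma> z)" using \<nu>(2) by blast
    then have "on_Y ?m (AM ?m (lam + rho C)) = q \<cdot> on_Y ?m (AM ?m \<nu>)" by (simp add: on_Y_scale)
    then show ?thesis unfolding on_Y using cfun.span_scale[OF regular_Alt[OF \<nu>(1)]] by simp
  qed
qed

lemma Alt_line_holomorphic:
  assumes "f \<in> Alt k"
  obtains F where "line_holomorphic F" "f = on_Y (k + dual_coxeter C) F"
proof -
  let ?m = "k + dual_coxeter C"
  have m: "?m > 0" using dual_coxeter_pos by simp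
  have "Alt k \<subseteq> {f. \<exists>F. line_holomorphic F \<and> f = on_Y ?m F}"
  proof (rule cfun.span_minimal)
    show "cfun.subspace {f. \<exists>F. line_holomorphic F \<and> f = on_Y ?m F}"
      unfolding cfun.subspace_def
    proof (intro conjI ballI allI)
      have "line_holomorphic (\<lambda>_ _. 0)" by (simp add: line_holomorphic_def)
      then show "0 \<in> {f. \<exists>F. line_holomorphic F \<and> f = on_Y ?m F}" using on_Y_zero[of "\<lambda>_ _. 0" ?m] by auto
      fix f assume "f \<in> {f. \<exists>F. line_holomorphic F \<and> f = on_Y ?m F}"
      then obtain F where F: "line_holomorphic F" "f = on_Y ?m F" by blast
      have "line_holomorphic (\<lambda>\<sigma> z. q * F \<sigma> z)" for q using F(1) by (auto simp: line_holomorphic_def intro!: holomorphic_on_mult)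
      then show "q \<cdot> f \<in> {f. \<exists>F. line_holomorphic F \<and> f = on_Y ?m F}" for q
        unfolding mem_Collect_eq F(2) on_Y_scale[symmetric] by blast
      fix g assume "g \<in> {f. \<exists>F. line_holomorphic F \<and> f = on_Y ?m F}"
      then obtain G where G: "line_holomorphic G" "g = on_Y ?m G" by blast
      have "line_holomorphic (\<lambda>\<sigma> z. F \<sigma> z + G \<sigma> z)" using F(1) G(1) by (auto simp: line_holomorphic_def intro!: holomorphic_on_add)
      then show "f + g \<in> {f. \<exists>F. line_holomorphic F \<and> f = on_Y ?m F}" using F(2) G(2) on_Y_add[of ?m F G] by auto
    qed
    show "(\<lambda>lam. alt_theta C (lam + rho C)) ` dominant_weights C k \<subseteq> {f. \<exists>F. line_holomorphic F \<and> f = on_Y ?m F}"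
      using alt_theta_on_Y[OF weight_shift(3,2) m] AM_line_holomorphic[OF m] dominant_weights_subset by blast
  qed
  then show ?thesis using assms that by blast
qed

text \<open>With value 0 where the denominator vanishes, a zero quotient means that f times A_\<rho>
  is zero on all of Y, and \<open>line_holomorphic_domain\<close> applies.\<close>

lemma Alt_quotient_zero:
  assumes "f \<in> Alt k" and 0: "\<And>v. v \<in> Y C \<Longrightarrow> f v / alt_theta C (rho C) v = 0"
  shows "f = 0"
proof -
  let ?m = "k + dual_coxeter C"
  obtain F where F: "line_holomorphic F" "f = on_Y ?m F" by (rule Alt_line_holomorphic[OF assms(1)])
  have \<rho>: "alt_theta C (rho C) = on_Y (dual_coxeter C) (AM (dual_coxeter C) (rho C))"
    by (rule alt_theta_on_Y[OF rho_hstar rho_level dual_coxeter_pos])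
  obtain \<sigma>1 z1 where nz: "Im \<sigma>1 > 0" "z1 \<in> hring C" "AM (dual_coxeter C) (rho C) \<sigma>1 z1 \<noteq> 0" using AM_rho_nonzero by blast
  have "F \<sigma> z * AM (dual_coxeter C) (rho C) \<sigma> z = 0" if "Im \<sigma> > 0" "z \<in> hring C" for \<sigma> z
    using 0[OF point_Y[of "(\<sigma>, z, 0)"]] that by (auto simp: F(2) \<rho> on_Y_point coord_domain_def)
  then have "F \<sigma> z = 0" if "Im \<sigma> > 0" "z \<in> hring C" for \<sigma> z
    using line_holomorphic_domain[OF F(1) AM_line_holomorphic[OF dual_coxeter_pos] _ nz that] by blast
  then show ?thesis unfolding F(2) by (rule on_Y_zero)
qed

text \<open>Here p is the identity, so the kernel condition is void and every relation transfers by
  change of variables.\<close>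

lemma tau_Th_eq:
  assumes "f \<in> Th C m"
  shows "tau_Th C m f = (\<lambda>v. f (dn v))"
  unfolding tau_Th_def
proof (rule linear_extension_eq[where p = "\<lambda>f. f" and q = "\<lambda>f v. f (dn v)" and F = "Theta C"])
  show "Theta Ct (tau C \<mu>) = (\<lambda>v. Theta C \<mu> (dn v))" if "\<mu> \<in> theta_weights C m" for \<mu>
    using that by (simp add: theta_weights_def tau_eq Theta_Ct fun_eq_iff)
qed (use assms in \<open>auto simp: Th_def smul_def fun_ap fun_eq_iff\<close>)

lemma chi_tau_dot:
  assumes "lam \<in> weights C k"
  shows "chi Ct (tau_dot C lam) v = alt_theta C (lam + rho C) (dn v) / alt_theta C (dn (rho Ct)) (dn v)"
proof -
  have "tau_dot C lam + rho Ct = up (lam + rho C)"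
    unfolding tau_dot_def using tau_eq[OF weight_shift(3)[OF assms]] by simp
  then show ?thesis unfolding chi_def using alt_theta_Ct[of "lam + rho C" v] alt_theta_Ct[of "dn (rho Ct)" v] by simp
qed

text \<open>Now p and q divide by different functions, and the kernel condition is exactly
  \<open>Alt_quotient_zero\<close>.\<close>

lemma tau_dot_Ch_eq:
  assumes "f \<in> Alt k"
  shows "tau_dot_Ch C k (\<lambda>v. f v / alt_theta C (rho C) v) = (\<lambda>v. f (dn v) / alt_theta C (dn (rho Ct)) (dn v))"
  unfolding tau_dot_Ch_def
proof (rule linear_extension_eq[where p = "\<lambda>f v. f v / alt_theta C (rho C) v" and q = "\<lambda>f v. f (dn v) / alt_theta C (dn (rho Ct)) (dn v)"
      and F = "\<lambda>lam. alt_theta C (lam + rho C)", OF _ _ _ _ _ _ _ assms])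
  show "chi C lam = (\<lambda>v. alt_theta C (lam + rho C) v / alt_theta C (rho C) v)" for lam by (simp add: chi_def)
  show "chi Ct (tau_dot C lam) = (\<lambda>v. alt_theta C (lam + rho C) (dn v) / alt_theta C (dn (rho Ct)) (dn v))" if "lam \<in> dominant_weights C k" for lam
    using chi_tau_dot[OF dominant_weights_subset[OF that]] by blast
  show "(\<lambda>v. f (dn v) / alt_theta C (dn (rho Ct)) (dn v)) = 0" if "f \<in> Alt k" "(\<lambda>v. f v / alt_theta C (rho C) v) = 0" for f
  proof -
    have "f = 0" by (rule Alt_quotient_zero[OF that(1)]) (use fun_cong[OF that(2)] in \<open>simp add: fun_ap\<close>)
    then show ?thesis by (simp add: fun_eq_iff fun_ap)
  qed
qed (auto simp: smul_def fun_ap fun_eq_iff add_divide_distrib)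

theorem slash_transpose:
  assumes X: "X \<in> Gamma1 r" and k: "k > 0"
  shows "(\<forall>lam\<in>weights C k. \<forall>j. metaplectic_lift X j \<longrightarrow>
        tau_Th C (real (k + dual_coxeter C)) (slash_theta C X j (alt_theta C (lam + rho C)))
          = slash_theta Ct X j (alt_theta Ct (tau C (lam + rho C))))
     \<and> (\<exists>v. v \<noteq> 0 \<and> (\<forall>lam\<in>weights C k.
             tau_dot_Ch C k (slash_char C X (chi C lam)) = v \<cdot> slash_char Ct X (tau_dot_Ch C k (chi C lam))))"
proof -
  interpret long: affine_roots C r a e e r by (rule long_roots)
  interpret short: affine_roots C r a e "\<lambda>_. 1" 1 by (rule short_roots)
  let ?m = "k + dual_coxeter C"
  let ?a = "X $ 1 $ 1" and ?b = "X $ 1 $ 2" and ?c = "X $ 2 $ 1" and ?d = "X $ 2 $ 2"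
  have m: "?m > 0" using k by simp
  have det: "?a * ?d - ?b * ?c = 1" using X by (simp add: Gamma1_def det_2)
  have rc: "int r dvd ?c" using X by (simp add: Gamma1_def cong_0_iff)
  \<comment> \<open>The congruence on X enters here: e_i is 1 or r, and r divides c. The two
    divisibilities put c \<alpha>_i/e_i into M and make half of c times the norm of \<alpha>_i/e_i
    an integer.\<close>
  have hc: "int (e i) dvd ?c" "(int (e i))\<^sup>2 dvd ?c * int (e i)" if "i \<in> {1..l}" for i
  proof -
    show "int (e i) dvd ?c" using e_cases[of i] that rc by auto
    then show "(int (e i))\<^sup>2 dvd ?c * int (e i)" by (simp add: power2_eq_square)
  qed
  have hc1: "int 1 dvd ?c" "(int 1)\<^sup>2 dvd ?c * int (e i)" for i by simp_all
  have lift: "metaplectic_lift X j \<longleftrightarrow> lift_of ?c ?d j" for j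
    by (simp add: metaplectic_lift_def lift_of_def autom_def)
  have Alt_slash: "slash_theta C X j (alt_theta C (lam + rho C)) \<in> Alt k" if lam: "lam \<in> weights C k" and j: "lift_of ?c ?d j" for lam j
  proof -
    note \<mu> = weight_shift[OF lam]
    obtain F where F: "lincomb (AM ?m) (long.regular ?m) F"
      "\<And>\<sigma> z. Im \<sigma> > 0 \<Longrightarrow> z \<in> hring C \<Longrightarrow> slash ?m ?a ?b ?c ?d (AM ?m (lam + rho C)) \<sigma> z = j \<sigma> ^ l * F \<sigma> z"
      by (rule long.AM_slash[OF det j m \<mu>(1,2) hc]) (assumption | rule that)+
    have "slash_theta C X j (alt_theta C (lam + rho C)) = on_Y ?m F"
      unfolding alt_theta_on_Y[OF \<mu>(3,2) m] slash_theta_on_Y[OF det]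
      using lift_nonzero(1)[OF det j] by (intro on_Y_cong) (simp add: F(2))
    also have "\<dots> \<in> Alt k" by (rule lincomb_on_Y[OF F(1) cfun.subspace_span]) (rule regular_Alt)
    finally show ?thesis .
  qed
  have minimal: "\<exists>q. slash_theta C X j (alt_theta C R0) = q \<cdot> alt_theta C R0 \<and> (alt_theta C R0 \<noteq> 0 \<longrightarrow> q \<noteq> 0)"
    if j: "lift_of ?c ?d j" and R0: "R0 \<in> hstar C" "R0 (l + 1) = of_nat n" "n > 0"
      and q: "\<And>\<sigma> z. Im \<sigma> > 0 \<Longrightarrow> z \<in> hring C \<Longrightarrow> slash n ?a ?b ?c ?d (AM n R0) \<sigma> z = j \<sigma> ^ l * q * AM n R0 \<sigma> z" for j R0 n q
  proof (intro exI conjI impI)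
    have on_Y: "alt_theta C R0 = on_Y n (AM n R0)" by (rule alt_theta_on_Y[OF R0])
    have "slash_theta C X j (alt_theta C R0) = on_Y n (\<lambda>\<sigma> z. q * AM n R0 \<sigma> z)"
      unfolding on_Y slash_theta_on_Y[OF det] using lift_nonzero(1)[OF det j] by (intro on_Y_cong) (simp add: q)
    then show "slash_theta C X j (alt_theta C R0) = q \<cdot> alt_theta C R0" by (simp add: on_Y on_Y_scale)
    assume "alt_theta C R0 \<noteq> 0"
    then obtain \<sigma> z where nz: "Im \<sigma> > 0" "z \<in> hring C" "AM n R0 \<sigma> z \<noteq> 0" unfolding on_Y using on_Y_zero by metis
    show "q \<noteq> 0" by (rule long.slash_scalar_nonzero[OF det q nz])
  qed
  \<comment> \<open>One lift suffices for the second claim, because j cancels from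
    quotients.\<close>
  obtain j where j: "lift_of ?c ?d j" using th1_liftable_SL2[OF det] by (auto simp: th1_liftable_def)
  have jnz: "j \<sigma> \<noteq> 0" if "Im \<sigma> > 0" for \<sigma> by (rule lift_nonzero(1)[OF det j that])
  let ?A = "alt_theta C (rho C)" and ?A' = "alt_theta C (dn (rho Ct))"
  have dc: "dual_coxeter C = (\<Sum>i\<le>l. a i * e i)" by (simp add: dual_coxeter_def colabel_eq mult.commute)
  obtain q0 where "slash_theta C X j ?A = q0 \<cdot> ?A" "?A \<noteq> 0 \<longrightarrow> q0 \<noteq> 0"
  proof -
    obtain q where "\<And>\<sigma> z. Im \<sigma> > 0 \<Longrightarrow> z \<in> hring C \<Longrightarrow> slash (dual_coxeter C) ?a ?b ?c ?d (AM (dual_coxeter C) (rho C)) \<sigma> z = j \<sigma> ^ l * q * AM (dual_coxeter C) (rho C) \<sigma> z"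
      by (rule long.AM_minimal_slash[OF det j dc rho_hstar rho_alpha hc]) (assumption | rule that)+
    from minimal[OF j rho_hstar rho_level dual_coxeter_pos this] show ?thesis using that by blast
  qed
  moreover have "?A \<noteq> 0"
  proof
    assume "?A = 0"
    then have "on_Y (dual_coxeter C) (AM (dual_coxeter C) (rho C)) = 0"
      using alt_theta_on_Y[OF rho_hstar rho_level dual_coxeter_pos] by simp
    then show False using AM_rho_nonzero on_Y_point[where u = 0] by (metis exp_not_eq_zero mult_eq_0_iff zero_fun_apply)
  qed
  ultimately have q0: "slash_theta C X j ?A = q0 \<cdot> ?A" "q0 \<noteq> 0" by auto
  obtain q1 where q1: "slash_theta C X j ?A' = q1 \<cdot> ?A'" "?A' \<noteq> 0 \<longrightarrow> q1 \<noteq> 0"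
  proof -
    define n where "n = (\<Sum>i\<le>l. a i * 1)"
    have R0: "dn (rho Ct) \<in> hstar C" using rho_Ct(1) up_hstar[of "dn (rho Ct)"] by simp
    have Ra: "form C (dn (rho Ct)) (alpha i) = of_nat 1" if "i \<le> l" for i using rho_Ct(2)[OF that] by simp
    have "dn (rho Ct) (l + 1) = of_nat n" using level_sum[of "dn (rho Ct)"] rho_Ct(2) by (simp add: n_def)
    moreover have "n > 0" unfolding n_def using a_pos[of 0] by (intro sum_pos2[of _ 0]) auto
    moreover obtain q where "\<And>\<sigma> z. Im \<sigma> > 0 \<Longrightarrow> z \<in> hring C \<Longrightarrow> slash n ?a ?b ?c ?d (AM n (dn (rho Ct))) \<sigma> z = j \<sigma> ^ l * q * AM n (dn (rho Ct)) \<sigma> z"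
      by (rule short.AM_minimal_slash[OF det j n_def R0 Ra hc1]) (assumption | rule that)+
    ultimately show ?thesis using minimal[OF j R0] that by blast
  qed
  \<comment> \<open>One side carries f/(q0 A'), the other f/(q1 A'). If A' is zero, both sides
    vanish under division by zero, and 1 serves as a nonzero value.\<close>
  define v where "v = (if ?A' = 0 then 1 else q1 / q0)"
  have "v \<noteq> 0" using q0(2) q1(2) by (simp add: v_def)
  moreover have "tau_dot_Ch C k (slash_char C X (chi C lam)) = v \<cdot> slash_char Ct X (tau_dot_Ch C k (chi C lam))" if lam: "lam \<in> weights C k" for lam
  proof -
    define f where "f = slash_theta C X j (alt_theta C (lam + rho C))"
    have fA: "f \<in> Alt k" unfolding f_def by (rule Alt_slash[OF lam j])
    have chi: "chi C lam = (\<lambda>v. alt_theta C (lam + rho C) v / ?A v)" by (simp add: chi_def)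
    have "slash_char C X (chi C lam) = (\<lambda>v. f v / (q0 \<cdot> ?A) v)"
      unfolding chi f_def q0(1)[symmetric] by (rule slash_char_quotient[where j = j]) (rule jnz)
    also have "\<dots> = (\<lambda>v. ((1 / q0) \<cdot> f) v / ?A v)" by (simp add: smul_def)
    finally have lhs: "tau_dot_Ch C k (slash_char C X (chi C lam)) = (\<lambda>v. ((1 / q0) \<cdot> f) (dn v) / ?A' (dn v))"
      using tau_dot_Ch_eq[OF cfun.span_scale[OF fA]] by simp
    have "slash_char Ct X (tau_dot_Ch C k (chi C lam)) = (\<lambda>v. slash_char C X (\<lambda>v. alt_theta C (lam + rho C) v / ?A' v) (dn v))"
      unfolding chi tau_dot_Ch_eq[OF alt_theta_Alt[OF lam]] by (rule slash_char_Ct)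
    also have "slash_char C X (\<lambda>v. alt_theta C (lam + rho C) v / ?A' v) = (\<lambda>v. f v / (q1 \<cdot> ?A') v)"
      unfolding f_def q1(1)[symmetric] by (rule slash_char_quotient[where j = j]) (rule jnz)
    finally have rhs: "slash_char Ct X (tau_dot_Ch C k (chi C lam)) = (\<lambda>v. f (dn v) / (q1 \<cdot> ?A') (dn v))" .
    show ?thesis unfolding lhs rhs using q1(2) by (cases "?A' = 0") (auto simp: v_def smul_def fun_eq_iff fun_ap)
  qed
  moreover have "tau_Th C (real ?m) (slash_theta C X j (alt_theta C (lam + rho C))) = slash_theta Ct X j (alt_theta Ct (tau C (lam + rho C)))"
    if lam: "lam \<in> weights C k" and j: "metaplectic_lift X j" for lam j
  proof -
    have "alt_theta Ct (tau C (lam + rho C)) = (\<lambda>v. alt_theta C (lam + rho C) (dn v))"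
      using tau_eq[OF weight_shift(3)[OF lam]] alt_theta_Ct by auto
    then show ?thesis using tau_Th_eq[OF Alt_Th[OF Alt_slash[OF lam j[unfolded lift]]]] by (simp add: slash_theta_Ct)
  qed
  ultimately show ?thesis by blast
qed

end

section \<open>The four types\<close>

lemma sum_supported:
  fixes f :: "nat \<Rightarrow> int"
  assumes "S \<subseteq> {..n}" "\<And>j. j \<le> n \<Longrightarrow> j \<notin> S \<Longrightarrow> f j = 0"
  shows "(\<Sum>j\<le>n. f j) = sum f S"
  using assms by (intro sum.mono_neutral_right) auto

text \<open>\<theta> is the sum of the a_i \<alpha>_i, so one simple root with label 1 is obtained
  from \<theta> and the others. This handles a bond with a_ij = -2, across which
  \<open>alpha_latticeM_step\<close> cannot go.\<close>

lemma (in affine_datum) alpha_latticeM_last: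
  assumes n: "n \<in> {1..l}" "a n = 1" and others: "\<And>i. i \<in> {1..l} - {n} \<Longrightarrow> alpha i \<in> latticeM C"
  shows "alpha n \<in> latticeM C"
proof -
  have sum: "(\<Sum>i\<in>A. of_int (int (a i)) \<cdot> alpha i) \<in> latticeM C" if "A \<subseteq> {1..l} - {n}" for A
    using finite_subset[OF that finite_Diff[OF finite_atLeastAtMost]] that
  proof (induction A rule: finite_induct)
    case empty
    then show ?case by (simp add: latticeM_def)
  next
    case (insert i A)
    have "of_int (int (a i)) \<cdot> alpha i + (\<Sum>i\<in>A. of_int (int (a i)) \<cdot> alpha i) \<in> latticeM C"
      by (intro latticeM_add latticeM_int_smul others insert.IH) (use insert.prems in auto)
    then show ?case using insert.hyps by simp
  qed
  have "theta_root C = (\<Sum>i=1..l. theta_root C i \<cdot> alpha i)" by (rule hring_expand[OF theta_hring])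
  also have "\<dots> = (\<Sum>i=1..l. of_int (int (a i)) \<cdot> alpha i)" by (intro sum.cong refl) (simp add: theta_apply)
  also have "\<dots> = alpha n + (\<Sum>i\<in>{1..l} - {n}. of_int (int (a i)) \<cdot> alpha i)"
    using n by (subst sum.remove[of _ n]) auto
  finally have "alpha n = theta_root C - (\<Sum>i\<in>{1..l} - {n}. of_int (int (a i)) \<cdot> alpha i)" by simp
  then show ?thesis
    using group_closure.diff[OF theta_latticeM[unfolded latticeM_def] sum[OF order_refl, unfolded latticeM_def]]
    by (simp add: latticeM_def)
qed

lemma ent_A2odd:
  assumes "n \<ge> 3"
  shows "ent (cartan (A2odd n)) i j = (if i = j then 2 else if i = n - 1 \<and> j = n then - 2
    else if i = 0 then (if j = 2 then - 1 else 0) else if j = 0 then (if i = 2 then - 1 else 0)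
    else if i = Suc j \<or> j = Suc i then - 1 else 0)"
proof -
  have "{i, j} = {0, 2} \<longleftrightarrow> i = 0 \<and> j = 2 \<or> i = 2 \<and> j = 0" "{i, j} = {0, 1} \<longleftrightarrow> i = 0 \<and> j = 1 \<or> i = 1 \<and> j = 0"
    by (auto simp: doubleton_eq_iff)
  then have "ent (cartan (A2odd n)) i j = (if i = j then 2 else if i = n - 1 \<and> j = n then - 2
     else if i = 0 \<and> j = 2 \<or> i = 2 \<and> j = 0 then - 1 else if i = 0 \<and> j = 1 \<or> i = 1 \<and> j = 0 then 0
     else if i = Suc j \<or> j = Suc i then - 1 else 0)"
    by (simp only: cartan.simps gcm.sel prod.inject)
  moreover have "i = 0 \<or> (\<exists>p. i = Suc p)" "j = 0 \<or> (\<exists>p. j = Suc p)" by presburger+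
  ultimately show ?thesis using assms by (elim disjE exE) simp_all
qed

declare cartan.simps(1) [simp del]

lemma rk_A2odd [simp]: "rk (cartan (A2odd n)) = n" by (simp add: cartan.simps(1))

text \<open>The only long simple root is \<alpha>_n. The cases in the row sums are the three nodes
  of the fork, the interior of the chain and the end with the double bond.\<close>

lemma affine_lattice_A2odd:
  assumes l: "n \<ge> 3"
  shows "affine_lattice (cartan (A2odd n)) 2 (\<lambda>i. if i > n then 0 else if i = 0 \<or> i = 1 \<or> i = n then 1 else 2) (\<lambda>i. if i = n then 2 else 1)"
    (is "affine_lattice ?C 2 ?a ?e")
proof -
  note ent = ent_A2odd[OF l]
  have if_le: "(if P then x else y) \<le> 0" if "x \<le> 0" "y \<le> 0" for P and x y :: int using that by simp
  have nonpos: "ent ?C i j \<le> 0" if "i \<noteq> j" for i j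
    unfolding ent if_not_P[OF that] by (intro if_le) simp_all
  have null: "(\<Sum>j\<le>rk ?C. ent ?C i j * int (?a j)) = 0" if i: "i \<le> rk ?C" for i
  proof -
    consider "i = 0" | "i = 1" | "i = 2" | "i = n" "i \<ge> 3" | "i \<ge> 3" "i < n" using i by fastforce
    then show ?thesis
    proof cases
      case 1
      have "(\<Sum>j\<le>n. ent ?C i j * int (?a j)) = (\<Sum>j\<in>{0, 2}. ent ?C i j * int (?a j))"
        by (rule sum_supported) (use l 1 in \<open>auto simp: ent\<close>)
      then show ?thesis using l 1 by (simp add: ent)
    next
      case 2
      have "(\<Sum>j\<le>n. ent ?C i j * int (?a j)) = (\<Sum>j\<in>{1, 2}. ent ?C i j * int (?a j))"
        by (rule sum_supported) (use l 2 in \<open>auto simp: ent\<close>)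
      then show ?thesis using l 2 by (simp add: ent)
    next
      case 3
      have "(\<Sum>j\<le>n. ent ?C i j * int (?a j)) = (\<Sum>j\<in>{0, 1, 2, 3}. ent ?C i j * int (?a j))"
        by (rule sum_supported) (use l 3 in \<open>auto simp: ent\<close>)
      then show ?thesis using l 3 by (auto simp: ent)
    next
      case 4
      have "(\<Sum>j\<le>n. ent ?C i j * int (?a j)) = (\<Sum>j\<in>{n - 1, n}. ent ?C i j * int (?a j))"
        by (rule sum_supported) (use l 4 in \<open>auto simp: ent\<close>)
      moreover have "n - 1 \<noteq> n" "n - 1 \<noteq> 0" "n - 1 \<noteq> 1" using l by auto
      ultimately show ?thesis using l 4 by (simp add: ent)
    next
      case 5
      define p where "p = i - 1"
      have p: "i = Suc p" "p \<ge> 2" "Suc p < n" using 5 by (auto simp: p_def)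
      have "(\<Sum>j\<le>n. ent ?C (Suc p) j * int (?a j)) = (\<Sum>j\<in>{p, Suc p, Suc (Suc p)}. ent ?C (Suc p) j * int (?a j))"
        by (rule sum_supported) (use p in \<open>auto simp: ent\<close>)
      also have "\<dots> = 0"
        using p(2,3) by (cases "Suc (Suc p) = n") (simp_all add: ent)
      finally show ?thesis by (simp add: p(1))
    qed
  qed
  interpret affine_datum ?C 2 ?a ?e
  proof
    fix P :: "nat \<Rightarrow> bool" and i
    assume P0: "P 0" and st: "\<And>i j. i \<le> rk ?C \<Longrightarrow> j \<le> rk ?C \<Longrightarrow> P i \<Longrightarrow> ent ?C i j \<noteq> 0 \<Longrightarrow> P j" and i: "i \<le> rk ?C"
    have P2: "P 2" by (rule st[OF _ _ P0]) (use l in \<open>auto simp: ent\<close>)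
    have P1: "P 1" by (rule st[OF _ _ P2]) (use l in \<open>auto simp: ent\<close>)
    have "P j" if "2 \<le> j" "j \<le> n" for j
      using that
    proof (induction j rule: dec_induct)
      case (step j)
      then have "P j" by simp
      show ?case by (rule st[OF _ _ \<open>P j\<close>]) (use step l in \<open>auto simp: ent\<close>)
    qed (rule P2)
    moreover have "i = 0 \<or> i = 1 \<or> 2 \<le> i" by linarith
    ultimately show "P i" using i P0 P1 by auto
  next
    fix i j assume "i \<le> rk ?C" "j \<le> rk ?C"
    then consider "i = j" | "i \<noteq> j" "i = n" "j < n" | "i \<noteq> j" "j = n" "i < n" | "i \<noteq> j" "i < n" "j < n" by fastforce
    then show "int (?e i) * ent ?C i j = int (?e j) * ent ?C j i"
    proof cases
      case 1
      then show ?thesis by simp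
    next
      case 2
      then show ?thesis using l by (cases "j = 0") (auto simp: ent)
    next
      case 3
      then show ?thesis using l by (cases "i = 0") (auto simp: ent)
    next
      case 4
      then show ?thesis using l by (cases "i = 0"; cases "j = 0") (simp_all add: ent)
    qed
  next
    show "(\<Sum>j\<le>rk ?C. ent ?C i j * int (?a j)) = 0" if "i \<le> rk ?C" for i by (rule null[OF that])
    show "ent ?C i j \<le> 0" if "i \<le> rk ?C" "j \<le> rk ?C" "i \<noteq> j" for i j by (rule nonpos[OF that(3)])
  qed (use l in \<open>simp_all add: ent\<close>)
  have a2: "alpha 2 \<in> latticeM ?C" by (rule alpha_latticeM_adjacent) (use l in \<open>auto simp: ent\<close>)
  have a1: "alpha 1 \<in> latticeM ?C" by (rule alpha_latticeM_step[OF _ _ a2]) (use l in \<open>auto simp: ent\<close>)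
  have "alpha j \<in> latticeM ?C" if "2 \<le> j" "j \<le> n" for j
    using that
  proof (induction j rule: dec_induct)
    case (step j)
    then have "alpha j \<in> latticeM ?C" by simp
    then show ?case by (rule alpha_latticeM_step[rotated 2]) (use step l in \<open>auto simp: ent\<close>)
  qed (rule a2)
  moreover have "i = 1 \<or> 2 \<le> i" if "i \<in> {1..rk ?C}" for i using that by auto
  ultimately show ?thesis using a1 by unfold_locales (metis atLeastAtMost_iff rk_A2odd)
qed

text \<open>All labels are 1, and the short simple roots are those at the two ends of the
  chain.\<close>

lemma affine_lattice_D2:
  assumes l: "n \<ge> 2"
  shows "affine_lattice (cartan (D2 n)) 2 (\<lambda>i. if i > n then 0 else 1) (\<lambda>i. if i \<in> {0, n} then 1 else 2)"
    (is "affine_lattice ?C 2 ?a ?e")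
proof -
  have null: "(\<Sum>j\<le>rk ?C. ent ?C i j * int (?a j)) = 0" if i: "i \<le> rk ?C" for i
  proof -
    define S where "S = (if i = 0 then {0, 1} else if i = n then {n - 1, n} else {i - 1, i, i + 1})"
    have "(\<Sum>j\<le>n. ent ?C i j * int (?a j)) = (\<Sum>j\<in>S. ent ?C i j * int (?a j))"
      by (rule sum_supported) (use l i in \<open>auto simp: S_def split: if_splits\<close>)
    also have "\<dots> = 0"
    proof -
      consider "i = 0" | "i = n" "i \<ge> 2" | "i \<ge> 1" "i < n" using i l by fastforce
      then show ?thesis
      proof cases
        case 3
        then have S: "S = {i - 1, i, i + 1}" "i - 1 \<noteq> i" "i - 1 \<noteq> i + 1" "i \<noteq> i + 1" by (auto simp: S_def)
        then show ?thesis using 3 l by auto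
      next
        case 2
        then have S: "S = {n - 1, n}" "n - 1 \<noteq> n" by (auto simp: S_def)
        then show ?thesis using 2 l by auto
      qed (use l in \<open>auto simp: S_def\<close>)
    qed
    finally show ?thesis by simp
  qed
  interpret affine_datum ?C 2 ?a ?e
  proof
    fix P :: "nat \<Rightarrow> bool" and i
    assume P0: "P 0" and st: "\<And>i j. i \<le> rk ?C \<Longrightarrow> j \<le> rk ?C \<Longrightarrow> P i \<Longrightarrow> ent ?C i j \<noteq> 0 \<Longrightarrow> P j" and i: "i \<le> rk ?C"
    have "P j" if "j \<le> n" for j
      using that
    proof (induction j)
      case (Suc j)
      then have "P j" by simp
      show ?case by (rule st[OF _ _ \<open>P j\<close>]) (use Suc l in auto)
    qed (rule P0)
    then show "P i" using i by simp
  next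
    fix i j assume "i \<le> rk ?C" "j \<le> rk ?C"
    then show "int (?e i) * ent ?C i j = int (?e j) * ent ?C j i" using l by auto
  qed (use l null in auto)
  have a1: "alpha 1 \<in> latticeM ?C" by (rule alpha_latticeM_adjacent) (use l in auto)
  have a: "alpha j \<in> latticeM ?C" if "1 \<le> j" "j < n" for j
    using that
  proof (induction j rule: dec_induct)
    case (step j)
    then have "alpha j \<in> latticeM ?C" by simp
    then show ?case by (rule alpha_latticeM_step[rotated 2]) (use step l in auto)
  qed (rule a1)
  \<comment> \<open>The entry in row n and column n - 1 is -2, so the walk along the chain stops
    before node n.\<close>
  have an: "alpha n \<in> latticeM ?C" by (rule alpha_latticeM_last) (use l a in auto)
  have "alpha i \<in> latticeM ?C" if "i \<in> {1..rk ?C}" for i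
    using a[of i] an that by (cases "i = n") auto
  then show ?thesis by unfold_locales
qed

lemma atMost_4: "{..4 :: nat} = {0, 1, 2, 3, 4}" and atMost_2: "{..2 :: nat} = {0, 1, 2}" by auto

lemma le_4: "i \<le> 4 \<longleftrightarrow> i = 0 \<or> i = 1 \<or> i = 2 \<or> i = 3 \<or> i = (4 :: nat)" and le_2: "i \<le> 2 \<longleftrightarrow> i = 0 \<or> i = 1 \<or> i = (2 :: nat)" by auto

lemma affine_lattice_E6_2:
  "affine_lattice (cartan E6_2) 2 (\<lambda>i. if i = 0 then 1 else if i = 1 then 2 else if i = 2 then 3 else if i = 3 then 2 else if i = 4 then 1 else 0)
     (\<lambda>i. if i \<in> {3, 4} then 2 else 1)"
    (is "affine_lattice ?C 2 ?a ?e")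
proof -
  interpret affine_datum ?C 2 ?a ?e
  proof
    fix P :: "nat \<Rightarrow> bool" and i
    assume P0: "P 0" and st: "\<And>i j. i \<le> rk ?C \<Longrightarrow> j \<le> rk ?C \<Longrightarrow> P i \<Longrightarrow> ent ?C i j \<noteq> 0 \<Longrightarrow> P j" and i: "i \<le> rk ?C"
    have P: "P 1" "P 2" "P 3" "P 4" using st[OF _ _ P0, of 1] st[of 1 2] st[of 2 3] st[of 3 4] by simp_all
    show "P i" using i P0 P by (auto simp: le_4)
  qed (auto simp: le_4 atMost_4)
  have a1: "alpha 1 \<in> latticeM ?C" by (rule alpha_latticeM_adjacent) auto
  have a2: "alpha 2 \<in> latticeM ?C" by (rule alpha_latticeM_step[OF _ _ a1]) auto
  have a3: "alpha 3 \<in> latticeM ?C" by (rule alpha_latticeM_step[OF _ _ a2]) auto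
  have a4: "alpha 4 \<in> latticeM ?C" by (rule alpha_latticeM_step[OF _ _ a3]) auto
  have "alpha i \<in> latticeM ?C" if "i \<in> {1..rk ?C}" for i
  proof -
    have "i = 1 \<or> i = 2 \<or> i = 3 \<or> i = 4" using that by auto
    then show ?thesis using a1 a2 a3 a4 by blast
  qed
  then show ?thesis by unfold_locales
qed

lemma affine_lattice_D4_3:
  "affine_lattice (cartan D4_3) 3 (\<lambda>i. if i = 0 then 1 else if i = 1 then 2 else if i = 2 then 1 else 0) (\<lambda>i. if i = 2 then 3 else 1)"
    (is "affine_lattice ?C 3 ?a ?e")
proof -
  interpret affine_datum ?C 3 ?a ?e
  proof
    fix P :: "nat \<Rightarrow> bool" and i
    assume P0: "P 0" and st: "\<And>i j. i \<le> rk ?C \<Longrightarrow> j \<le> rk ?C \<Longrightarrow> P i \<Longrightarrow> ent ?C i j \<noteq> 0 \<Longrightarrow> P j" and i: "i \<le> rk ?C"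
    have P: "P 1" "P 2" using st[OF _ _ P0, of 1] st[of 1 2] by simp_all
    show "P i" using i P0 P by (auto simp: le_2)
  qed (auto simp: le_2 atMost_2)
  have a1: "alpha 1 \<in> latticeM ?C" by (rule alpha_latticeM_adjacent) auto
  have a2: "alpha 2 \<in> latticeM ?C" by (rule alpha_latticeM_step[OF _ _ a1]) auto
  have "alpha i \<in> latticeM ?C" if "i \<in> {1..rk ?C}" for i
  proof -
    have "i = 1 \<or> i = 2" using that by auto
    then show ?thesis using a1 a2 by blast
  qed
  then show ?thesis by unfold_locales
qed

theorem theorem3p3:
  fixes T :: twisted_type and C :: gcm and k :: nat and X :: "int^2^2"
  assumes "is_twisted_type T" and "C = cartan T"
    and "k > 0"
    and "X \<in> Gamma1 (twist_order T)"
  shows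
    "(\<forall>lam\<in>weights C k. \<forall>j. metaplectic_lift X j \<longrightarrow>
        tau_Th C (real (k + dual_coxeter C)) (slash_theta C X j (alt_theta C (lam + rho C)))
          = slash_theta (transposed C) X j (alt_theta (transposed C) (tau C (lam + rho C))))
     \<and> (\<exists>v. v \<noteq> 0 \<and>
          (\<forall>lam\<in>weights C k.
             tau_dot_Ch C k (slash_char C X (chi C lam))
               = v \<cdot> slash_char (transposed C) X (tau_dot_Ch C k (chi C lam))))"
proof -
  have "\<exists>a e. affine_lattice C (twist_order T) a e"
    using assms(1) affine_lattice_A2odd affine_lattice_D2 affine_lattice_E6_2 affine_lattice_D4_3
    unfolding assms(2) by (cases T) (simp_all only: is_twisted_type.simps twist_order.simps, blast+)
  then obtain a e where "affine_lattice C (twist_order T) a e" by blast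
  then show ?thesis using assms(3,4) by (intro affine_lattice.slash_transpose)
qed

end
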